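(* Let $\Gamma_S$ be a finitely generated word-hyperbolic group whose Gromov boundary is homeomorphic to the circle. In the space of weakly irreducible $\{\mathsf a_1,\mathsf a_2\}$-Anosov representations $\Gamma_S\to\mathrm{PGL}_d(\mathbb R)$, the subset of those that are not $(1,1,2)$-hyperconvex is open (equivalently, the weakly irreducible $(1,1,2)$-hyperconvex representations form a closed subset of it).
   Context: The space of representations is a subspace of $\hom(\Gamma_S,\mathrm{PGL}_d(\mathbb R))$ with the topology of pointwise convergence. Fix an inner product on $\mathbb R^d$; $\sigma_1(g)\ge\dots\ge\sigma_d(g)$ are the singular values of $g$ (ratios are well defined on $\mathrm{PGL}_d(\mathbb R)$). $|\cdot|$ is the word length on the group $\Gamma=\Gamma_S$ for a fixed finite symmetric generating set. $\rho$ is $\{\mathsf a_p\}$-Anosov if there are $c,\mu>0$ with $\frac{\sigma_{p+1}}{\sigma_p}(\rho(\gamma))\le ce^{-\mu|\gamma|}$ for all $\gamma\in\Gamma$; $\{\mathsf a_1,\mathsf a_2\}$-Anosov means this for $p=1$ and $p=2$ ($d\ge3$). It then has continuous $\rho$-equivariant boundary maps $\xi^k:\partial\Gamma\to\mathcal G_k(\mathbb R^d)$, $k\in\{p,d-p\}$, with $\xi^p(x)\oplus\xi^{d-p}(y)=\mathbb R^d$ for $x\ne y$; explicitly $\xi^k(x)=\lim_nU_k(\rho(\gamma_n))$ for any geodesic ray $\gamma_n\to x$, where $U_k(g)$ is the span of the $k$ longest axes of the ellipsoid $\{gv:\|v\|=1\}$. An $\{\mathsf a_1\}$-Anosov representation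 is weakly irreducible if $\xi^1(\partial\Gamma)$ is not contained in $\mathbb P(W)$ for a proper subspace $W\subsetneq\mathbb R^d$. An $\{\mathsf a_1,\mathsf a_2\}$-Anosov representation is $(1,1,2)$-hyperconvex if $(\xi^1(x)\oplus\xi^1(y))\cap\xi^{d-2}(z)=\{0\}$ for all pairwise distinct $x,y,z\in\partial\Gamma$. *)

theory Defs
  imports "HOL-Analysis.Analysis" "HOL-Algebra.Coset" "HOL-Algebra.Generated_Groups"
begin

section \<open>Quotient topologies\<close>

definition quotient_topology :: "'a topology \<Rightarrow> ('a \<Rightarrow> 'b) \<Rightarrow> 'b topology" where
  "quotient_topology X f =
     topology (\<lambda>U. U \<subseteq> f ` topspace X \<and> openin X {x \<in> topspace X. f x \<in> U})"

lemma openin_quotient_topology: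
  "openin (quotient_topology X f) U \<longleftrightarrow>
     U \<subseteq> f ` topspace X \<and> openin X {x \<in> topspace X. f x \<in> U}"
proof -
  let ?P = "\<lambda>U. U \<subseteq> f ` topspace X \<and> openin X {x \<in> topspace X. f x \<in> U}"
  have "istopology ?P"
    unfolding istopology_def
  proof (intro conjI allI impI)
    fix U V assume "?P U" "?P V"
    moreover have "{x \<in> topspace X. f x \<in> U \<inter> V} =
        {x \<in> topspace X. f x \<in> U} \<inter> {x \<in> topspace X. f x \<in> V}"
      by blast
    ultimately show "U \<inter> V \<subseteq> f ` topspace X" "openin X {x \<in> topspace X. f x \<in> U \<inter> V}"
      by auto
  next
    fix \<K> assume K: "\<forall>U\<in>\<K>. ?P U"
    then show "\<Union>\<K> \<subseteq> f ` topspace X" by blast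
    have "{x \<in> topspace X. f x \<in> \<Union>\<K>} = (\<Union>U\<in>\<K>. {x \<in> topspace X. f x \<in> U})"
      by blast
    with K show "openin X {x \<in> topspace X. f x \<in> \<Union>\<K>}" by auto
  qed
  then show ?thesis
    by (simp add: quotient_topology_def topology_inverse')
qed

lemma topspace_quotient_topology: "topspace (quotient_topology X f) = f ` topspace X"
proof
  show "topspace (quotient_topology X f) \<subseteq> f ` topspace X"
    using openin_quotient_topology[of X f "topspace (quotient_topology X f)"] by simp
  have "{x \<in> topspace X. f x \<in> f ` topspace X} = topspace X" by blast
  then have "openin (quotient_topology X f) (f ` topspace X)"
    by (simp add: openin_quotient_topology)
  then show "f ` topspace X \<subseteq> topspace (quotient_topology X f)"
    by (rule openin_subset)
qed

lemma quotient_map_quotient_topology: "quotient_map X (quotient_topology X f) f"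
  by (auto simp: quotient_map_def topspace_quotient_topology openin_quotient_topology)


section \<open>Word metric, hyperbolicity and the Gromov boundary\<close>

definition finite_symmetric_generating_set :: "('g, 'm) monoid_scheme \<Rightarrow> 'g set \<Rightarrow> bool" where
  "finite_symmetric_generating_set G S \<longleftrightarrow>
     finite S \<and> S \<subseteq> carrier G \<and> (\<forall>s\<in>S. inv\<^bsub>G\<^esub> s \<in> S) \<and> generate G S = carrier G"

definition word_length :: "('g, 'm) monoid_scheme \<Rightarrow> 'g set \<Rightarrow> 'g \<Rightarrow> nat" where
  "word_length G S g =
     (LEAST n. \<exists>ws. set ws \<subseteq> S \<and> length ws = n \<and> foldr (\<otimes>\<^bsub>G\<^esub>) ws \<one>\<^bsub>G\<^esub> = g)"

definition word_dist :: "('g, 'm) monoid_scheme \<Rightarrow> 'g set \<Rightarrow> 'g \<Rightarrow> 'g \<Rightarrow> nat" where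
  "word_dist G S g h = word_length G S (inv\<^bsub>G\<^esub> g \<otimes>\<^bsub>G\<^esub> h)"

definition gromov_product :: "('g, 'm) monoid_scheme \<Rightarrow> 'g set \<Rightarrow> 'g \<Rightarrow> 'g \<Rightarrow> 'g \<Rightarrow> real" where
  "gromov_product G S w x y =
     (real (word_dist G S x w) + real (word_dist G S y w) - real (word_dist G S x y)) / 2"

definition word_hyperbolic :: "('g, 'm) monoid_scheme \<Rightarrow> 'g set \<Rightarrow> bool" where
  "word_hyperbolic G S \<longleftrightarrow>
     (\<exists>\<delta>::real. \<forall>w\<in>carrier G. \<forall>x\<in>carrier G. \<forall>y\<in>carrier G. \<forall>z\<in>carrier G.
        gromov_product G S w x z
          \<ge> min (gromov_product G S w x y) (gromov_product G S w y z) - \<delta>)"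

definition geodesic_rays :: "('g, 'm) monoid_scheme \<Rightarrow> 'g set \<Rightarrow> (nat \<Rightarrow> 'g) set" where
  "geodesic_rays G S =
     {r. range r \<subseteq> carrier G \<and> (\<forall>m n. m \<le> n \<longrightarrow> word_dist G S (r m) (r n) = n - m)}"

definition asymptotic_class ::
    "('g, 'm) monoid_scheme \<Rightarrow> 'g set \<Rightarrow> (nat \<Rightarrow> 'g) \<Rightarrow> (nat \<Rightarrow> 'g) set" where
  "asymptotic_class G S r =
     {r' \<in> geodesic_rays G S. \<exists>K. \<forall>n. word_dist G S (r n) (r' n) \<le> K}"

text \<open>
  A boundary point is a class of asymptotic geodesic rays, so the rays converging to it are
  its elements. The topology is the quotient of pointwise convergence of rays. The starting
  point is not fixed: rays with a given starting point form an open and closed set of rays,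
  and for a hyperbolic group each of these compact sets already induces the usual topology
  on the boundary, so their disjoint union induces the same one.
\<close>

definition gromov_boundary ::
    "('g, 'm) monoid_scheme \<Rightarrow> 'g set \<Rightarrow> (nat \<Rightarrow> 'g) set topology" where
  "gromov_boundary G S =
     quotient_topology
       (subtopology (product_topology (\<lambda>_. discrete_topology (carrier G)) UNIV)
          (geodesic_rays G S))
       (asymptotic_class G S)"


section \<open>The projective linear group and spaces of representations\<close>

definition GL :: "(real^'n^'n) monoid" where
  "GL = \<lparr>carrier = {A. invertible A}, mult = (**), one = mat 1\<rparr>"

definition scalar_matrices :: "(real^'n^'n) set" where
  "scalar_matrices = {c *\<^sub>R mat 1 | c. c \<noteq> 0}"

text \<open>Elements of the projective group are the sets of all their representing matrices.\<close>

definition PGL :: "(real^'n^'n) set monoid" where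
  "PGL = GL Mod scalar_matrices"

definition PGL_topology :: "(real^'n^'n) set topology" where
  "PGL_topology =
     quotient_topology (top_of_set (carrier GL)) (\<lambda>A. scalar_matrices #>\<^bsub>GL\<^esub> A)"

lemma group_GL: "group (GL :: (real^'n^'n) monoid)"
proof (rule groupI)
  have "invertible (mat 1 :: real^'n^'n)"
    unfolding invertible_def by (intro exI[of _ "mat 1"]) simp
  then show "\<one>\<^bsub>GL\<^esub> \<in> carrier (GL :: (real^'n^'n) monoid)" by (simp add: GL_def)
next
  fix A :: "real^'n^'n" assume "A \<in> carrier GL"
  then show "\<exists>B\<in>carrier GL. B \<otimes>\<^bsub>GL\<^esub> A = \<one>\<^bsub>GL\<^esub>"
    unfolding GL_def invertible_def by auto
qed (auto simp: GL_def invertible_mult matrix_mul_assoc)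

lemma normal_scalar_matrices: "(scalar_matrices :: (real^'n^'n) set) \<lhd> GL"
proof -
  interpret group "GL :: (real^'n^'n) monoid" by (rule group_GL)
  have mult: "(c *\<^sub>R mat 1) ** (A :: real^'n^'n) = c *\<^sub>R A"
      "A ** (c *\<^sub>R mat 1) = c *\<^sub>R A" for c and A :: "real^'n^'n"
    by (simp_all add: matrix_scalar_ac flip: scalar_matrix_assoc)
  have inverse: "(c *\<^sub>R mat 1) ** ((1 / c) *\<^sub>R mat 1) = (mat 1 :: real^'n^'n)"
    if "c \<noteq> 0" for c :: real
    using that by (simp add: mult)
  have inverse': "((1 / c) *\<^sub>R mat 1) ** (c *\<^sub>R mat 1) = (mat 1 :: real^'n^'n)"
    if "c \<noteq> 0" for c :: real
    using that by (simp add: mult)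
  have sub: "(scalar_matrices :: (real^'n^'n) set) \<subseteq> carrier GL"
    using inverse inverse' by (auto simp: scalar_matrices_def GL_def invertible_def)
  have "subgroup (scalar_matrices :: (real^'n^'n) set) GL"
  proof (rule subgroupI[OF sub])
    show "(scalar_matrices :: (real^'n^'n) set) \<noteq> {}"
      by (auto simp: scalar_matrices_def intro: exI[of _ 1])
  next
    fix A :: "real^'n^'n" assume A: "A \<in> scalar_matrices"
    then obtain c where c: "c \<noteq> 0" "A = c *\<^sub>R mat 1" by (auto simp: scalar_matrices_def)
    have B: "(1 / c) *\<^sub>R mat 1 \<in> (scalar_matrices :: (real^'n^'n) set)"
      using c by (auto simp: scalar_matrices_def)
    have "((1 / c) *\<^sub>R mat 1) \<otimes>\<^bsub>GL\<^esub> A = \<one>\<^bsub>GL\<^esub>"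
      using inverse' c by (simp add: GL_def)
    then have "inv\<^bsub>GL\<^esub> A = (1 / c) *\<^sub>R mat 1"
      using A B sub by (intro inv_equality) auto
    with B show "inv\<^bsub>GL\<^esub> A \<in> scalar_matrices" by simp
  next
    fix A A' :: "real^'n^'n" assume "A \<in> scalar_matrices" "A' \<in> scalar_matrices"
    then show "A \<otimes>\<^bsub>GL\<^esub> A' \<in> scalar_matrices"
      by (auto simp: scalar_matrices_def GL_def mult)
  qed
  moreover have "scalar_matrices #>\<^bsub>GL\<^esub> A = A <#\<^bsub>GL\<^esub> scalar_matrices" for A :: "real^'n^'n"
    unfolding r_coset_def l_coset_def
    by (auto simp: scalar_matrices_def GL_def mult)
  ultimately show ?thesis
    by (simp add: normal_def normal_axioms_def group_GL)
qed

lemma group_PGL: "group (PGL :: (real^'n^'n) set monoid)"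
  unfolding PGL_def by (rule normal.factorgroup_is_group[OF normal_scalar_matrices])

lemma topspace_PGL_topology:
  "topspace (PGL_topology :: (real^'n^'n) set topology) = carrier PGL"
  by (auto simp: PGL_topology_def topspace_quotient_topology PGL_def FactGroup_def RCOSETS_def)

text \<open>
  Homomorphisms are made extensional so that they are determined by their values on the
  group, as the points of the product topology are.
\<close>

definition representations ::
    "('g, 'm) monoid_scheme \<Rightarrow> ('g \<Rightarrow> (real^'n^'n) set) set" where
  "representations G = hom G PGL \<inter> extensional (carrier G)"

definition representation_topology ::
    "('g, 'm) monoid_scheme \<Rightarrow> ('g \<Rightarrow> (real^'n^'n) set) topology" where
  "representation_topology G =
     subtopology (product_topology (\<lambda>_. PGL_topology) (carrier G)) (representations G)"

lemma topspace_representation_topology: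
  "topspace (representation_topology G) = representations G"
  by (auto simp: representation_topology_def representations_def topspace_PGL_topology
      hom_def PiE_def)


section \<open>Singular values\<close>

definition inner_product :: "(real^'n \<Rightarrow> real^'n \<Rightarrow> real) \<Rightarrow> bool" where
  "inner_product B \<longleftrightarrow>
     bilinear B \<and> (\<forall>u v. B u v = B v u) \<and> (\<forall>v. v \<noteq> 0 \<longrightarrow> B v v > 0)"

definition orthonormal_frame ::
    "(real^'n \<Rightarrow> real^'n \<Rightarrow> real) \<Rightarrow> (nat \<Rightarrow> real^'n) \<Rightarrow> bool" where
  "orthonormal_frame B e \<longleftrightarrow>
     (\<forall>i\<in>{1..CARD('n)}. \<forall>j\<in>{1..CARD('n)}. B (e i) (e j) = (if i = j then 1 else 0))"

text \<open>
  In a singular value decomposition the vectors \<open>\<sigma> i *\<^sub>R f i\<close> are the semi-axes, in order of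
  decreasing length, of the image of the unit sphere of \<open>B\<close>.
\<close>

definition is_svd ::
    "(real^'n \<Rightarrow> real^'n \<Rightarrow> real) \<Rightarrow> real^'n^'n \<Rightarrow> (nat \<Rightarrow> real) \<Rightarrow>
     (nat \<Rightarrow> real^'n) \<Rightarrow> (nat \<Rightarrow> real^'n) \<Rightarrow> bool" where
  "is_svd B A \<sigma> e f \<longleftrightarrow>
     orthonormal_frame B e \<and> orthonormal_frame B f \<and>
     (\<forall>i\<in>{1..CARD('n)}. \<sigma> i \<ge> 0 \<and> A *v e i = \<sigma> i *\<^sub>R f i) \<and>
     (\<forall>i\<in>{1..CARD('n)}. \<forall>j\<in>{1..CARD('n)}. i \<le> j \<longrightarrow> \<sigma> j \<le> \<sigma> i)"

definition singular_value ::
    "(real^'n \<Rightarrow> real^'n \<Rightarrow> real) \<Rightarrow> nat \<Rightarrow> real^'n^'n \<Rightarrow> real" where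
  "singular_value B i A = (THE s. \<exists>\<sigma> e f. is_svd B A \<sigma> e f \<and> s = \<sigma> i)"

text \<open>
  The span of the \<open>k\<close> longest axes, for a projective class \<open>X\<close>. It is unique if
  the singular values of index \<open>k\<close> and \<open>k + 1\<close> differ; otherwise this is one of the possible
  choices. Along a geodesic ray of an Anosov representation the gap is eventually present, so
  limits do not depend on the choice.
\<close>

definition longest_axes_space ::
    "(real^'n \<Rightarrow> real^'n \<Rightarrow> real) \<Rightarrow> nat \<Rightarrow> (real^'n^'n) set \<Rightarrow> (real^'n) set" where
  "longest_axes_space B k X =
     (SOME W. \<exists>A\<in>X. \<exists>\<sigma> e f. is_svd B A \<sigma> e f \<and> W = span (f ` {1..k}))"


section \<open>Grassmannians\<close>

text \<open>Families of \<open>k\<close> linearly independent vectors, as a subspace of a \<open>k\<close>-fold product.\<close>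

definition frame_topology :: "nat \<Rightarrow> (nat \<Rightarrow> real^'n) topology" where
  "frame_topology k =
     subtopology (product_topology (\<lambda>_. euclidean) {1..k})
       {v. inj_on v {1..k} \<and> independent (v ` {1..k})}"

definition grassmannian :: "nat \<Rightarrow> (real^'n) set topology" where
  "grassmannian k = quotient_topology (frame_topology k) (\<lambda>v. span (v ` {1..k}))"


section \<open>Anosov representations\<close>

definition anosov ::
    "('g, 'm) monoid_scheme \<Rightarrow> 'g set \<Rightarrow> (real^'n \<Rightarrow> real^'n \<Rightarrow> real) \<Rightarrow> nat \<Rightarrow>
     ('g \<Rightarrow> (real^'n^'n) set) \<Rightarrow> bool" where
  "anosov G S B p \<rho> \<longleftrightarrow>
     (\<exists>c>0. \<exists>\<mu>>0. \<forall>\<gamma>\<in>carrier G. \<forall>A\<in>\<rho> \<gamma>.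
        singular_value B (p + 1) A / singular_value B p A
          \<le> c * exp (- \<mu> * real (word_length G S \<gamma>)))"

definition boundary_map ::
    "('g, 'm) monoid_scheme \<Rightarrow> 'g set \<Rightarrow> (real^'n \<Rightarrow> real^'n \<Rightarrow> real) \<Rightarrow>
     ('g \<Rightarrow> (real^'n^'n) set) \<Rightarrow> nat \<Rightarrow> (nat \<Rightarrow> 'g) set \<Rightarrow> (real^'n) set" where
  "boundary_map G S B \<rho> k x =
     (THE L. \<forall>r\<in>x. limitin (grassmannian k)
                        (\<lambda>n. longest_axes_space B k (\<rho> (r n))) L sequentially)"

definition weakly_irreducible ::
    "('g, 'm) monoid_scheme \<Rightarrow> 'g set \<Rightarrow> (real^'n \<Rightarrow> real^'n \<Rightarrow> real) \<Rightarrow>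
     ('g \<Rightarrow> (real^'n^'n) set) \<Rightarrow> bool" where
  "weakly_irreducible G S B \<rho> \<longleftrightarrow>
     \<not> (\<exists>W. subspace W \<and> W \<noteq> UNIV \<and>
           (\<forall>x\<in>topspace (gromov_boundary G S). boundary_map G S B \<rho> 1 x \<subseteq> W))"

definition hyperconvex_112 ::
    "('g, 'm) monoid_scheme \<Rightarrow> 'g set \<Rightarrow> (real^'n \<Rightarrow> real^'n \<Rightarrow> real) \<Rightarrow>
     ('g \<Rightarrow> (real^'n^'n) set) \<Rightarrow> bool" where
  "hyperconvex_112 G S B \<rho> \<longleftrightarrow>
     (\<forall>x\<in>topspace (gromov_boundary G S). \<forall>y\<in>topspace (gromov_boundary G S).
      \<forall>z\<in>topspace (gromov_boundary G S). x \<noteq> y \<and> y \<noteq> z \<and> x \<noteq> z \<longrightarrow>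
        {u + v | u v. u \<in> boundary_map G S B \<rho> 1 x \<and> v \<in> boundary_map G S B \<rho> 1 y}
          \<inter> boundary_map G S B \<rho> (CARD('n) - 2) z = {0})"

definition weakly_irreducible_anosov_12 ::
    "('g, 'm) monoid_scheme \<Rightarrow> 'g set \<Rightarrow> (real^'n \<Rightarrow> real^'n \<Rightarrow> real) \<Rightarrow>
     ('g \<Rightarrow> (real^'n^'n) set) set" where
  "weakly_irreducible_anosov_12 G S B =
     {\<rho> \<in> representations G.
        anosov G S B 1 \<rho> \<and> anosov G S B 2 \<rho> \<and> weakly_irreducible G S B \<rho>}"

end

theory Submission imports Defs begin

text \<open>
  Fix \<open>z\<close> in the boundary circle. Projecting the limit curve from \<open>\<xi>\<^sup>d\<^sup>-\<^sup>2(z)\<close> and using the affine chart that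
  sends \<open>\<xi>\<^sup>d\<^sup>-\<^sup>1(z)\<close> to infinity gives a continuous real function on the circle minus \<open>z\<close>, and \<open>\<rho>\<close> is hyperconvex
  if and only if all these functions are injective. If one of them takes the same value at \<open>a < b\<close>,
  weak irreducibility and the contraction dynamics on the boundary show that it is not constant on
  \<open>[a, b]\<close>, so there is \<open>s\<close> between \<open>a\<close> and \<open>b\<close> whose value lies strictly on one side of the common value. Such a
  strict fold, with values at \<open>a\<close> and \<open>b\<close> no longer required to be equal, involves only four boundary points. It persists under
  perturbation because the limit lines at each fixed boundary point depend continuously on \<open>\<rho>\<close>, and
  it contradicts injectivity by the intermediate value theorem.

  Continuity in \<open>\<rho>\<close> of the limit lines is obtained from a local-to-global principle: along a geodesic
  ray, blocks of a fixed long length map a cone of directions well inside the next one, and this is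
  an open condition on the finitely many generators. The spaces \<open>\<xi>\<^sup>1\<close>, \<open>\<xi>\<^sup>d\<^sup>-\<^sup>1\<close>, \<open>\<xi>\<^sup>d\<^sup>-\<^sup>2\<close> are all reduced to limit
  lines, of \<open>\<rho>\<close>, of its contragredient, and of the exterior square of the latter.
\<close>

text \<open>Failure of hyperconvexity is an equality, and an equality is lost under perturbation;
  hence the detour through a strict inequality. The second obstacle: a representation near
  \<open>\<rho>\<close> satisfies the Anosov inequalities with constants of its own, over which
  there is no control. Limit lines are therefore compared one-sidedly. The constants of
  \<open>\<rho>\<close> alone fix a block length \<open>N\<close> and a tolerance
  \<open>\<epsilon>\<close>; a perturbed product over a multiple of \<open>N\<close> enters only
  through a vector at which its norm is attained, which cannot stay outside the cones. Chaining the
  cones needs the input direction of each block to be uniformly transverse to the image direction of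
  the next. This is extracted from norms: the norm of a product measures the pairing of these
  directions, and norms along a path decay at most at a fixed exponential rate. The same estimate,
  applied to two rays glued at the identity, gives the transversality of the boundary maps. Rays are
  kept as sequences in the group, fixed while the representation varies, so that a fold requires
  control at four rays only.\<close>

section \<open>Lines and operators with a dominant direction\<close>

text \<open>For unit vectors this is the distance of the lines they span.\<close>

definition ldist :: "'a::real_normed_vector \<Rightarrow> 'a \<Rightarrow> real" where
  "ldist a b = min (norm (a - b)) (norm (a + b))"

lemma ldist_nonneg: "0 \<le> ldist a b"
  by (simp add: ldist_def)

lemma ldist_self [simp]: "ldist a a = 0"
  by (simp add: ldist_def min_def)

lemma ldist_commute: "ldist a b = ldist b a"
  unfolding ldist_def by (subst norm_minus_commute, subst add.commute) (rule refl)

lemma ldist_minus_left [simp]: "ldist (- a) b = ldist a b"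
proof -
  have "norm (- a - b) = norm (a + b)"
    by (metis add_uminus_conv_diff minus_add_distrib norm_minus_cancel)
  moreover have "norm (- a + b) = norm (a - b)"
    by (metis add.commute norm_minus_commute uminus_add_conv_diff)
  ultimately show ?thesis by (simp add: ldist_def min.commute)
qed

lemma ldist_minus_right [simp]: "ldist a (- b) = ldist a b"
  by (metis ldist_commute ldist_minus_left)

lemma ldist_cases:
  obtains t where "t = 1 \<or> t = -1" "norm (a - t *\<^sub>R b) = ldist a b"
proof (cases "norm (a - b) \<le> norm (a + b)")
  case True
  then show ?thesis using that[of 1] by (simp add: ldist_def)
next
  case False
  then show ?thesis using that[of "-1"] by (simp add: ldist_def)
qed

lemma ldist_le_norm: "ldist a b \<le> norm (a - b)"
  by (simp add: ldist_def)

lemma ldist_triangle: "ldist a c \<le> ldist a b + ldist b c"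
proof -
  obtain s where s: "s = 1 \<or> s = -1" "norm (a - s *\<^sub>R b) = ldist a b" by (rule ldist_cases)
  obtain t where t: "t = 1 \<or> t = -1" "norm (b - t *\<^sub>R c) = ldist b c" by (rule ldist_cases)
  have "ldist a c = ldist a (s *\<^sub>R t *\<^sub>R c)" using s t by auto
  also have "\<dots> \<le> norm (a - s *\<^sub>R t *\<^sub>R c)" by (rule ldist_le_norm)
  also have "a - s *\<^sub>R t *\<^sub>R c = (a - s *\<^sub>R b) + s *\<^sub>R (b - t *\<^sub>R c)"
    by (simp add: algebra_simps)
  also have "norm \<dots> \<le> ldist a b + norm (s *\<^sub>R (b - t *\<^sub>R c))"
    using s(2) norm_triangle_ineq by metis
  also have "norm (s *\<^sub>R (b - t *\<^sub>R c)) = ldist b c" using s(1) t(2) by auto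
  finally show ?thesis by simp
qed

lemma abs_inner_ldist:
  fixes a b x :: "'a::real_inner"
  shows "\<bar>x \<bullet> a\<bar> \<le> \<bar>x \<bullet> b\<bar> + norm x * ldist a b"
proof -
  obtain t where t: "t = 1 \<or> t = -1" "norm (a - t *\<^sub>R b) = ldist a b" by (rule ldist_cases)
  have "x \<bullet> a = x \<bullet> (t *\<^sub>R b) + x \<bullet> (a - t *\<^sub>R b)" by (simp add: inner_diff_right)
  moreover have "\<bar>x \<bullet> (t *\<^sub>R b)\<bar> = \<bar>x \<bullet> b\<bar>" using t by auto
  moreover have "\<bar>x \<bullet> (a - t *\<^sub>R b)\<bar> \<le> norm x * ldist a b"
    using Cauchy_Schwarz_ineq2 t(2) by metis
  ultimately show ?thesis by linarith
qed

text \<open>With the sign chosen so that \<open>t = b \<bullet> a\<close> lies in [0, 1], the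
  squared distance is 2 - 2t and the squared perpendicular part is 1 - t^2; what remains is (1 -
  t)(2 + 4t) \<ge> 0. Distances of lines are estimated below through such perpendicular
  parts.\<close>

lemma ldist_le_perp:
  fixes a b :: "'a::real_inner"
  assumes "norm a = 1" "norm b = 1"
  shows "ldist a b \<le> 2 * norm (b - (b \<bullet> a) *\<^sub>R a)"
proof -
  have main: "norm (a - b) \<le> 2 * norm (b - (b \<bullet> a) *\<^sub>R a)" 
    if "norm a = 1" "norm b = 1" "b \<bullet> a \<ge> 0" for a b :: 'a
  proof -
    let ?t = "b \<bullet> a"
    have t1: "?t \<le> 1" using norm_cauchy_schwarz[of b a] that by simp
    have aa: "a \<bullet> a = 1" "b \<bullet> b = 1" using that by (simp_all add: norm_eq_1)
    have "(norm (a - b))\<^sup>2 = 2 - 2 * ?t"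
      using aa by (simp add: power2_norm_eq_inner algebra_simps inner_commute)
    also have "\<dots> \<le> 4 * (1 - ?t\<^sup>2)"
    proof -
      have "0 \<le> (1 - ?t) * (2 + 4 * ?t)" using t1 that(3) by simp
      then show ?thesis by (simp add: algebra_simps power2_eq_square)
    qed
    also have "1 - ?t\<^sup>2 = (norm (b - ?t *\<^sub>R a))\<^sup>2"
      unfolding power2_norm_eq_inner using aa
      by (simp add: algebra_simps inner_commute power2_eq_square)
    also have "4 * (norm (b - ?t *\<^sub>R a))\<^sup>2 = (2 * norm (b - ?t *\<^sub>R a))\<^sup>2" by simp
    finally show ?thesis by (rule power2_le_imp_le) simp
  qed
  show ?thesis
  proof (cases "b \<bullet> a \<ge> 0")
    case True
    then show ?thesis using main[OF assms] ldist_le_norm order_trans by blast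
  next
    case False
    then have "norm (- a - b) \<le> 2 * norm (b - (b \<bullet> a) *\<^sub>R a)" using main[of "-a" b] assms by simp
    then show ?thesis using ldist_le_norm[of "-a" b] by simp
  qed
qed

lemma ldist_unit_multiple:
  assumes "norm a = 1" "norm b = 1" "ldist a b = 0"
  obtains t where "t = 1 \<or> t = -1" "a = t *\<^sub>R b"
proof -
  obtain t where "t = 1 \<or> t = -1" "norm (a - t *\<^sub>R b) = ldist a b" by (rule ldist_cases)
  then show ?thesis using that[of t] assms(3) by simp
qed

lemma tendsto_ldist [tendsto_intros]:
  "(f \<longlongrightarrow> a) F \<Longrightarrow> (g \<longlongrightarrow> b) F \<Longrightarrow> ((\<lambda>x. ldist (f x) (g x)) \<longlongrightarrow> ldist a b) F"
  unfolding ldist_def by (intro tendsto_intros)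

section \<open>Operators with a gap after the first singular value\<close>

lemma onorm_bound:
  fixes f :: "'a::euclidean_space \<Rightarrow> 'b::real_normed_vector"
  assumes "linear f" shows "norm (f x) \<le> onorm f * norm x"
  using assms onorm linear_conv_bounded_linear by blast

lemma onorm_nonneg:
  fixes f :: "'a::euclidean_space \<Rightarrow> 'b::real_normed_vector"
  assumes "linear f" shows "0 \<le> onorm f"
  using assms onorm_pos_le linear_conv_bounded_linear by blast

lemma onorm_comp_le:
  fixes f :: "'b::euclidean_space \<Rightarrow> 'c::real_normed_vector" and g :: "'a::euclidean_space \<Rightarrow> 'b"
  assumes "linear f" "linear g" shows "onorm (f \<circ> g) \<le> onorm f * onorm g"
  using assms by (intro onorm_compose) (simp_all add: linear_conv_bounded_linear)

lemma onorm_scale: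
  fixes f :: "'a::euclidean_space \<Rightarrow> 'b::real_normed_vector"
  assumes "linear f" shows "onorm (\<lambda>v. t *\<^sub>R f v) = \<bar>t\<bar> * onorm f"
  using assms onorm_scaleR linear_conv_bounded_linear by blast

text \<open>In terms of a singular value decomposition, \<open>e\<close> and \<open>h\<close> are
  the first right and left singular vectors, called input and image direction below, and
  \<open>\<theta>\<close> bounds the ratio of the second singular value to the first. No
  decomposition is mentioned, so that the notion also fits operators with a kernel. As
  \<open>\<theta>\<close> is only an upper bound and may exceed 1, \<open>e\<close> and
  \<open>h\<close> need not be unique up to sign.\<close>

definition top_gap :: "('a::euclidean_space \<Rightarrow> 'a) \<Rightarrow> 'a \<Rightarrow> 'a \<Rightarrow> real \<Rightarrow> bool" where
  "top_gap f e h \<theta> \<longleftrightarrow> norm e = 1 \<and> norm h = 1 \<and> f e = onorm f *\<^sub>R h \<and> 0 < onorm f \<and> 0 \<le> \<theta> \<and>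
     (\<forall>w. w \<bullet> e = 0 \<longrightarrow> f w \<bullet> h = 0 \<and> norm (f w) \<le> \<theta> * onorm f * norm w)"

lemma top_gap_mono: "top_gap f e h \<theta> \<Longrightarrow> \<theta> \<le> \<theta>' \<Longrightarrow> top_gap f e h \<theta>'"
proof -
  assume a: "top_gap f e h \<theta>" "\<theta> \<le> \<theta>'"
  then have "\<theta> * onorm f * norm w \<le> \<theta>' * onorm f * norm w" for w
    by (intro mult_right_mono) (auto simp: top_gap_def)
  with a show ?thesis unfolding top_gap_def by (fastforce intro: order_trans)
qed

lemma top_gap_par:
  assumes "linear f" "top_gap f e h \<theta>"
  shows "f v \<bullet> h = onorm f * (v \<bullet> e)"
    and "norm (f v - (f v \<bullet> h) *\<^sub>R h) \<le> \<theta> * onorm f * norm v"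
proof -
  define w where "w = v - (v \<bullet> e) *\<^sub>R e"
  have ee: "e \<bullet> e = 1" "h \<bullet> h = 1" using assms by (auto simp: top_gap_def norm_eq_1)
  have we: "w \<bullet> e = 0" by (simp add: w_def inner_diff_left ee)
  have fw: "f w \<bullet> h = 0" "norm (f w) \<le> \<theta> * onorm f * norm w"
    using assms we by (auto simp: top_gap_def)
  have v: "v = (v \<bullet> e) *\<^sub>R e + w" by (simp add: w_def)
  have fv: "f v = ((v \<bullet> e) * onorm f) *\<^sub>R h + f w"
    using assms by (subst v) (simp add: linear_add linear_scale top_gap_def)
  show 1: "f v \<bullet> h = onorm f * (v \<bullet> e)" by (simp add: fv inner_add_left fw ee)
  have "(norm w)\<^sup>2 = (norm v)\<^sup>2 - (v \<bullet> e)\<^sup>2"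
    unfolding w_def power2_norm_eq_inner by (simp add: algebra_simps inner_commute ee power2_eq_square)
  then have "(norm w)\<^sup>2 \<le> (norm v)\<^sup>2" by simp
  then have "norm w \<le> norm v" by (rule power2_le_imp_le) simp
  moreover have "0 \<le> \<theta> * onorm f" using assms by (auto simp: top_gap_def)
  ultimately have "\<theta> * onorm f * norm w \<le> \<theta> * onorm f * norm v" by (rule mult_left_mono)
  then show "norm (f v - (f v \<bullet> h) *\<^sub>R h) \<le> \<theta> * onorm f * norm v"
    using fw by (simp add: 1) (simp add: fv mult.commute)
qed

lemma top_gap_scale:
  assumes "linear f" "top_gap f e h \<theta>" "t \<noteq> 0"
  shows "top_gap (\<lambda>v. t *\<^sub>R f v) e (sgn t *\<^sub>R h) \<theta>"
proof -
  have f: "norm e = 1" "norm h = 1" "f e = onorm f *\<^sub>R h" "0 < onorm f" "0 \<le> \<theta>"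
    "\<And>w. w \<bullet> e = 0 \<Longrightarrow> f w \<bullet> h = 0" "\<And>w. w \<bullet> e = 0 \<Longrightarrow> norm (f w) \<le> \<theta> * onorm f * norm w"
    using assms(2) by (auto simp: top_gap_def)
  have 1: "t * onorm f = \<bar>t\<bar> * onorm f * sgn t" by (simp add: sgn_if)
  have 2: "\<bar>t\<bar> * norm (f w) \<le> \<theta> * (\<bar>t\<bar> * onorm f) * norm w" if "w \<bullet> e = 0" for w
    using mult_left_mono[OF f(7)[OF that], of "\<bar>t\<bar>"] by (simp add: algebra_simps)
  have 3: "t *\<^sub>R f e = (\<bar>t\<bar> * onorm f) *\<^sub>R (sgn t *\<^sub>R h)" unfolding f(3) scaleR_scaleR by (metis 1)
  have 4: "norm (sgn t *\<^sub>R h) = 1" using f(2) assms(3) by (simp add: sgn_if)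
  show ?thesis unfolding top_gap_def onorm_scale[OF assms(1)]
    by (intro conjI allI impI 3 4 f(1,5)) (use f(4,6) 2 assms(3) in auto)
qed

lemma norm_adjoint_le:
  fixes f :: "'a::euclidean_space \<Rightarrow> 'b::euclidean_space"
  assumes "linear f" shows "onorm (adjoint f) \<le> onorm f"
proof (rule onorm_le)
  fix y
  have "(norm (adjoint f y))\<^sup>2 = f (adjoint f y) \<bullet> y"
    by (simp add: power2_norm_eq_inner adjoint_works[OF assms])
  also have "\<dots> \<le> norm (f (adjoint f y)) * norm y" by (rule norm_cauchy_schwarz)
  also have "\<dots> \<le> (onorm f * norm (adjoint f y)) * norm y"
    by (intro mult_right_mono onorm_bound assms) simp
  finally show "norm (adjoint f y) \<le> onorm f * norm y"
    using onorm_nonneg[OF assms]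
    by (cases "norm (adjoint f y) = 0") (auto simp: power2_eq_square mult.commute mult.left_commute)
qed

lemma onorm_adjoint:
  fixes f :: "'a::euclidean_space \<Rightarrow> 'b::euclidean_space"
  assumes "linear f" shows "onorm (adjoint f) = onorm f"
  using norm_adjoint_le[OF assms] norm_adjoint_le[OF adjoint_linear[OF assms]] adjoint_adjoint[OF assms] by simp

text \<open>Input and image direction change places. The bound on the complement of \<open>h\<close>
  comes from writing the squared norm of \<open>adjoint f w\<close> as
  \<open>f (adjoint f w) \<bullet> w\<close> and cancelling one factor.\<close>

lemma top_gap_adjoint:
  assumes f: "linear f" and t: "top_gap f e h \<theta>"
  shows "top_gap (adjoint f) h e \<theta>"
proof -
  have ee: "e \<bullet> e = 1" "h \<bullet> h = 1" using t by (auto simp: top_gap_def norm_eq_1)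
  have 1: "adjoint f h = onorm f *\<^sub>R e"
  proof (rule vector_eq_ldot[THEN iffD1], rule allI)
    fix v show "v \<bullet> adjoint f h = v \<bullet> (onorm f *\<^sub>R e)"
      using top_gap_par(1)[OF f t, of v] by (simp add: adjoint_works[OF f])
  qed
  have 2: "adjoint f w \<bullet> e = 0 \<and> norm (adjoint f w) \<le> \<theta> * onorm f * norm w" if w: "w \<bullet> h = 0" for w
  proof
    have "e \<bullet> adjoint f w = 0" using t w
      by (simp add: adjoint_works[OF f] top_gap_def inner_commute)
    then show o: "adjoint f w \<bullet> e = 0" by (simp add: inner_commute)
    let ?v = "adjoint f w"
    have "(norm ?v)\<^sup>2 = f ?v \<bullet> w" by (simp add: power2_norm_eq_inner adjoint_works[OF f])
    also have "\<dots> \<le> norm (f ?v) * norm w" by (rule norm_cauchy_schwarz)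
    also have "\<dots> \<le> (\<theta> * onorm f * norm ?v) * norm w"
      using t o by (intro mult_right_mono) (auto simp: top_gap_def)
    finally show "norm ?v \<le> \<theta> * onorm f * norm w"
      using t by (cases "norm ?v = 0") (auto simp: power2_eq_square top_gap_def mult.commute mult.left_commute)
  qed
  show ?thesis using t 1 2 unfolding top_gap_def onorm_adjoint[OF f] by simp
qed

text \<open>A factor on the right hardly moves the image direction: \<open>X\<close> sends every
  \<open>v\<close> to within \<open>\<theta> * onorm X * norm v\<close> of the line of
  \<open>h\<close>, and \<open>X (A e')\<close>, whose norm is \<open>onorm (X \<circ> A)\<close>,
  is not short compared with \<open>onorm X\<close>.\<close>

lemma top_gap_comp_right:
  assumes X: "linear X" and A: "linear A"
    and t: "top_gap X e h \<theta>" and t': "top_gap (X \<circ> A) e' h' \<theta>'"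
    and K: "onorm A \<le> K" "onorm X \<le> K * onorm (X \<circ> A)"
  shows "ldist h h' \<le> 2 * K\<^sup>2 * \<theta>"
proof -
  let ?s = "onorm X" and ?s' = "onorm (X \<circ> A)"
  have n: "norm e' = 1" "norm h' = 1" "norm h = 1" "?s' > 0" "X (A e') = ?s' *\<^sub>R h'" "?s > 0" "\<theta> \<ge> 0"
    using t t' by (auto simp: top_gap_def)
  have "norm (X (A e') - (X (A e') \<bullet> h) *\<^sub>R h) \<le> \<theta> * ?s * norm (A e')"
    by (rule top_gap_par(2)[OF X t])
  also have "\<dots> \<le> \<theta> * (K * ?s') * K"
    using n K onorm_bound[OF A, of e'] onorm_nonneg[OF A] by (intro mult_mono) auto
  also have "X (A e') - (X (A e') \<bullet> h) *\<^sub>R h = ?s' *\<^sub>R (h' - (h' \<bullet> h) *\<^sub>R h)"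
    by (simp add: n(5) algebra_simps)
  finally have "?s' * norm (h' - (h' \<bullet> h) *\<^sub>R h) \<le> ?s' * (K\<^sup>2 * \<theta>)"
    using n(4) by (simp add: power2_eq_square mult.commute mult.left_commute del: comp_apply o_apply)
  then have "norm (h' - (h' \<bullet> h) *\<^sub>R h) \<le> K\<^sup>2 * \<theta>" using n(4) by simp
  then show ?thesis using ldist_le_perp[OF n(3,2)] by linarith
qed

text \<open>The adjoint of the preceding estimate: a factor on the left hardly moves the input
  direction.\<close>

lemma top_gap_comp_left:
  assumes X: "linear X" and A: "linear A"
    and t: "top_gap X e h \<theta>" and t': "top_gap (A \<circ> X) e' h' \<theta>'"
    and K: "onorm A \<le> K" "onorm X \<le> K * onorm (A \<circ> X)"
  shows "ldist e e' \<le> 2 * K\<^sup>2 * \<theta>"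
proof -
  have AX: "linear (A \<circ> X)" using linear_compose[OF X A] .
  have ad: "adjoint (A \<circ> X) = adjoint X \<circ> adjoint A"
    by (rule adjoint_unique) (simp add: adjoint_works[OF A] adjoint_works[OF X])
  show ?thesis
    using top_gap_comp_right[OF adjoint_linear[OF X] adjoint_linear[OF A] top_gap_adjoint[OF X t], of h' e' \<theta>' K]
      top_gap_adjoint[OF AX t'] K onorm_adjoint[OF AX] unfolding ad
    by (simp add: onorm_adjoint[OF X] onorm_adjoint[OF A])
qed

text \<open>Composition with the identity. Two top directions of one operator may differ as long as
  the gap is weak, so they have to be compared as well.\<close>

lemma top_gap_same:
  assumes X: "linear X" and t: "top_gap X e h \<theta>" and t': "top_gap X e' h' \<theta>'"
  shows "ldist h h' \<le> 2 * \<theta>" "ldist e e' \<le> 2 * \<theta>"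
proof -
  have o: "onorm (id :: 'a \<Rightarrow> 'a) \<le> 1" by (rule onorm_le) simp
  have X0: "X \<circ> id = X" "id \<circ> X = X" by auto
  show "ldist h h' \<le> 2 * \<theta>"
    using top_gap_comp_right[OF X linear_id t, of e' h' \<theta>' 1] t' o X0 by simp
  show "ldist e e' \<le> 2 * \<theta>"
    using top_gap_comp_left[OF X linear_id t, of e' h' \<theta>' 1] t' o X0 by simp
qed

text \<open>Up to the two gaps, \<open>X \<circ> Y\<close> has rank one: \<open>Y\<close> produces
  multiples of \<open>h'\<close>, of which \<open>X\<close> sees only the component along
  \<open>e\<close>. Together with the lower bound \<open>onorm_comp_top_ge\<close>, the norm of a
  product and the transversality of the two inner directions control each other.\<close>

lemma onorm_comp_top_le:
  assumes X: "linear X" and Y: "linear Y"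
    and t: "top_gap X e h \<theta>" and t': "top_gap Y e' h' \<theta>'"
  shows "onorm (X \<circ> Y) \<le> onorm X * onorm Y * (\<bar>e \<bullet> h'\<bar> + \<theta> + \<theta>')"
proof (rule onorm_le)
  fix v
  let ?u = "Y v - (Y v \<bullet> h') *\<^sub>R h'"
  have n: "norm e' = 1" "norm h' = 1" "norm h = 1" "onorm X > 0" "onorm Y > 0" "\<theta> \<ge> 0" "\<theta>' \<ge> 0"
    using t t' by (auto simp: top_gap_def)
  have p: "\<bar>Y v \<bullet> h'\<bar> \<le> onorm Y * norm v"
    using top_gap_par(1)[OF Y t', of v] Cauchy_Schwarz_ineq2[of v e'] n by (simp add: abs_mult)
  have Xh: "norm (X h') \<le> onorm X * (\<bar>e \<bullet> h'\<bar> + \<theta>)"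
  proof -
    have "norm (X h') \<le> norm ((X h' \<bullet> h) *\<^sub>R h) + norm (X h' - (X h' \<bullet> h) *\<^sub>R h)"
      by (metis add_diff_cancel_left' add_diff_eq norm_triangle_ineq)
    also have "\<dots> \<le> onorm X * \<bar>e \<bullet> h'\<bar> + \<theta> * onorm X"
      using top_gap_par[OF X t, of h'] n by (simp add: abs_mult inner_commute)
    finally show ?thesis by (simp add: algebra_simps)
  qed
  have "X (Y v) = (Y v \<bullet> h') *\<^sub>R X h' + X ?u"
    using X by (simp add: linear_diff linear_scale)
  then have "norm (X (Y v)) \<le> \<bar>Y v \<bullet> h'\<bar> * norm (X h') + norm (X ?u)"
    by (metis norm_scaleR norm_triangle_ineq)
  also have "\<dots> \<le> (onorm Y * norm v) * (onorm X * (\<bar>e \<bullet> h'\<bar> + \<theta>)) + onorm X * (\<theta>' * onorm Y * norm v)"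
  proof (intro add_mono mult_mono p Xh)
    have "norm (X ?u) \<le> onorm X * norm ?u" by (rule onorm_bound[OF X])
    also have "\<dots> \<le> onorm X * (\<theta>' * onorm Y * norm v)"
      using top_gap_par(2)[OF Y t', of v] n by (intro mult_left_mono) auto
    finally show "norm (X ?u) \<le> onorm X * (\<theta>' * onorm Y * norm v)" .
  qed (use n in auto)
  finally show "norm ((X \<circ> Y) v) \<le> onorm X * onorm Y * (\<bar>e \<bullet> h'\<bar> + \<theta> + \<theta>') * norm v"
    by (simp add: algebra_simps)
qed

lemma onorm_comp_top_ge:
  assumes X: "linear X" and Y: "linear Y"
    and t: "top_gap X e h \<theta>" and t': "top_gap Y e' h' \<theta>'"
  shows "\<bar>e \<bullet> h'\<bar> * onorm X * onorm Y \<le> onorm (X \<circ> Y)"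
proof -
  have n: "norm e' = 1" "norm h = 1" "onorm Y > 0" "Y e' = onorm Y *\<^sub>R h'" using t t' by (auto simp: top_gap_def)
  have "X (Y e') \<bullet> h = onorm Y * (onorm X * (h' \<bullet> e))"
    using top_gap_par(1)[OF X t, of h'] X by (simp add: n linear_scale)
  moreover have "\<bar>X (Y e') \<bullet> h\<bar> \<le> onorm (X \<circ> Y)"
    using onorm_bound[OF linear_compose[OF Y X], of e'] Cauchy_Schwarz_ineq2[of "X (Y e')" h] n
    by simp
  ultimately show ?thesis using n onorm_nonneg[OF X]
    by (simp add: abs_mult inner_commute mult.commute mult.left_commute)
qed

text \<open>\<open>H k\<close> is the set of all admissible directions at stage \<open>k\<close>, so
  that nothing has to be chosen while the gap is weak. Besides the geometric sum, the bound carries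
  an extra 1 for the change of representative at the initial stage; both are at most 1 / (1 - q),
  whence the factor 2.\<close>

lemma geometric_chain:
  fixes H :: "nat \<Rightarrow> 'a::real_normed_vector set"
  assumes q: "0 < q" "q < 1" and D: "0 \<le> D"
    and ne: "\<And>k. b \<le> k \<Longrightarrow> k \<le> N \<Longrightarrow> H k \<noteq> {}"
    and same: "\<And>k h h'. b \<le> k \<Longrightarrow> k \<le> N \<Longrightarrow> h \<in> H k \<Longrightarrow> h' \<in> H k \<Longrightarrow> ldist h h' \<le> D * q ^ k"
    and step: "\<And>k h h'. b \<le> k \<Longrightarrow> k < N \<Longrightarrow> h \<in> H k \<Longrightarrow> h' \<in> H (Suc k) \<Longrightarrow> ldist h h' \<le> D * q ^ k"
    and k: "b \<le> k" "k \<le> k'" "k' \<le> N" and h: "h \<in> H k" "h' \<in> H k'"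
  shows "ldist h h' \<le> (2 * D / (1 - q)) * q ^ k"
proof -
  have "ldist h h' \<le> D * q ^ k * (1 + (\<Sum>i<j. q ^ i))" if "k + j \<le> N" "h' \<in> H (k + j)" for j h'
    using that
  proof (induction j arbitrary: h')
    case 0
    then show ?case using same[of k h h'] k h by simp
  next
    case (Suc j)
    obtain g where g: "g \<in> H (k + j)" using ne[of "k+j"] Suc k by fastforce
    have "ldist h h' \<le> ldist h g + ldist g h'" by (rule ldist_triangle)
    also have "\<dots> \<le> D * q ^ k * (1 + (\<Sum>i<j. q ^ i)) + D * q ^ (k + j)"
      using Suc g k by (intro add_mono step) auto
    also have "\<dots> = D * q ^ k * (1 + (\<Sum>i<Suc j. q ^ i))" by (simp add: algebra_simps power_add)
    finally show ?case .
  qed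
  from this[of "k' - k"] have "ldist h h' \<le> D * q ^ k * (1 + (\<Sum>i<k'-k. q ^ i))" using k h by simp
  also have "(\<Sum>i<k'-k. q ^ i) \<le> 1 / (1 - q)"
    using q by (subst sum_gp_strict) (auto simp: divide_right_mono)
  then have "D * q ^ k * (1 + (\<Sum>i<k'-k. q ^ i)) \<le> D * q ^ k * (1 / (1 - q) + 1 / (1 - q))"
    using q D by (intro mult_left_mono add_mono) auto
  finally show ?thesis by (simp add: algebra_simps)
qed

text \<open>Compactness of the unit sphere gives a limit along a subsequence. As the hypothesis
  compares stage \<open>k\<close> with every later one, its bound passes to this limit at each
  \<open>k\<close>.\<close>

lemma line_limit_exists:
  fixes H :: "nat \<Rightarrow> 'a::euclidean_space set"
  assumes ne: "\<And>k. b \<le> k \<Longrightarrow> H k \<noteq> {}" and u: "\<And>k h. h \<in> H k \<Longrightarrow> norm h = 1"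
    and c: "\<And>k k' h h'. b \<le> k \<Longrightarrow> k \<le> k' \<Longrightarrow> h \<in> H k \<Longrightarrow> h' \<in> H k' \<Longrightarrow> ldist h h' \<le> E k"
  obtains l where "norm l = 1" "\<And>k h. b \<le> k \<Longrightarrow> h \<in> H k \<Longrightarrow> ldist h l \<le> E k"
proof -
  define g where "g k = (SOME h. h \<in> H (b + k))" for k
  have g: "g k \<in> H (b + k)" for k unfolding g_def using ne[of "b+k"] by (simp add: some_in_eq)
  have "\<forall>k. g k \<in> sphere 0 1" using u[OF g] by simp
  then obtain l r where l: "l \<in> sphere 0 1" "strict_mono (r :: nat \<Rightarrow> nat)" "(g \<circ> r) \<longlonglongrightarrow> l"
    using compact_sphere[of "0::'a" 1] unfolding compact_def by metis
  have "ldist h l \<le> E k" if k: "b \<le> k" "h \<in> H k" for k h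
  proof (rule tendsto_upperbound)
    show "(\<lambda>i. ldist h ((g \<circ> r) i)) \<longlonglongrightarrow> ldist h l" by (intro tendsto_intros l(3))
    show "\<forall>\<^sub>F i in sequentially. ldist h ((g \<circ> r) i) \<le> E k"
      using eventually_ge_at_top[of k]
    proof eventually_elim
      case (elim i)
      have "i \<le> r i" using l(2) by (rule seq_suble)
      then show ?case using c[OF k(1) _ k(2) g] elim by simp
    qed
  qed simp
  then show ?thesis using that l(1) by simp
qed

section \<open>Dominated sequences of operators\<close>

text \<open>Later factors are applied first, as in the operator of the group element that leads from
  one vertex of a path to a later one. Lengthening the product at its far end therefore acts on the
  right and keeps the image direction nearly fixed; factors added in front keep the input direction
  nearly fixed.\<close>

primrec seq_prod :: "(nat \<Rightarrow> 'a \<Rightarrow> 'a) \<Rightarrow> nat \<Rightarrow> nat \<Rightarrow> 'a \<Rightarrow> 'a" where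
  "seq_prod A m 0 = id"
| "seq_prod A m (Suc k) = seq_prod A m k \<circ> A (m + k)"

lemma seq_prod_add: "seq_prod A m (j + k) = seq_prod A m j \<circ> seq_prod A (m + j) k"
  by (induction k) (auto simp: fun_eq_iff add.assoc)

lemma seq_prod_Suc_left: "seq_prod A m (Suc k) = A m \<circ> seq_prod A (Suc m) k"
  using seq_prod_add[of A m 1 k] by simp

lemma linear_seq_prod:
  fixes A :: "nat \<Rightarrow> 'a::real_vector \<Rightarrow> 'a"
  assumes "\<And>n. linear (A n)" shows "linear (seq_prod A m k)"
proof (induction k)
  case 0 show ?case unfolding seq_prod.simps by (rule linear_id)
next
  case (Suc k) then show ?case unfolding seq_prod.simps by (intro linear_compose assms)
qed

lemma onorm_seq_prod_le:
  fixes A :: "nat \<Rightarrow> 'a::euclidean_space \<Rightarrow> 'a"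
  assumes lin: "\<And>n. linear (A n)" and K: "\<And>n. onorm (A n) \<le> K" "0 \<le> K"
  shows "onorm (seq_prod A m k) \<le> K ^ k"
proof (induction k)
  case 0
  show ?case by (rule onorm_le) simp
next
  case (Suc k)
  have "onorm (seq_prod A m (Suc k)) \<le> onorm (seq_prod A m k) * onorm (A (m + k))"
    by (simp only: seq_prod.simps) (intro onorm_comp_le linear_seq_prod lin)
  also have "\<dots> \<le> K ^ k * K" using Suc K onorm_nonneg[OF lin] by (intro mult_mono) auto
  finally show ?case by (simp only: power_Suc2)
qed

text \<open>The gap is required of all products of consecutive factors, wherever they start. The
  conditions with \<open>K\<close> say that one more factor, at either end, cannot make the norm
  collapse; they take the place of bounds on inverses, since the factors may have a kernel.\<close>

definition dominated :: "(nat \<Rightarrow> 'a::euclidean_space \<Rightarrow> 'a) \<Rightarrow> real \<Rightarrow> real \<Rightarrow> real \<Rightarrow> bool" where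
  "dominated A c q K \<longleftrightarrow> (\<forall>n. linear (A n)) \<and> 0 < c \<and> 0 < q \<and> q < 1 \<and> 1 \<le> K \<and>
     (\<forall>n. onorm (A n) \<le> K \<and> 1 \<le> K * onorm (A n)) \<and>
     (\<forall>m k. 0 < k \<longrightarrow> (\<exists>e h. top_gap (seq_prod A m k) e h (c * q ^ k))) \<and>
     (\<forall>m k. 0 < k \<longrightarrow> onorm (seq_prod A m k) \<le> K * onorm (seq_prod A m (Suc k)) \<and>
        onorm (seq_prod A (Suc m) k) \<le> K * onorm (seq_prod A m (Suc k)))"

lemma mult_chain: "(x::real) \<le> a * y \<Longrightarrow> y \<le> b * z \<Longrightarrow> 0 \<le> a \<Longrightarrow> x \<le> (a * b) * z"
  by (metis mult.assoc mult_left_mono order_trans)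

context
  fixes A :: "nat \<Rightarrow> 'a::euclidean_space \<Rightarrow> 'a" and c q K :: real
  assumes dom: "dominated A c q K"
begin

lemma dom_basic: "linear (A n)" "linear (seq_prod A m k)" "0 < c" "0 < q" "q < 1" "1 \<le> K"
    "onorm (A n) \<le> K" "1 \<le> K * onorm (A n)"
  using dom linear_seq_prod[of A] by (auto simp: dominated_def)

lemma dom_top: "0 < k \<Longrightarrow> \<exists>e h. top_gap (seq_prod A m k) e h (c * q ^ k)"
  using dom by (auto simp: dominated_def)

lemma dom_shrink:
  assumes "0 < k"
  shows "onorm (seq_prod A m k) \<le> K ^ j * onorm (seq_prod A m (k + j))"
    and "onorm (seq_prod A (m + j) k) \<le> K ^ j * onorm (seq_prod A m (k + j))"
proof -
  have K: "0 \<le> K" using dom_basic by simp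
  have s: "onorm (seq_prod A m k) \<le> K * onorm (seq_prod A m (Suc k))"
    "onorm (seq_prod A (Suc m) k) \<le> K * onorm (seq_prod A m (Suc k))" if "0 < k" for m k
    using dom that unfolding dominated_def by blast+
  show "onorm (seq_prod A m k) \<le> K ^ j * onorm (seq_prod A m (k + j))"
  proof (induction j)
    case (Suc j)
    have "onorm (seq_prod A m k) \<le> (K ^ j * K) * onorm (seq_prod A m (Suc (k + j)))"
      by (rule mult_chain[OF Suc s(1)]) (use K assms in auto)
    then show ?case by (simp only: add_Suc_right power_Suc2)
  qed simp
  show "onorm (seq_prod A (m + j) k) \<le> K ^ j * onorm (seq_prod A m (k + j))"
  proof (induction j arbitrary: m)
    case (Suc j)
    have "onorm (seq_prod A (Suc m + j) k) \<le> (K ^ j * K) * onorm (seq_prod A m (Suc (k + j)))"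
      by (rule mult_chain[OF Suc s(2)]) (use K assms in auto)
    then show ?case by (simp only: add_Suc_right add_Suc power_Suc2)
  qed simp
qed

lemma dom_grow: 
  shows "onorm (seq_prod A m (k + j)) \<le> K ^ j * onorm (seq_prod A m k)"
    and "onorm (seq_prod A m (k + j)) \<le> K ^ j * onorm (seq_prod A (m + j) k)"
proof -
  have K: "0 \<le> K" using dom_basic by simp
  have p: "onorm (seq_prod A m j) \<le> K ^ j" for m j
    using onorm_seq_prod_le[of A K] dom_basic K by blast
  have n: "0 \<le> onorm (seq_prod A m k)" for m k using onorm_nonneg dom_basic by blast
  have "onorm (seq_prod A m (k + j)) \<le> onorm (seq_prod A m k) * onorm (seq_prod A (m + k) j)"
    unfolding seq_prod_add by (intro onorm_comp_le dom_basic)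
  also have "\<dots> \<le> onorm (seq_prod A m k) * K ^ j" by (intro mult_left_mono p n)
  finally show "onorm (seq_prod A m (k + j)) \<le> K ^ j * onorm (seq_prod A m k)" by (simp add: mult.commute)
  have "onorm (seq_prod A m (j + k)) \<le> onorm (seq_prod A m j) * onorm (seq_prod A (m + j) k)"
    unfolding seq_prod_add by (intro onorm_comp_le dom_basic)
  also have "\<dots> \<le> K ^ j * onorm (seq_prod A (m + j) k)" by (intro mult_right_mono p n)
  finally show "onorm (seq_prod A m (k + j)) \<le> K ^ j * onorm (seq_prod A (m + j) k)"
    by (simp add: add.commute)
qed

lemma dom_lower: "1 \<le> K ^ k * onorm (seq_prod A m k)" if "0 < k"
proof -
  have s: "onorm (seq_prod A m 1) \<le> K ^ (k - 1) * onorm (seq_prod A m (1 + (k - 1)))"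
    by (rule dom_shrink) simp
  have "1 \<le> K * onorm (seq_prod A m 1)" using dom_basic(8)[of m] by simp
  from mult_chain[OF this s] have "1 \<le> (K * K ^ (k - 1)) * onorm (seq_prod A m (1 + (k - 1)))"
    using dom_basic by simp
  moreover have "K * K ^ (k - 1) = K ^ k" "1 + (k - 1) = k" using that by (auto simp: power_eq_if)
  ultimately show ?thesis by simp
qed

text \<open>Each further factor on the right moves the image direction by at most
  \<open>2 * K\<^sup>2 * c * q ^ k\<close> (\<open>top_gap_comp_right\<close>), and
  \<open>geometric_chain\<close> sums these moves.\<close>

lemma dom_cauchy_left:
  assumes "0 < k" "k \<le> k'"
    and "top_gap (seq_prod A m k) e h (c * q ^ k)" "top_gap (seq_prod A m k') e' h' (c * q ^ k')"
  shows "ldist h h' \<le> 4 * K\<^sup>2 * c / (1 - q) * q ^ k"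
proof -
  let ?H = "\<lambda>k. {h. \<exists>e. top_gap (seq_prod A m k) e h (c * q ^ k)}"
  have K1: "1 \<le> K\<^sup>2" using dom_basic by simp
  have "ldist h h' \<le> (2 * (2 * K\<^sup>2 * c) / (1 - q)) * q ^ k"
  proof (rule geometric_chain[where H = ?H and b = 1 and N = k' and k' = k' and q = q and D = "2 * K\<^sup>2 * c"])
    fix k h h' assume k: "1 \<le> k" and hh: "h \<in> ?H k" "h' \<in> ?H k"
    then have "ldist h h' \<le> 2 * (c * q ^ k)" using top_gap_same(1)[OF dom_basic(2)] by blast
    also have "\<dots> \<le> K\<^sup>2 * (2 * (c * q ^ k))" using mult_right_mono[OF K1, of "2 * (c * q ^ k)"] dom_basic by simp
    finally show "ldist h h' \<le> 2 * K\<^sup>2 * c * q ^ k" by (simp add: mult.assoc mult.left_commute)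
  next
    fix k :: nat assume "1 \<le> k"
    then show "?H k \<noteq> {}" using dom_top[of k m] by fastforce
  next
    fix k h h' assume k: "1 \<le> k" and hh: "h \<in> ?H k" "h' \<in> ?H (Suc k)"
    then obtain e e' where t: "top_gap (seq_prod A m k) e h (c * q ^ k)"
      "top_gap (seq_prod A m k \<circ> A (m + k)) e' h' (c * q ^ Suc k)" by auto
    have "onorm (seq_prod A m k) \<le> K * onorm (seq_prod A m k \<circ> A (m + k))"
      using dom_shrink(1)[of k m 1] k by simp
    from top_gap_comp_right[OF dom_basic(2,1) t dom_basic(7) this]
    show "ldist h h' \<le> 2 * K\<^sup>2 * c * q ^ k" by (simp add: mult.assoc)
  qed (use assms dom_basic K1 dom_top in \<open>auto simp: Suc_le_eq\<close>)
  then show ?thesis by simp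
qed

text \<open>The mirror image, for input directions of products that end just before
  \<open>m\<close>. Lengthening to the left lowers the start \<open>m - k\<close>, whence the
  restriction \<open>k' \<le> m\<close>.\<close>

lemma dom_cauchy_right:
  assumes "0 < k" "k \<le> k'" "k' \<le> m"
    and "top_gap (seq_prod A (m - k) k) e h (c * q ^ k)" "top_gap (seq_prod A (m - k') k') e' h' (c * q ^ k')"
  shows "ldist e e' \<le> 4 * K\<^sup>2 * c / (1 - q) * q ^ k"
proof -
  let ?H = "\<lambda>k. {e. \<exists>h. top_gap (seq_prod A (m - k) k) e h (c * q ^ k)}"
  have K1: "1 \<le> K\<^sup>2" using dom_basic by simp
  have "ldist e e' \<le> (2 * (2 * K\<^sup>2 * c) / (1 - q)) * q ^ k"
  proof (rule geometric_chain[where H = ?H and b = 1 and N = k' and k' = k' and q = q and D = "2 * K\<^sup>2 * c"])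
    fix k h h' assume k: "1 \<le> k" and hh: "h \<in> ?H k" "h' \<in> ?H k"
    then have "ldist h h' \<le> 2 * (c * q ^ k)" using top_gap_same(2)[OF dom_basic(2)] by blast
    also have "\<dots> \<le> K\<^sup>2 * (2 * (c * q ^ k))" using mult_right_mono[OF K1, of "2 * (c * q ^ k)"] dom_basic by simp
    finally show "ldist h h' \<le> 2 * K\<^sup>2 * c * q ^ k" by (simp add: mult.assoc mult.left_commute)
  next
    fix k e e' assume k: "1 \<le> k" "k < k'" and hh: "e \<in> ?H k" "e' \<in> ?H (Suc k)"
    have S: "m - k = Suc (m - Suc k)" using k assms by simp
    have P: "seq_prod A (m - Suc k) (Suc k) = A (m - Suc k) \<circ> seq_prod A (m - k) k"
      unfolding seq_prod_Suc_left S ..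
    from hh obtain h h' where t: "top_gap (seq_prod A (m - k) k) e h (c * q ^ k)"
      "top_gap (A (m - Suc k) \<circ> seq_prod A (m - k) k) e' h' (c * q ^ Suc k)" unfolding P by auto
    have "onorm (seq_prod A (m - k) k) \<le> K * onorm (A (m - Suc k) \<circ> seq_prod A (m - k) k)"
      using dom_shrink(2)[of k "m - Suc k" 1] k
      unfolding P[symmetric] by (simp add: S[symmetric] del: seq_prod.simps)
    from top_gap_comp_left[OF dom_basic(2,1) t dom_basic(7) this]
    show "ldist e e' \<le> 2 * K\<^sup>2 * c * q ^ k" by (simp add: mult.assoc)
  qed (use assms dom_basic K1 dom_top in \<open>auto simp: Suc_le_eq\<close>)
  then show ?thesis by simp
qed

text \<open>If the pairing of the two halves were nearly degenerate at every midpoint of a window, the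
  norm would lose a factor \<open>q ^ (2 ^ j)\<close> at the \<open>j\<close>-th doubling, and after boundedly many doublings
  it would drop below the a priori bound \<open>K ^ - (2 ^ J)\<close>.\<close>

lemma dom_good_time:
  fixes J :: nat
  defines "C1 \<equiv> 8 * K\<^sup>2 * c / (1 - q) + 2 * c + 1"
  assumes J: "ln (K * C1) + ln K < J * (- ln q) / 2"
    and N: "2 ^ J \<le> N" "N \<le> M"
  obtains m e h e' h' where "M \<le> m" "m \<le> M + 2 ^ J"
    "top_gap (seq_prod A (m - N) N) e h (c * q ^ N)" "top_gap (seq_prod A m N) e' h' (c * q ^ N)"
    "q ^ (2 ^ J) < \<bar>e \<bullet> h'\<bar>"
proof (rule ccontr)
  note obt = that
  assume neg: "\<not> thesis"
  let ?C0 = "4 * K\<^sup>2 * c / (1 - q)"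
  let ?mu = "- ln q"
  have b: "0 < c" "0 < q" "q < 1" "1 \<le> K" using dom_basic by auto
  have C1: "1 \<le> C1" using b by (simp add: C1_def)
  have N0: "0 < N" using N by (metis gr0I not_one_le_zero one_le_numeral one_le_power order_trans)
  have bad: "\<bar>e \<bullet> h'\<bar> \<le> q ^ (2 ^ J)" if "M \<le> m" "m \<le> M + 2 ^ J"
    "top_gap (seq_prod A (m - N) N) e h (c * q ^ N)" "top_gap (seq_prod A m N) e' h' (c * q ^ N)"
    for m e h e' h' by (rule ccontr) (use neg obt[OF that] in \<open>simp add: not_le\<close>)
  \<comment> \<open>At the midpoint the pairing at scale \<open>n\<close> differs from that at scale
    \<open>N\<close> by at most \<open>2 * ?C0 * q ^ n\<close>, by the two Cauchy estimates. This,
    the two gap terms \<open>c * q ^ n\<close> and the assumed bound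
    \<open>q ^ (2 ^ J) \<le> q ^ n\<close> add up to \<open>C1 * q ^ n\<close>.\<close>
  have step: "onorm (seq_prod A a (n + n)) \<le> onorm (seq_prod A a n) * onorm (seq_prod A (a + n) n) * (C1 * q ^ n)"
    if n: "0 < n" "n \<le> 2 ^ J" and a: "M \<le> a + n" "a + n \<le> M + 2 ^ J" for a n
  proof -
    let ?m = "a + n"
    obtain e h where t1: "top_gap (seq_prod A (?m - n) n) e h (c * q ^ n)" using dom_top n by blast
    obtain e' h' where t2: "top_gap (seq_prod A ?m n) e' h' (c * q ^ n)" using dom_top n by blast
    obtain E H where T1: "top_gap (seq_prod A (?m - N) N) E H (c * q ^ N)" using dom_top N0 by blast
    obtain E' H' where T2: "top_gap (seq_prod A ?m N) E' H' (c * q ^ N)" using dom_top N0 by blast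
    have nm: "norm e = 1" "norm H' = 1" using t1 T2 by (auto simp: top_gap_def)
    have d1: "ldist e E \<le> ?C0 * q ^ n"
      by (rule dom_cauchy_right[OF n(1) _ _ t1 T1]) (use n N a in auto)
    have d2: "ldist h' H' \<le> ?C0 * q ^ n"
      by (rule dom_cauchy_left[OF n(1) _ t2 T2]) (use n N a in auto)
    have "\<bar>e \<bullet> h'\<bar> \<le> \<bar>e \<bullet> H'\<bar> + ?C0 * q ^ n"
      using abs_inner_ldist[of e h' H'] d2 nm by simp
    also have "\<bar>e \<bullet> H'\<bar> \<le> \<bar>E \<bullet> H'\<bar> + ?C0 * q ^ n"
      using abs_inner_ldist[of H' e E] d1 nm by (simp add: inner_commute)
    also have "\<bar>E \<bullet> H'\<bar> \<le> q ^ (2 ^ J)" by (rule bad[OF a T1 T2])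
    also have "\<dots> \<le> q ^ n" using b n by (intro power_decreasing) auto
    finally have eh: "\<bar>e \<bullet> h'\<bar> + c * q ^ n + c * q ^ n \<le> C1 * q ^ n"
      by (simp add: C1_def algebra_simps)
    have "onorm (seq_prod A a (n + n)) \<le> onorm (seq_prod A a n) * onorm (seq_prod A (a + n) n) *
        (\<bar>e \<bullet> h'\<bar> + c * q ^ n + c * q ^ n)"
      unfolding seq_prod_add by (rule onorm_comp_top_le[OF dom_basic(2,2) t1[unfolded add_diff_cancel_right'] t2])
    also have "\<dots> \<le> onorm (seq_prod A a n) * onorm (seq_prod A (a + n) n) * (C1 * q ^ n)"
      by (intro mult_left_mono eh mult_nonneg_nonneg onorm_nonneg dom_basic)
    finally show ?thesis .
  qed
  define L where "L = ln (K * C1)"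
  have KC: "0 < K * C1" using C1 b by simp
  \<comment> \<open>Weighted by \<open>C1\<close>, the norms satisfy a recursion without constant:
    the bound for length \<open>2 * n\<close> is the product of the two bounds for length
    \<open>n\<close>, times \<open>q ^ n\<close>. Per unit of length, each doubling thus lowers the
    exponent by half of \<open>- ln q\<close>.\<close>
  have main: "C1 * onorm (seq_prod A a (2 ^ j)) \<le> exp (2 ^ j * (L - j * ?mu / 2))"
    if "j \<le> J" "M \<le> a" "a + 2 ^ j \<le> M + 2 ^ J" for j a
    using that
  proof (induction j arbitrary: a)
    case 0
    have "C1 * onorm (A a) \<le> C1 * K" using C1 dom_basic by (intro mult_left_mono) auto
    then show ?case using KC by (simp add: L_def mult.commute)
  next
    case (Suc j)
    let ?n = "2 ^ j :: nat" and ?E = "exp (2 ^ j * (L - j * ?mu / 2))"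
    have i1: "C1 * onorm (seq_prod A a ?n) \<le> ?E"
      and i2: "C1 * onorm (seq_prod A (a + ?n) ?n) \<le> ?E"
      by (rule Suc.IH; use Suc.prems in simp)+
    have "?n \<le> 2 ^ J" using Suc.prems by (intro power_increasing) auto
    then have "onorm (seq_prod A a (?n + ?n)) \<le> onorm (seq_prod A a ?n) * onorm (seq_prod A (a + ?n) ?n) * (C1 * q ^ ?n)"
      using Suc.prems by (intro step) auto
    then have "C1 * onorm (seq_prod A a (?n + ?n)) \<le>
        (C1 * onorm (seq_prod A a ?n)) * (C1 * onorm (seq_prod A (a + ?n) ?n)) * q ^ ?n"
      using C1 by (simp add: mult.commute mult.left_commute)
    also have "\<dots> \<le> ?E * ?E * q ^ ?n"
      using i1 i2 C1 b onorm_nonneg[OF dom_basic(2)] by (intro mult_mono) auto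
    also have "q ^ ?n = exp (- (2 ^ j * ?mu))"
      using b by (simp add: exp_minus exp_of_nat_mult[of "2^j" "ln q", simplified])
    also have "?E * ?E * exp (- (2 ^ j * ?mu)) = exp (2 ^ Suc j * (L - Suc j * ?mu / 2))"
      unfolding exp_add[symmetric] by (simp add: algebra_simps add_divide_distrib diff_divide_distrib)
    finally have *: "C1 * onorm (seq_prod A a (?n + ?n)) \<le> exp (2 ^ Suc j * (L - Suc j * ?mu / 2))" .
    have "(2::nat) ^ Suc j = ?n + ?n" by simp
    with * show ?case by (simp only:)
  qed
  have "C1 * onorm (seq_prod A M (2 ^ J)) \<le> exp (2 ^ J * (L - J * ?mu / 2))"
    by (rule main[OF order_refl order_refl order_refl])
  also have "\<dots> < exp (2 ^ J * (- ln K))"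
  proof -
    have "L - J * ?mu / 2 < - ln K" using J unfolding L_def by linarith
    then show ?thesis by (simp only: exp_less_cancel_iff) (intro mult_strict_left_mono, auto)
  qed
  also have "\<dots> = 1 / K ^ (2 ^ J)"
    using b by (simp add: exp_minus exp_of_nat_mult[of "2^J" "ln K", simplified] divide_inverse)
  also have "\<dots> \<le> onorm (seq_prod A M (2 ^ J))"
    using dom_lower[of "2^J" M] b by (simp add: divide_le_eq mult.commute)
  also have "\<dots> \<le> C1 * onorm (seq_prod A M (2 ^ J))"
    using mult_right_mono[OF C1 onorm_nonneg[OF dom_basic(2)[of M "2^J"]]] by simp
  finally show False by simp
qed

end

text \<open>A transverse time exists at most \<open>2 ^ J\<close> steps after the given one, by
  \<open>dom_good_time\<close>. Sliding both blocks from there to the given time changes the norms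
  involved by bounded powers of \<open>K\<close>, and norms detect transversality. The constants
  depend on \<open>c\<close>, \<open>q\<close>, \<open>K\<close> only: the estimate will be applied
  to whole families of sequences.\<close>

lemma uniform_transversality:
  fixes c q K :: real
  assumes "0 < c" "0 < q" "q < 1" "1 \<le> K"
  obtains \<alpha> N0 where "0 < \<alpha>"
    "\<And>(A :: nat \<Rightarrow> 'a::euclidean_space \<Rightarrow> 'a) N m e h e' h'. dominated A c q K \<Longrightarrow> N0 \<le> N \<Longrightarrow> N \<le> m \<Longrightarrow>
      top_gap (seq_prod A (m - N) N) e h (c * q ^ N) \<Longrightarrow> top_gap (seq_prod A m N) e' h' (c * q ^ N) \<Longrightarrow>
      \<alpha> \<le> \<bar>e \<bullet> h'\<bar>"
proof -
  let ?C1 = "8 * K\<^sup>2 * c / (1 - q) + 2 * c + 1"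
  obtain J :: nat where J: "(ln (K * ?C1) + ln K) / (- ln q / 2) < J" using reals_Archimedean2 by blast
  have lq: "0 < - ln q / 2" using assms by simp
  from J have J': "ln (K * ?C1) + ln K < J * (- ln q) / 2"
    using pos_divide_less_eq[OF lq] by (simp only: times_divide_eq_right)
  \<comment> \<open>\<open>\<beta>\<close> is the pairing \<open>q ^ I\<close> at the good time
    divided by the cost of sliding over at most \<open>I\<close> steps, which is a factor
    \<open>K ^ 2\<close> per step for each of the two blocks and for their product.\<close>
  define I where "I = (2::nat) ^ J"
  define \<beta> where "\<beta> = q ^ I / K ^ (6 * I)"
  have K0: "0 < K" using assms by simp
  have \<beta>: "0 < \<beta>" using assms by (simp add: \<beta>_def)
  have "(\<lambda>n. 2 * c * q ^ n) \<longlonglongrightarrow> 2 * c * 0"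
    using assms by (intro tendsto_intros LIMSEQ_power_zero) auto
  then have "\<forall>\<^sub>F n in sequentially. 2 * c * q ^ n < \<beta> / 2" using \<beta> by (intro order_tendstoD) auto
  then obtain N1 where N1: "\<And>n. N1 \<le> n \<Longrightarrow> 2 * c * q ^ n < \<beta> / 2" unfolding eventually_sequentially by blast
  show ?thesis
  proof (rule that[of "\<beta> / 2" "max N1 I"])
    show "0 < \<beta> / 2" using \<beta> by simp
  next
    fix A :: "nat \<Rightarrow> 'a::euclidean_space \<Rightarrow> 'a" and N M e h e' h'
    assume dom: "dominated A c q K" and N: "max N1 I \<le> N" "N \<le> M"
      and t: "top_gap (seq_prod A (M - N) N) e h (c * q ^ N)" and t': "top_gap (seq_prod A M N) e' h' (c * q ^ N)"
    have N': "2 ^ J \<le> N" "0 < N" using N by (auto simp: I_def intro: less_le_trans[of 0 "2^J"])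
    obtain m E H E' H' where m: "M \<le> m" "m \<le> M + 2 ^ J"
      and T: "top_gap (seq_prod A (m - N) N) E H (c * q ^ N)" and T': "top_gap (seq_prod A m N) E' H' (c * q ^ N)"
      and EH: "q ^ (2 ^ J) < \<bar>E \<bullet> H'\<bar>"
      using dom_good_time[OF dom J' N'(1) N(2)] by metis
    define i where "i = m - M"
    have i: "m = M + i" "i \<le> I" using m by (auto simp: i_def I_def)
    let ?X = "seq_prod A (M - N) N" and ?Y = "seq_prod A M N" and ?X' = "seq_prod A (m - N) N" and ?Y' = "seq_prod A m N"
    note lin = dom_basic(2)[OF dom]
    have mN: "m - N = (M - N) + i" "m = (m - N) + N" "M = (M - N) + N" using i N by auto
    have nn: "0 < onorm ?X" "0 < onorm ?Y" using t t' by (auto simp: top_gap_def)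
    have XY: "?X \<circ> ?Y = seq_prod A (M - N) (N + N)" unfolding seq_prod_add using N by simp
    have XY': "?X' \<circ> ?Y' = seq_prod A (m - N) (N + N)" unfolding seq_prod_add using i N by simp
    have Kp: "0 \<le> K ^ i" using K0 by simp
    have sX: "onorm ?X \<le> (K ^ i * K ^ i) * onorm ?X'"
      unfolding mN(1)
      by (rule mult_chain[OF dom_shrink(1)[OF dom] dom_grow(2)[OF dom]]) (use N' Kp in auto)
    have sY: "onorm ?Y \<le> (K ^ i * K ^ i) * onorm ?Y'"
      unfolding i(1)
      by (rule mult_chain[OF dom_shrink(1)[OF dom] dom_grow(2)[OF dom]]) (use N' Kp in auto)
    have sXY: "onorm (?X' \<circ> ?Y') \<le> (K ^ i * K ^ i) * onorm (?X \<circ> ?Y)"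
      unfolding XY XY' unfolding mN(1)
      by (rule mult_chain[OF dom_shrink(2)[OF dom] dom_grow(1)[OF dom]]) (use N' Kp in auto)
    have "q ^ I * (onorm ?X * onorm ?Y) \<le> q ^ I * (((K ^ i * K ^ i) * onorm ?X') * ((K ^ i * K ^ i) * onorm ?Y'))"
      using sX sY nn assms Kp onorm_nonneg[OF lin] by (intro mult_left_mono mult_mono) auto
    also have "\<dots> \<le> \<bar>E \<bullet> H'\<bar> * (((K ^ i * K ^ i) * onorm ?X') * ((K ^ i * K ^ i) * onorm ?Y'))"
      using EH Kp onorm_nonneg[OF lin] by (intro mult_right_mono) (auto simp: I_def)
    also have "\<dots> = (K ^ i * K ^ i * K ^ i * K ^ i) * (\<bar>E \<bullet> H'\<bar> * onorm ?X' * onorm ?Y')" by (simp add: ac_simps)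
    also have "\<dots> \<le> (K ^ i * K ^ i * K ^ i * K ^ i) * ((K ^ i * K ^ i) * onorm (?X \<circ> ?Y))"
      using onorm_comp_top_ge[OF lin lin T T'] sXY Kp by (intro mult_left_mono) auto
    also have "\<dots> = K ^ (6 * i) * onorm (?X \<circ> ?Y)" 
    proof -
      have "6 * i = i + i + i + i + i + i" by simp
      then show ?thesis by (simp only: power_add ac_simps)
    qed
    also have "\<dots> \<le> K ^ (6 * I) * onorm (?X \<circ> ?Y)"
      using i(2) assms by (intro mult_right_mono power_increasing onorm_nonneg linear_compose lin) auto
    also have "\<dots> \<le> K ^ (6 * I) * (onorm ?X * onorm ?Y * (\<bar>e \<bullet> h'\<bar> + c * q ^ N + c * q ^ N))"
      using onorm_comp_top_le[OF lin lin t t'] K0 by (intro mult_left_mono) auto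
    finally have "q ^ I * (onorm ?X * onorm ?Y) \<le> (K ^ (6 * I) * (\<bar>e \<bullet> h'\<bar> + c * q ^ N + c * q ^ N)) * (onorm ?X * onorm ?Y)"
      by (simp only: ac_simps)
    then have "q ^ I \<le> K ^ (6 * I) * (\<bar>e \<bullet> h'\<bar> + c * q ^ N + c * q ^ N)"
      using nn by (metis mult_le_cancel_right_pos mult_pos_pos)
    then have "\<beta> \<le> \<bar>e \<bullet> h'\<bar> + 2 * c * q ^ N" using K0 by (simp add: \<beta>_def divide_le_eq algebra_simps)
    then show "\<beta> / 2 \<le> \<bar>e \<bullet> h'\<bar>" using N1[of N] N by simp
  qed
qed

lemma norm_perp_le:
  fixes w h :: "'a::real_inner"
  assumes "norm h = 1"
  shows "norm (w - (w \<bullet> h) *\<^sub>R h) \<le> norm w"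
proof (rule power2_le_imp_le)
  have "h \<bullet> h = 1" using assms by (simp add: norm_eq_1)
  then have "(norm (w - (w \<bullet> h) *\<^sub>R h))\<^sup>2 = (norm w)\<^sup>2 - (w \<bullet> h)\<^sup>2"
    unfolding power2_norm_eq_inner by (simp add: algebra_simps inner_commute power2_eq_square)
  then show "(norm (w - (w \<bullet> h) *\<^sub>R h))\<^sup>2 \<le> (norm w)\<^sup>2" by simp
qed simp

lemma norm_le_par_perp:
  fixes w h :: "'a::real_inner"
  assumes "norm h = 1"
  shows "norm w \<le> \<bar>w \<bullet> h\<bar> + norm (w - (w \<bullet> h) *\<^sub>R h)"
  using norm_triangle_ineq[of "(w \<bullet> h) *\<^sub>R h" "w - (w \<bullet> h) *\<^sub>R h"] assms by simp

text \<open>The vector whose image is longest must have its image in the cone: a vector whose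
  image is outside was outside the cone at every stage, so it gained a factor of at most
  \<open>2 * \<theta> / \<kappa>\<close> per block, whereas some vector gains \<open>\<alpha> / 4\<close> per block.\<close>

lemma cone_local_to_global:
  fixes X :: "nat \<Rightarrow> 'a::euclidean_space \<Rightarrow> 'a" and e h :: "nat \<Rightarrow> 'a" and s :: "nat \<Rightarrow> real"
  assumes lin: "\<And>i. linear (X i)" and unit: "\<And>i. norm (e i) = 1" "\<And>i. norm (h i) = 1" and s: "\<And>i. 0 < s i"
    and par: "\<And>i v. s i * (\<bar>v \<bullet> e i\<bar> - \<theta> * norm v) \<le> \<bar>X i v \<bullet> h i\<bar>"
    and perp: "\<And>i v. norm (X i v - (X i v \<bullet> h i) *\<^sub>R h i) \<le> \<theta> * s i * norm v"
    and tr: "\<And>i. \<alpha> \<le> \<bar>e i \<bullet> h (Suc i)\<bar>"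
    and cst: "0 < \<alpha>" "\<alpha> \<le> 1" "0 < \<kappa>" "\<kappa> \<le> \<alpha> / 4" "0 \<le> \<theta>" "\<theta> \<le> \<kappa> * \<alpha> / 16"
    and j: "0 < j" and v: "norm v = 1"
    and max: "\<And>w. norm (seq_prod X 0 j w) \<le> norm (seq_prod X 0 j v) * norm w"
  shows "norm (seq_prod X 0 j v - (seq_prod X 0 j v \<bullet> h 0) *\<^sub>R h 0) \<le> \<kappa> * \<bar>seq_prod X 0 j v \<bullet> h 0\<bar>"
proof (rule ccontr)
  \<comment> \<open>\<open>C i\<close> is the cone of slope \<open>\<kappa>\<close> around
    \<open>h i\<close>; \<open>p i k\<close> collects the sizes of the \<open>k\<close> blocks from
    \<open>i\<close> on, against which all growth is measured.\<close>
  define C where "C i w \<longleftrightarrow> norm (w - (w \<bullet> h i) *\<^sub>R h i) \<le> \<kappa> * \<bar>w \<bullet> h i\<bar>" for i w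
  define p where "p i k = (\<Prod>l<k. s (i + l))" for i k
  assume "\<not> ?thesis"
  then have nC: "\<not> C 0 (seq_prod X 0 j v)" by (simp add: C_def)
  have \<kappa>1: "\<kappa> \<le> 1 / 4" using cst by linarith
  have \<theta>1: "\<theta> \<le> \<alpha> / 64"
  proof -
    have "\<kappa> * \<alpha> \<le> (1/4) * \<alpha>" using cst \<kappa>1 by (intro mult_right_mono) auto
    then show ?thesis using cst by linarith
  qed
  have \<theta>2: "\<theta> \<le> \<kappa> / 16"
  proof -
    have "\<kappa> * \<alpha> \<le> \<kappa> * 1" using cst by (intro mult_left_mono) auto
    then show ?thesis using cst by linarith
  qed
  have p_Suc: "p i (Suc k) = s i * p (Suc i) k" for i k
    unfolding p_def by (subst prod.lessThan_Suc_shift) simp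
  have p_pos: "0 < p i k" for i k unfolding p_def using s by (intro prod_pos) auto
  \<comment> \<open>A vector \<open>w\<close> of the cone at \<open>Suc i\<close> has a component
    along \<open>e i\<close> of at least 3/4 of \<open>\<alpha> * t\<close>, as
    \<open>\<kappa> \<le> \<alpha> / 4\<close>. The block \<open>X i\<close> hence stretches it
    along \<open>h i\<close>, whereas its sideways part comes with the much smaller factor
    \<open>\<theta>\<close>.\<close>
  have step: "C i (X i w) \<and> s i * (\<alpha> / 4) * norm w \<le> norm (X i w)" if w: "C (Suc i) w" for i w
  proof -
    let ?h = "h (Suc i)"
    define t where "t = \<bar>w \<bullet> ?h\<bar>"
    have t0: "0 \<le> t" by (simp add: t_def)
    have pw: "norm (w - (w \<bullet> ?h) *\<^sub>R ?h) \<le> \<kappa> * t" using w by (simp add: C_def t_def)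
    have "\<kappa> * t \<le> (1/4) * t" using \<kappa>1 t0 by (intro mult_right_mono)
    then have nw: "norm w \<le> 5/4 * t" using norm_le_par_perp[OF unit(2), of w "Suc i"] pw unfolding t_def by linarith
    have "w \<bullet> e i = (w \<bullet> ?h) * (?h \<bullet> e i) + (w - (w \<bullet> ?h) *\<^sub>R ?h) \<bullet> e i"
      by (simp add: inner_diff_left)
    moreover have "\<bar>(w \<bullet> ?h) * (?h \<bullet> e i)\<bar> \<ge> t * \<alpha>"
      unfolding abs_mult t_def using tr[of i] by (intro mult_left_mono) (auto simp: inner_commute)
    moreover have "\<bar>(w - (w \<bullet> ?h) *\<^sub>R ?h) \<bullet> e i\<bar> \<le> \<kappa> * t"
      using Cauchy_Schwarz_ineq2[of "w - (w \<bullet> ?h) *\<^sub>R ?h" "e i"] pw unit by simp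
    moreover have "\<kappa> * t \<le> \<alpha> / 4 * t" using cst t0 by (intro mult_right_mono) auto
    ultimately have we: "3/4 * (\<alpha> * t) \<le> \<bar>w \<bullet> e i\<bar>" by (simp add: mult.commute abs_if split: if_splits)
    have "\<theta> * norm w \<le> \<alpha> / 64 * (5/4 * t)" using \<theta>1 nw cst by (intro mult_mono) auto
    with we have "\<alpha> * t / 2 \<le> \<bar>w \<bullet> e i\<bar> - \<theta> * norm w" using cst t0 by simp
    then have "s i * (\<alpha> * t / 2) \<le> s i * (\<bar>w \<bullet> e i\<bar> - \<theta> * norm w)" using s[of i] by (intro mult_left_mono) auto
    then have 1: "s i * (\<alpha> * t / 2) \<le> \<bar>X i w \<bullet> h i\<bar>" using par order_trans by blast
    have "\<theta> * s i * norm w = (\<theta> * norm w) * s i" by simp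
    also have "\<dots> \<le> ((\<kappa> * \<alpha> / 16) * (5/4 * t)) * s i"
      using nw cst t0 s[of i] by (intro mult_right_mono mult_mono) auto
    also have "\<dots> \<le> \<kappa> * (s i * (\<alpha> * t / 2))" using cst t0 s[of i] by (simp add: algebra_simps)
    also have "\<dots> \<le> \<kappa> * \<bar>X i w \<bullet> h i\<bar>" using 1 cst by (intro mult_left_mono) auto
    finally have "C i (X i w)" unfolding C_def using perp[of i w] by linarith
    moreover have "s i * (\<alpha> / 4) * norm w \<le> s i * (\<alpha> / 4) * (5/4 * t)"
      using nw s[of i] cst by (intro mult_left_mono) auto
    moreover have "\<dots> \<le> s i * (\<alpha> * t / 2)" using s[of i] cst t0 by (simp add: algebra_simps)
    moreover have "\<bar>X i w \<bullet> h i\<bar> \<le> norm (X i w)" using Cauchy_Schwarz_ineq2[of "X i w" "h i"] unit by simp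
    ultimately show ?thesis using 1 by linarith
  qed
  have grow: "\<exists>u. norm u = 1 \<and> C i (seq_prod X i (Suc k) u) \<and>
      p i (Suc k) * (\<alpha> / 4) ^ Suc k \<le> norm (seq_prod X i (Suc k) u)" for i k
  proof (induction k arbitrary: i)
    case 0
    have a: "s i * (1 - \<theta>) \<le> \<bar>X i (e i) \<bullet> h i\<bar>" using par[of i "e i"] unit by (simp add: norm_eq_1)
    have b: "norm (X i (e i) - (X i (e i) \<bullet> h i) *\<^sub>R h i) \<le> \<theta> * s i" using perp[of i "e i"] unit by simp
    have "\<theta> * s i \<le> (\<kappa> * (1 - \<theta>)) * s i"
    proof (rule mult_right_mono)
      have "\<kappa> * \<theta> \<le> \<kappa> * (1/2)" using cst \<theta>1 by (intro mult_left_mono) auto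
      moreover have "\<kappa> * (1 - \<theta>) = \<kappa> - \<kappa> * \<theta>" by (simp add: algebra_simps)
      ultimately show "\<theta> \<le> \<kappa> * (1 - \<theta>)" using \<theta>2 cst by linarith
    qed (use s[of i] in simp)
    also have "\<dots> = \<kappa> * (s i * (1 - \<theta>))" by simp
    also have "\<dots> \<le> \<kappa> * \<bar>X i (e i) \<bullet> h i\<bar>" using a cst by (intro mult_left_mono) auto
    finally have "C i (X i (e i))" using b by (simp add: C_def)
    moreover have "s i * (\<alpha> / 4) \<le> s i * (1 - \<theta>)" using s[of i] cst \<theta>1 by (intro mult_left_mono) auto
    moreover have "\<bar>X i (e i) \<bullet> h i\<bar> \<le> norm (X i (e i))" using Cauchy_Schwarz_ineq2[of "X i (e i)" "h i"] unit by simp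
    ultimately have "C i (X i (e i)) \<and> s i * (\<alpha> / 4) \<le> norm (X i (e i))" using a by linarith
    then show ?case using unit by (intro exI[of _ "e i"]) (simp add: p_def)
  next
    case (Suc k)
    obtain u where u: "norm u = 1" "C (Suc i) (seq_prod X (Suc i) (Suc k) u)"
      "p (Suc i) (Suc k) * (\<alpha> / 4) ^ Suc k \<le> norm (seq_prod X (Suc i) (Suc k) u)" using Suc by blast
    let ?w = "seq_prod X (Suc i) (Suc k) u"
    have w: "seq_prod X i (Suc (Suc k)) u = X i ?w" by (subst seq_prod_Suc_left) simp
    have "p i (Suc (Suc k)) * (\<alpha> / 4) ^ Suc (Suc k) = (s i * (\<alpha> / 4)) * (p (Suc i) (Suc k) * (\<alpha> / 4) ^ Suc k)"
      unfolding p_Suc[of i "Suc k"] by simp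
    also have "\<dots> \<le> (s i * (\<alpha> / 4)) * norm ?w" using u(3) s[of i] cst by (intro mult_left_mono) auto
    also have "\<dots> \<le> norm (X i ?w)" using step[OF u(2)] by simp
    finally show ?case using u(1) step[OF u(2)] w by metis
  qed
  have out: "norm (seq_prod X i k w) \<le> p i k * (2 * \<theta> / \<kappa>) ^ k * norm w" if "\<not> C i (seq_prod X i k w)" for i k w
    using that
  proof (induction k arbitrary: i)
    case 0 then show ?case by (simp add: p_def)
  next
    case (Suc k)
    let ?w = "seq_prod X (Suc i) k w"
    have w: "seq_prod X i (Suc k) w = X i ?w" by (subst seq_prod_Suc_left) simp
    have n: "\<not> C i (X i ?w)" using Suc.prems w by simp
    then have "\<not> C (Suc i) ?w" using step by blast
    then have IH: "norm ?w \<le> p (Suc i) k * (2 * \<theta> / \<kappa>) ^ k * norm w" by (rule Suc.IH)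
    let ?P = "norm (X i ?w - (X i ?w \<bullet> h i) *\<^sub>R h i)"
    have "\<kappa> * \<bar>X i ?w \<bullet> h i\<bar> \<le> ?P" using n by (simp add: C_def)
    then have "\<kappa> * norm (X i ?w) \<le> ?P + \<kappa> * ?P"
      using mult_left_mono[OF norm_le_par_perp[OF unit(2), of "X i ?w" i], of \<kappa>] cst
      by (simp add: algebra_simps)
    also have "\<dots> \<le> 2 * ?P" using mult_right_mono[of \<kappa> 1 ?P] \<kappa>1 by simp
    also have "\<dots> \<le> 2 * (\<theta> * s i * norm ?w)" using perp[of i ?w] by simp
    finally have "norm (X i ?w) \<le> (s i * (2 * \<theta> / \<kappa>)) * norm ?w"
      using cst by (simp add: field_simps)
    also have "\<dots> \<le> (s i * (2 * \<theta> / \<kappa>)) * (p (Suc i) k * (2 * \<theta> / \<kappa>) ^ k * norm w)"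
      using IH s[of i] cst by (intro mult_left_mono) auto
    finally show ?case unfolding w p_Suc power_Suc by (simp only: ac_simps)
  qed
  obtain k where k: "j = Suc k" using j by (metis gr0_conv_Suc)
  obtain u where u: "norm u = 1" "p 0 j * (\<alpha> / 4) ^ j \<le> norm (seq_prod X 0 j u)" using grow[of 0 k] k by blast
  have "p 0 j * (\<alpha> / 4) ^ j \<le> norm (seq_prod X 0 j v)" using u max[of u] by simp
  also have "\<dots> \<le> p 0 j * (2 * \<theta> / \<kappa>) ^ j" using out[OF nC] v by simp
  finally have "(\<alpha> / 4) ^ j \<le> (2 * \<theta> / \<kappa>) ^ j" using p_pos[of 0 j] by simp
  \<comment> \<open>The bound on \<open>\<theta>\<close> makes the left side at most
    \<open>\<alpha> / 8\<close>, so the two growth rates contradict each other.\<close>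
  moreover have "2 * \<theta> / \<kappa> < \<alpha> / 4"
  proof -
    have "\<alpha> / 4 * \<kappa> = \<kappa> * \<alpha> / 4" by simp
    then show ?thesis
      using cst(6) mult_pos_pos[OF cst(3,1)] unfolding pos_divide_less_eq[OF cst(3)] by linarith
  qed
  then have "(2 * \<theta> / \<kappa>) ^ j < (\<alpha> / 4) ^ j" using cst j by (intro power_strict_mono) auto
  ultimately show False by simp
qed

text \<open>One factor is replaced at a time. The constant is exponential in \<open>k\<close>, which
  is harmless because \<open>k\<close> will be a block length fixed before \<open>\<epsilon>\<close>
  is chosen.\<close>

lemma seq_prod_perturb:
  fixes A A' :: "nat \<Rightarrow> 'a::euclidean_space \<Rightarrow> 'a"
  assumes lin: "\<And>n. linear (A n)" and K: "\<And>n. onorm (A n) \<le> K" "0 \<le> K"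
    and d: "\<And>n v. norm (A' n v - A n v) \<le> \<epsilon> * norm v" and \<epsilon>: "0 \<le> \<epsilon>" "\<epsilon> \<le> 1"
  shows "norm (seq_prod A' m k v - seq_prod A m k v) \<le> \<epsilon> * (k * (K + 1) ^ k) * norm v"
proof (induction k arbitrary: v)
  case 0 show ?case by simp
next
  case (Suc k)
  let ?a = "A (m + k) v" and ?a' = "A' (m + k) v" and ?P = "seq_prod A m k" and ?P' = "seq_prod A' m k"
  have P: "linear ?P" by (rule linear_seq_prod[OF lin])
  have na: "norm ?a \<le> K * norm v"
    using onorm_bound[OF lin, of "m + k" v] K mult_right_mono[of "onorm (A (m+k))" K "norm v"] by fastforce
  have "norm ?a' \<le> norm (?a' - ?a) + norm ?a" by (metis diff_add_cancel norm_triangle_ineq)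
  also have "\<dots> \<le> 1 * norm v + K * norm v"
    using d[of "m + k" v] na mult_right_mono[OF \<epsilon>(2) norm_ge_zero[of v]] by linarith
  finally have na': "norm ?a' \<le> (K + 1) * norm v" by (simp add: algebra_simps)
  have "norm (?P' ?a' - ?P ?a) \<le> norm (?P' ?a' - ?P ?a') + norm (?P (?a' - ?a))"
    using norm_triangle_ineq[of "?P' ?a' - ?P ?a'" "?P (?a' - ?a)"] by (simp add: linear_diff[OF P])
  also have "\<dots> \<le> \<epsilon> * (k * (K + 1) ^ k) * ((K + 1) * norm v) + K ^ k * (\<epsilon> * norm v)"
  proof (rule add_mono)
    show "norm (?P' ?a' - ?P ?a') \<le> \<epsilon> * (k * (K + 1) ^ k) * ((K + 1) * norm v)"
      using Suc[of ?a'] mult_left_mono[OF na', of "\<epsilon> * (k * (K + 1) ^ k)"] \<epsilon> K by simp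
    have "norm (?P (?a' - ?a)) \<le> onorm ?P * norm (?a' - ?a)" by (rule onorm_bound[OF P])
    also have "\<dots> \<le> K ^ k * (\<epsilon> * norm v)"
      using onorm_seq_prod_le[of A K m k] lin K d \<epsilon> by (intro mult_mono) auto
    finally show "norm (?P (?a' - ?a)) \<le> K ^ k * (\<epsilon> * norm v)" .
  qed
  also have "K ^ k * (\<epsilon> * norm v) \<le> (K + 1) ^ Suc k * (\<epsilon> * norm v)"
  proof (rule mult_right_mono)
    have "K ^ k \<le> (K + 1) ^ k" using K by (intro power_mono) auto
    also have "\<dots> \<le> (K + 1) ^ Suc k" using K by (intro power_increasing) auto
    finally show "K ^ k \<le> (K + 1) ^ Suc k" .
  qed (use \<epsilon> in simp)
  finally show ?case by (simp add: algebra_simps)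
qed

lemma seq_prod_blocks: "seq_prod (\<lambda>i. seq_prod A (i * N) N) 0 j = seq_prod A 0 (j * N)"
proof (induction j)
  case (Suc j)
  have "seq_prod A 0 (Suc j * N) = seq_prod A 0 (j * N + N)" by (simp add: add.commute)
  then show ?case using Suc by (simp add: seq_prod_add)
qed simp

text \<open>Blocks of \<open>A\<close> of a large length \<open>N\<close> satisfy the hypotheses of
  \<open>cone_local_to_global\<close> with room to spare, by the gap and by
  \<open>uniform_transversality\<close>, and for small \<open>\<epsilon>\<close> the blocks of
  \<open>A'\<close> still satisfy them. The bound \<open>\<theta>'\<close> is left arbitrary: the
  perturbed product enters through the vector \<open>e'\<close> that realises its norm and the
  direction \<open>h'\<close> of its image.\<close>

lemma dominated_stability:
  fixes A :: "nat \<Rightarrow> 'a::euclidean_space \<Rightarrow> 'a"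
  assumes dom: "dominated A c q K" and \<eta>: "0 < \<eta>"
  obtains \<epsilon> N where "0 < \<epsilon>" "0 < N" "4 * K\<^sup>2 * c / (1 - q) * q ^ N \<le> \<eta>"
    "\<And>A' j e h e' h' \<theta>'. (\<And>n. linear (A' n)) \<Longrightarrow> (\<And>n v. norm (A' n v - A n v) \<le> \<epsilon> * norm v) \<Longrightarrow> 0 < j \<Longrightarrow>
       top_gap (seq_prod A 0 N) e h (c * q ^ N) \<Longrightarrow> top_gap (seq_prod A' 0 (j * N)) e' h' \<theta>' \<Longrightarrow> ldist h h' \<le> \<eta>"
proof -
  note b = dom_basic[OF dom]
  obtain \<alpha>0 N0 where \<alpha>0: "0 < \<alpha>0"
    and tr0: "\<And>(A :: nat \<Rightarrow> 'a \<Rightarrow> 'a) N m e h e' h'. dominated A c q K \<Longrightarrow> N0 \<le> N \<Longrightarrow> N \<le> m \<Longrightarrow>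
      top_gap (seq_prod A (m - N) N) e h (c * q ^ N) \<Longrightarrow> top_gap (seq_prod A m N) e' h' (c * q ^ N) \<Longrightarrow>
      \<alpha>0 \<le> \<bar>e \<bullet> h'\<bar>"
    using uniform_transversality[of c q K, where ?'a = 'a] b by blast
  define \<alpha> where "\<alpha> = min \<alpha>0 1"
  \<comment> \<open>Lying in a cone of slope \<open>\<kappa>\<close> bounds \<open>ldist\<close> by
    \<open>2 * \<kappa>\<close>, whence \<open>\<eta> / 2\<close>; the remaining choices are
    dictated by \<open>cone_local_to_global\<close>.\<close>
  define \<kappa> where "\<kappa> = min (\<alpha> / 4) (\<eta> / 2)"
  define \<theta> where "\<theta> = \<kappa> * \<alpha> / 16"
  have \<alpha>: "0 < \<alpha>" "\<alpha> \<le> 1" "\<alpha> \<le> \<alpha>0" using \<alpha>0 by (auto simp: \<alpha>_def)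
  have \<kappa>: "0 < \<kappa>" "\<kappa> \<le> \<alpha> / 4" "\<kappa> \<le> \<eta> / 2" using \<alpha> \<eta> by (auto simp: \<kappa>_def)
  have \<theta>: "0 < \<theta>" using \<alpha> \<kappa> by (simp add: \<theta>_def)
  have lim: "(\<lambda>n. x * q ^ n) \<longlonglongrightarrow> x * 0" for x
    using b by (intro tendsto_intros LIMSEQ_power_zero) auto
  have "\<forall>\<^sub>F n in sequentially. 4 * K\<^sup>2 * c / (1 - q) * q ^ n < \<eta>" by (rule order_tendstoD(2)[OF lim]) (use \<eta> in simp)
  moreover have "\<forall>\<^sub>F n in sequentially. c * q ^ n < \<theta> / 2" by (rule order_tendstoD(2)[OF lim]) (use \<theta> in simp)
  moreover have "\<forall>\<^sub>F n in sequentially. max N0 1 \<le> n" by (rule eventually_ge_at_top)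
  ultimately have "\<forall>\<^sub>F n in sequentially. 4 * K\<^sup>2 * c / (1 - q) * q ^ n < \<eta> \<and> c * q ^ n < \<theta> / 2 \<and> max N0 1 \<le> n"
    by eventually_elim simp
  then obtain N where N: "4 * K\<^sup>2 * c / (1 - q) * q ^ N < \<eta>" "c * q ^ N < \<theta> / 2" "N0 \<le> N" "0 < N"
    unfolding eventually_sequentially by (metis max.bounded_iff order_refl less_eq_Suc_le One_nat_def)
  \<comment> \<open>\<open>N * (K + 1) ^ N\<close> is the constant of
    \<open>seq_prod_perturb\<close>; the factor \<open>K ^ N\<close> makes the error relative to the
    norm of a block, which is at least \<open>1 / K ^ N\<close>.\<close>
  define Z where "Z = N * (K + 1) ^ N * K ^ N"
  have Z: "0 < Z" using N b(6) by (simp add: Z_def)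
  define \<epsilon> where "\<epsilon> = min 1 (\<theta> / 2 / Z)"
  have \<epsilon>: "0 < \<epsilon>" "\<epsilon> \<le> 1" "\<epsilon> * Z \<le> \<theta> / 2" using \<theta> Z by (auto simp: \<epsilon>_def min_def divide_simps)
  show ?thesis
  proof (rule that[OF \<epsilon>(1) N(4)])
    show "4 * K\<^sup>2 * c / (1 - q) * q ^ N \<le> \<eta>" using N(1) by simp
    fix A' :: "nat \<Rightarrow> 'a \<Rightarrow> 'a" and j e h e' h' \<theta>'
    assume lin': "\<And>n. linear (A' n)" and d: "\<And>n v. norm (A' n v - A n v) \<le> \<epsilon> * norm v" and j: "0 < j"
      and t: "top_gap (seq_prod A 0 N) e h (c * q ^ N)" and t': "top_gap (seq_prod A' 0 (j * N)) e' h' \<theta>'"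
    let ?Y = "\<lambda>i. seq_prod A (i * N) N" and ?X = "\<lambda>i. seq_prod A' (i * N) N"
    have "\<forall>i. \<exists>e h. top_gap (?Y i) e h (c * q ^ N)" using dom_top[OF dom N(4)] by blast
    then obtain E H0 where EH0: "\<And>i. top_gap (?Y i) (E i) (H0 i) (c * q ^ N)" by metis
    \<comment> \<open>Top directions of a block are not unique. The conclusion speaks of the given
      \<open>h\<close>, so block 0 uses the given pair instead of a chosen one.\<close>
    define E' where "E' = E(0 := e)"
    define H where "H = H0(0 := h)"
    have EH: "top_gap (?Y i) (E' i) (H i) (c * q ^ N)" for i using EH0 t by (simp add: E'_def H_def)
    have unit: "norm (E' i) = 1" "norm (H i) = 1" for i using EH by (auto simp: top_gap_def)
    have s: "1 \<le> K ^ N * onorm (?Y i)" for i by (rule dom_lower[OF dom N(4)])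
    have s0: "0 < onorm (?Y i)" for i using EH by (auto simp: top_gap_def)
    have pert: "norm (?X i v - ?Y i v) \<le> \<theta> / 2 * onorm (?Y i) * norm v" for i v
    proof -
      have "norm (?X i v - ?Y i v) \<le> \<epsilon> * (N * (K + 1) ^ N) * norm v"
        by (rule seq_prod_perturb) (use b d \<epsilon> in auto)
      also have "\<dots> \<le> (\<epsilon> * (N * (K + 1) ^ N) * (K ^ N * onorm (?Y i))) * norm v"
        using mult_left_mono[OF s[of i], of "\<epsilon> * (N * (K + 1) ^ N)"] \<epsilon> b(6) by (intro mult_right_mono) auto
      also have "\<dots> = (\<epsilon> * Z) * onorm (?Y i) * norm v" by (simp add: Z_def)
      also have "\<dots> \<le> \<theta> / 2 * onorm (?Y i) * norm v" using \<epsilon>(3) s0[of i] by (intro mult_right_mono) auto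
      finally show ?thesis .
    qed
    let ?P = "seq_prod ?X 0 j"
    have P: "?P = seq_prod A' 0 (j * N)" by (rule seq_prod_blocks)
    have linP: "linear ?P" unfolding P by (rule linear_seq_prod[OF lin'])
    have e'1: "norm e' = 1" "norm h' = 1" "?P e' = onorm ?P *\<^sub>R h'" "0 < onorm ?P" using t' unfolding P by (auto simp: top_gap_def)
    have "norm (?P e' - (?P e' \<bullet> H 0) *\<^sub>R H 0) \<le> \<kappa> * \<bar>?P e' \<bullet> H 0\<bar>"
    proof (rule cone_local_to_global[where e = E' and s = "\<lambda>i. onorm (?Y i)" and \<alpha> = \<alpha> and \<theta> = \<theta>])
      show "linear (?X i)" for i by (rule linear_seq_prod[OF lin'])
      show "onorm (?Y i) * (\<bar>v \<bullet> E' i\<bar> - \<theta> * norm v) \<le> \<bar>?X i v \<bullet> H i\<bar>" for i v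
      proof -
        have "\<bar>?Y i v \<bullet> H i\<bar> = onorm (?Y i) * \<bar>v \<bullet> E' i\<bar>"
          using top_gap_par(1)[OF b(2) EH] s0[of i] by (simp add: abs_mult)
        moreover have "\<bar>(?X i v - ?Y i v) \<bullet> H i\<bar> \<le> norm (?X i v - ?Y i v)"
          using Cauchy_Schwarz_ineq2[of "?X i v - ?Y i v" "H i"] unit by simp
        moreover have "\<theta> / 2 * onorm (?Y i) * norm v \<le> onorm (?Y i) * (\<theta> * norm v)"
          using \<theta> s0[of i] by simp
        ultimately show ?thesis using pert[of i v] unfolding inner_diff_left right_diff_distrib by linarith
      qed
      show "norm (?X i v - (?X i v \<bullet> H i) *\<^sub>R H i) \<le> \<theta> * onorm (?Y i) * norm v" for i v
      proof -
        let ?D = "?X i v - ?Y i v"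
        have "?X i v - (?X i v \<bullet> H i) *\<^sub>R H i = (?Y i v - (?Y i v \<bullet> H i) *\<^sub>R H i) + (?D - (?D \<bullet> H i) *\<^sub>R H i)"
          by (simp add: inner_diff_left scaleR_left_diff_distrib)
        then have "norm (?X i v - (?X i v \<bullet> H i) *\<^sub>R H i) \<le> norm (?Y i v - (?Y i v \<bullet> H i) *\<^sub>R H i) + norm (?D - (?D \<bullet> H i) *\<^sub>R H i)"
          by (metis norm_triangle_ineq)
        also have "\<dots> \<le> c * q ^ N * onorm (?Y i) * norm v + \<theta> / 2 * onorm (?Y i) * norm v"
          using top_gap_par(2)[OF b(2) EH] norm_perp_le[OF unit(2), of ?D i] pert[of i v] by (intro add_mono) auto
        also have "\<dots> = (c * q ^ N + \<theta> / 2) * (onorm (?Y i) * norm v)" by (simp add: algebra_simps)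
        also have "\<dots> \<le> \<theta> * (onorm (?Y i) * norm v)" using N(2) s0[of i] by (intro mult_right_mono) auto
        finally show ?thesis by simp
      qed
      show "\<alpha> \<le> \<bar>E' i \<bullet> H (Suc i)\<bar>" for i
      proof -
        have "\<alpha>0 \<le> \<bar>E' i \<bullet> H (Suc i)\<bar>"
          by (rule tr0[OF dom N(3), of "Suc i * N"]) (use EH[of i] EH[of "Suc i"] in auto)
        then show ?thesis using \<alpha> by simp
      qed
      show "norm (?P w) \<le> norm (?P e') * norm w" for w
        using onorm_bound[OF linP, of w] e'1 by simp
    qed (use unit s0 \<alpha> \<kappa> \<theta> j e'1 in \<open>auto simp: \<theta>_def\<close>)
    then have "onorm ?P * norm (h' - (h' \<bullet> H 0) *\<^sub>R H 0) \<le> onorm ?P * (\<kappa> * \<bar>h' \<bullet> H 0\<bar>)"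
    proof -
      have "?P e' - (?P e' \<bullet> H 0) *\<^sub>R H 0 = onorm ?P *\<^sub>R (h' - (h' \<bullet> H 0) *\<^sub>R H 0)"
        unfolding e'1(3) by (simp add: algebra_simps)
      moreover have "\<bar>?P e' \<bullet> H 0\<bar> = onorm ?P * \<bar>h' \<bullet> H 0\<bar>" unfolding e'1(3) using e'1(4) by (simp add: abs_mult)
      moreover assume "norm (?P e' - (?P e' \<bullet> H 0) *\<^sub>R H 0) \<le> \<kappa> * \<bar>?P e' \<bullet> H 0\<bar>"
      ultimately show ?thesis using e'1(4) by (simp add: mult.left_commute)
    qed
    then have "norm (h' - (h' \<bullet> H 0) *\<^sub>R H 0) \<le> \<kappa> * \<bar>h' \<bullet> H 0\<bar>" using e'1(4) by simp
    also have "\<dots> \<le> \<kappa> * 1" using Cauchy_Schwarz_ineq2[of h' "H 0"] unit e'1 \<kappa> by (intro mult_left_mono) auto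
    finally have "ldist (H 0) h' \<le> 2 * \<kappa>" using ldist_le_perp[of "H 0" h'] unit e'1 by simp
    then show "ldist h h' \<le> \<eta>" using \<kappa> by (simp add: H_def)
  qed
qed

section \<open>Geodesic rays in a group\<close>

locale marked_group = group G for G :: "'g monoid" (structure) +
  fixes S :: "'g set"
  assumes gens: "finite_symmetric_generating_set G S"
begin

abbreviation "wl \<equiv> word_length G S"
abbreviation "wd \<equiv> word_dist G S"
abbreviation "eval_word ws \<equiv> foldr (\<otimes>) ws \<one>"

lemma S_sub: "S \<subseteq> carrier G" and S_fin: "finite S" and S_inv: "s \<in> S \<Longrightarrow> inv s \<in> S" and S_gen: "generate G S = carrier G"
  using gens by (auto simp: finite_symmetric_generating_set_def)

lemma S_carrier [simp, intro]: "s \<in> S \<Longrightarrow> s \<in> carrier G" using S_sub by blast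

lemma eval_word_closed [simp, intro]: "set ws \<subseteq> S \<Longrightarrow> eval_word ws \<in> carrier G"
  by (induction ws) auto

lemma eval_word_append:
  assumes "set ws \<subseteq> S" "set vs \<subseteq> S"
  shows "eval_word (ws @ vs) = eval_word ws \<otimes> eval_word vs"
  using assms by (induction ws) (auto simp: m_assoc)

lemma ex_word: "g \<in> carrier G \<Longrightarrow> \<exists>ws. set ws \<subseteq> S \<and> eval_word ws = g"
  unfolding S_gen[symmetric]
proof (induction g rule: generate.induct)
  case one
  show ?case by (intro exI[of _ "[]"]) simp
next
  case (incl h)
  then show ?case by (intro exI[of _ "[h]"]) simp
next
  case (inv h)
  then show ?case using S_inv by (intro exI[of _ "[inv h]"]) simp
next
  case (eng h1 h2)
  then obtain a b where "set a \<subseteq> S" "eval_word a = h1" "set b \<subseteq> S" "eval_word b = h2" by blast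
  then show ?case by (intro exI[of _ "a @ b"]) (simp add: eval_word_append del: foldr_append)
qed

lemma wl_word: assumes "g \<in> carrier G" obtains ws where "set ws \<subseteq> S" "length ws = wl g" "eval_word ws = g"
proof -
  have "\<exists>n ws. set ws \<subseteq> S \<and> length ws = n \<and> eval_word ws = g" using ex_word[OF assms] by blast
  from LeastI_ex[OF this] show ?thesis using that unfolding word_length_def by blast
qed

lemma wl_le: "set ws \<subseteq> S \<Longrightarrow> wl (eval_word ws) \<le> length ws"
  unfolding word_length_def by (rule Least_le) blast

lemma wl_one [simp]: "wl \<one> = 0" using wl_le[of "[]"] by simp

lemma wl_gen: "s \<in> S \<Longrightarrow> wl s \<le> 1" using wl_le[of "[s]"] by simp

lemma wl_eq_1: "g \<in> carrier G \<Longrightarrow> wl g = 1 \<Longrightarrow> g \<in> S"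
proof -
  assume g: "g \<in> carrier G" "wl g = 1"
  then obtain ws where "set ws \<subseteq> S" "length ws = 1" "eval_word ws = g" using wl_word by metis
  then show "g \<in> S" by (auto simp: length_Suc_conv)
qed

lemma wl_mult: "g \<in> carrier G \<Longrightarrow> h \<in> carrier G \<Longrightarrow> wl (g \<otimes> h) \<le> wl g + wl h"
proof -
  assume a: "g \<in> carrier G" "h \<in> carrier G"
  obtain ws where ws: "set ws \<subseteq> S" "length ws = wl g" "eval_word ws = g" using wl_word a by metis
  obtain vs where vs: "set vs \<subseteq> S" "length vs = wl h" "eval_word vs = h" using wl_word a by metis
  show ?thesis using wl_le[of "ws @ vs"] ws vs eval_word_append[OF ws(1) vs(1)] by simp
qed

lemma wl_inv_le: "g \<in> carrier G \<Longrightarrow> wl (inv g) \<le> wl g"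
proof -
  assume a: "g \<in> carrier G"
  obtain ws where ws: "set ws \<subseteq> S" "length ws = wl g" "eval_word ws = g" using wl_word a by metis
  have "\<exists>vs. set vs \<subseteq> S \<and> length vs = length ws \<and> eval_word vs = inv (eval_word ws)" using ws(1)
  proof (induction ws)
    case Nil show ?case by simp
  next
    case (Cons s ws)
    then obtain vs where vs: "set vs \<subseteq> S" "length vs = length ws" "eval_word vs = inv (eval_word ws)" by auto
    have "eval_word (vs @ [inv s]) = eval_word vs \<otimes> eval_word [inv s]"
      using vs Cons.prems S_inv by (intro eval_word_append) auto
    then have "eval_word (vs @ [inv s]) = inv (eval_word (s # ws))"
      using Cons.prems vs(3) by (simp add: inv_mult_group)
    then show ?case using vs Cons.prems S_inv by (intro exI[of _ "vs @ [inv s]"]) auto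
  qed
  then show ?thesis using ws wl_le by metis
qed

lemma wl_inv [simp]: "g \<in> carrier G \<Longrightarrow> wl (inv g) = wl g"
  using wl_inv_le[of g] wl_inv_le[of "inv g"] by simp

lemma inv_mult_inv: "g \<in> carrier G \<Longrightarrow> h \<in> carrier G \<Longrightarrow> inv (inv g \<otimes> h) = inv h \<otimes> g"
  by (simp add: inv_mult_group)

lemma inv_mult_chain: "g \<in> carrier G \<Longrightarrow> h \<in> carrier G \<Longrightarrow> k \<in> carrier G \<Longrightarrow> (inv g \<otimes> h) \<otimes> (inv h \<otimes> k) = inv g \<otimes> k"
  by (metis inv_closed inv_solve_left m_assoc m_closed)

lemma wd_commute: "g \<in> carrier G \<Longrightarrow> h \<in> carrier G \<Longrightarrow> wd g h = wd h g"
  unfolding word_dist_def by (metis inv_closed inv_mult_inv m_closed wl_inv)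

lemma wd_triangle: "g \<in> carrier G \<Longrightarrow> h \<in> carrier G \<Longrightarrow> k \<in> carrier G \<Longrightarrow> wd g k \<le> wd g h + wd h k"
  unfolding word_dist_def using wl_mult[of "inv g \<otimes> h" "inv h \<otimes> k"] inv_mult_chain[of g h k] by simp

lemma wd_left: "a \<in> carrier G \<Longrightarrow> g \<in> carrier G \<Longrightarrow> h \<in> carrier G \<Longrightarrow> wd (a \<otimes> g) (a \<otimes> h) = wd g h"
proof -
  assume a: "a \<in> carrier G" "g \<in> carrier G" "h \<in> carrier G"
  have "inv (a \<otimes> g) \<otimes> (a \<otimes> h) = inv g \<otimes> (inv a \<otimes> (a \<otimes> h))" using a by (simp add: inv_mult_group m_assoc)
  also have "inv a \<otimes> (a \<otimes> h) = h" using a by (simp add: m_assoc[symmetric])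
  finally show ?thesis by (simp add: word_dist_def)
qed

lemma wd_self [simp]: "g \<in> carrier G \<Longrightarrow> wd g g = 0" by (simp add: word_dist_def)

lemma wd_one [simp]: "g \<in> carrier G \<Longrightarrow> wd \<one> g = wl g" by (simp add: word_dist_def)

lemma finite_ball: "finite {g \<in> carrier G. wl g \<le> k}"
proof (rule finite_subset)
  show "{g \<in> carrier G. wl g \<le> k} \<subseteq> eval_word ` {ws. set ws \<subseteq> S \<and> length ws \<le> k}"
  proof
    fix g assume "g \<in> {g \<in> carrier G. wl g \<le> k}"
    then obtain ws where "set ws \<subseteq> S" "length ws \<le> k" "eval_word ws = g" using wl_word by (metis (mono_tags) mem_Collect_eq)
    then show "g \<in> eval_word ` {ws. set ws \<subseteq> S \<and> length ws \<le> k}" by blast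
  qed
  show "finite (eval_word ` {ws. set ws \<subseteq> S \<and> length ws \<le> k})"
    using finite_lists_length_le[OF S_fin] by (rule finite_imageI)
qed

section \<open>Quasi-geodesic paths from the identity\<close>

definition edge_path :: "(nat \<Rightarrow> 'g) \<Rightarrow> bool" where
  "edge_path p \<longleftrightarrow> (\<forall>n. p n \<in> carrier G \<and> inv (p n) \<otimes> p (Suc n) \<in> S)"

lemma edge_path_wd: "edge_path p \<Longrightarrow> wd (p m) (p (m + k)) \<le> k"
proof (induction k)
  case 0 then show ?case by (simp add: edge_path_def)
next
  case (Suc k)
  have c: "p n \<in> carrier G" "inv (p n) \<otimes> p (Suc n) \<in> S" for n using Suc by (auto simp: edge_path_def)
  have "wd (p m) (p (m + Suc k)) \<le> wd (p m) (p (m + k)) + wd (p (m + k)) (p (m + Suc k))" by (intro wd_triangle c)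
  moreover have "wd (p (m + k)) (p (m + Suc k)) \<le> 1" using wl_gen[OF c(2)[of "m+k"]] by (simp add: word_dist_def)
  ultimately show ?case using Suc by simp
qed

text \<open>Geodesic up to an additive error, and based at the identity: products of the operators
  along its edges then represent the group elements \<open>p n\<close> themselves.\<close>

definition qpath :: "(nat \<Rightarrow> 'g) \<Rightarrow> nat \<Rightarrow> bool" where
  "qpath p b \<longleftrightarrow> edge_path p \<and> p 0 = \<one> \<and> (\<forall>m k. k \<le> wd (p m) (p (m + k)) + b)"

lemma qpathD:
  assumes "qpath p b"
  shows "p n \<in> carrier G" "inv (p n) \<otimes> p (Suc n) \<in> S" "p 0 = \<one>" "k \<le> wd (p m) (p (m + k)) + b" "edge_path p"
    "wd (p m) (p (m + k)) \<le> k" "n \<le> wl (p n) + b" "wl (p n) \<le> n"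
proof -
  show 1: "p n \<in> carrier G" "inv (p n) \<otimes> p (Suc n) \<in> S" "p 0 = \<one>" "k \<le> wd (p m) (p (m + k)) + b" "edge_path p" for k m
    using assms by (auto simp: qpath_def edge_path_def)
  show 2: "wd (p m) (p (m + k)) \<le> k" for k m using edge_path_wd[OF 1(5)] .
  show "n \<le> wl (p n) + b" using 1(4)[of n 0] 1(1,3) by simp
  show "wl (p n) \<le> n" using 2[of 0 n] 1(1,3) by simp
qed

definition word_of :: "'g \<Rightarrow> 'g list" where
  "word_of g = (SOME ws. set ws \<subseteq> S \<and> eval_word ws = g)"

lemma word_of: "g \<in> carrier G \<Longrightarrow> set (word_of g) \<subseteq> S \<and> eval_word (word_of g) = g"
  unfolding word_of_def by (rule someI_ex) (rule ex_word)

text \<open>The ray is preceded by a word that leads from the identity to its first vertex. The word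
  depends on that vertex only, so rays with the same start are extended in the same way and obtain
  the same constants.\<close>

definition path_of :: "(nat \<Rightarrow> 'g) \<Rightarrow> nat \<Rightarrow> 'g" where
  "path_of r n = (let ws = word_of (r 0) in if n < length ws then eval_word (take n ws) else r (n - length ws))"

abbreviation "rays \<equiv> geodesic_rays G S"

lemma raysD: "r \<in> rays \<Longrightarrow> r n \<in> carrier G" "r \<in> rays \<Longrightarrow> wd (r m) (r (m + k)) = k"
  "r \<in> rays \<Longrightarrow> inv (r n) \<otimes> r (Suc n) \<in> S"
proof -
  show 1: "r \<in> rays \<Longrightarrow> r n \<in> carrier G" for n by (auto simp: geodesic_rays_def)
  show 2: "r \<in> rays \<Longrightarrow> wd (r m) (r (m + k)) = k" for m k unfolding geodesic_rays_def by (metis (mono_tags, lifting) add_diff_cancel_left' le_add1 mem_Collect_eq)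
  show "r \<in> rays \<Longrightarrow> inv (r n) \<otimes> r (Suc n) \<in> S" using 1 2[of n 1] by (intro wl_eq_1) (auto simp: word_dist_def)
qed

text \<open>The error \<open>2 * L\<close> comes from points \<open>path_of r m\<close> on the
  prefix: the stretch of \<open>L - m\<close> edges up to the ray is lost once in the index and once
  in the triangle inequality.\<close>

lemma path_of:
  assumes r: "r \<in> rays"
  defines "L \<equiv> length (word_of (r 0))"
  shows "path_of r (L + n) = r n" and "qpath (path_of r) (2 * L)"
proof -
  let ?p = "path_of r" and ?ws = "word_of (r 0)"
  note w = word_of[OF raysD(1)[OF r, of 0]]
  show R: "?p (L + n) = r n" for n by (simp add: path_of_def L_def Let_def)
  have pre: "?p n = eval_word (take n ?ws)" if "n \<le> L" for n
    using that w by (cases "n = L") (auto simp: path_of_def Let_def L_def)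
  have tk: "set (take n ?ws) \<subseteq> S" for n using w set_take_subset by fast
  have c: "?p n \<in> carrier G" for n
    using tk raysD(1)[OF r] by (auto simp: path_of_def Let_def)
  have e: "inv (?p n) \<otimes> ?p (Suc n) \<in> S" for n
  proof (cases "n < L")
    case True
    then have s: "?ws ! n \<in> S" using w by (auto simp: L_def)
    have "?p (Suc n) = eval_word (take n ?ws @ [?ws ! n])"
      using True pre[of "Suc n"] by (simp add: take_Suc_conv_app_nth L_def)
    also have "\<dots> = ?p n \<otimes> ?ws ! n"
      using True pre[of n] s by (subst eval_word_append[OF tk]) auto
    finally have "inv (?p n) \<otimes> ?p (Suc n) = ?ws ! n" using c s by (simp add: m_assoc[symmetric])
    then show ?thesis using s by simp
  next
    case False
    then obtain j where "n = L + j" using le_Suc_ex not_less by blast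
    then show ?thesis using R[of j] R[of "Suc j"] raysD(3)[OF r] by simp
  qed
  have ep: "edge_path ?p" using c e by (simp add: edge_path_def)
  have "k \<le> wd (?p m) (?p (m + k)) + 2 * L" for m k
  proof (cases "m < L")
    case False
    then obtain j where "m = L + j" using le_Suc_ex not_less by blast
    then show ?thesis using R[of j] R[of "j + k"] raysD(2)[OF r, of j k] by (simp add: add.assoc)
  next
    case m: True
    show ?thesis
    proof (cases "m + k \<le> L")
      case True then show ?thesis using m by simp
    next
      case False
      then obtain j where j: "m + k = L + j" using le_Suc_ex[of L "m + k"] by auto
      have "wd (r 0) (r j) = j" using raysD(2)[OF r, of 0 j] by simp
      moreover have "wd (?p L) (?p (m + k)) \<le> wd (?p L) (?p m) + wd (?p m) (?p (m + k))" by (intro wd_triangle c)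
      moreover have "wd (?p L) (?p m) \<le> L - m"
        using edge_path_wd[OF ep, of m "L - m"] m wd_commute[OF c c, of L m] by simp
      moreover have "?p L = r 0" using R[of 0] by simp
      ultimately show ?thesis using j R[of j] m by simp
    qed
  qed
  moreover have "?p 0 = \<one>" using pre[of 0] by simp
  ultimately show "qpath ?p (2 * L)" using ep by (simp add: qpath_def)
qed

abbreviation "cls \<equiv> asymptotic_class G S"

lemma cls_self: "r \<in> rays \<Longrightarrow> r \<in> cls r"
  by (auto simp: asymptotic_class_def raysD intro!: exI[of _ 0])

lemma cls_rays: "r' \<in> cls r \<Longrightarrow> r' \<in> rays" by (simp add: asymptotic_class_def)

lemma cls_eq_iff:
  assumes "r \<in> rays" "r' \<in> rays"
  shows "cls r = cls r' \<longleftrightarrow> (\<exists>K. \<forall>n. wd (r n) (r' n) \<le> K)"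
proof
  assume "cls r = cls r'"
  then have "r' \<in> cls r" using cls_self assms by blast
  then show "\<exists>K. \<forall>n. wd (r n) (r' n) \<le> K" by (simp add: asymptotic_class_def)
next
  assume "\<exists>K. \<forall>n. wd (r n) (r' n) \<le> K"
  then obtain K where K: "\<And>n. wd (r n) (r' n) \<le> K" by blast
  have "\<exists>K. \<forall>n. wd (b n) (t n) \<le> K" if ab: "a \<in> rays" "b \<in> rays" "t \<in> rays" "\<And>n. wd (a n) (b n) \<le> K" "\<forall>n. wd (a n) (t n) \<le> K'"
    for a b t K K'
  proof (intro exI allI)
    fix n
    have "wd (b n) (t n) \<le> wd (b n) (a n) + wd (a n) (t n)" by (intro wd_triangle raysD ab)
    also have "wd (b n) (a n) = wd (a n) (b n)" by (intro wd_commute raysD ab)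
    finally show "wd (b n) (t n) \<le> K + K'" using ab(4)[of n] ab(5) by (meson add_mono order_trans)
  qed
  note tr = this
  have K': "wd (r' n) (r n) \<le> K" for n using K wd_commute raysD assms by metis
  show "cls r = cls r'"
    unfolding asymptotic_class_def using tr[OF assms(1,2) _ K] tr[OF assms(2,1) _ K'] by blast
qed

lemma translate_ray: "g \<in> carrier G \<Longrightarrow> r \<in> rays \<Longrightarrow> (\<lambda>n. g \<otimes> r n) \<in> rays"
  unfolding geodesic_rays_def using wd_left[of g] by (auto simp: image_subset_iff)

lemma qpath_gromov_product:
  assumes "qpath p b" "N \<le> n"
  shows "real N - real b \<le> gromov_product G S \<one> (p N) (p n)"
proof -
  note D = qpathD[OF assms(1)]
  obtain k where n: "n = N + k" using assms(2) le_Suc_ex by blast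
  have 1: "wd (p N) \<one> = wl (p N)" "wd (p n) \<one> = wl (p n)" using D(1) wd_commute by auto
  have "N \<le> wl (p N) + b" "n \<le> wl (p n) + b" "wd (p N) (p n) \<le> n - N" using D(7) D(6)[of N k] n by auto
  then show ?thesis unfolding gromov_product_def 1 using n by simp
qed

text \<open>If the Gromov products of points on the two paths are unbounded, then so are those at equal
  times, and the paths stay at bounded distance.\<close>

lemma qpaths_diverge:
  assumes hyp: "word_hyperbolic G S" and p: "qpath p b" and p': "qpath p' b'"
    and far: "\<not> (\<exists>K. \<forall>n. wd (p n) (p' n) \<le> K)"
  obtains K where "\<And>n m. n + m \<le> wd (p n) (p' m) + K"
proof -
  let ?g = "gromov_product G S \<one>"
  note D = qpathD[OF p] and D' = qpathD[OF p']
  obtain \<delta> where \<delta>: "\<And>x y z. x \<in> carrier G \<Longrightarrow> y \<in> carrier G \<Longrightarrow> z \<in> carrier G \<Longrightarrow>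
      min (?g x y) (?g y z) - \<delta> \<le> ?g x z"
    using hyp unfolding word_hyperbolic_def by (metis one_closed)
  have w1: "wd (p n) \<one> = wl (p n)" "wd (p' n) \<one> = wl (p' n)" for n using D(1) D'(1) wd_commute by auto
  have sym: "?g x y = ?g y x" if "x \<in> carrier G" "y \<in> carrier G" for x y
    using that by (simp add: gromov_product_def wd_commute)
  define C where "C = real b + real b' + 2 * \<bar>\<delta>\<bar>"
  have "\<exists>M::real. \<forall>n m. ?g (p n) (p' m) \<le> M"
  proof (rule ccontr)
    assume neg: "\<not> ?thesis"
    have "wd (p N) (p' N) \<le> nat \<lceil>2 * C\<rceil>" for N
    proof -
      \<comment> \<open>Hyperbolicity is applied twice along \<open>p N\<close>, \<open>p n\<close>,
        \<open>p' m\<close>, \<open>p' N\<close>. A Gromov product at the identity is at most the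
        length of either element, so a large one forces \<open>N \<le> n\<close> and
        \<open>N \<le> m\<close>.\<close>
      obtain n m where nm: "real N + (2 * N + 0) < ?g (p n) (p' m)" using neg not_le by blast
      have g1: "?g (p n) (p' m) \<le> n" "?g (p n) (p' m) \<le> m"
      proof -
        have "wl (p' m) \<le> wd (p n) (p' m) + wl (p n)" "wl (p n) \<le> wd (p n) (p' m) + wl (p' m)"
          using wd_triangle[of \<one> "p n" "p' m"] wd_triangle[of \<one> "p' m" "p n"] D(1) D'(1) wd_commute[of "p n" "p' m"] by auto
        then show "?g (p n) (p' m) \<le> n" "?g (p n) (p' m) \<le> m"
          using D(8)[of n] D'(8)[of m] unfolding gromov_product_def w1 by auto
      qed
      have le: "N \<le> n" "N \<le> m" using g1 nm by linarith+
      have a: "real N - b \<le> ?g (p N) (p n)" by (rule qpath_gromov_product[OF p le(1)])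
      have c: "real N - b' \<le> ?g (p' m) (p' N)" using qpath_gromov_product[OF p' le(2)] sym D'(1) by metis
      have "min (?g (p N) (p n)) (?g (p n) (p' m)) - \<delta> \<le> ?g (p N) (p' m)" by (intro \<delta> D D')
      then have "real N - b - \<bar>\<delta>\<bar> \<le> ?g (p N) (p' m)" using a nm by linarith
      moreover have "min (?g (p N) (p' m)) (?g (p' m) (p' N)) - \<delta> \<le> ?g (p N) (p' N)" by (intro \<delta> D D')
      ultimately have "real N - C \<le> ?g (p N) (p' N)" using c unfolding C_def by linarith
      then have "real (wd (p N) (p' N)) \<le> 2 * C"
        unfolding gromov_product_def w1 using D(8)[of N] D'(8)[of N] by (simp add: field_simps)
      then show ?thesis by linarith
    qed
    then show False using far by blast
  qed
  then obtain M where M: "\<And>n m. ?g (p n) (p' m) \<le> M" by blast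
  show ?thesis
  proof (rule that[of "b + b' + nat \<lceil>2 * M\<rceil>"])
    fix n m
    have "real (wl (p n)) + real (wl (p' m)) - real (wd (p n) (p' m)) \<le> 2 * M"
      using M[of n m] unfolding gromov_product_def w1 by simp
    then have "real (wl (p n)) + real (wl (p' m)) \<le> real (wd (p n) (p' m)) + real (nat \<lceil>2 * M\<rceil>)" by linarith
    then have "wl (p n) + wl (p' m) \<le> wd (p n) (p' m) + nat \<lceil>2 * M\<rceil>" by linarith
    then show "n + m \<le> wd (p n) (p' m) + (b + b' + nat \<lceil>2 * M\<rceil>)" using D(7)[of n] D'(7)[of m] by linarith
  qed
qed

text \<open>If the paths stayed close, so would the rays: comparing both at the common time
  \<open>?L + ?L' + n\<close>, beyond both prefixes, shifts each ray by a bounded amount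
  only.\<close>

lemma rays_diverge:
  assumes hyp: "word_hyperbolic G S" and r: "r \<in> rays" and r': "r' \<in> rays" and ne: "cls r \<noteq> cls r'"
  obtains K where "\<And>n m. n + m \<le> wd (path_of r n) (path_of r' m) + K"
proof (rule qpaths_diverge[OF hyp path_of(2)[OF r] path_of(2)[OF r']])
  let ?p = "path_of r" and ?p' = "path_of r'"
  let ?L = "length (word_of (r 0))" and ?L' = "length (word_of (r' 0))"
  note D = qpathD[OF path_of(2)[OF r]] and D' = qpathD[OF path_of(2)[OF r']]
  show "\<not> (\<exists>K. \<forall>n. wd (?p n) (?p' n) \<le> K)"
  proof
    assume "\<exists>K. \<forall>n. wd (?p n) (?p' n) \<le> K"
    then obtain K where K: "\<And>n. wd (?p n) (?p' n) \<le> K" by blast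
    have "wd (r n) (r' n) \<le> K + ?L + ?L'" for n
    proof -
      have "wd (r n) (r' n) \<le> wd (r n) (?p (?L + ?L' + n)) + wd (?p (?L + ?L' + n)) (r' n)"
        by (intro wd_triangle raysD r r' D)
      moreover have "wd (?p (?L + ?L' + n)) (r' n) \<le> wd (?p (?L + ?L' + n)) (?p' (?L + ?L' + n)) + wd (?p' (?L + ?L' + n)) (r' n)"
        by (intro wd_triangle raysD r r' D D')
      moreover have "wd (r n) (?p (?L + ?L' + n)) \<le> ?L'"
        using D(6)[of "?L + n" ?L'] path_of(1)[OF r, of n] by (simp add: ac_simps)
      moreover have "wd (?p' (?L + ?L' + n)) (r' n) \<le> ?L"
        using D'(6)[of "?L' + n" ?L] path_of(1)[OF r', of n] wd_commute[OF D'(1) raysD(1)[OF r']] by (simp add: ac_simps)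
      ultimately show ?thesis using K[of "?L + ?L' + n"] by linarith
    qed
    then show False using ne cls_eq_iff[OF r r'] by blast
  qed
qed (use that in blast)

end

text \<open>Koenig's lemma: a prefix shared by infinitely many \<open>f n\<close> can be extended by
  pigeonhole, since the next value ranges over a finite set.\<close>

lemma diagonal_limit:
  fixes f :: "nat \<Rightarrow> nat \<Rightarrow> 'a"
  assumes fin: "\<And>k. finite (F k)" and f: "\<And>n k. f n k \<in> F k"
  obtains t where "\<And>N. infinite {n. \<forall>k<N. f n k = t k}"
proof -
  define P where "P N l \<longleftrightarrow> length l = N \<and> infinite {n. \<forall>k<N. f n k = l ! k}" for N and l :: "'a list"
  have "\<exists>g. \<forall>N. P N (g N) \<and> (\<exists>a. g (Suc N) = g N @ [a])"
  proof (rule dependent_nat_choice)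
    show "\<exists>l. P 0 l" by (intro exI[of _ "[]"]) (simp add: P_def)
    fix l N assume l: "P N l"
    let ?A = "{n. \<forall>k<N. f n k = l ! k}"
    have "infinite ?A" "finite ((\<lambda>n. f n N) ` ?A)" using l fin[of N] f by (auto simp: P_def intro: finite_subset)
    then obtain n0 where n0: "infinite {n \<in> ?A. f n N = f n0 N}" using pigeonhole_infinite by blast
    have "{n \<in> ?A. f n N = f n0 N} = {n. \<forall>k<Suc N. f n k = (l @ [f n0 N]) ! k}"
      using l by (auto simp: P_def nth_append less_Suc_eq)
    then have "P (Suc N) (l @ [f n0 N])" using n0 l by (simp add: P_def)
    then show "\<exists>y. P (Suc N) y \<and> (\<exists>a. y = l @ [a])" by blast
  qed
  then obtain g where g: "\<And>N. P N (g N)" "\<And>N. \<exists>a. g (Suc N) = g N @ [a]" by blast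
  have len: "length (g N) = N" for N using g by (simp add: P_def)
  have nth: "g (Suc k + j) ! k = g (Suc k) ! k" for k j
  proof (induction j)
    case (Suc j)
    obtain a where "g (Suc (Suc k + j)) = g (Suc k + j) @ [a]" using g(2) by blast
    then show ?case using Suc len[of "Suc k + j"] by (simp add: nth_append)
  qed simp
  show ?thesis
  proof (rule that[of "\<lambda>k. g (Suc k) ! k"])
    fix N
    have "g (Suc k) ! k = g N ! k" if "k < N" for k using nth[of k "N - Suc k"] that by simp
    then have "{n. \<forall>k<N. f n k = g (Suc k) ! k} = {n. \<forall>k<N. f n k = g N ! k}" by auto
    then show "infinite {n. \<forall>k<N. f n k = g (Suc k) ! k}" using g(1)[of N] by (simp add: P_def)
  qed
qed

context marked_group begin

text \<open>Seen from its \<open>n\<close>-th vertex, the path runs back towards the identity; balls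
  are finite, so these views converge to a ray along a subsequence. Its class will be the only
  boundary point that translation by such vertices may fail to contract.\<close>

lemma reversed_ray_limit:
  assumes r: "r \<in> rays"
  obtains t where "t \<in> rays" "t 0 = \<one>"
    "\<And>N. infinite {n. N \<le> n \<and> (\<forall>k\<le>N. inv (path_of r n) \<otimes> path_of r (n - k) = t k)}"
proof -
  let ?p = "path_of r" and ?L = "length (word_of (r 0))"
  note D = qpathD[OF path_of(2)[OF r]]
  \<comment> \<open>Positions beyond the start of the path get the value \<open>\<one>\<close>,
    which lies in every ball and so keeps the finite ranges.\<close>
  define f where "f n k = (if k \<le> n then inv (?p n) \<otimes> ?p (n - k) else \<one>)" for n k
  have "f n k \<in> {g \<in> carrier G. wl g \<le> k}" for n k
  proof (cases "k \<le> n")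
    case True
    have "wd (?p n) (?p (n - k)) \<le> k" using D(6)[of "n - k" k] True wd_commute[OF D(1) D(1)] by simp
    then show ?thesis using True D(1) by (simp add: f_def word_dist_def)
  qed (simp add: f_def)
  then obtain t where t: "\<And>N. infinite {n. \<forall>k<N. f n k = t k}" using diagonal_limit[of "\<lambda>k. {g \<in> carrier G. wl g \<le> k}" f] finite_ball by blast
  have inf: "infinite {n. M \<le> n \<and> (\<forall>k\<le>N. f n k = t k)}" for M N
  proof -
    have "infinite ({n. \<forall>k<Suc N. f n k = t k} - {..<M})" using t by (rule Diff_infinite_finite[rotated]) simp
    moreover have "{n. \<forall>k<Suc N. f n k = t k} - {..<M} = {n. M \<le> n \<and> (\<forall>k\<le>N. f n k = t k)}" by (auto simp: less_Suc_eq_le)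
    ultimately show ?thesis by simp
  qed
  have tray: "wd (t m) (t (m + k)) = k \<and> t m \<in> carrier G" for m k
  proof -
    \<comment> \<open>For \<open>n\<close> this large, the points seen lie beyond the prefix, where
      the path is the ray itself. Distances are exact there, so that the limit is geodesic and not
      merely quasi-geodesic.\<close>
    obtain n where n: "?L + m + k \<le> n" "\<forall>i\<le>m+k. f n i = t i" using inf[of "?L + m + k" "m + k"] not_finite_existsD by fastforce
    obtain j where j: "n = ?L + m + k + j" using n(1) le_Suc_ex by blast
    have 1: "t m = inv (?p n) \<otimes> ?p (n - m)" "t (m + k) = inv (?p n) \<otimes> ?p (n - (m + k))"
      using n by (auto simp: f_def dest: spec[of _ m] spec[of _ "m+k"])
    have "wd (t m) (t (m + k)) = wd (?p (n - m)) (?p (n - (m + k)))" unfolding 1 using D(1) by (intro wd_left) auto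
    also have "\<dots> = wd (r (j + k)) (r j)"
      using path_of(1)[OF r, of "j + k"] path_of(1)[OF r, of j] j by (simp add: ac_simps)
    also have "\<dots> = k" using raysD(2)[OF r, of j k] wd_commute raysD(1)[OF r] by metis
    finally show ?thesis using 1 D(1) by simp
  qed
  show ?thesis
  proof (rule that[of t])
    show "t \<in> rays" using tray unfolding geodesic_rays_def by (auto simp: le_iff_add)
    obtain n where "\<forall>i\<le>0. f n i = t i" using inf[of 0 0] not_finite_existsD by fastforce
    then show "t 0 = \<one>" using D(1) by (simp add: f_def)
    show "infinite {n. N \<le> n \<and> (\<forall>k\<le>N. inv (?p n) \<otimes> ?p (n - k) = t k)}" for N
    proof -
      have "{n. N \<le> n \<and> (\<forall>k\<le>N. inv (?p n) \<otimes> ?p (n - k) = t k)} = {n. N \<le> n \<and> (\<forall>k\<le>N. f n k = t k)}" by (auto simp: f_def)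
      then show ?thesis using inf[of N N] by simp
    qed
  qed
qed

end

section \<open>Limit lines of projective actions\<close>

lemma adjoint_comp:
  fixes f :: "'b::euclidean_space \<Rightarrow> 'c::euclidean_space" and g :: "'a::euclidean_space \<Rightarrow> 'b"
  assumes "linear f" "linear g"
  shows "adjoint (\<lambda>v. f (g v)) = (\<lambda>v. adjoint g (adjoint f v))"
  by (rule adjoint_unique) (simp add: adjoint_works[OF assms(1)] adjoint_works[OF assms(2)])

lemma adjoint_scale:
  fixes f :: "'b::euclidean_space \<Rightarrow> 'c::euclidean_space"
  assumes "linear f"
  shows "adjoint (\<lambda>v. t *\<^sub>R f v) = (\<lambda>v. t *\<^sub>R adjoint f v)"
  by (rule adjoint_unique) (simp add: adjoint_works[OF assms])

lemma linear_comp': "linear f \<Longrightarrow> linear g \<Longrightarrow> linear (\<lambda>v. f (g v))"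
  using linear_compose[of g f] by (simp add: o_def)

text \<open>A gap system is a linear action defined up to scalars whose operators have a gap after the
  first singular value that grows linearly with the word length. Operators need not be
  invertible: the second exterior power will be realised on all matrices, killing the
  symmetric ones.\<close>

locale gap_system = marked_group G S for G :: "'g monoid" (structure) and S +
  fixes R :: "'g \<Rightarrow> 'a::euclidean_space \<Rightarrow> 'a" and c q :: real
  assumes lin: "g \<in> carrier G \<Longrightarrow> linear (R g)"
    and mult: "g \<in> carrier G \<Longrightarrow> h \<in> carrier G \<Longrightarrow> \<exists>t. t \<noteq> 0 \<and> (\<forall>v. R (g \<otimes> h) v = t *\<^sub>R R g (R h v))"
    and cancel: "g \<in> carrier G \<Longrightarrow> \<exists>t. t \<noteq> 0 \<and> (\<forall>h\<in>carrier G. \<forall>v. R h (R g (R (inv g) v)) = t *\<^sub>R R h v \<and>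
        R (inv g) (R g (R h v)) = t *\<^sub>R R h v)"
    and top: "g \<in> carrier G \<Longrightarrow> \<exists>e h. top_gap (R g) e h (c * q ^ wl g)"
    and cq: "0 < c" "0 < q" "q < 1"
begin

text \<open>The contragredient action has the same constants, because adjoints keep gaps and
  \<open>wl (inv g) = wl g\<close>. Reversing the order of products twice, by \<open>inv\<close> and
  by \<open>adjoint\<close>, leaves the system multiplicative.\<close>

lemma dual: "gap_system G S (\<lambda>g. adjoint (R (inv g))) c q"
proof (rule gap_system.intro[OF marked_group_axioms], rule gap_system_axioms.intro)
  fix g assume g: "g \<in> carrier G"
  then show "linear (adjoint (R (inv g)))" by (intro adjoint_linear lin) simp
next
  fix g assume g: "g \<in> carrier G"
  show "\<exists>e h. top_gap (adjoint (R (inv g))) e h (c * q ^ wl g)"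
  proof -
    obtain e h where "top_gap (R (inv g)) e h (c * q ^ wl (inv g))" using top[OF inv_closed[OF g]] by blast
    then have "top_gap (adjoint (R (inv g))) h e (c * q ^ wl (inv g))" by (rule top_gap_adjoint[OF lin[OF inv_closed[OF g]]])
    then show ?thesis unfolding wl_inv[OF g] by blast
  qed
next
  fix g assume g: "g \<in> carrier G"
  obtain t where t: "t \<noteq> 0 \<and> (\<forall>h\<in>carrier G. \<forall>v. R h (R (inv g) (R g v)) = t *\<^sub>R R h v \<and>
      R g (R (inv g) (R h v)) = t *\<^sub>R R h v)"
    using cancel[OF inv_closed[OF g], unfolded inv_inv[OF g]] by (elim exE) (rule that)
  note t0 = conjunct1[OF t] and t1 = conjunct2[OF t]
  have "adjoint (R (inv h)) (adjoint (R (inv g)) (adjoint (R (inv (inv g))) v)) = t *\<^sub>R adjoint (R (inv h)) v \<and>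
      adjoint (R (inv (inv g))) (adjoint (R (inv g)) (adjoint (R (inv h)) v)) = t *\<^sub>R adjoint (R (inv h)) v"
    if h: "h \<in> carrier G" for h v
  proof -
    have l: "linear (R g)" "linear (R (inv g))" "linear (R (inv h))" using g h lin by auto
    note w = adjoint_works[OF l(1)] adjoint_works[OF l(2)] adjoint_works[OF l(3)]
    have ih: "inv h \<in> carrier G" using h by simp
    have e: "R g (R (inv g) (R (inv h) x)) = t *\<^sub>R R (inv h) x" "R (inv h) (R (inv g) (R g x)) = t *\<^sub>R R (inv h) x" for x
      using t1 ih by blast+
    have "x \<bullet> adjoint (R (inv h)) (adjoint (R (inv g)) (adjoint (R g) v)) = x \<bullet> (t *\<^sub>R adjoint (R (inv h)) v)"
      "x \<bullet> adjoint (R g) (adjoint (R (inv g)) (adjoint (R (inv h)) v)) = x \<bullet> (t *\<^sub>R adjoint (R (inv h)) v)" for x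
      by (simp_all add: w e)
    then show ?thesis unfolding inv_inv[OF g] by (metis vector_eq_ldot)
  qed
  then show "\<exists>t. t \<noteq> 0 \<and> (\<forall>h\<in>carrier G. \<forall>v. adjoint (R (inv h)) (adjoint (R (inv g)) (adjoint (R (inv (inv g))) v)) = t *\<^sub>R adjoint (R (inv h)) v \<and>
      adjoint (R (inv (inv g))) (adjoint (R (inv g)) (adjoint (R (inv h)) v)) = t *\<^sub>R adjoint (R (inv h)) v)"
    using t0 by blast
next
  fix g h assume gh: "g \<in> carrier G" "h \<in> carrier G"
  obtain t where t: "t \<noteq> 0" "\<And>v. R (inv h \<otimes> inv g) v = t *\<^sub>R R (inv h) (R (inv g) v)"
    using mult[OF inv_closed[OF gh(2)] inv_closed[OF gh(1)]] by blast
  have l: "linear (R (inv g))" "linear (R (inv h))" using gh lin by auto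
  have "R (inv (g \<otimes> h)) = (\<lambda>v. t *\<^sub>R R (inv h) (R (inv g) v))" using t(2) gh by (auto simp: inv_mult_group)
  then have "adjoint (R (inv (g \<otimes> h))) v = t *\<^sub>R adjoint (R (inv g)) (adjoint (R (inv h)) v)" for v
    using l by (simp add: adjoint_comp adjoint_scale linear_comp')
  then show "\<exists>t. t \<noteq> 0 \<and> (\<forall>v. adjoint (R (inv (g \<otimes> h))) v = t *\<^sub>R adjoint (R (inv g)) (adjoint (R (inv h)) v))"
    using t(1) by blast
qed (use cq in auto)

lemma onorm_pos: "g \<in> carrier G \<Longrightarrow> 0 < onorm (R g)"
  using top by (auto simp: top_gap_def)

text \<open>The substitute for invertibility: \<open>R (inv g)\<close> undoes \<open>R g\<close> up
  to a scalar as soon as a third operator of the system stands next to them, and this suffices to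
  bound norms of products from below.\<close>

lemma onorm_R_comp:
  assumes g: "g \<in> carrier G"
  shows "\<exists>k\<ge>0. \<forall>h\<in>carrier G. onorm (R h) \<le> k * onorm (R h \<circ> R g) \<and> onorm (R h) \<le> k * onorm (R g \<circ> R h)"
proof -
  obtain t where t: "t \<noteq> 0" "\<And>h v. h \<in> carrier G \<Longrightarrow> R h (R g (R (inv g) v)) = t *\<^sub>R R h v"
    "\<And>h v. h \<in> carrier G \<Longrightarrow> R (inv g) (R g (R h v)) = t *\<^sub>R R h v"
    using cancel[OF g] by auto
  let ?k = "onorm (R (inv g)) / \<bar>t\<bar>"
  have l: "linear (R g)" "linear (R (inv g))" using g lin by auto
  show ?thesis
  proof (intro exI[of _ ?k] conjI ballI)
    show "0 \<le> ?k" using onorm_nonneg[OF l(2)] by simp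
    fix h assume h: "h \<in> carrier G"
    then have lh: "linear (R h)" by (rule lin)
    have "\<bar>t\<bar> * onorm (R h) = onorm ((R h \<circ> R g) \<circ> R (inv g))"
      using t(2)[OF h] onorm_scale[OF lh, of t] by (simp add: o_def)
    also have "\<dots> \<le> onorm (R h \<circ> R g) * onorm (R (inv g))" by (intro onorm_comp_le linear_compose l lh)
    finally show "onorm (R h) \<le> ?k * onorm (R h \<circ> R g)" using t(1) by (simp add: field_simps)
    have "\<bar>t\<bar> * onorm (R h) = onorm (R (inv g) \<circ> (R g \<circ> R h))"
      using t(3)[OF h] onorm_scale[OF lh, of t] by (simp add: o_def)
    also have "\<dots> \<le> onorm (R (inv g)) * onorm (R g \<circ> R h)" by (intro onorm_comp_le linear_compose l lh)
    finally show "onorm (R h) \<le> ?k * onorm (R g \<circ> R h)" using t(1) by (simp add: field_simps)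
  qed
qed

lemma ex_K: "\<exists>K\<ge>1. \<forall>s\<in>S. onorm (R s) \<le> K \<and> 1 \<le> K * onorm (R s) \<and>
    (\<forall>h\<in>carrier G. onorm (R h) \<le> K * onorm (R h \<circ> R s) \<and> onorm (R h) \<le> K * onorm (R s \<circ> R h))"
proof -
  have "\<forall>s\<in>S. \<exists>k\<ge>0. \<forall>h\<in>carrier G. onorm (R h) \<le> k * onorm (R h \<circ> R s) \<and> onorm (R h) \<le> k * onorm (R s \<circ> R h)"
  proof
    fix s assume s: "s \<in> S"
    show "\<exists>k\<ge>0. \<forall>h\<in>carrier G. onorm (R h) \<le> k * onorm (R h \<circ> R s) \<and> onorm (R h) \<le> k * onorm (R s \<circ> R h)"
      by (rule onorm_R_comp[OF S_carrier[OF s]])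
  qed
  then obtain k where k: "\<And>s. s \<in> S \<Longrightarrow> k s \<ge> 0"
    "\<And>s h. s \<in> S \<Longrightarrow> h \<in> carrier G \<Longrightarrow> onorm (R h) \<le> k s * onorm (R h \<circ> R s) \<and> onorm (R h) \<le> k s * onorm (R s \<circ> R h)"
    by metis
  define K where "K = 1 + (\<Sum>s\<in>S. onorm (R s) + 1 / onorm (R s) + k s)"
  have nn: "0 \<le> onorm (R s) + 1 / onorm (R s) + k s" if "s \<in> S" for s
    using onorm_pos[OF S_carrier[OF that]] k(1)[OF that] by simp
  have K1: "1 \<le> K" unfolding K_def using nn by (simp add: sum_nonneg)
  have b: "onorm (R s) + 1 / onorm (R s) + k s \<le> K" if s: "s \<in> S" for s
    using member_le_sum[OF s, of "\<lambda>s. onorm (R s) + 1 / onorm (R s) + k s"] nn S_fin unfolding K_def by auto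
  show ?thesis
  proof (intro exI[of _ K] conjI ballI K1)
    fix s assume s: "s \<in> S"
    note p = onorm_pos[OF S_carrier[OF s]]
    have p': "0 < 1 / onorm (R s)" using p by simp
    show "onorm (R s) \<le> K" using b[OF s] p' k(1)[OF s] by linarith
    have "1 / onorm (R s) \<le> K" using b[OF s] p k(1)[OF s] by linarith
    then show "1 \<le> K * onorm (R s)" using p by (simp add: divide_le_eq)
    have kK: "k s \<le> K" using b[OF s] p p' by linarith
    fix h assume h: "h \<in> carrier G"
    have l: "linear (R s)" "linear (R h)" using s h lin by auto
    have "k s * onorm (R h \<circ> R s) \<le> K * onorm (R h \<circ> R s)" "k s * onorm (R s \<circ> R h) \<le> K * onorm (R s \<circ> R h)"
      by (intro mult_right_mono kK onorm_nonneg linear_compose l)+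
    then show "onorm (R h) \<le> K * onorm (R h \<circ> R s)" "onorm (R h) \<le> K * onorm (R s \<circ> R h)"
      using k(2)[OF s h] by auto
  qed
qed

definition K :: real where
  "K = (SOME K. 1 \<le> K \<and> (\<forall>s\<in>S. onorm (R s) \<le> K \<and> 1 \<le> K * onorm (R s) \<and>
    (\<forall>h\<in>carrier G. onorm (R h) \<le> K * onorm (R h \<circ> R s) \<and> onorm (R h) \<le> K * onorm (R s \<circ> R h))))"

lemma K: "1 \<le> K" "s \<in> S \<Longrightarrow> onorm (R s) \<le> K" "s \<in> S \<Longrightarrow> 1 \<le> K * onorm (R s)"
   "s \<in> S \<Longrightarrow> h \<in> carrier G \<Longrightarrow> onorm (R h) \<le> K * onorm (R h \<circ> R s)"
   "s \<in> S \<Longrightarrow> h \<in> carrier G \<Longrightarrow> onorm (R h) \<le> K * onorm (R s \<circ> R h)"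
proof -
  have *: "1 \<le> K \<and> (\<forall>s\<in>S. onorm (R s) \<le> K \<and> 1 \<le> K * onorm (R s) \<and>
    (\<forall>h\<in>carrier G. onorm (R h) \<le> K * onorm (R h \<circ> R s) \<and> onorm (R h) \<le> K * onorm (R s \<circ> R h)))"
    unfolding K_def using ex_K by (rule someI_ex)
  then show "1 \<le> K" "s \<in> S \<Longrightarrow> onorm (R s) \<le> K" "s \<in> S \<Longrightarrow> 1 \<le> K * onorm (R s)"
   "s \<in> S \<Longrightarrow> h \<in> carrier G \<Longrightarrow> onorm (R h) \<le> K * onorm (R h \<circ> R s)"
   "s \<in> S \<Longrightarrow> h \<in> carrier G \<Longrightarrow> onorm (R h) \<le> K * onorm (R s \<circ> R h)"
    by blast+
qed

text \<open>All admissible image directions of \<open>R g\<close>. As \<open>c * q ^ wl g\<close>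
  may exceed 1, they form a single line only approximately, and only for long
  \<open>g\<close>.\<close>

definition tops :: "'g \<Rightarrow> 'a set" where
  "tops g = {h. \<exists>e. top_gap (R g) e h (c * q ^ wl g)}"

lemma tops_ne: "g \<in> carrier G \<Longrightarrow> tops g \<noteq> {}" using top[of g] unfolding tops_def by blast

lemma tops_unit: "h \<in> tops g \<Longrightarrow> norm h = 1" by (auto simp: tops_def top_gap_def)

lemma tops_same: "g \<in> carrier G \<Longrightarrow> h \<in> tops g \<Longrightarrow> h' \<in> tops g \<Longrightarrow> ldist h h' \<le> 2 * K\<^sup>2 * c * q ^ wl g"
proof -
  assume a: "g \<in> carrier G" "h \<in> tops g" "h' \<in> tops g"
  then have "ldist h h' \<le> 2 * (c * q ^ wl g)" unfolding tops_def using top_gap_same(1)[OF lin] by blast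
  also have "\<dots> \<le> K\<^sup>2 * (2 * (c * q ^ wl g))"
    using mult_right_mono[of 1 "K\<^sup>2" "2 * (c * q ^ wl g)"] K(1) cq by simp
  finally show ?thesis by (simp only: ac_simps)
qed

lemma tops_step:
  assumes g: "g \<in> carrier G" "s \<in> S" and h: "h \<in> tops g" "h' \<in> tops (g \<otimes> s)"
  shows "ldist h h' \<le> 2 * K\<^sup>2 * c * q ^ wl g"
proof -
  obtain e e' where t: "top_gap (R g) e h (c * q ^ wl g)" "top_gap (R (g \<otimes> s)) e' h' (c * q ^ wl (g \<otimes> s))"
    using h by (auto simp: tops_def)
  obtain t where tt: "t \<noteq> 0" "\<And>v. R (g \<otimes> s) v = t *\<^sub>R R g (R s v)" using mult[of g s] g by auto
  have "(\<lambda>v. (1 / t) *\<^sub>R R (g \<otimes> s) v) = R g \<circ> R s" using tt by (auto simp: fun_eq_iff)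
  then have "top_gap (R g \<circ> R s) e' (sgn (1 / t) *\<^sub>R h') (c * q ^ wl (g \<otimes> s))"
    using top_gap_scale[OF lin t(2), of "1 / t"] g tt(1) by auto
  from top_gap_comp_right[OF lin lin t(1) this K(2) K(4)] g
  have "ldist h (sgn (1 / t) *\<^sub>R h') \<le> 2 * K\<^sup>2 * (c * q ^ wl g)" by auto
  moreover have "ldist h (sgn (1 / t) *\<^sub>R h') = ldist h h'" using tt(1) by (auto simp: sgn_if)
  ultimately show ?thesis by (simp only: ac_simps)
qed

lemma q_wl_le: "n \<le> wl g + b \<Longrightarrow> q ^ wl g \<le> q ^ n / q ^ b"
  using cq power_decreasing[of n "wl g + b" q] by (simp add: pos_le_divide_eq power_add)

text \<open>The constant that \<open>geometric_chain\<close> gives for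
  \<open>D = 2 * K\<^sup>2 * c / q ^ b\<close>, where \<open>q ^ b\<close> pays for the additive
  error of the path.\<close>

definition C :: "nat \<Rightarrow> real" where
  "C b = 2 * (2 * K\<^sup>2 * c / q ^ b) / (1 - q)"

lemma C_nonneg: "0 \<le> C b" unfolding C_def using cq K(1) by simp

text \<open>Formulated for a finite stretch because it also serves for paths read backwards, which
  end at the inverse of their starting vertex.\<close>

lemma tops_chain:
  assumes p: "\<And>n. n \<le> N \<Longrightarrow> p n \<in> carrier G \<and> n \<le> wl (p n) + b" "\<And>n. n < N \<Longrightarrow> inv (p n) \<otimes> p (Suc n) \<in> S"
    and n: "n \<le> n'" "n' \<le> N" and h: "h \<in> tops (p n)" "h' \<in> tops (p n')"
  shows "ldist h h' \<le> C b * q ^ n"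
  unfolding C_def
proof (rule geometric_chain[where H = "\<lambda>n. tops (p n)" and b = 0 and N = N and k' = n'])
  have m: "2 * K\<^sup>2 * c * q ^ wl (p k) \<le> 2 * K\<^sup>2 * c / q ^ b * q ^ k" if "k \<le> N" for k
    using mult_left_mono[OF q_wl_le[of k "p k" b], of "2 * K\<^sup>2 * c"] p(1)[OF that] cq K(1) by simp
  fix k
  show "tops (p k) \<noteq> {}" if "k \<le> N" using p(1)[OF that] tops_ne by auto
  fix h h'
  show "ldist h h' \<le> 2 * K\<^sup>2 * c / q ^ b * q ^ k" if "k \<le> N" "h \<in> tops (p k)" "h' \<in> tops (p k)"
    using tops_same[of "p k" h h'] m[of k] p(1)[of k] that by linarith
  show "ldist h h' \<le> 2 * K\<^sup>2 * c / q ^ b * q ^ k" if a: "k < N" "h \<in> tops (p k)" "h' \<in> tops (p (Suc k))"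
  proof -
    have "p k \<otimes> (inv (p k) \<otimes> p (Suc k)) = p (Suc k)" using p(1)[of k] p(1)[of "Suc k"] a by (simp add: m_assoc[symmetric])
    then have "ldist h h' \<le> 2 * K\<^sup>2 * c * q ^ wl (p k)"
      using tops_step[of "p k" "inv (p k) \<otimes> p (Suc k)" h h'] p(1)[of k] p(2)[of k] a by simp
    then show ?thesis using m[of k] a by linarith
  qed
qed (use n h cq K(1) in auto)

lemma tops_path:
  assumes "qpath p b" "n \<le> n'" "h \<in> tops (p n)" "h' \<in> tops (p n')"
  shows "ldist h h' \<le> C b * q ^ n"
  by (rule tops_chain[where N = n', OF _ _ assms(2) _ assms(3,4)]) (use qpathD[OF assms(1)] in auto)

definition cst :: "(nat \<Rightarrow> 'g) \<Rightarrow> real" where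
  "cst r = C (2 * length (word_of (r 0)))"

text \<open>A unit vector on the limit line, so determined up to sign only. The rate of convergence
  is part of the choice, being used throughout.\<close>

definition lim :: "(nat \<Rightarrow> 'g) \<Rightarrow> 'a" where
  "lim r = (SOME l. norm l = 1 \<and> (\<forall>n. \<forall>h\<in>tops (path_of r n). ldist h l \<le> cst r * q ^ n))"

lemma lim:
  assumes r: "r \<in> rays"
  shows "norm (lim r) = 1" "h \<in> tops (path_of r n) \<Longrightarrow> ldist h (lim r) \<le> cst r * q ^ n"
proof -
  have "\<exists>l. norm l = 1 \<and> (\<forall>n. \<forall>h\<in>tops (path_of r n). ldist h l \<le> cst r * q ^ n)"
  proof (rule line_limit_exists[of 0 "\<lambda>n. tops (path_of r n)" "\<lambda>n. cst r * q ^ n"])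
    show "tops (path_of r n) \<noteq> {}" for n using qpathD(1)[OF path_of(2)[OF r]] tops_ne by blast
    show "ldist h h' \<le> cst r * q ^ n" if "n \<le> n'" "h \<in> tops (path_of r n)" "h' \<in> tops (path_of r n')" for n n' h h'
      unfolding cst_def by (rule tops_path[OF path_of(2)[OF r] that])
  qed (auto simp: tops_unit)
  from someI_ex[OF this] show "norm (lim r) = 1" "h \<in> tops (path_of r n) \<Longrightarrow> ldist h (lim r) \<le> cst r * q ^ n"
    unfolding lim_def by blast+
qed

lemma qpow_tendsto: "(\<lambda>n. x * q ^ n) \<longlonglongrightarrow> 0"
proof -
  have "(\<lambda>n. x * q ^ n) \<longlonglongrightarrow> x * 0" using cq by (intro tendsto_intros LIMSEQ_power_zero) auto
  then show ?thesis by simp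
qed

lemma lim_ray:
  assumes r: "r \<in> rays" and h: "h \<in> tops (r n)"
  shows "ldist h (lim r) \<le> cst r * q ^ n"
proof -
  let ?L = "length (word_of (r 0))"
  have "ldist h (lim r) \<le> cst r * q ^ (?L + n)"
    using lim(2)[OF r, of h "?L + n"] h path_of(1)[OF r, of n] by simp
  also have "\<dots> \<le> cst r * q ^ n" using cq C_nonneg by (intro mult_left_mono power_decreasing) (auto simp: cst_def)
  finally show ?thesis .
qed

lemma lim_unique:
  assumes r: "r \<in> rays" and l: "norm l = 1" "\<And>n. \<exists>h\<in>tops (r n). ldist h l \<le> E n" "E \<longlonglongrightarrow> 0"
  shows "ldist (lim r) l = 0"
proof -
  have "ldist (lim r) l \<le> 0 + 0"
  proof (rule tendsto_lowerbound)
    show "(\<lambda>n. cst r * q ^ n + E n) \<longlonglongrightarrow> 0 + 0" by (intro tendsto_add qpow_tendsto l(3))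
    show "\<forall>\<^sub>F n in sequentially. ldist (lim r) l \<le> cst r * q ^ n + E n"
    proof (rule always_eventually, rule allI)
      fix n
      obtain h where h: "h \<in> tops (r n)" "ldist h l \<le> E n" using l(2) by blast
      then show "ldist (lim r) l \<le> cst r * q ^ n + E n"
        using ldist_triangle[of "lim r" l h] lim_ray[OF r h(1)] ldist_commute[of "lim r" h] by linarith
    qed
  qed simp
  then show ?thesis using ldist_nonneg[of "lim r" l] by simp
qed

text \<open>One generator is moved at a time. The induction hypothesis is applied at
  \<open>g \<otimes> s\<close>, whose length may be one less than that of \<open>g\<close>, whence
  the term \<open>D / q\<close>.\<close>

lemma tops_bounded_move:
  "\<exists>D\<ge>0. \<forall>g\<in>carrier G. \<forall>h\<in>carrier G. \<forall>x\<in>tops g. \<forall>y\<in>tops (g \<otimes> h). wl h \<le> k \<longrightarrow> ldist x y \<le> D * q ^ wl g"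
proof (induction k)
  case 0
  have "ldist x y \<le> 2 * K\<^sup>2 * c * q ^ wl g" if a: "g \<in> carrier G" "h \<in> carrier G" "x \<in> tops g" "y \<in> tops (g \<otimes> h)" "wl h \<le> 0" for g h x y
  proof -
    obtain ws where ws: "length ws = wl h" "eval_word ws = h" using wl_word[OF a(2)] by metis
    have "ws = []" using ws(1) a(5) by simp
    then have "h = \<one>" using ws(2) by simp
    then have "y \<in> tops g" using a(1,4) by simp
    then show ?thesis using tops_same a(1,3) by blast
  qed
  then show ?case using cq by (intro exI[of _ "2 * K\<^sup>2 * c"]) auto
next
  case (Suc k)
  then obtain D where D: "0 \<le> D" "\<And>g h x y. g \<in> carrier G \<Longrightarrow> h \<in> carrier G \<Longrightarrow> x \<in> tops g \<Longrightarrow> y \<in> tops (g \<otimes> h) \<Longrightarrow> wl h \<le> k \<Longrightarrow>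
    ldist x y \<le> D * q ^ wl g" by blast
  let ?D = "D + (2 * K\<^sup>2 * c + D / q)"
  have "ldist x y \<le> ?D * q ^ wl g" if a: "g \<in> carrier G" "h \<in> carrier G" "x \<in> tops g" "y \<in> tops (g \<otimes> h)" "wl h \<le> Suc k" for g h x y
  proof (cases "wl h \<le> k")
    case True
    have "ldist x y \<le> D * q ^ wl g" using D(2) a True by blast
    also have "\<dots> \<le> ?D * q ^ wl g" using cq D(1) by (intro mult_right_mono) auto
    finally show ?thesis .
  next
    case False
    obtain ws where ws: "set ws \<subseteq> S" "length ws = wl h" "eval_word ws = h" using wl_word a by metis
    then obtain s vs where sv: "ws = s # vs" using False a by (cases ws) auto
    then have v: "s \<in> S" "set vs \<subseteq> S" "h = s \<otimes> eval_word vs" "wl (eval_word vs) \<le> k"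
      using ws wl_le[of vs] a(5) by auto
    have gs: "g \<otimes> s \<in> carrier G" using a v by auto
    obtain z where z: "z \<in> tops (g \<otimes> s)" using tops_ne[OF gs] by blast
    have "y \<in> tops ((g \<otimes> s) \<otimes> eval_word vs)" using a v by (simp add: m_assoc)
    then have 1: "ldist z y \<le> D * q ^ wl (g \<otimes> s)" using D(2) gs v z by blast
    have 2: "ldist x z \<le> 2 * K\<^sup>2 * c * q ^ wl g" by (rule tops_step) (use a v z in auto)
    have "g = (g \<otimes> s) \<otimes> inv s" using a v by (simp add: m_assoc)
    then have "wl g \<le> wl (g \<otimes> s) + 1" using wl_mult[of "g \<otimes> s" "inv s"] wl_gen[OF v(1)] v(1) gs by simp
    then have "q ^ wl (g \<otimes> s) \<le> q ^ wl g / q ^ 1" by (rule q_wl_le)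
    then have "D * q ^ wl (g \<otimes> s) \<le> D * (q ^ wl g / q)" using D(1) by (intro mult_left_mono) auto
    then have "ldist x y \<le> 2 * K\<^sup>2 * c * q ^ wl g + D * (q ^ wl g / q)"
      using 1 2 ldist_triangle[of x y z] by linarith
    also have "\<dots> = (2 * K\<^sup>2 * c + D / q) * q ^ wl g" by (simp add: algebra_simps)
    also have "\<dots> \<le> ?D * q ^ wl g" using cq D(1) by (intro mult_right_mono) auto
    finally show ?thesis .
  qed
  moreover have "0 \<le> ?D" using D(1) cq by simp
  ultimately show ?case by blast
qed

lemma ray_wl: "r \<in> rays \<Longrightarrow> n \<le> wl (r n) + wl (r 0)"
  using wd_triangle[of "r 0" \<one> "r n"] raysD(1)[of r] raysD(2)[of r 0 n] wd_commute[of "r 0" \<one>] by simp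

text \<open>Elements at equal times on asymptotic rays differ by a right factor of bounded length,
  so their top directions merge at the rate \<open>q ^ n\<close>.\<close>

lemma lim_cls:
  assumes r: "r \<in> rays" "r' \<in> rays" "cls r = cls r'"
  shows "ldist (lim r) (lim r') = 0"
proof -
  obtain k where k: "\<And>n. wd (r n) (r' n) \<le> k" using cls_eq_iff r by blast
  obtain D where D: "0 \<le> D" "\<And>g h x y. g \<in> carrier G \<Longrightarrow> h \<in> carrier G \<Longrightarrow> x \<in> tops g \<Longrightarrow> y \<in> tops (g \<otimes> h) \<Longrightarrow> wl h \<le> k \<Longrightarrow>
    ldist x y \<le> D * q ^ wl g" using tops_bounded_move[of k] by blast
  show ?thesis
  proof (rule lim_unique[OF r(1) lim(1)[OF r(2)]])
  show "(\<lambda>n. D / q ^ wl (r 0) * q ^ n + cst r' * q ^ n) \<longlonglongrightarrow> 0"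
    using tendsto_add[OF qpow_tendsto[of "D / q ^ wl (r 0)"] qpow_tendsto[of "cst r'"]] by simp
  fix n
  note c = raysD(1)[OF r(1)] raysD(1)[OF r(2)]
  obtain x y where xy: "x \<in> tops (r n)" "y \<in> tops (r' n)" using tops_ne[OF c(1)] tops_ne[OF c(2)] by blast
  have "r' n = r n \<otimes> (inv (r n) \<otimes> r' n)" using c by (simp add: m_assoc[symmetric])
  then have "ldist x y \<le> D * q ^ wl (r n)" using D(2)[of "r n" "inv (r n) \<otimes> r' n" x y] k[of n] c xy by (simp add: word_dist_def)
  also have "\<dots> \<le> D * (q ^ n / q ^ wl (r 0))" using D(1) q_wl_le[OF ray_wl[OF r(1)]] by (intro mult_left_mono)
  finally have "ldist x (lim r') \<le> D / q ^ wl (r 0) * q ^ n + cst r' * q ^ n"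
    using lim_ray[OF r(2) xy(2)] ldist_triangle[of x "lim r'" y] by simp
  then show "\<exists>h\<in>tops (r n). ldist h (lim r') \<le> D / q ^ wl (r 0) * q ^ n + cst r' * q ^ n" using xy by blast
qed
qed

text \<open>Both limits are near the same direction of the common vertex \<open>r n\<close>, with a
  constant that depends on the common start only.\<close>

lemma lim_continuous:
  assumes r: "r \<in> rays" "r' \<in> rays" and eq: "\<And>k. k \<le> n \<Longrightarrow> r k = r' k"
  shows "ldist (lim r) (lim r') \<le> 2 * cst r * q ^ n"
proof -
  obtain h where h: "h \<in> tops (r n)" using tops_ne raysD(1)[OF r(1)] by blast
  have "cst r = cst r'" using eq[of 0] by (simp add: cst_def)
  then show ?thesis
    using lim_ray[OF r(1) h] lim_ray[OF r(2), of h n] h eq[of n] ldist_triangle[of "lim r" "lim r'" h] ldist_commute[of "lim r" h] by simp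
qed

text \<open>The image direction of \<open>R (g \<otimes> r n)\<close> is, up to an error of order
  \<open>q ^ n\<close>, a multiple of \<open>R g\<close> applied to that of \<open>R (r n)\<close>.
  The limit is therefore shown to lie in the closed set \<open>span {R g (lim r)}\<close>; that
  \<open>R g (lim r)\<close> is non-zero, which is not obvious for operators with a kernel, then
  comes for free.\<close>

lemma lim_translate:
  assumes g: "g \<in> carrier G" and r: "r \<in> rays"
  shows "\<exists>a. a \<noteq> 0 \<and> lim (\<lambda>n. g \<otimes> r n) = a *\<^sub>R R g (lim r)"
proof -
  let ?r' = "\<lambda>n. g \<otimes> r n"
  have r': "?r' \<in> rays" by (rule translate_ray[OF g r])
  note c = raysD(1)[OF r]
  let ?X = "R g" and ?l = "lim r" and ?l' = "lim ?r'"
  have X: "linear ?X" by (rule lin[OF g])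
  obtain k where k0: "0 \<le> k" and k1: "\<forall>h\<in>carrier G. onorm (R h) \<le> k * onorm (R h \<circ> R g) \<and> onorm (R h) \<le> k * onorm (R g \<circ> R h)"
    using onorm_R_comp[OF g] by (elim exE conjE) (rule that)
  have k: "0 \<le> k" "h \<in> carrier G \<Longrightarrow> onorm (R h) \<le> k * onorm (R g \<circ> R h)" for h using k0 k1 by blast+
  \<comment> \<open>Three errors: the distance of \<open>h'\<close> to its limit, the part of
    \<open>?Y e'\<close> perpendicular to \<open>h\<close>, and the distance of \<open>h\<close> to
    \<open>lim r\<close>.\<close>
  define W where "W = cst ?r' + (k * onorm ?X * (c / q ^ wl (r 0)) + k * onorm ?X * cst r)"
  define E where "E = (\<lambda>n. W * q ^ n)"
  have E0: "E \<longlonglongrightarrow> 0" unfolding E_def by (rule qpow_tendsto)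
  have ap: "\<exists>z. z \<in> span {?X ?l} \<and> norm (?l' - z) \<le> E n" for n
  proof -
    let ?Y = "R (r n)"
    have Y: "linear ?Y" by (rule lin[OF c])
    obtain e h where t: "top_gap ?Y e h (c * q ^ wl (r n))" using top[OF c] by blast
    obtain e' h' where t': "top_gap (R (g \<otimes> r n)) e' h' (c * q ^ wl (g \<otimes> r n))" using top[OF m_closed[OF g c]] by blast
    have hh: "h \<in> tops (r n)" "h' \<in> tops (g \<otimes> r n)" using t t' by (auto simp: tops_def)
    obtain \<tau> where \<tau>: "\<tau> \<noteq> 0" "\<And>v. R (g \<otimes> r n) v = \<tau> *\<^sub>R ?X (?Y v)" using mult[OF g c[of n]] by blast
    let ?s = "onorm (R (g \<otimes> r n))"
    have s: "?s = \<bar>\<tau>\<bar> * onorm (?X \<circ> ?Y)"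
    proof -
      have "R (g \<otimes> r n) = (\<lambda>v. \<tau> *\<^sub>R (?X \<circ> ?Y) v)" using \<tau>(2) by auto
      then show ?thesis using onorm_scale[OF linear_compose[OF Y X], of \<tau>] by simp
    qed
    have s0: "0 < ?s" "norm e' = 1" "norm h = 1" "?s *\<^sub>R h' = \<tau> *\<^sub>R ?X (?Y e')" using t t' \<tau>(2)[of e'] by (auto simp: top_gap_def)
    let ?w = "?Y e' - (?Y e' \<bullet> h) *\<^sub>R h"
    let ?a = "\<tau> * (?Y e' \<bullet> h) / ?s"
    have Yk: "onorm ?Y * \<bar>\<tau>\<bar> \<le> k * ?s" using mult_right_mono[OF k(2)[OF c], of "\<bar>\<tau>\<bar>" n] unfolding s by (simp add: ac_simps)
    \<comment> \<open>\<open>?Y e'\<close> is split along \<open>h\<close>; after rescaling, the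
      main part is a multiple of \<open>?X h\<close> and the rest is small by the gap of
      \<open>?Y\<close>.\<close>
    have dec: "h' = ?a *\<^sub>R ?X h + (\<tau> / ?s) *\<^sub>R ?X ?w"
    proof -
      have "h' = (1 / ?s) *\<^sub>R (?s *\<^sub>R h')" using s0(1) by simp
      also have "\<dots> = (\<tau> / ?s) *\<^sub>R ?X (?Y e')" unfolding s0(4) by simp
      also have "?X (?Y e') = (?Y e' \<bullet> h) *\<^sub>R ?X h + ?X ?w" using X by (simp add: linear_diff linear_scale)
      finally show ?thesis by (simp add: scaleR_add_right)
    qed
    have aw: "\<bar>?a\<bar> \<le> k"
    proof -
      have "\<bar>?Y e' \<bullet> h\<bar> \<le> onorm ?Y" using Cauchy_Schwarz_ineq2[of "?Y e'" h] onorm_bound[OF Y, of e'] s0 by simp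
      then have "\<bar>?Y e' \<bullet> h\<bar> * \<bar>\<tau>\<bar> \<le> onorm ?Y * \<bar>\<tau>\<bar>" by (rule mult_right_mono) simp
      then have "\<bar>\<tau>\<bar> * \<bar>?Y e' \<bullet> h\<bar> \<le> k * ?s" using Yk by (simp add: mult.commute)
      then show ?thesis using s0(1) by (simp add: abs_mult divide_le_eq)
    qed
    have wb: "norm ((\<tau> / ?s) *\<^sub>R ?X ?w) \<le> k * onorm ?X * (c / q ^ wl (r 0)) * q ^ n"
    proof -
      have "norm (?X ?w) \<le> onorm ?X * (c * q ^ wl (r n) * onorm ?Y)"
        using onorm_bound[OF X, of ?w] mult_left_mono[OF top_gap_par(2)[OF Y t, of e'] onorm_nonneg[OF X]] s0 by simp
      then have "\<bar>\<tau>\<bar> * norm (?X ?w) \<le> \<bar>\<tau>\<bar> * (onorm ?X * (c * q ^ wl (r n) * onorm ?Y))" by (rule mult_left_mono) simp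
      also have "\<dots> = (onorm ?X * (c * q ^ wl (r n))) * (onorm ?Y * \<bar>\<tau>\<bar>)" by (simp only: ac_simps)
      also have "\<dots> \<le> (onorm ?X * (c * q ^ wl (r n))) * (k * ?s)"
        using Yk cq onorm_nonneg[OF X] by (intro mult_left_mono) auto
      also have "\<dots> \<le> (onorm ?X * (c * (q ^ n / q ^ wl (r 0)))) * (k * ?s)"
        using cq onorm_nonneg[OF X] k(1) s0(1) q_wl_le[OF ray_wl[OF r]] by (intro mult_right_mono mult_left_mono) auto
      finally have "\<bar>\<tau>\<bar> * norm (?X ?w) \<le> (k * onorm ?X * (c / q ^ wl (r 0)) * q ^ n) * ?s" by (simp add: ac_simps)
      then show ?thesis using s0(1) by (simp add: divide_le_eq)
    qed
    obtain \<sigma> where \<sigma>: "\<sigma> = 1 \<or> \<sigma> = -1" "norm (h - \<sigma> *\<^sub>R ?l) = ldist h ?l" by (rule ldist_cases)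
    obtain \<sigma>' where \<sigma>': "\<sigma>' = 1 \<or> \<sigma>' = -1" "norm (?l' - \<sigma>' *\<^sub>R h') = ldist ?l' h'" by (rule ldist_cases)
    let ?z = "(\<sigma>' * ?a * \<sigma>) *\<^sub>R ?X ?l"
    have Xh: "norm (?a *\<^sub>R ?X h - (?a * \<sigma>) *\<^sub>R ?X ?l) \<le> k * onorm ?X * cst r * q ^ n"
    proof -
      have "?a *\<^sub>R ?X h - (?a * \<sigma>) *\<^sub>R ?X ?l = ?a *\<^sub>R ?X (h - \<sigma> *\<^sub>R ?l)" using X by (simp add: linear_diff linear_scale scaleR_diff_right)
      then have "norm (?a *\<^sub>R ?X h - (?a * \<sigma>) *\<^sub>R ?X ?l) = \<bar>?a\<bar> * norm (?X (h - \<sigma> *\<^sub>R ?l))" by simp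
      also have "\<dots> \<le> k * (onorm ?X * ldist h ?l)"
        using aw k(1) onorm_bound[OF X, of "h - \<sigma> *\<^sub>R ?l"] unfolding \<sigma>(2) by (intro mult_mono) auto
      also have "\<dots> \<le> k * (onorm ?X * (cst r * q ^ n))"
        using k(1) onorm_nonneg[OF X] lim_ray[OF r hh(1)] by (intro mult_left_mono) auto
      finally show ?thesis by (simp add: mult.assoc)
    qed
    have "?l' - ?z = (?l' - \<sigma>' *\<^sub>R h') + \<sigma>' *\<^sub>R ((?a *\<^sub>R ?X h - (?a * \<sigma>) *\<^sub>R ?X ?l) + (\<tau> / ?s) *\<^sub>R ?X ?w)"
    proof -
      have "\<sigma>' *\<^sub>R h' = \<sigma>' *\<^sub>R (?a *\<^sub>R ?X h + (\<tau> / ?s) *\<^sub>R ?X ?w)" using dec by simp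
      then show ?thesis by (simp add: scaleR_add_right scaleR_diff_right mult.assoc)
    qed
    then have "norm (?l' - ?z) \<le> norm (?l' - \<sigma>' *\<^sub>R h') + norm (\<sigma>' *\<^sub>R ((?a *\<^sub>R ?X h - (?a * \<sigma>) *\<^sub>R ?X ?l) + (\<tau> / ?s) *\<^sub>R ?X ?w))"
      by (metis norm_triangle_ineq)
    also have "norm (\<sigma>' *\<^sub>R ((?a *\<^sub>R ?X h - (?a * \<sigma>) *\<^sub>R ?X ?l) + (\<tau> / ?s) *\<^sub>R ?X ?w)) = norm ((?a *\<^sub>R ?X h - (?a * \<sigma>) *\<^sub>R ?X ?l) + (\<tau> / ?s) *\<^sub>R ?X ?w)"
      by (subst norm_scaleR) (use \<sigma>'(1) in auto)
    also have "\<dots> \<le> k * onorm ?X * cst r * q ^ n + k * onorm ?X * (c / q ^ wl (r 0)) * q ^ n"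
      by (rule order_trans[OF norm_triangle_ineq add_mono[OF Xh wb]])
    also have "norm (?l' - \<sigma>' *\<^sub>R h') \<le> cst ?r' * q ^ n"
      unfolding \<sigma>'(2) using lim_ray[OF r' hh(2)] by (simp add: ldist_commute)
    finally have "norm (?l' - ?z) \<le> E n" by (simp add: E_def W_def distrib_right)
    moreover have "?z \<in> span {?X ?l}" by (simp add: span_base span_mul)
    ultimately show ?thesis by blast
  qed
  then obtain z where z: "\<And>n. z n \<in> span {?X ?l}" "\<And>n. norm (?l' - z n) \<le> E n" by metis
  have "z \<longlonglongrightarrow> ?l'"
  proof (rule Lim_transform2[OF tendsto_const])
    show "(\<lambda>n. ?l' - z n) \<longlonglongrightarrow> 0" by (rule tendsto_norm_zero_cancel, rule tendsto_sandwich[OF _ _ tendsto_const E0]) (use z in auto)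
  qed
  then have "?l' \<in> span {?X ?l}" using closed_sequentially[OF closed_span, of z] z(1) by blast
  then obtain a where a: "?l' = a *\<^sub>R ?X ?l" by (auto simp: span_singleton)
  moreover have "a \<noteq> 0" using a lim(1)[OF r'] by auto
  ultimately show ?thesis by blast
qed

end

section \<open>Domination along paths, stability, transversality and contraction\<close>

context gap_system begin

text \<open>Each factor may carry its own non-zero scalar: operators of a nearby representation are
  comparable only after rescaling.\<close>

lemma seq_prod_R:
  assumes p: "edge_path p" and A: "\<And>n. \<exists>t. t \<noteq> 0 \<and> (\<forall>v. A n v = t *\<^sub>R R (inv (p n) \<otimes> p (Suc n)) v)" and k: "0 < k"
  shows "\<exists>t. t \<noteq> 0 \<and> (\<forall>v. seq_prod A m k v = t *\<^sub>R R (inv (p m) \<otimes> p (m + k)) v)"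
  using k
proof (induction k rule: nat_induct_non_zero)
  case 1
  then show ?case using A[of m] by simp
next
  case (Suc k)
  have c: "p n \<in> carrier G" for n using p by (simp add: edge_path_def)
  let ?g = "inv (p m) \<otimes> p (m + k)" and ?s = "inv (p (m + k)) \<otimes> p (Suc (m + k))"
  have gs: "?g \<in> carrier G" "?s \<in> carrier G" using c by auto
  obtain t where t: "t \<noteq> 0" "\<And>v. seq_prod A m k v = t *\<^sub>R R ?g v" using Suc by blast
  obtain u where u: "u \<noteq> 0" "\<And>v. A (m + k) v = u *\<^sub>R R ?s v" using A by blast
  obtain w where w: "w \<noteq> 0" "\<And>v. R (?g \<otimes> ?s) v = w *\<^sub>R R ?g (R ?s v)" using mult[OF gs] by blast
  have e: "?g \<otimes> ?s = inv (p m) \<otimes> p (m + Suc k)" using inv_mult_chain[OF c c c] by simp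
  have "seq_prod A m (Suc k) v = (t * u / w) *\<^sub>R R (inv (p m) \<otimes> p (m + Suc k)) v" for v
  proof -
    have "seq_prod A m (Suc k) v = t *\<^sub>R R ?g (u *\<^sub>R R ?s v)" by (simp add: t u)
    also have "\<dots> = (t * u) *\<^sub>R R ?g (R ?s v)" using lin[OF gs(1)] by (simp add: linear_scale)
    also have "R ?g (R ?s v) = (1 / w) *\<^sub>R R (?g \<otimes> ?s) v" using w by simp
    finally show ?thesis unfolding e by simp
  qed
  moreover have "t * u / w \<noteq> 0" using t u w by simp
  ultimately show ?case by blast
qed

lemma top_gap_multiple:
  assumes g: "g \<in> carrier G" and f: "t \<noteq> 0" "\<And>v. f v = t *\<^sub>R R g v" and h: "top_gap (R g) e h \<theta>"
  obtains \<sigma> where "\<sigma> = 1 \<or> \<sigma> = -1" "top_gap f e (\<sigma> *\<^sub>R h) \<theta>"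
proof -
  have "f = (\<lambda>v. t *\<^sub>R R g v)" using f by auto
  then show ?thesis using that[of "sgn t"] top_gap_scale[OF lin[OF g] h f(1)] f(1) by (simp add: sgn_if split: if_splits)
qed

text \<open>The element reached after \<open>k\<close> edges has length at least
  \<open>k - b\<close>, so its gap is one in terms of \<open>k\<close> at the price of the factor
  \<open>1 / q ^ b\<close>.\<close>

lemma seq_top:
  assumes p: "edge_path p" and A: "\<And>n. \<exists>t. t \<noteq> 0 \<and> (\<forall>v. A n v = t *\<^sub>R R (inv (p n) \<otimes> p (Suc n)) v)" and k: "0 < k"
    and b: "k \<le> wd (p m) (p (m + k)) + b"
    and h: "top_gap (R (inv (p m) \<otimes> p (m + k))) e h (c * q ^ wl (inv (p m) \<otimes> p (m + k)))"
  shows "\<exists>\<sigma>. (\<sigma> = 1 \<or> \<sigma> = -1) \<and> top_gap (seq_prod A m k) e (\<sigma> *\<^sub>R h) (c / q ^ b * q ^ k)"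
proof -
  let ?g = "inv (p m) \<otimes> p (m + k)"
  have g: "?g \<in> carrier G" using p by (simp add: edge_path_def)
  obtain t where t: "t \<noteq> 0" "\<And>v. seq_prod A m k v = t *\<^sub>R R ?g v" using seq_prod_R[OF p A k] by blast
  obtain \<sigma> where s: "\<sigma> = 1 \<or> \<sigma> = -1" "top_gap (seq_prod A m k) e (\<sigma> *\<^sub>R h) (c * q ^ wl ?g)"
    by (rule top_gap_multiple[OF g t h])
  have "c * q ^ wl ?g \<le> c * (q ^ k / q ^ b)"
    using b cq unfolding word_dist_def by (intro mult_left_mono q_wl_le) auto
  then have "top_gap (seq_prod A m k) e (\<sigma> *\<^sub>R h) (c / q ^ b * q ^ k)" using top_gap_mono[OF s(2)] by simp
  with s(1) show ?thesis by blast
qed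

lemma dominated_path:
  assumes p: "edge_path p" and b: "\<And>m k. k \<le> wd (p m) (p (m + k)) + b"
  shows "dominated (\<lambda>n. R (inv (p n) \<otimes> p (Suc n))) (c / q ^ b) q K"
proof -
  let ?A = "\<lambda>n. R (inv (p n) \<otimes> p (Suc n))"
  have c: "p n \<in> carrier G" and s: "inv (p n) \<otimes> p (Suc n) \<in> S" for n using p by (auto simp: edge_path_def)
  have A: "\<exists>t. t \<noteq> 0 \<and> (\<forall>v. ?A n v = t *\<^sub>R R (inv (p n) \<otimes> p (Suc n)) v)" for n by (intro exI[of _ 1]) simp
  have lA: "linear (?A n)" for n using lin S_carrier s by blast
  have topA: "\<exists>e h. top_gap (seq_prod ?A m k) e h (c / q ^ b * q ^ k)" if k: "0 < k" for m k
  proof -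
    obtain e h where "top_gap (R (inv (p m) \<otimes> p (m + k))) e h (c * q ^ wl (inv (p m) \<otimes> p (m + k)))"
      using top[of "inv (p m) \<otimes> p (m + k)"] c by auto
    from seq_top[OF p A k b this] show ?thesis by blast
  qed
  have nrm: "onorm (seq_prod ?A m k) \<le> K * onorm (seq_prod ?A m (Suc k)) \<and>
        onorm (seq_prod ?A (Suc m) k) \<le> K * onorm (seq_prod ?A m (Suc k))" if k: "0 < k" for m k
  proof
    let ?g = "inv (p m) \<otimes> p (m + k)" and ?s = "inv (p (m + k)) \<otimes> p (Suc (m + k))"
    have g: "?g \<in> carrier G" using c by simp
    obtain t where t: "t \<noteq> 0" "\<And>v. seq_prod ?A m k v = t *\<^sub>R R ?g v" using seq_prod_R[OF p A k] by blast
    have e: "seq_prod ?A m k = (\<lambda>v. t *\<^sub>R R ?g v)" "seq_prod ?A m (Suc k) = (\<lambda>v. t *\<^sub>R (R ?g \<circ> R ?s) v)" using t by auto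
    have l: "linear (R ?g)" "linear (R ?g \<circ> R ?s)" using lin g lA[of "m + k"] linear_compose by auto
    show "onorm (seq_prod ?A m k) \<le> K * onorm (seq_prod ?A m (Suc k))"
      unfolding e onorm_scale[OF l(1)] onorm_scale[OF l(2)]
      using mult_left_mono[OF K(4)[OF s g], of "\<bar>t\<bar>" "m + k"] by (simp add: mult.left_commute)
  next
    let ?g = "inv (p (Suc m)) \<otimes> p (Suc m + k)" and ?s = "inv (p m) \<otimes> p (Suc m)"
    have g: "?g \<in> carrier G" using c by simp
    obtain t where t: "t \<noteq> 0" "\<And>v. seq_prod ?A (Suc m) k v = t *\<^sub>R R ?g v" using seq_prod_R[OF p A k] by blast
    have ls: "linear (R ?s)" by (rule lA)
    have e: "seq_prod ?A (Suc m) k = (\<lambda>v. t *\<^sub>R R ?g v)" "seq_prod ?A m (Suc k) = (\<lambda>v. t *\<^sub>R (R ?s \<circ> R ?g) v)"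
      unfolding seq_prod_Suc_left using t ls by (auto simp: linear_scale)
    have l: "linear (R ?g)" "linear (R ?s \<circ> R ?g)" using lin g ls linear_compose by auto
    show "onorm (seq_prod ?A (Suc m) k) \<le> K * onorm (seq_prod ?A m (Suc k))"
      unfolding e onorm_scale[OF l(1)] onorm_scale[OF l(2)]
      using mult_left_mono[OF K(5)[OF s g], of "\<bar>t\<bar>" m] by (simp add: mult.left_commute)
  qed
  have "0 < c / q ^ b" using cq by simp
  then show ?thesis unfolding dominated_def using lA cq K(1) K(2,3)[OF s] topA nrm by blast
qed

lemma le_if_le_qpow:
  assumes "\<And>n. n0 \<le> n \<Longrightarrow> x \<le> a + W * q ^ n" shows "x \<le> a"
proof (rule tendsto_lowerbound)
  show "(\<lambda>n. a + W * q ^ n) \<longlonglongrightarrow> a" using tendsto_add[OF tendsto_const[of a] qpow_tendsto[of W]] by simp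
  show "\<forall>\<^sub>F n in sequentially. x \<le> a + W * q ^ n" by (rule eventually_sequentiallyI[OF assms])
qed simp

text \<open>The top direction \<open>h0\<close> at the single time \<open>N\<close> mediates. It is
  near \<open>lim r\<close> by the estimates of the given system, and near the perturbed directions
  at all multiples of \<open>N\<close> by \<open>dominated_stability\<close>; the perturbed system
  needs its own constants merely to let those directions converge, so they do not affect the
  bound.\<close>

lemma lim_stable:
  assumes r: "r \<in> rays" and \<eta>: "0 < \<eta>"
  obtains \<epsilon> where "0 < \<epsilon>"
    "\<And>R' c' q'. gap_system G S R' c' q' \<Longrightarrow> (\<And>s. s \<in> S \<Longrightarrow> \<exists>t. t \<noteq> 0 \<and> (\<forall>v. norm (t *\<^sub>R R' s v - R s v) \<le> \<epsilon> * norm v)) \<Longrightarrow>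
       ldist (lim r) (gap_system.lim G S R' c' q' r) \<le> \<eta>"
proof -
  let ?p = "path_of r" and ?b = "2 * length (word_of (r 0))"
  let ?A = "\<lambda>n. R (inv (?p n) \<otimes> ?p (Suc n))"
  note P = qpathD[OF path_of(2)[OF r]]
  have A: "\<exists>t. t \<noteq> 0 \<and> (\<forall>v. ?A n v = t *\<^sub>R R (inv (?p n) \<otimes> ?p (Suc n)) v)" for n by (intro exI[of _ 1]) simp
  have dom: "dominated ?A (c / q ^ ?b) q K" by (rule dominated_path[OF P(5,4)])
  have \<eta>2: "0 < \<eta> / 2" using \<eta> by simp
  have z: "inv (?p 0) \<otimes> ?p (0 + k) = ?p k" for k using P(1,3) by simp
  have tp: "\<exists>\<sigma>. (\<sigma> = 1 \<or> \<sigma> = -1) \<and> top_gap (seq_prod ?A 0 k) e (\<sigma> *\<^sub>R h) (c / q ^ ?b * q ^ k)"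
    if "0 < k" "top_gap (R (?p k)) e h (c * q ^ wl (?p k))" for k e h
    using seq_top[where A = ?A and p = ?p and m = 0, OF P(5) A that(1) P(4), unfolded z, OF that(2)] .
  show ?thesis
  proof (rule dominated_stability[OF dom \<eta>2])
  fix \<epsilon> N assume \<epsilon>: "0 < \<epsilon>" "0 < N" "4 * K\<^sup>2 * (c / q ^ ?b) / (1 - q) * q ^ N \<le> \<eta> / 2"
    and st: "\<And>A' j e h e' h' \<theta>'. (\<And>n. linear (A' n)) \<Longrightarrow> (\<And>n v. norm (A' n v - ?A n v) \<le> \<epsilon> * norm v) \<Longrightarrow> 0 < j \<Longrightarrow>
       top_gap (seq_prod ?A 0 N) e h (c / q ^ ?b * q ^ N) \<Longrightarrow> top_gap (seq_prod A' 0 (j * N)) e' h' \<theta>' \<Longrightarrow> ldist h h' \<le> \<eta> / 2"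
  obtain e0 h0 where h0: "top_gap (R (?p N)) e0 h0 (c * q ^ wl (?p N))" using top[OF P(1)] by blast
  obtain \<sigma>0 where \<sigma>0: "\<sigma>0 = 1 \<or> \<sigma>0 = -1" "top_gap (seq_prod ?A 0 N) e0 (\<sigma>0 *\<^sub>R h0) (c / q ^ ?b * q ^ N)"
    using tp[OF \<epsilon>(2) h0] by blast
  have 1: "ldist h0 (lim r) \<le> \<eta> / 2"
  proof (rule le_if_le_qpow)
    fix n assume n: "N \<le> n"
    obtain e h where h: "top_gap (R (?p n)) e h (c * q ^ wl (?p n))" using top[OF P(1)] by blast
    have n0: "0 < n" using \<epsilon>(2) n by simp
    obtain \<sigma> where \<sigma>: "\<sigma> = 1 \<or> \<sigma> = -1" "top_gap (seq_prod ?A 0 n) e (\<sigma> *\<^sub>R h) (c / q ^ ?b * q ^ n)"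
      using tp[OF n0 h] by blast
    have "ldist (\<sigma>0 *\<^sub>R h0) (\<sigma> *\<^sub>R h) \<le> \<eta> / 2"
      using dom_cauchy_left[OF dom \<epsilon>(2) n \<sigma>0(2) \<sigma>(2)] \<epsilon>(3) by linarith
    then have "ldist h0 h \<le> \<eta> / 2" using \<sigma>0(1) \<sigma>(1) by auto
    moreover have "ldist h (lim r) \<le> cst r * q ^ n" using h by (intro lim(2)[OF r]) (auto simp: tops_def)
    ultimately show "ldist h0 (lim r) \<le> \<eta> / 2 + cst r * q ^ n" using ldist_triangle[of h0 "lim r" h] by linarith
  qed
  show ?thesis
  proof (rule that[OF \<epsilon>(1)])
    fix R' c' q' assume gs: "gap_system G S R' c' q'"
      and cl: "\<And>s. s \<in> S \<Longrightarrow> \<exists>t. t \<noteq> 0 \<and> (\<forall>v. norm (t *\<^sub>R R' s v - R s v) \<le> \<epsilon> * norm v)"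
    interpret R': gap_system G S R' c' q' by (rule gs)
    obtain t where t: "\<And>s. s \<in> S \<Longrightarrow> t s \<noteq> 0" "\<And>s v. s \<in> S \<Longrightarrow> norm (t s *\<^sub>R R' s v - R s v) \<le> \<epsilon> * norm v" using cl by metis
    \<comment> \<open>The perturbed generators, with the scalars that make them close to the given
      ones.\<close>
    define A' where "A' n v = t (inv (?p n) \<otimes> ?p (Suc n)) *\<^sub>R R' (inv (?p n) \<otimes> ?p (Suc n)) v" for n v
    have A': "\<exists>u. u \<noteq> 0 \<and> (\<forall>v. A' n v = u *\<^sub>R R' (inv (?p n) \<otimes> ?p (Suc n)) v)" for n
      using t(1)[OF P(2)] unfolding A'_def by blast
    have lA': "linear (A' n)" for n
      unfolding A'_def using R'.lin[OF S_carrier[OF P(2)]] by (rule linear_compose_scale_right)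
    have cA': "norm (A' n v - ?A n v) \<le> \<epsilon> * norm v" for n v unfolding A'_def by (rule t(2)[OF P(2)])
    have 2: "ldist h0 (R'.lim r) \<le> \<eta> / 2"
    proof (rule R'.le_if_le_qpow)
      fix j :: nat assume j: "1 \<le> j"
      let ?k = "j * N"
      have k: "0 < ?k" using j \<epsilon>(2) by simp
      obtain e h where h: "top_gap (R' (?p ?k)) e h (c' * q' ^ wl (?p ?k))" using R'.top[OF P(1)] by blast
      obtain \<sigma> where \<sigma>: "\<sigma> = 1 \<or> \<sigma> = -1" "top_gap (seq_prod A' 0 ?k) e (\<sigma> *\<^sub>R h) (c' / q' ^ ?b * q' ^ ?k)"
        using R'.seq_top[where A = A' and p = ?p and m = 0, OF P(5) A' k P(4), unfolded z, OF h] by blast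
      have "ldist (\<sigma>0 *\<^sub>R h0) (\<sigma> *\<^sub>R h) \<le> \<eta> / 2" using st[OF lA' cA' _ \<sigma>0(2) \<sigma>(2)] j by simp
      then have "ldist h0 h \<le> \<eta> / 2" using \<sigma>0(1) \<sigma>(1) by auto
      moreover have "ldist h (R'.lim r) \<le> R'.cst r * q' ^ ?k" using h by (intro R'.lim(2)[OF r]) (auto simp: R'.tops_def)
      moreover have "R'.cst r * q' ^ ?k \<le> R'.cst r * q' ^ j"
        using R'.cq \<epsilon>(2) R'.C_nonneg unfolding R'.cst_def by (intro mult_left_mono power_decreasing) auto
      ultimately show "ldist h0 (R'.lim r) \<le> \<eta> / 2 + R'.cst r * q' ^ j" using ldist_triangle[of h0 "R'.lim r" h] by linarith
    qed
    show "ldist (lim r) (R'.lim r) \<le> \<eta>"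
      using 1 2 ldist_triangle[of "lim r" "R'.lim r" h0] ldist_commute[of "lim r" h0] by linarith
  qed
  qed
qed

text \<open>The limit line of the contragredient action; its orthogonal complement is the limit
  hyperplane of the ray.\<close>

definition colim :: "(nat \<Rightarrow> 'g) \<Rightarrow> 'a" where
  "colim = gap_system.lim G S (\<lambda>g. adjoint (R (inv g))) c q"

lemma top_dual:
  assumes g: "g \<in> carrier G" and t: "top_gap (R g) e h (c * q ^ wl g)"
  shows "e \<in> gap_system.tops G S (\<lambda>g. adjoint (R (inv g))) c q (inv g)"
proof -
  interpret D: gap_system G S "\<lambda>g. adjoint (R (inv g))" c q by (rule dual)
  show ?thesis unfolding D.tops_def using top_gap_adjoint[OF lin[OF g] t] g by auto
qed

text \<open>The path of \<open>r'\<close> read backwards, followed by the path of \<open>r\<close>,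
  is quasi-geodesic by hyperbolicity. At the junction, the input direction of the operator before it
  tends to \<open>colim r'\<close> and the image direction of the one after it to
  \<open>lim r\<close>, while \<open>uniform_transversality\<close> keeps their pairing above a
  bound independent of the length.\<close>

lemma lim_transverse:
  assumes hyp: "word_hyperbolic G S" and r: "r \<in> rays" and r': "r' \<in> rays" and ne: "cls r \<noteq> cls r'"
  shows "lim r \<bullet> colim r' \<noteq> 0"
proof -
  interpret D: gap_system G S "\<lambda>g. adjoint (R (inv g))" c q by (rule dual)
  let ?p = "path_of r" and ?p' = "path_of r'"
  let ?b = "2 * length (word_of (r 0))" and ?b' = "2 * length (word_of (r' 0))"
  note P = qpathD[OF path_of(2)[OF r]] and P' = qpathD[OF path_of(2)[OF r']]
  have "\<exists>K0. \<forall>n m. n + m \<le> wd (?p n) (?p' m) + K0" by (rule rays_diverge[OF hyp r r' ne]) blast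
  then obtain K0 where K0: "\<And>n m. n + m \<le> wd (?p n) (?p' m) + K0" by blast
  define b where "b = ?b + ?b' + K0"
  define pN where "pN N n = (if n \<le> N then ?p' (N - n) else ?p (n - N))" for N n
  have pN: "pN N n = ?p' (N - n)" if "n \<le> N" for N n using that by (simp add: pN_def)
  have pN': "pN N n = ?p (n - N)" if "N \<le> n" for N n using that P(3) P'(3) by (cases "n = N") (auto simp: pN_def)
  have c: "pN N n \<in> carrier G" for N n using P(1) P'(1) by (simp add: pN_def)
  have ep: "edge_path (pN N)" for N
    unfolding edge_path_def
  proof (intro allI conjI c)
    fix n
    show "inv (pN N n) \<otimes> pN N (Suc n) \<in> S"
    proof (cases "n < N")
      case True
      then have S: "N - n = Suc (N - Suc n)" by simp
      have "inv (pN N n) \<otimes> pN N (Suc n) = inv (inv (?p' (N - Suc n)) \<otimes> ?p' (N - n))"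
        using True pN[of n N] pN[of "Suc n" N] P'(1) by (simp add: inv_mult_inv)
      also have "\<dots> \<in> S" unfolding S by (intro S_inv P'(2))
      finally show ?thesis .
    next
      case False
      then show ?thesis using pN'[of N n] pN'[of N "Suc n"] P(2)[of "n - N"] by (simp add: Suc_diff_le)
    qed
  qed
  have bd: "k \<le> wd (pN N m) (pN N (m + k)) + b" for N m k
  proof -
    consider "m + k \<le> N" | "N \<le> m" | "m < N" "N < m + k" by linarith
    then show ?thesis
    proof cases
      case 1
      have "k \<le> wd (?p' (N - (m + k))) (?p' (N - (m + k) + k)) + ?b'" by (rule P'(4))
      moreover have "N - (m + k) + k = N - m" using 1 by simp
      ultimately show ?thesis using 1 pN[of m N] pN[of "m + k" N] wd_commute[OF P'(1) P'(1)] by (simp add: b_def)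
    next
      case 2
      have "k \<le> wd (?p (m - N)) (?p (m - N + k)) + ?b" by (rule P(4))
      then show ?thesis using 2 pN'[of N m] pN'[of N "m + k"] by (simp add: b_def)
    next
      case 3
      have "(m + k - N) + (N - m) \<le> wd (?p (m + k - N)) (?p' (N - m)) + K0" by (rule K0)
      then show ?thesis using 3 pN[of m N] pN'[of N "m + k"] wd_commute[OF P(1) P'(1)] by (simp add: b_def)
    qed
  qed
  have cb: "0 < c / q ^ b" using cq by simp
  show ?thesis
  proof (rule uniform_transversality[OF cb cq(2,3) K(1), where ?'a = 'a])
  fix \<alpha> N0 assume \<alpha>: "0 < \<alpha>"
    and tr: "\<And>(A :: nat \<Rightarrow> 'a \<Rightarrow> 'a) N m e h e' h'. dominated A (c / q ^ b) q K \<Longrightarrow> N0 \<le> N \<Longrightarrow> N \<le> m \<Longrightarrow>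
      top_gap (seq_prod A (m - N) N) e h (c / q ^ b * q ^ N) \<Longrightarrow> top_gap (seq_prod A m N) e' h' (c / q ^ b * q ^ N) \<Longrightarrow>
      \<alpha> \<le> \<bar>e \<bullet> h'\<bar>"
  have "\<alpha> \<le> \<bar>lim r \<bullet> colim r'\<bar>"
  proof (rule le_if_le_qpow)
    fix N assume "max N0 1 \<le> N"
    then have N: "N0 \<le> N" "0 < N" by auto
    let ?A = "\<lambda>n. R (inv (pN N n) \<otimes> pN N (Suc n))"
    have A: "\<exists>t. t \<noteq> 0 \<and> (\<forall>v. ?A n v = t *\<^sub>R R (inv (pN N n) \<otimes> pN N (Suc n)) v)" for n by (intro exI[of _ 1]) simp
    have g1: "inv (pN N 0) \<otimes> pN N (0 + N) = inv (?p' N)" using pN[of 0 N] pN[of N N] P'(1,3) by simp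
    have g2: "inv (pN N N) \<otimes> pN N (N + N) = ?p N" using pN'[of N N] pN'[of N "N + N"] P(1,3) by simp
    have ip: "inv (?p' N) \<in> carrier G" using P'(1) by simp
    obtain e h where t1: "top_gap (R (inv (?p' N))) e h (c * q ^ wl (inv (?p' N)))" using top[OF ip] by blast
    obtain e' h' where t2: "top_gap (R (?p N)) e' h' (c * q ^ wl (?p N))" using top[OF P(1)] by blast
    obtain \<sigma> where s1: "\<sigma> = 1 \<or> \<sigma> = -1" "top_gap (seq_prod ?A 0 N) e (\<sigma> *\<^sub>R h) (c / q ^ b * q ^ N)"
      using seq_top[where A = ?A and p = "pN N" and m = 0, OF ep A N(2) bd, unfolded g1, OF t1] by blast
    obtain \<sigma>' where s2: "\<sigma>' = 1 \<or> \<sigma>' = -1" "top_gap (seq_prod ?A N N) e' (\<sigma>' *\<^sub>R h') (c / q ^ b * q ^ N)"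
      using seq_top[where A = ?A and p = "pN N" and m = N, OF ep A N(2) bd, unfolded g2, OF t2] by blast
    have "\<alpha> \<le> \<bar>e \<bullet> (\<sigma>' *\<^sub>R h')\<bar>"
      by (rule tr[OF dominated_path[OF ep bd] N(1) order_refl]) (use s1 s2 in auto)
    then have a: "\<alpha> \<le> \<bar>e \<bullet> h'\<bar>" using s2(1) by auto
    have eD: "e \<in> D.tops (?p' N)" using top_dual[OF ip t1] P'(1) by simp
    have "ldist e (colim r') \<le> D.cst r' * q ^ N" unfolding colim_def by (rule D.lim(2)[OF r' eD])
    moreover have "ldist h' (lim r) \<le> cst r * q ^ N" using t2 by (intro lim(2)[OF r]) (auto simp: tops_def)
    moreover have "norm e = 1" "norm (lim r) = 1" using t1 lim(1)[OF r] by (auto simp: top_gap_def)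
    ultimately show "\<alpha> \<le> \<bar>lim r \<bullet> colim r'\<bar> + (D.cst r' + cst r) * q ^ N"
      using abs_inner_ldist[of e h' "lim r"] abs_inner_ldist[of "lim r" e "colim r'"] a
      by (simp add: inner_commute distrib_right)
  qed
  then show ?thesis using \<alpha> by auto
  qed
qed

text \<open>\<open>g j\<close> is a vertex of \<open>path_of r\<close> from which the path looks,
  for at least \<open>j\<close> steps, like the ray \<open>t\<close>. Its image direction is near
  \<open>lim r\<close> and its input direction near \<open>colim t\<close>; a limit vector
  transverse to the latter has a component along the input direction that is bounded below, and is
  thus sent close to the image direction.\<close>

lemma contraction:
  assumes hyp: "word_hyperbolic G S" and r: "r \<in> rays"
  obtains t g where "t \<in> rays" "\<And>j::nat. g j \<in> carrier G"
    "\<And>y. y \<in> rays \<Longrightarrow> cls y \<noteq> cls t \<Longrightarrow> (\<lambda>j. ldist (lim (\<lambda>n. g j \<otimes> y n)) (lim r)) \<longlonglongrightarrow> 0"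
proof -
  interpret D: gap_system G S "\<lambda>g. adjoint (R (inv g))" c q by (rule dual)
  let ?p = "path_of r" and ?b = "2 * length (word_of (r 0))"
  note P = qpathD[OF path_of(2)[OF r]]
  show ?thesis
  proof (rule reversed_ray_limit[OF r])
  fix t assume t: "t \<in> rays" "\<And>N. infinite {n. N \<le> n \<and> (\<forall>k\<le>N. inv (?p n) \<otimes> ?p (n - k) = t k)}"
  define m where "m N = (SOME n. N \<le> n \<and> (\<forall>k\<le>N. inv (?p n) \<otimes> ?p (n - k) = t k))" for N
  have ms: "N \<le> m N \<and> (\<forall>k\<le>N. inv (?p (m N)) \<otimes> ?p (m N - k) = t k)" for N
  proof -
    have "{n. N \<le> n \<and> (\<forall>k\<le>N. inv (?p n) \<otimes> ?p (n - k) = t k)} \<noteq> {}" using t(2)[of N] infinite_imp_nonempty by blast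
    then have "\<exists>n. N \<le> n \<and> (\<forall>k\<le>N. inv (?p n) \<otimes> ?p (n - k) = t k)" by blast
    then show ?thesis unfolding m_def by (rule someI_ex)
  qed
  have m: "N \<le> m N" "k \<le> N \<Longrightarrow> inv (?p (m N)) \<otimes> ?p (m N - k) = t k" for N k using ms by auto
  let ?g = "\<lambda>N. ?p (m N)"
  have g: "?g N \<in> carrier G" for N by (rule P(1))
  \<comment> \<open>\<open>e\<close> is a top direction of the contragredient at
    \<open>inv (?g N)\<close>. This is the end of the path read backwards from \<open>?g N\<close>,
    which goes through \<open>t N\<close> at step \<open>N\<close>.\<close>
  have e_near: "ldist e (colim t) \<le> (D.C ?b + D.cst t) * q ^ N" if e: "top_gap (R (?g N)) e h (c * q ^ wl (?g N))" for N e h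
  proof -
    let ?s = "\<lambda>k. inv (?p (m N)) \<otimes> ?p (m N - k)"
    obtain z where z: "z \<in> D.tops (t N)" using D.tops_ne raysD(1)[OF t(1)] by blast
    have "ldist z e \<le> D.C ?b * q ^ N"
    proof (rule D.tops_chain[where N = "m N" and p = ?s and n' = "m N"])
      fix k assume k: "k \<le> m N"
      have "k \<le> wd (?p (m N - k)) (?p (m N)) + ?b" using P(4)[of k "m N - k"] k by simp
      then show "?s k \<in> carrier G \<and> k \<le> wl (?s k) + ?b" using P(1) wd_commute[OF P(1) P(1)] by (simp add: word_dist_def)
    next
      fix k assume k: "k < m N"
      then have S: "m N - k = Suc (m N - Suc k)" by simp
      have "inv (?s k) \<otimes> ?s (Suc k) = inv (?p (m N - k)) \<otimes> ?p (m N - Suc k)"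
        using inv_mult_chain[OF P(1) P(1) P(1)] by (simp add: inv_mult_inv P(1))
      also have "\<dots> = inv (inv (?p (m N - Suc k)) \<otimes> ?p (m N - k))" by (simp add: inv_mult_inv P(1))
      also have "\<dots> \<in> S" unfolding S by (intro S_inv P(2))
      finally show "inv (?s k) \<otimes> ?s (Suc k) \<in> S" .
    next
      show "z \<in> D.tops (?s N)" using z m(2)[of N N] by simp
      show "e \<in> D.tops (?s (m N))" using top_dual[OF g e] P(1,3) by simp
    qed (use m(1) in auto)
    moreover have "ldist z (colim t) \<le> D.cst t * q ^ N" unfolding colim_def by (rule D.lim_ray[OF t(1) z])
    ultimately show ?thesis using ldist_triangle[of e "colim t" z] ldist_commute[of z e] by (simp add: distrib_right)
  qed
  show ?thesis
  proof (rule that[of t ?g, OF t(1) g])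
    fix y assume y: "y \<in> rays" "cls y \<noteq> cls t"
    let ?v = "lim y"
    define \<beta> where "\<beta> = \<bar>?v \<bullet> colim t\<bar>"
    have \<beta>: "0 < \<beta>" using lim_transverse[OF hyp y(1) t(1) y(2)] by (simp add: \<beta>_def)
    \<comment> \<open>The factor 4 / \<beta> combines the lower bound \<open>\<beta> / 2\<close> on
      the component along \<open>e\<close> with the factor 2 of
      \<open>ldist_le_perp\<close>.\<close>
    define W where "W = 4 / \<beta> * (c / q ^ ?b) + cst r"
    have "\<forall>\<^sub>F N in sequentially. (D.C ?b + D.cst t) * q ^ N < \<beta> / 2"
      by (rule order_tendstoD(2)[OF qpow_tendsto]) (use \<beta> in simp)
    then have ev: "\<forall>\<^sub>F N in sequentially. ldist (lim (\<lambda>n. ?g N \<otimes> y n)) (lim r) \<le> W * q ^ N"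
    proof eventually_elim
      case (elim N)
      let ?X = "R (?g N)" and ?u = "lim (\<lambda>n. ?g N \<otimes> y n)"
      have X: "linear ?X" by (rule lin[OF g])
      obtain e h where th: "top_gap ?X e h (c * q ^ wl (?g N))" using top[OF g] by blast
      have n: "norm e = 1" "norm h = 1" "0 < onorm ?X" "norm ?v = 1" "norm ?u = 1"
        using th lim(1)[OF y(1)] lim(1)[OF translate_ray[OF g y(1)]] by (auto simp: top_gap_def)
      have "\<beta> \<le> \<bar>?v \<bullet> e\<bar> + ldist e (colim t)"
        unfolding \<beta>_def using abs_inner_ldist[of ?v "colim t" e] n by (simp add: ldist_commute)
      then have ve: "\<beta> / 2 \<le> \<bar>?v \<bullet> e\<bar>" using e_near[OF th] elim by linarith
      obtain a where a: "a \<noteq> 0" "?u = a *\<^sub>R ?X ?v" using lim_translate[OF g y(1)] by blast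
      have "\<bar>a\<bar> * onorm ?X * (\<beta> / 2) \<le> \<bar>a\<bar> * onorm ?X * \<bar>?v \<bullet> e\<bar>" using ve n by (intro mult_left_mono) auto
      also have "\<dots> = \<bar>?u \<bullet> h\<bar>" using top_gap_par(1)[OF X th, of ?v] n unfolding a(2) by (simp add: abs_mult)
      also have "\<dots> \<le> 1" using Cauchy_Schwarz_ineq2[of ?u h] n by simp
      finally have aX: "\<bar>a\<bar> * onorm ?X \<le> 2 / \<beta>" using \<beta> by (simp add: field_simps)
      have "norm (?u - (?u \<bullet> h) *\<^sub>R h) = \<bar>a\<bar> * norm (?X ?v - (?X ?v \<bullet> h) *\<^sub>R h)"
      proof -
        have "?u - (?u \<bullet> h) *\<^sub>R h = a *\<^sub>R (?X ?v - (?X ?v \<bullet> h) *\<^sub>R h)" unfolding a(2) by (simp add: scaleR_diff_right)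
        then show ?thesis by simp
      qed
      also have "\<dots> \<le> \<bar>a\<bar> * (c * q ^ wl (?g N) * onorm ?X * 1)"
        using top_gap_par(2)[OF X th, of ?v] n by (intro mult_left_mono) auto
      also have "\<dots> = (\<bar>a\<bar> * onorm ?X) * (c * q ^ wl (?g N))" by (simp only: ac_simps mult_1_right)
      also have "\<dots> \<le> (2 / \<beta>) * (c * (q ^ N / q ^ ?b))"
      proof (rule mult_mono[OF aX])
        have "N \<le> wl (?g N) + ?b" using P(7)[of "m N"] m(1)[of N] by linarith
        then show "c * q ^ wl (?g N) \<le> c * (q ^ N / q ^ ?b)" using cq by (intro mult_left_mono q_wl_le) auto
      qed (use cq \<beta> in auto)
      finally have "ldist h ?u \<le> 4 / \<beta> * (c / q ^ ?b) * q ^ N" using ldist_le_perp[OF n(2,5)] by simp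
      moreover have "ldist h (lim r) \<le> cst r * q ^ N"
      proof -
        have "ldist h (lim r) \<le> cst r * q ^ m N" using th by (intro lim(2)[OF r]) (auto simp: tops_def)
        also have "\<dots> \<le> cst r * q ^ N" using m(1) cq C_nonneg unfolding cst_def by (intro mult_left_mono power_decreasing) auto
        finally show ?thesis .
      qed
      ultimately show ?case using ldist_triangle[of ?u "lim r" h] ldist_commute[of h ?u] by (simp add: W_def distrib_right)
    qed
    show "(\<lambda>N. ldist (lim (\<lambda>n. ?g N \<otimes> y n)) (lim r)) \<longlonglongrightarrow> 0"
      by (rule tendsto_sandwich[OF always_eventually ev tendsto_const qpow_tendsto]) (simp add: ldist_nonneg)
  qed
  qed
qed

end

section \<open>Singular value decompositions\<close>

abbreviation std_frame :: "(nat \<Rightarrow> real^'n) \<Rightarrow> bool" where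
  "std_frame e \<equiv> orthonormal_frame (\<bullet>) e"

lemma std_frameD: "std_frame (e :: nat \<Rightarrow> real^'n) \<Longrightarrow> i \<in> {1..CARD('n)} \<Longrightarrow> j \<in> {1..CARD('n)} \<Longrightarrow> e i \<bullet> e j = (if i = j then 1 else 0)"
  by (simp add: orthonormal_frame_def)

lemma std_frame_expand:
  fixes e :: "nat \<Rightarrow> real^'n"
  assumes e: "std_frame e"
  shows "(\<Sum>i\<in>{1..CARD('n)}. (v \<bullet> e i) *\<^sub>R e i) = v"
proof -
  let ?I = "{1..CARD('n)}"
  have inj: "inj_on e ?I"
    by (rule inj_onI) (metis std_frameD[OF e] zero_neq_one)
  have po: "pairwise orthogonal (e ` ?I)"
    unfolding pairwise_def orthogonal_def using std_frameD[OF e] by (auto split: if_splits)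
  have n1: "norm x = 1" if "x \<in> e ` ?I" for x using that std_frameD[OF e] by (auto simp: norm_eq_1)
  then have "0 \<notin> e ` ?I" by fastforce
  then have ind: "independent (e ` ?I)" using po by (rule pairwise_orthogonal_independent[rotated])
  have "card (e ` ?I) = DIM(real^'n)" using card_image[OF inj] by simp
  then have sp: "v \<in> span (e ` ?I)" using ind
    by (metis UNIV_I card_ge_dim_independent[of "e ` ?I" UNIV] dim_UNIV order_refl subset_UNIV subsetD)
  have "(\<Sum>x\<in>e ` ?I. (v \<bullet> x) *\<^sub>R x) = v" by (rule orthonormal_basis_expand[OF po n1 sp]) auto
  then show ?thesis unfolding sum.reindex[OF inj] o_def .
qed

lemma std_frame_inner:
  fixes e :: "nat \<Rightarrow> real^'n"
  assumes e: "std_frame e"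
  shows "v \<bullet> w = (\<Sum>i\<in>{1..CARD('n)}. (v \<bullet> e i) * (w \<bullet> e i))"
proof -
  have "v \<bullet> w = (\<Sum>i\<in>{1..CARD('n)}. (v \<bullet> e i) *\<^sub>R e i) \<bullet> w" using std_frame_expand[OF e, of v] by simp
  also have "\<dots> = (\<Sum>i\<in>{1..CARD('n)}. (v \<bullet> e i) * (e i \<bullet> w))" unfolding inner_sum_left inner_scaleR_left ..
  finally show ?thesis by (simp only: inner_commute[of "e _" w])
qed

lemma std_frame_norm:
  fixes e :: "nat \<Rightarrow> real^'n"
  assumes "std_frame e"
  shows "(norm v)\<^sup>2 = (\<Sum>i\<in>{1..CARD('n)}. (v \<bullet> e i)\<^sup>2)"
  using std_frame_inner[OF assms, of v v] by (simp add: power2_norm_eq_inner) (simp add: power2_eq_square)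

abbreviation std_svd :: "real^'n^'n \<Rightarrow> (nat \<Rightarrow> real) \<Rightarrow> (nat \<Rightarrow> real^'n) \<Rightarrow> (nat \<Rightarrow> real^'n) \<Rightarrow> bool" where
  "std_svd \<equiv> is_svd (\<bullet>)"

lemma std_svdD:
  fixes A :: "real^'n^'n"
  assumes "std_svd A \<sigma> e f"
  shows "std_frame e" "std_frame f" "i \<in> {1..CARD('n)} \<Longrightarrow> 0 \<le> \<sigma> i" "i \<in> {1..CARD('n)} \<Longrightarrow> A *v e i = \<sigma> i *\<^sub>R f i"
    "i \<in> {1..CARD('n)} \<Longrightarrow> j \<in> {1..CARD('n)} \<Longrightarrow> i \<le> j \<Longrightarrow> \<sigma> j \<le> \<sigma> i"
  using assms unfolding is_svd_def by blast+

lemma std_svd_coeff: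
  fixes A :: "real^'n^'n"
  assumes s: "std_svd A \<sigma> e f" and i: "i \<in> {1..CARD('n)}"
  shows "(A *v v) \<bullet> f i = \<sigma> i * (v \<bullet> e i)"
proof -
  note D = std_svdD[OF s]
  have "A *v v = A *v (\<Sum>j\<in>{1..CARD('n)}. (v \<bullet> e j) *\<^sub>R e j)" using std_frame_expand[OF D(1), of v] by simp
  also have "\<dots> = (\<Sum>j\<in>{1..CARD('n)}. (v \<bullet> e j) *\<^sub>R (\<sigma> j *\<^sub>R f j))"
    unfolding linear_sum[OF matrix_vector_mul_linear] matrix_vector_mult_scaleR by (intro sum.cong refl) (simp only: D(4))
  finally have "(A *v v) \<bullet> f i = (\<Sum>j\<in>{1..CARD('n)}. (v \<bullet> e j) * (\<sigma> j * (f j \<bullet> f i)))" by (simp add: inner_sum_left mult.assoc)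
  also have "\<dots> = (\<Sum>j\<in>{1..CARD('n)}. if j = i then (v \<bullet> e j) * \<sigma> j else 0)"
  proof (rule sum.cong[OF refl])
    fix j assume j: "j \<in> {1..CARD('n)}"
    show "(v \<bullet> e j) * (\<sigma> j * (f j \<bullet> f i)) = (if j = i then (v \<bullet> e j) * \<sigma> j else 0)"
      using std_frameD[OF D(2) j i] by simp
  qed
  also have "\<dots> = \<sigma> i * (v \<bullet> e i)" using i by (simp add: sum.delta)
  finally show ?thesis .
qed

lemma std_svd_norm:
  fixes A :: "real^'n^'n"
  assumes s: "std_svd A \<sigma> e f"
  shows "(norm (A *v v))\<^sup>2 = (\<Sum>i\<in>{1..CARD('n)}. (\<sigma> i)\<^sup>2 * (v \<bullet> e i)\<^sup>2)"
  unfolding std_frame_norm[OF std_svdD(2)[OF s]]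
  by (intro sum.cong) (auto simp: std_svd_coeff[OF s] power_mult_distrib)

lemma std_svd_transpose:
  fixes A :: "real^'n^'n"
  assumes s: "std_svd A \<sigma> e f"
  shows "std_svd (transpose A) \<sigma> f e"
proof -
  note D = std_svdD[OF s]
  have "transpose A *v f i = \<sigma> i *\<^sub>R e i" if i: "i \<in> {1..CARD('n)}" for i
  proof (rule vector_eq_ldot[THEN iffD1], rule allI)
    fix v
    have "v \<bullet> (transpose A *v f i) = (A *v v) \<bullet> f i" by (simp add: dot_lmul_matrix[symmetric] inner_commute)
    then show "v \<bullet> (transpose A *v f i) = v \<bullet> (\<sigma> i *\<^sub>R e i)" using std_svd_coeff[OF s i, of v] by simp
  qed
  then show ?thesis using D unfolding is_svd_def by blast
qed

text \<open>The Courant-Fischer argument: some \<open>v \<noteq> 0\<close> is orthogonal to the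
  \<open>e j\<close> with j > i and to the \<open>e' j\<close> with j < i, which are at most d - 1
  vectors. On it \<open>A\<close> stretches by at least \<open>\<sigma> i\<close> and by at most
  \<open>\<sigma>' i\<close>.\<close>

lemma std_svd_unique_le:
  fixes A :: "real^'n^'n"
  assumes s: "std_svd A \<sigma> e f" and s': "std_svd A \<sigma>' e' f'" and i: "i \<in> {1..CARD('n)}"
  shows "\<sigma> i \<le> \<sigma>' i"
proof -
  let ?I = "{1..CARD('n)}"
  note D = std_svdD[OF s] and D' = std_svdD[OF s']
  let ?X = "e ` {Suc i..CARD('n)} \<union> e' ` {1..<i}"
  have "card ?X \<le> card (e ` {Suc i..CARD('n)}) + card (e' ` {1..<i})" by (rule card_Un_le)
  also have "\<dots> \<le> (CARD('n) - i) + (i - 1)"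
    using card_image_le[of "{Suc i..CARD('n)}" e] card_image_le[of "{1..<i}" e'] by simp
  also have "\<dots> < DIM(real^'n)" using i by simp
  finally have "dim ?X < DIM(real^'n)" using dim_le_card'[of ?X] by simp
  then obtain v where v: "v \<noteq> 0" "\<And>y. y \<in> span ?X \<Longrightarrow> orthogonal v y" using orthogonal_to_subspace_exists by blast
  have ve: "v \<bullet> e j = 0" if "j \<in> {Suc i..CARD('n)}" for j using v(2)[OF span_base, of "e j"] that by (auto simp: orthogonal_def)
  have ve': "v \<bullet> e' j = 0" if "j \<in> {1..<i}" for j using v(2)[OF span_base, of "e' j"] that by (auto simp: orthogonal_def)
  have "(\<sigma> i)\<^sup>2 * (norm v)\<^sup>2 = (\<Sum>j\<in>?I. (\<sigma> i)\<^sup>2 * (v \<bullet> e j)\<^sup>2)" by (simp add: std_frame_norm[OF D(1)] sum_distrib_left)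
  also have "\<dots> \<le> (\<Sum>j\<in>?I. (\<sigma> j)\<^sup>2 * (v \<bullet> e j)\<^sup>2)"
  proof (rule sum_mono)
    fix j assume j: "j \<in> ?I"
    show "(\<sigma> i)\<^sup>2 * (v \<bullet> e j)\<^sup>2 \<le> (\<sigma> j)\<^sup>2 * (v \<bullet> e j)\<^sup>2"
    proof (cases "j \<le> i")
      case True
      then show ?thesis using D(5)[OF j i] D(3)[OF i] by (intro mult_right_mono power_mono) auto
    qed (use ve j in auto)
  qed
  also have "\<dots> = (norm (A *v v))\<^sup>2" by (rule std_svd_norm[OF s, symmetric])
  also have "\<dots> = (\<Sum>j\<in>?I. (\<sigma>' j)\<^sup>2 * (v \<bullet> e' j)\<^sup>2)" by (rule std_svd_norm[OF s'])
  also have "\<dots> \<le> (\<Sum>j\<in>?I. (\<sigma>' i)\<^sup>2 * (v \<bullet> e' j)\<^sup>2)"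
  proof (rule sum_mono)
    fix j assume j: "j \<in> ?I"
    show "(\<sigma>' j)\<^sup>2 * (v \<bullet> e' j)\<^sup>2 \<le> (\<sigma>' i)\<^sup>2 * (v \<bullet> e' j)\<^sup>2"
    proof (cases "i \<le> j")
      case True
      then show ?thesis using D'(5)[OF i j] D'(3)[OF j] by (intro mult_right_mono power_mono) auto
    qed (use ve' j in auto)
  qed
  also have "\<dots> = (\<sigma>' i)\<^sup>2 * (norm v)\<^sup>2" by (simp add: std_frame_norm[OF D'(1)] sum_distrib_left)
  finally have "(\<sigma> i)\<^sup>2 \<le> (\<sigma>' i)\<^sup>2" using v(1) by simp
  then show ?thesis using D'(3)[OF i] by (rule power2_le_imp_le)
qed

lemma std_svd_unique:
  fixes A :: "real^'n^'n"
  assumes "std_svd A \<sigma> e f" "std_svd A \<sigma>' e' f'" "i \<in> {1..CARD('n)}"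
  shows "\<sigma> i = \<sigma>' i"
  using std_svd_unique_le[OF assms(1,2,3)] std_svd_unique_le[OF assms(2,1,3)] by simp

text \<open>The last property is the vanishing of the first variation at a maximiser: an inequality
  \<open>2 * t * a \<le> t\<^sup>2 * b\<close> for all \<open>t\<close> forces
  \<open>a = 0\<close>.\<close>

lemma matrix_unit_sphere_max:
  fixes A :: "real^'n^'n"
  assumes W: "subspace W" and w: "w \<in> W" "w \<noteq> 0"
  obtains x where "x \<in> W" "norm x = 1" "\<And>u. u \<in> W \<Longrightarrow> norm (A *v u) \<le> norm (A *v x) * norm u"
    "\<And>u. u \<in> W \<Longrightarrow> u \<bullet> x = 0 \<Longrightarrow> (A *v u) \<bullet> (A *v x) = 0"
proof -
  let ?K = "W \<inter> sphere 0 1"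
  have "compact ?K" by (intro closed_Int_compact closed_subspace W compact_sphere)
  moreover have "?K \<noteq> {}"
  proof -
    have "(1 / norm w) *\<^sub>R w \<in> ?K" using W w by (simp add: subspace_scale)
    then show ?thesis by blast
  qed
  moreover have "continuous_on ?K (\<lambda>x. norm (A *v x))" by (intro continuous_intros)
  ultimately obtain x where x: "x \<in> ?K" "\<And>y. y \<in> ?K \<Longrightarrow> norm (A *v y) \<le> norm (A *v x)"
    using continuous_attains_sup[of ?K "\<lambda>x. norm (A *v x)"] by blast
  have max: "norm (A *v u) \<le> norm (A *v x) * norm u" if u: "u \<in> W" for u
  proof (cases "u = 0")
    case False
    then have "(1 / norm u) *\<^sub>R u \<in> ?K" using W u by (simp add: subspace_scale)
    from x(2)[OF this] have "norm (A *v u) / norm u \<le> norm (A *v x)" by (simp add: matrix_vector_mult_scaleR)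
    then show ?thesis using False by (simp add: divide_le_eq)
  qed simp
  show ?thesis
  proof (rule that[OF _ _ max])
    show "x \<in> W" "norm x = 1" using x by auto
    fix u assume u: "u \<in> W" "u \<bullet> x = 0"
    let ?a = "(A *v u) \<bullet> (A *v x)" and ?s = "(norm (A *v x))\<^sup>2" and ?U = "(norm u)\<^sup>2"
    have q: "2 * t * ?a \<le> t\<^sup>2 * (?s * ?U)" for t
    proof -
      have "x + t *\<^sub>R u \<in> W" using W u x by (simp add: subspace_add subspace_scale)
      from max[OF this] have "(norm (A *v (x + t *\<^sub>R u)))\<^sup>2 \<le> (norm (A *v x) * norm (x + t *\<^sub>R u))\<^sup>2"
        by (rule power_mono) simp
      moreover have "(norm (x + t *\<^sub>R u))\<^sup>2 = 1 + t\<^sup>2 * ?U"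
        using x(1) u(2) unfolding power2_norm_eq_inner by (simp add: inner_add_left inner_add_right inner_commute power2_eq_square norm_eq_1)
      moreover have "(norm (A *v (x + t *\<^sub>R u)))\<^sup>2 = ?s + 2 * t * ?a + t\<^sup>2 * (norm (A *v u))\<^sup>2"
        unfolding power2_norm_eq_inner
        by (simp add: matrix_vector_right_distrib matrix_vector_mult_scaleR inner_add_left inner_add_right inner_commute power2_eq_square algebra_simps)
      ultimately have "?s + 2 * t * ?a + t\<^sup>2 * (norm (A *v u))\<^sup>2 \<le> ?s * (1 + t\<^sup>2 * ?U)" by (simp add: power_mult_distrib)
      moreover have "0 \<le> t\<^sup>2 * (norm (A *v u))\<^sup>2" by simp
      ultimately have "2 * t * ?a \<le> ?s * (1 + t\<^sup>2 * ?U) - ?s" by linarith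
      then show ?thesis by (simp add: algebra_simps)
    qed
    show "?a = 0"
    proof (rule ccontr)
      assume a: "?a \<noteq> 0"
      \<comment> \<open>The summand 1 makes \<open>b\<close> positive, so that
        \<open>t = ?a / b\<close> can be tested.\<close>
      define b where "b = ?s * ?U + 1"
      have b: "0 < b" unfolding b_def by (intro add_nonneg_pos mult_nonneg_nonneg) auto
      have "2 * (?a / b) * ?a \<le> (?a / b)\<^sup>2 * (?s * ?U)" by (rule q)
      also have "\<dots> \<le> (?a / b)\<^sup>2 * b" unfolding b_def by (intro mult_left_mono) auto
      also have "\<dots> = ?a\<^sup>2 / b" using b by (simp add: power2_eq_square)
      finally have "2 * (?a\<^sup>2 / b) \<le> ?a\<^sup>2 / b" by (simp add: power2_eq_square)
      moreover have "0 < ?a\<^sup>2 / b" using a b by simp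
      ultimately show False by simp
    qed
  qed
qed

text \<open>The right singular vectors are chosen greedily, each maximising
  \<open>norm (A *v x)\<close> on the complement of its predecessors. Invertibility makes all
  stretches positive, so the left vectors are obtained by division.\<close>

lemma std_svd_exists:
  fixes A :: "real^'n^'n"
  assumes A: "invertible A"
  obtains \<sigma> e f where "std_svd A \<sigma> e f"
proof -
  let ?d = "CARD('n)"
  define P where "P k e \<longleftrightarrow> (\<forall>i\<in>{1..k}. \<forall>j\<in>{1..k}. e i \<bullet> e j = (if i = j then 1 else 0)) \<and>
     (\<forall>i\<in>{1..k}. \<forall>w. (\<forall>j\<in>{1..i}. w \<bullet> e j = 0) \<longrightarrow> (A *v w) \<bullet> (A *v e i) = 0) \<and>
     (\<forall>i\<in>{1..k}. \<forall>w. (\<forall>j\<in>{1..<i}. w \<bullet> e j = 0) \<longrightarrow> norm (A *v w) \<le> norm (A *v e i) * norm w)" for k and e :: "nat \<Rightarrow> real^'n"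
  have "\<exists>e. P k e" if "k \<le> ?d" for k
    using that
  proof (induction k)
    case 0
    show ?case by (simp add: P_def)
  next
    case (Suc k)
    then obtain e where e: "P k e" by auto
    have "dim (e ` {1..k}) < DIM(real^'n)"
      using dim_le_card'[of "e ` {1..k}"] card_image_le[of "{1..k}" e] Suc.prems by simp
    then obtain w where w: "w \<noteq> 0" "\<And>y. y \<in> span (e ` {1..k}) \<Longrightarrow> orthogonal w y" using orthogonal_to_subspace_exists by blast
    define W where "W = {u. \<forall>j\<in>{1..k}. u \<bullet> e j = 0}"
    have W: "subspace W" by (auto simp: W_def subspace_def inner_add_left)
    have wW: "w \<in> W" using w(2) by (auto simp: W_def orthogonal_def intro: span_base)
    show ?case
    proof (rule matrix_unit_sphere_max[OF W wW w(1), of A])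
      fix x assume x: "x \<in> W" "norm x = 1" "\<And>u. u \<in> W \<Longrightarrow> norm (A *v u) \<le> norm (A *v x) * norm u"
        "\<And>u. u \<in> W \<Longrightarrow> u \<bullet> x = 0 \<Longrightarrow> (A *v u) \<bullet> (A *v x) = 0"
      let ?e = "e(Suc k := x)"
      have eq: "?e i = e i" if "i \<in> {1..k}" for i using that by auto
      have xe: "x \<bullet> e i = 0" "e i \<bullet> x = 0" if "i \<in> {1..k}" for i using x(1) that by (auto simp: W_def inner_commute)
      have xx: "x \<bullet> x = 1" using x(2) by (simp add: norm_eq_1)
      have I: "{1..Suc k} = insert (Suc k) {1..k}" by auto
      have "P (Suc k) ?e"
        unfolding P_def
      proof (intro conjI ballI allI impI)
        fix i j assume ij: "i \<in> {1..Suc k}" "j \<in> {1..Suc k}"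
        show "?e i \<bullet> ?e j = (if i = j then 1 else 0)"
          using ij e xe xx unfolding I P_def by auto
      next
        fix i w assume i: "i \<in> {1..Suc k}" and w: "\<forall>j\<in>{1..i}. w \<bullet> ?e j = 0"
        show "(A *v w) \<bullet> (A *v ?e i) = 0"
        proof (cases "i = Suc k")
          case True
          have "w \<bullet> e j = 0" if "j \<in> {1..k}" for j using w[rule_format, of j] eq[OF that] True that by simp
          moreover have "w \<bullet> x = 0" using w[rule_format, of "Suc k"] True by simp
          ultimately have "w \<in> W" "w \<bullet> x = 0" by (auto simp: W_def)
          then show ?thesis using x(4) True by simp
        next
          case False
          then have i: "i \<in> {1..k}" using i by simp
          have "\<forall>j\<in>{1..i}. w \<bullet> e j = 0" using w i by auto
          then show ?thesis using e i by (auto simp: P_def)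
        qed
      next
        fix i w assume i: "i \<in> {1..Suc k}" and w: "\<forall>j\<in>{1..<i}. w \<bullet> ?e j = 0"
        show "norm (A *v w) \<le> norm (A *v ?e i) * norm w"
        proof (cases "i = Suc k")
          case True
          have "w \<bullet> e j = 0" if "j \<in> {1..k}" for j using w[rule_format, of j] eq[OF that] True that by simp
          then have "w \<in> W" by (auto simp: W_def)
          then show ?thesis using x(3) True by simp
        next
          case False
          then have i: "i \<in> {1..k}" using i by simp
          have "\<forall>j\<in>{1..<i}. w \<bullet> e j = 0" using w i by auto
          then show ?thesis using e i by (auto simp: P_def)
        qed
      qed
      then show ?thesis by blast
    qed
  qed
  then obtain e where e: "P ?d e" by blast
  define \<sigma> where "\<sigma> i = norm (A *v e i)" for i
  define f where "f i = (1 / \<sigma> i) *\<^sub>R (A *v e i)" for i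
  have fr: "e i \<bullet> e j = (if i = j then 1 else 0)" if "i \<in> {1..?d}" "j \<in> {1..?d}" for i j using e that by (auto simp: P_def)
  have s0: "0 < \<sigma> i" if i: "i \<in> {1..?d}" for i
  proof -
    have "e i \<noteq> 0" using fr[OF i i] by auto
    then have "A *v e i \<noteq> 0" using A by (metis invertible_def matrix_left_invertible_ker)
    then show ?thesis by (simp add: \<sigma>_def)
  qed
  have Ao: "(A *v e i) \<bullet> (A *v e j) = 0" if ij: "i \<in> {1..?d}" "j \<in> {1..?d}" "j < i" for i j
  proof -
    have "\<forall>l\<in>{1..j}. e i \<bullet> e l = 0" using fr ij by auto
    then show ?thesis using e ij(2) unfolding P_def by blast
  qed
  have "f i \<bullet> f j = (if i = j then 1 else 0)" if ij: "i \<in> {1..?d}" "j \<in> {1..?d}" for i j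
  proof (cases "i = j")
    case True
    have "(A *v e i) \<bullet> (A *v e i) = \<sigma> i * \<sigma> i" by (simp add: \<sigma>_def dot_square_norm power2_eq_square)
    then show ?thesis using True s0[OF ij(1)] by (simp add: f_def)
  next
    case False
    then consider "j < i" | "i < j" by linarith
    then have "(A *v e i) \<bullet> (A *v e j) = 0" using Ao[OF ij] Ao[OF ij(2,1)] inner_commute[of "A *v e i" "A *v e j"] by cases simp_all
    then show ?thesis using False by (simp add: f_def)
  qed
  moreover have "\<sigma> j \<le> \<sigma> i" if ij: "i \<in> {1..?d}" "j \<in> {1..?d}" "i \<le> j" for i j
  proof -
    have "\<forall>l\<in>{1..<i}. e j \<bullet> e l = 0" using fr ij by auto
    then have "norm (A *v e j) \<le> norm (A *v e i) * norm (e j)" using e ij(1) unfolding P_def by blast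
    moreover have "norm (e j) = 1" using fr[OF ij(2,2)] by (simp add: norm_eq_1)
    ultimately show ?thesis by (simp add: \<sigma>_def)
  qed
  moreover have "0 \<le> \<sigma> i \<and> A *v e i = \<sigma> i *\<^sub>R f i" if "i \<in> {1..?d}" for i
    using s0[OF that] by (simp add: f_def)
  ultimately have "std_svd A \<sigma> e f" using fr unfolding is_svd_def orthonormal_frame_def by blast
  then show ?thesis by (rule that)
qed

text \<open>Gram-Schmidt for \<open>B\<close>: the columns of \<open>M\<close> form a basis
  orthonormal for \<open>B\<close>, and \<open>T\<close> is the inverse of \<open>M\<close>.\<close>

lemma inner_product_matrix:
  fixes B :: "real^'n \<Rightarrow> real^'n \<Rightarrow> real"
  assumes B: "inner_product B"
  obtains T T' :: "real^'n^'n" where "T ** T' = mat 1" "T' ** T = mat 1" "\<And>u v. B u v = (T *v u) \<bullet> (T *v v)"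
proof -
  let ?d = "CARD('n)"
  have bil: "linear (B u)" "linear (\<lambda>v. B v u)" and sym: "B u v = B v u" and pos: "v \<noteq> 0 \<Longrightarrow> 0 < B v v" for u v
    using B by (auto simp: inner_product_def bilinear_def)
  have sc: "B (a *\<^sub>R u) v = a * B u v" "B u (a *\<^sub>R v) = a * B u v" for a u v
  proof -
    have "B (a *\<^sub>R u) v = a *\<^sub>R B u v" "B u (a *\<^sub>R v) = a *\<^sub>R B u v"
      by (rule linear_scale[OF bil(2)], rule linear_scale[OF bil(1)])
    then show "B (a *\<^sub>R u) v = a * B u v" "B u (a *\<^sub>R v) = a * B u v" by simp_all
  qed
  have su: "B (\<Sum>i\<in>UNIV. f i) v = (\<Sum>i\<in>UNIV. B (f i) v)" "B v (\<Sum>i\<in>UNIV. f i) = (\<Sum>i\<in>UNIV. B v (f i))" for f :: "'n \<Rightarrow> real^'n" and v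
    by (rule linear_sum[OF bil(2)], rule linear_sum[OF bil(1)])
  have "\<exists>b. \<forall>i<k. \<forall>j<k. B (b i) (b j) = (if i = j then 1 else 0)" if "k \<le> ?d" for k :: nat
    using that
  proof (induction k)
    case 0 show ?case by simp
  next
    case (Suc k)
    then obtain b where b: "\<And>i j. i < k \<Longrightarrow> j < k \<Longrightarrow> B (b i) (b j) = (if i = j then 1 else 0)" by auto
    \<comment> \<open>The standard inner product with \<open>?m i\<close> is the functional
      \<open>B (b i)\<close>, so that orthogonality with respect to \<open>B\<close> becomes
      ordinary orthogonality.\<close>
    let ?m = "\<lambda>i. adjoint (B (b i)) 1"
    have m: "B (b i) v = v \<bullet> ?m i" for i v using adjoint_works[OF bil(1), of v "b i" 1] by simp
    have "dim (?m ` {..<k}) < DIM(real^'n)"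
      using dim_le_card'[of "?m ` {..<k}"] card_image_le[of "{..<k}" ?m] Suc.prems by simp
    then obtain w where w: "w \<noteq> 0" "\<And>y. y \<in> span (?m ` {..<k}) \<Longrightarrow> orthogonal w y" using orthogonal_to_subspace_exists by blast
    have w0: "B (b i) w = 0" if "i < k" for i
    proof -
      have "orthogonal w (?m i)" using that by (intro w(2) span_base) auto
      then have "w \<bullet> ?m i = 0" unfolding orthogonal_def .
      with m[of i w] show ?thesis by (rule trans)
    qed
    define x where "x = (1 / sqrt (B w w)) *\<^sub>R w"
    have "B x x = (1 / sqrt (B w w)) * ((1 / sqrt (B w w)) * B w w)"
      unfolding x_def sc ..
    also have "\<dots> = 1"
    proof -
      have gen: "1 / s * (1 / s * c) = 1" if "s * s = c" "c \<noteq> 0" for s c :: real using that by auto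
      have "sqrt (B w w) * sqrt (B w w) = B w w" using pos[OF w(1)] by simp
      then show ?thesis by (rule gen) (use pos[OF w(1)] in simp)
    qed
    finally have xx: "B x x = 1" .
    have x0: "B (b i) x = 0" "B x (b i) = 0" if "i < k" for i
      using w0[OF that] sym[of x "b i"] unfolding x_def sc by simp_all
    show ?case
      by (intro exI[of _ "b(k := x)"]) (use b xx x0 in \<open>auto simp: less_Suc_eq\<close>)
  qed
  then obtain b where b: "\<And>i j. i < ?d \<Longrightarrow> j < ?d \<Longrightarrow> B (b i) (b j) = (if i = j then 1 else 0)" by blast
  obtain idx where idx: "bij_betw idx (UNIV :: 'n set) {..<?d}"
    using ex_bij_betw_finite_nat[of "UNIV :: 'n set"] by (auto simp: atLeast0LessThan)
  have id: "idx i < ?d" for i using bij_betwE[OF idx] by blast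
  have inj: "idx i = idx j \<longleftrightarrow> i = j" for i j using bij_betw_imp_inj_on[OF idx] by (auto dest: injD)
  define M :: "real^'n^'n" where "M = (\<chi> r i. b (idx i) $ r)"
  have Mv: "M *v x = (\<Sum>i\<in>UNIV. x $ i *\<^sub>R b (idx i))" for x
    by (simp add: M_def matrix_vector_mult_def vec_eq_iff mult.commute)
  have BM: "B (M *v x) (M *v y) = x \<bullet> y" for x y
  proof -
    have "B (M *v x) (M *v y) = (\<Sum>i\<in>UNIV. x $ i * (\<Sum>j\<in>UNIV. y $ j * B (b (idx i)) (b (idx j))))"
    proof -
      have a: "B u (M *v y) = (\<Sum>j\<in>UNIV. y $ j * B u (b (idx j)))" for u
        unfolding Mv by (simp only: su(2) sc(2))
      have "B (M *v x) u = (\<Sum>i\<in>UNIV. x $ i * B (b (idx i)) u)" for u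
        unfolding Mv by (simp only: su(1) sc(1))
      from this[of "M *v y"] show ?thesis by (simp only: a[of "b _"])
    qed
    also have "\<dots> = (\<Sum>i\<in>UNIV. x $ i * (\<Sum>j\<in>UNIV. if j = i then y $ j else 0))"
      by (intro sum.cong refl) (simp add: b id inj if_distrib eq_commute cong: if_cong sum.cong)
    also have "\<dots> = x \<bullet> y" by (simp add: inner_vec_def)
    finally show ?thesis .
  qed
  have "inj ((*v) M)"
  proof (rule linear_injective_0[OF matrix_vector_mul_linear, THEN iffD2], intro allI impI)
    fix x assume "M *v x = 0"
    then have "x \<bullet> x = B 0 0" using BM[of x x] by simp
    then show "x = 0" using linear_0[OF bil(1), of 0] by simp
  qed
  then obtain T where T: "T ** M = mat 1" using matrix_left_invertible_injective by blast
  then have MT: "M ** T = mat 1" using matrix_left_right_inverse by blast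
  show ?thesis
  proof (rule that[OF T MT])
    fix u v
    have "M *v (T *v u) = u" "M *v (T *v v) = v" by (simp_all add: matrix_vector_mul_assoc MT)
    then show "B u v = (T *v u) \<bullet> (T *v v)" using BM[of "T *v u" "T *v v"] by simp
  qed
qed

lemma is_svd_conjugate:
  fixes T T' A :: "real^'n^'n"
  assumes T: "T ** T' = mat 1" "T' ** T = mat 1" and B: "\<And>u v. B u v = (T *v u) \<bullet> (T *v v)"
  shows "is_svd B A \<sigma> e f \<longleftrightarrow> std_svd (T ** A ** T') \<sigma> (\<lambda>i. T *v e i) (\<lambda>i. T *v f i)"
proof -
  have TT: "T' *v (T *v v) = v" for v by (simp add: matrix_vector_mul_assoc T)
  have i: "T *v u = T *v v \<longleftrightarrow> u = v" for u v by (metis TT)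
  have "(T ** A ** T') *v (T *v e j) = \<sigma> j *\<^sub>R (T *v f j) \<longleftrightarrow> A *v e j = \<sigma> j *\<^sub>R f j" for j
    unfolding matrix_vector_mul_assoc[symmetric] TT matrix_vector_mult_scaleR[symmetric] i ..
  then show ?thesis by (simp add: is_svd_def orthonormal_frame_def B)
qed

lemma std_svd_onorm:
  fixes A :: "real^'n^'n"
  assumes s: "std_svd A \<sigma> e f"
  shows "onorm ((*v) A) = \<sigma> 1"
proof (rule antisym)
  have d: "1 \<in> {1..CARD('n)}" using zero_less_card_finite[where 'a = 'n] by (simp add: Suc_leI)
  note D = std_svdD[OF s]
  show "onorm ((*v) A) \<le> \<sigma> 1"
  proof (rule onorm_le)
    fix v
    have "(norm (A *v v))\<^sup>2 \<le> (\<Sum>i\<in>{1..CARD('n)}. (\<sigma> 1)\<^sup>2 * (v \<bullet> e i)\<^sup>2)"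
      unfolding std_svd_norm[OF s] using D(3) D(5)[OF d] by (intro sum_mono mult_right_mono power_mono) auto
    also have "\<dots> = (\<sigma> 1 * norm v)\<^sup>2" by (simp add: std_frame_norm[OF D(1)] sum_distrib_left power_mult_distrib)
    finally show "norm (A *v v) \<le> \<sigma> 1 * norm v" by (rule power2_le_imp_le) (use D(3)[OF d] in simp)
  qed
  have "norm (e 1) = 1" "norm (f 1) = 1" using std_frameD[OF D(1) d d] std_frameD[OF D(2) d d] by (auto simp: norm_eq_1)
  then show "\<sigma> 1 \<le> onorm ((*v) A)"
    using onorm_bound[OF matrix_vector_mul_linear, of A "e 1"] D(4)[OF d] D(3)[OF d] by simp
qed

lemma std_svd_pos:
  fixes A :: "real^'n^'n"
  assumes s: "std_svd A \<sigma> e f" and A: "invertible A" and i: "i \<in> {1..CARD('n)}"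
  shows "0 < \<sigma> i"
proof -
  note D = std_svdD[OF s]
  have "e i \<noteq> 0" using std_frameD[OF D(1) i i] by auto
  then have "A *v e i \<noteq> 0" using A by (metis invertible_def matrix_left_invertible_ker)
  then show ?thesis using D(3,4)[OF i] by (cases "\<sigma> i = 0") auto
qed

lemma std_svd_top_gap:
  fixes A :: "real^'n^'n"
  assumes s: "std_svd A \<sigma> e f" and A: "invertible A" and d: "2 \<le> CARD('n)"
  shows "top_gap ((*v) A) (e 1) (f 1) (\<sigma> 2 / \<sigma> 1)"
proof -
  have d12: "1 \<in> {1..CARD('n)}" "2 \<in> {1..CARD('n)}" using d by auto
  note D = std_svdD[OF s]
  have p: "0 < \<sigma> 1" "0 < \<sigma> 2" using std_svd_pos[OF s A] d12 by auto
  have n: "norm (e 1) = 1" "norm (f 1) = 1" using std_frameD[OF D(1) d12(1,1)] std_frameD[OF D(2) d12(1,1)] by (auto simp: norm_eq_1)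
  have "norm (A *v w) \<le> \<sigma> 2 * norm w" if w: "w \<bullet> e 1 = 0" for w
  proof (rule power2_le_imp_le)
    have "(norm (A *v w))\<^sup>2 \<le> (\<Sum>i\<in>{1..CARD('n)}. (\<sigma> 2)\<^sup>2 * (w \<bullet> e i)\<^sup>2)"
      unfolding std_svd_norm[OF s]
    proof (rule sum_mono)
      fix i assume i: "i \<in> {1..CARD('n)}"
      show "(\<sigma> i)\<^sup>2 * (w \<bullet> e i)\<^sup>2 \<le> (\<sigma> 2)\<^sup>2 * (w \<bullet> e i)\<^sup>2"
      proof (cases "i = 1")
        case False
        then have "\<sigma> i \<le> \<sigma> 2" using D(5)[OF d12(2) i] i by simp
        then show ?thesis using D(3)[OF i] by (intro mult_right_mono power_mono) auto
      qed (use w in simp)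
    qed
    also have "\<dots> = (\<sigma> 2 * norm w)\<^sup>2" by (simp add: std_frame_norm[OF D(1)] sum_distrib_left power_mult_distrib)
    finally show "(norm (A *v w))\<^sup>2 \<le> (\<sigma> 2 * norm w)\<^sup>2" .
  qed (use p in simp)
  then show ?thesis
    unfolding top_gap_def std_svd_onorm[OF s] using n p D(4)[OF d12(1)] std_svd_coeff[OF s d12(1)] by simp
qed

lemma std_svd_inverse:
  fixes A M :: "real^'n^'n"
  assumes s: "std_svd A \<sigma> e f" and A: "invertible A" and M: "M ** A = c *\<^sub>R mat 1" and c: "c \<noteq> 0"
  defines "r \<equiv> \<lambda>i. CARD('n) + 1 - i"
  shows "std_svd M (\<lambda>i. \<bar>c\<bar> / \<sigma> (r i)) (\<lambda>i. f (r i)) (\<lambda>i. sgn c *\<^sub>R e (r i))"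
proof -
  let ?I = "{1..CARD('n)}"
  note D = std_svdD[OF s]
  have r: "r i \<in> ?I" if "i \<in> ?I" for i using that by (auto simp: r_def)
  have ri: "r i = r j \<longleftrightarrow> i = j" if "i \<in> ?I" "j \<in> ?I" for i j using that by (auto simp: r_def)
  have p: "0 < \<sigma> i" if "i \<in> ?I" for i by (rule std_svd_pos[OF s A that])
  have Mf: "M *v f i = (c / \<sigma> i) *\<^sub>R e i" if i: "i \<in> ?I" for i
  proof -
    have "\<sigma> i *\<^sub>R (M *v f i) = M *v (A *v e i)" using D(4)[OF i] by (simp add: matrix_vector_mult_scaleR)
    also have "\<dots> = c *\<^sub>R e i" by (simp add: matrix_vector_mul_assoc M scaleR_matrix_vector_assoc[symmetric])
    finally have "(1 / \<sigma> i) *\<^sub>R (\<sigma> i *\<^sub>R (M *v f i)) = (1 / \<sigma> i) *\<^sub>R (c *\<^sub>R e i)" by simp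
    then show ?thesis using p[OF i] by simp
  qed
  have "M *v f (r i) = (\<bar>c\<bar> / \<sigma> (r i)) *\<^sub>R (sgn c *\<^sub>R e (r i))" if "i \<in> ?I" for i
    using Mf[OF r[OF that]] c by (simp add: sgn_if)
  moreover have "\<bar>c\<bar> / \<sigma> (r j) \<le> \<bar>c\<bar> / \<sigma> (r i)" if ij: "i \<in> ?I" "j \<in> ?I" "i \<le> j" for i j
  proof -
    have "r j \<le> r i" unfolding r_def using ij(3) by (rule diff_le_mono2)
    then have "\<sigma> (r i) \<le> \<sigma> (r j)" using D(5) r ij by blast
    then show ?thesis using p[OF r[OF ij(1)]] by (intro divide_left_mono) (auto intro: mult_pos_pos p r ij)
  qed
  moreover have "sgn c * sgn c = 1" using c by (simp add: sgn_if)
  ultimately show ?thesis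
    unfolding is_svd_def orthonormal_frame_def using std_frameD[OF D(1) r r] std_frameD[OF D(2) r r] ri p r
    by (auto simp: less_imp_le mult.assoc[symmetric])
qed

section \<open>Exterior squares\<close>

text \<open>Bivectors are skew-symmetric matrices, on which \<open>A\<close> acts by \<open>A ** M ** transpose A\<close>. To have a
  Euclidean space as a type, this action is extended by \<open>0\<close> on symmetric matrices.\<close>

definition wedge :: "real^'n \<Rightarrow> real^'n \<Rightarrow> real^'n^'n" where
  "wedge u v = (\<chi> i j. u $ i * v $ j - v $ i * u $ j)"

definition skew :: "real^'n^'n \<Rightarrow> real^'n^'n" where
  "skew M = (1/2) *\<^sub>R (M - transpose M)"

definition Lam :: "real^'n^'n \<Rightarrow> real^'n^'n \<Rightarrow> real^'n^'n" where
  "Lam A M = A ** skew M ** transpose A"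

lemma wedge_mult: "wedge u v *v w = (v \<bullet> w) *\<^sub>R u - (u \<bullet> w) *\<^sub>R v"
proof (rule vec_eq_iff[THEN iffD2], rule allI)
  fix i
  have "(wedge u v *v w) $ i = (\<Sum>j\<in>UNIV. (u $ i * v $ j - v $ i * u $ j) * w $ j)"
    by (simp add: wedge_def matrix_vector_mult_def)
  also have "\<dots> = (\<Sum>j\<in>UNIV. u $ i * (v $ j * w $ j)) - (\<Sum>j\<in>UNIV. v $ i * (u $ j * w $ j))"
    by (simp add: left_diff_distrib sum_subtractf mult.assoc)
  also have "\<dots> = u $ i * (v \<bullet> w) - v $ i * (u \<bullet> w)" by (simp add: inner_vec_def sum_distrib_left)
  finally show "(wedge u v *v w) $ i = ((v \<bullet> w) *\<^sub>R u - (u \<bullet> w) *\<^sub>R v) $ i" by (simp add: mult.commute)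
qed

lemma transpose_wedge: "transpose (wedge u v) = - wedge u v"
  by (simp add: wedge_def transpose_def vec_eq_iff mult.commute)

lemma transpose_skew: "transpose (skew M) = - skew M"
  by (simp add: skew_def transpose_def vec_eq_iff diff_divide_distrib)

lemma skew_of_skew: "transpose M = - M \<Longrightarrow> skew M = M"
  by (simp add: skew_def)

lemma transpose_Lam: "transpose (Lam A M) = - Lam A M"
proof -
  have "transpose (Lam A M) = A ** (transpose (skew M) ** transpose A)"
    by (simp add: Lam_def matrix_transpose_mul transpose_transpose)
  also have "\<dots> = A ** ((- skew M) ** transpose A)" by (simp only: transpose_skew)
  also have "\<dots> = - Lam A M"
    unfolding Lam_def matrix_mul_assoc by (simp add: matrix_matrix_mult_def vec_eq_iff sum_negf)
  finally show ?thesis .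
qed

lemma linear_skew: "linear skew"
  by (rule linearI) (simp_all add: skew_def transpose_def vec_eq_iff algebra_simps)

lemma matrix_add_rdistrib': "((A :: real^'n^'n) + B) ** C = A ** C + B ** C"
  by (simp add: matrix_matrix_mult_def vec_eq_iff distrib_right sum.distrib)

lemma uminus_matrix_vector: "(- (M :: real^'n^'n)) *v v = - (M *v v)"
  by (simp add: matrix_vector_mult_def vec_eq_iff sum_negf)

lemma linear_Lam: "linear (Lam A)"
  by (rule linearI)
    (simp_all add: Lam_def linear_add[OF linear_skew] linear_scale[OF linear_skew] matrix_add_ldistrib
      matrix_mul_assoc scalar_matrix_assoc matrix_scalar_ac matrix_add_rdistrib' flip: scalar_matrix_assoc)

text \<open>Images under \<open>Lam B\<close> are skew, and there \<open>skew\<close> is the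
  identity. In contrast, \<open>Lam (mat 1)\<close> is the projection \<open>skew\<close>, which is
  why gap systems ask for cancellation only next to another operator.\<close>

lemma Lam_mult: "Lam (A ** B) M = Lam A (Lam B M)"
  unfolding Lam_def[of A "Lam B M"] skew_of_skew[OF transpose_Lam]
  by (simp add: Lam_def matrix_transpose_mul matrix_mul_assoc)

lemma matrix_eqI: "(\<And>v. A *v v = (B :: real^'n^'m) *v v) \<Longrightarrow> A = B"
  by (simp add: matrix_eq)

lemma Lam_scale: "Lam (c *\<^sub>R A) M = (c\<^sup>2) *\<^sub>R Lam A M"
  by (simp add: Lam_def transpose_scalar matrix_scalar_ac power2_eq_square flip: scalar_matrix_assoc)

lemma inner_transpose_move: "(transpose (A :: real^'n^'n) *v u) \<bullet> v = u \<bullet> (A *v v)"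
  by (metis dot_lmul_matrix transpose_transpose vector_transpose_matrix)

lemma mult_wedge:
  fixes A :: "real^'n^'n"
  shows "A ** wedge u v ** transpose A = wedge (A *v u) (A *v v)"
proof (rule matrix_eqI)
  fix w
  have a: "v \<bullet> (transpose A *v w) = (A *v v) \<bullet> w" for v using inner_transpose_move[of A w v] by (simp add: inner_commute)
  show "(A ** wedge u v ** transpose A) *v w = wedge (A *v u) (A *v v) *v w"
    unfolding matrix_vector_mul_assoc[symmetric] wedge_mult a
    by (simp add: matrix_vector_mult_diff_distrib matrix_vector_mult_scaleR)
qed

lemma matrix_inner_frame:
  fixes X Y :: "real^'n^'n"
  assumes f: "std_frame f"
  shows "X \<bullet> Y = (\<Sum>j\<in>{1..CARD('n)}. \<Sum>i\<in>{1..CARD('n)}. ((X *v f j) \<bullet> f i) * ((Y *v f j) \<bullet> f i))"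
proof -
  have "X \<bullet> Y = (\<Sum>a\<in>UNIV. X $ a \<bullet> Y $ a)" by (simp add: inner_vec_def)
  also have "\<dots> = (\<Sum>a\<in>UNIV. \<Sum>j\<in>{1..CARD('n)}. (X $ a \<bullet> f j) * (Y $ a \<bullet> f j))"
    by (intro sum.cong refl std_frame_inner[OF f])
  also have "\<dots> = (\<Sum>j\<in>{1..CARD('n)}. \<Sum>a\<in>UNIV. (X $ a \<bullet> f j) * (Y $ a \<bullet> f j))" by (rule sum.swap)
  also have "\<dots> = (\<Sum>j\<in>{1..CARD('n)}. (X *v f j) \<bullet> (Y *v f j))"
    by (intro sum.cong refl) (simp add: inner_vec_def[of "X *v _"] matrix_vector_mul_component)
  also have "\<dots> = (\<Sum>j\<in>{1..CARD('n)}. \<Sum>i\<in>{1..CARD('n)}. ((X *v f j) \<bullet> f i) * ((Y *v f j) \<bullet> f i))"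
    by (intro sum.cong refl std_frame_inner[OF f])
  finally show ?thesis .
qed

lemma matrix_norm_frame:
  fixes X :: "real^'n^'n"
  assumes f: "std_frame f"
  shows "(norm X)\<^sup>2 = (\<Sum>j\<in>{1..CARD('n)}. \<Sum>i\<in>{1..CARD('n)}. ((X *v f j) \<bullet> f i)\<^sup>2)"
  by (simp only: power2_norm_eq_inner matrix_inner_frame[OF f, of X X]) (simp only: power2_eq_square)

lemma norm_transpose: "norm (transpose M) = norm (M :: real^'n^'n)"
proof -
  have "transpose M \<bullet> transpose M = M \<bullet> M"
    unfolding inner_vec_def transpose_def by (simp add: inner_real_def) (rule sum.swap)
  then show ?thesis by (simp add: norm_eq_sqrt_inner)
qed

lemma norm_skew_le: "norm (skew M) \<le> norm (M :: real^'n^'n)"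
proof -
  have "norm (skew M) = (1/2) * norm (M - transpose M)" unfolding skew_def by simp
  also have "\<dots> \<le> (1/2) * (norm M + norm (transpose M))"
    by (intro mult_left_mono norm_triangle_ineq4) simp
  finally show ?thesis by (simp add: norm_transpose)
qed

lemma skew_swap: "transpose M = - M \<Longrightarrow> (M *v u) \<bullet> v = - ((M *v v) \<bullet> (u :: real^'n))"
  using inner_transpose_move[of M v u] by (simp add: uminus_matrix_vector inner_commute)

lemma inner_wedge:
  fixes M :: "real^'n^'n"
  shows "M \<bullet> wedge u v = 2 * ((skew M *v v) \<bullet> u)"
proof -
  have s: "(\<Sum>a\<in>UNIV. \<Sum>b\<in>UNIV. M $ a $ b * (x $ a * y $ b)) = (M *v y) \<bullet> x" for x y :: "real^'n"
    by (simp add: inner_vec_def matrix_vector_mult_def sum_distrib_left sum_distrib_right mult.assoc mult.commute mult.left_commute)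
  have "M \<bullet> wedge u v = (\<Sum>a\<in>UNIV. \<Sum>b\<in>UNIV. M $ a $ b * (u $ a * v $ b - v $ a * u $ b))"
    by (simp add: inner_vec_def wedge_def)
  also have "\<dots> = (M *v v) \<bullet> u - (M *v u) \<bullet> v"
    unfolding s[symmetric] right_diff_distrib sum_subtractf ..
  also have "(M *v u) \<bullet> v = (transpose M *v v) \<bullet> u" using inner_transpose_move[of M v u] by (simp add: inner_commute)
  also have "(M *v v) \<bullet> u - (transpose M *v v) \<bullet> u = ((M - transpose M) *v v) \<bullet> u"
    unfolding matrix_vector_mult_diff_rdistrib inner_diff_left ..
  also have "\<dots> = 2 * ((skew M *v v) \<bullet> u)"
    unfolding skew_def by (simp add: scaleR_matrix_vector_assoc[symmetric])
  finally show ?thesis .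
qed

lemma norm_wedge:
  fixes u v :: "real^'n"
  assumes "u \<bullet> u = 1" "v \<bullet> v = 1" "u \<bullet> v = 0"
  shows "norm ((1 / sqrt 2) *\<^sub>R wedge u v) = 1"
proof -
  have "wedge u v \<bullet> wedge u v = 2 * ((wedge u v *v v) \<bullet> u)"
    using inner_wedge[of "wedge u v" u v] by (simp add: skew_of_skew transpose_wedge)
  also have "\<dots> = 2" using assms by (simp add: wedge_mult inner_diff_left inner_commute)
  finally have "norm (wedge u v) = sqrt 2" by (simp add: norm_eq_sqrt_inner)
  then show ?thesis by simp
qed

text \<open>In the frames \<open>e\<close> and \<open>f\<close>, the entry (i, j) of
  \<open>Lam A M\<close> is \<open>\<sigma> i * \<sigma> j\<close> times that of
  \<open>skew M\<close>, whose diagonal vanishes. The largest factor is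
  \<open>\<sigma> 1 * \<sigma> 2\<close>, belonging to the wedge of the first two vectors, and the
  next is \<open>\<sigma> 1 * \<sigma> 3\<close>.\<close>

lemma Lam_top_gap:
  fixes A :: "real^'n^'n"
  assumes s: "std_svd A \<sigma> e f" and A: "invertible A" and d: "3 \<le> CARD('n)"
  shows "top_gap (Lam A) ((1 / sqrt 2) *\<^sub>R wedge (e 1) (e 2)) ((1 / sqrt 2) *\<^sub>R wedge (f 1) (f 2)) (\<sigma> 3 / \<sigma> 2)"
proof -
  let ?I = "{1..CARD('n)}"
  let ?E = "(1 / sqrt 2) *\<^sub>R wedge (e 1) (e 2)" and ?F = "(1 / sqrt 2) *\<^sub>R wedge (f 1) (f 2)"
  have I: "1 \<in> ?I" "2 \<in> ?I" "3 \<in> ?I" using d by auto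
  note D = std_svdD[OF s] and D' = std_svdD[OF std_svd_transpose[OF s]]
  have p: "0 < \<sigma> i" if "i \<in> ?I" for i by (rule std_svd_pos[OF s A that])
  have nE: "norm ?E = 1" "norm ?F = 1"
    by (rule norm_wedge; use std_frameD[OF D(1)] std_frameD[OF D(2)] I in simp)+
  have co: "(Lam A M *v f j) \<bullet> f i = \<sigma> i * (\<sigma> j * ((skew M *v e j) \<bullet> e i))" if "i \<in> ?I" "j \<in> ?I" for M i j
    unfolding Lam_def matrix_vector_mul_assoc[symmetric] std_svd_coeff[OF s that(1)] D'(4)[OF that(2)]
    by (simp add: matrix_vector_mult_scaleR)
  have diag: "(skew M *v v) \<bullet> v = 0" for M v using skew_swap[OF transpose_skew, of M v v] by simp
  \<comment> \<open>Only entries at which \<open>skew M\<close> is non-zero count, so the same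
    estimate yields the norm (all pairs of distinct indices) and the gap (all such pairs but {1,
    2}).\<close>
  have bound: "norm (Lam A M) \<le> b * norm M"
    if b: "0 \<le> b" "\<And>i j. i \<in> ?I \<Longrightarrow> j \<in> ?I \<Longrightarrow> i \<noteq> j \<Longrightarrow> (skew M *v e j) \<bullet> e i \<noteq> 0 \<Longrightarrow> \<sigma> i * \<sigma> j \<le> b" for b M
  proof (rule power2_le_imp_le)
    have "(norm (Lam A M))\<^sup>2 \<le> (\<Sum>j\<in>?I. \<Sum>i\<in>?I. b\<^sup>2 * ((skew M *v e j) \<bullet> e i)\<^sup>2)"
      unfolding matrix_norm_frame[OF D(2)]
    proof (intro sum_mono)
      fix i j assume ij: "i \<in> ?I" "j \<in> ?I"
      show "((Lam A M *v f j) \<bullet> f i)\<^sup>2 \<le> b\<^sup>2 * ((skew M *v e j) \<bullet> e i)\<^sup>2"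
      proof (cases "(skew M *v e j) \<bullet> e i = 0")
        case False
        then have "i \<noteq> j" using diag by auto
        then have "\<sigma> i * \<sigma> j \<le> b" using b(2) ij False by blast
        then have "(\<sigma> i * \<sigma> j)\<^sup>2 \<le> b\<^sup>2" using p[OF ij(1)] p[OF ij(2)] by (intro power_mono) auto
        then have "(\<sigma> i * \<sigma> j)\<^sup>2 * ((skew M *v e j) \<bullet> e i)\<^sup>2 \<le> b\<^sup>2 * ((skew M *v e j) \<bullet> e i)\<^sup>2" by (rule mult_right_mono) simp
        then show ?thesis unfolding co[OF ij] by (simp add: power_mult_distrib mult.assoc)
      qed (simp add: co[OF ij])
    qed
    also have "\<dots> = (b * norm (skew M))\<^sup>2" by (simp add: power_mult_distrib matrix_norm_frame[OF D(1)] sum_distrib_left)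
    also have "\<dots> \<le> (b * norm M)\<^sup>2" using b(1) norm_skew_le by (intro power_mono mult_left_mono) auto
    finally show "(norm (Lam A M))\<^sup>2 \<le> (b * norm M)\<^sup>2" .
  qed (use b in simp)
  have mono: "\<sigma> j \<le> \<sigma> i" if "i \<in> ?I" "j \<in> ?I" "i \<le> j" for i j using D(5) that by blast
  have b12: "\<sigma> i * \<sigma> j \<le> \<sigma> 1 * \<sigma> 2" if ij: "i \<in> ?I" "j \<in> ?I" "i \<noteq> j" for i j
  proof (cases "i = 1")
    case True
    then show ?thesis using mono[of 2 j] ij I p[OF I(1)] by auto
  next
    case False
    then have "\<sigma> i * \<sigma> j \<le> \<sigma> 2 * \<sigma> 1" using mono[of 2 i] mono[of 1 j] ij I p by (intro mult_mono) (auto simp: less_imp_le)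
    then show ?thesis by (simp add: mult.commute)
  qed
  have b13: "\<sigma> i * \<sigma> j \<le> \<sigma> 1 * \<sigma> 3" if ij: "i \<in> ?I" "j \<in> ?I" "i \<noteq> j" "\<not> (i = 1 \<and> j = 2)" "\<not> (i = 2 \<and> j = 1)" for i j
  proof (cases "3 \<le> i")
    case True
    then have "\<sigma> i * \<sigma> j \<le> \<sigma> 3 * \<sigma> 1" using mono[of 3 i] mono[of 1 j] ij I p by (intro mult_mono) (auto simp: less_imp_le)
    then show ?thesis by (simp add: mult.commute)
  next
    case False
    then have "3 \<le> j" using ij by auto
    then show ?thesis using mono[of 3 j] mono[of 1 i] ij I p by (intro mult_mono) (auto simp: less_imp_le)
  qed
  have LE: "Lam A ?E = (\<sigma> 1 * \<sigma> 2) *\<^sub>R ?F"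
  proof -
    have "skew ?E = ?E" by (rule skew_of_skew) (simp add: transpose_scalar transpose_wedge)
    then have "Lam A ?E = (1 / sqrt 2) *\<^sub>R (A ** wedge (e 1) (e 2) ** transpose A)"
      unfolding Lam_def by (simp add: matrix_scalar_ac flip: scalar_matrix_assoc)
    also have "A ** wedge (e 1) (e 2) ** transpose A = wedge (\<sigma> 1 *\<^sub>R f 1) (\<sigma> 2 *\<^sub>R f 2)" unfolding mult_wedge D(4)[OF I(1)] D(4)[OF I(2)] ..
    also have "\<dots> = (\<sigma> 1 * \<sigma> 2) *\<^sub>R wedge (f 1) (f 2)" by (simp add: wedge_def vec_eq_iff algebra_simps)
    finally show ?thesis by simp
  qed
  have on: "onorm (Lam A) = \<sigma> 1 * \<sigma> 2"
  proof (rule antisym)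
    show "onorm (Lam A) \<le> \<sigma> 1 * \<sigma> 2"
      by (rule onorm_le, rule bound) (use b12 p[OF I(1)] p[OF I(2)] in auto)
    have "norm (Lam A ?E) = \<bar>\<sigma> 1 * \<sigma> 2\<bar> * norm ?F" unfolding LE by (rule norm_scaleR)
    then have X: "norm (Lam A ?E) = \<sigma> 1 * \<sigma> 2" unfolding nE(2) using p[OF I(1)] p[OF I(2)] by simp
    have "norm (Lam A ?E) \<le> onorm (Lam A) * norm ?E" by (rule onorm_bound[OF linear_Lam])
    then show "\<sigma> 1 * \<sigma> 2 \<le> onorm (Lam A)" unfolding X nE(1) by simp
  qed
  have perp: "Lam A w \<bullet> ?F = 0 \<and> norm (Lam A w) \<le> \<sigma> 3 / \<sigma> 2 * (\<sigma> 1 * \<sigma> 2) * norm w" if w: "w \<bullet> ?E = 0" for w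
  proof
    have "w \<bullet> wedge (e 1) (e 2) = 0" using w by simp
    then have z: "(skew w *v e 2) \<bullet> e 1 = 0" unfolding inner_wedge by linarith
    then have z': "(skew w *v e 1) \<bullet> e 2 = 0" using skew_swap[OF transpose_skew, of w "e 1" "e 2"] by simp
    show "Lam A w \<bullet> ?F = 0"
      using co[OF I(1,2), of w] z unfolding inner_scaleR_right inner_wedge skew_of_skew[OF transpose_Lam] by simp
    have "norm (Lam A w) \<le> (\<sigma> 1 * \<sigma> 3) * norm w"
      by (rule bound) (use b13 z z' p[OF I(1)] p[OF I(3)] in auto)
    then show "norm (Lam A w) \<le> \<sigma> 3 / \<sigma> 2 * (\<sigma> 1 * \<sigma> 2) * norm w" using p[OF I(2)] by (simp add: mult.commute)
  qed
  have q: "0 < \<sigma> 1 * \<sigma> 2" "0 \<le> \<sigma> 3 / \<sigma> 2" using p[OF I(1)] p[OF I(2)] p[OF I(3)] by simp_all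
  show ?thesis
    unfolding top_gap_def on
    by (intro conjI nE LE q allI impI) (erule conjunct1[OF perp], erule conjunct2[OF perp])
qed

lemma norm_matrix_mult_le:
  fixes A B :: "real^'n^'n"
  shows "norm (A ** B) \<le> onorm ((*v) A) * norm B"
proof (rule power2_le_imp_le)
  let ?E = "\<lambda>X::real^'n^'n. (\<Sum>j\<in>UNIV. (norm (X *v axis j 1))\<^sup>2)"
  have E: "(norm X)\<^sup>2 = ?E X" for X :: "real^'n^'n"
  proof -
    have "(norm X)\<^sup>2 = (\<Sum>i\<in>UNIV. \<Sum>j\<in>UNIV. (X $ i $ j)\<^sup>2)"
      unfolding power2_norm_eq_inner by (simp add: inner_vec_def power2_eq_square)
    also have "\<dots> = (\<Sum>j\<in>UNIV. \<Sum>i\<in>UNIV. (X $ i $ j)\<^sup>2)" by (rule sum.swap)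
    also have "\<dots> = ?E X"
      unfolding power2_norm_eq_inner by (simp add: inner_vec_def power2_eq_square matrix_vector_mult_basis column_def)
    finally show ?thesis .
  qed
  have "(norm (A ** B))\<^sup>2 \<le> (\<Sum>j\<in>UNIV. (onorm ((*v) A))\<^sup>2 * (norm (B *v axis j 1))\<^sup>2)"
    unfolding E
  proof (rule sum_mono)
    fix j
    have "norm ((A ** B) *v axis j 1) \<le> onorm ((*v) A) * norm (B *v axis j 1)"
      unfolding matrix_vector_mul_assoc[symmetric] by (rule onorm_bound) simp
    then have "(norm ((A ** B) *v axis j 1))\<^sup>2 \<le> (onorm ((*v) A) * norm (B *v axis j 1))\<^sup>2" by (rule power_mono) simp
    then show "(norm ((A ** B) *v axis j 1))\<^sup>2 \<le> (onorm ((*v) A))\<^sup>2 * (norm (B *v axis j 1))\<^sup>2" by (simp add: power_mult_distrib)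
  qed
  also have "\<dots> = (onorm ((*v) A) * norm B)\<^sup>2" by (simp add: power_mult_distrib E sum_distrib_left)
  finally show "(norm (A ** B))\<^sup>2 \<le> (onorm ((*v) A) * norm B)\<^sup>2" .
qed (simp add: onorm_nonneg)

lemma norm_mult_vec_le: "norm ((A :: real^'n^'n) *v v) \<le> norm A * norm v"
proof (rule power2_le_imp_le)
  have "(norm (A *v v))\<^sup>2 = (\<Sum>i\<in>UNIV. (A $ i \<bullet> v)\<^sup>2)"
    unfolding power2_norm_eq_inner by (simp add: inner_vec_def[of "A *v v"] matrix_vector_mul_component power2_eq_square)
  also have "\<dots> \<le> (\<Sum>i\<in>UNIV. (norm (A $ i))\<^sup>2 * (norm v)\<^sup>2)"
  proof (rule sum_mono)
    fix i
    have "\<bar>A $ i \<bullet> v\<bar>\<^sup>2 \<le> (norm (A $ i) * norm v)\<^sup>2" by (rule power_mono[OF Cauchy_Schwarz_ineq2]) simp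
    then show "(A $ i \<bullet> v)\<^sup>2 \<le> (norm (A $ i))\<^sup>2 * (norm v)\<^sup>2" by (simp add: power_mult_distrib)
  qed
  also have "\<dots> = (norm A * norm v)\<^sup>2"
    unfolding power_mult_distrib power2_norm_eq_inner inner_vec_def[of A] sum_distrib_right ..
  finally show "(norm (A *v v))\<^sup>2 \<le> (norm A * norm v)\<^sup>2" .
qed simp

lemma onorm_le_norm: "onorm ((*v) (A :: real^'n^'n)) \<le> norm A"
  by (rule onorm_le) (rule norm_mult_vec_le)

lemma norm_mult_le: "norm ((A :: real^'n^'n) ** (B :: real^'n^'n)) \<le> norm A * norm B"
  using norm_matrix_mult_le[of A B] mult_right_mono[OF onorm_le_norm[of A], of "norm B"] by simp

lemma Lam_close:
  fixes A A' :: "real^'n^'n"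
  assumes "norm (A' - A) \<le> \<epsilon>" "\<epsilon> \<le> 1"
  shows "norm (Lam A' M - Lam A M) \<le> (\<epsilon> * (2 * norm A + 1)) * norm M"
proof -
  let ?N = "skew M"
  have \<epsilon>: "0 \<le> \<epsilon>" using assms(1) norm_ge_zero order_trans by blast
  have A': "norm A' \<le> norm A + 1" using norm_triangle_ineq[of A "A' - A"] assms by simp
  have "Lam A' M - Lam A M = (A' - A) ** ?N ** transpose A' + A ** ?N ** transpose (A' - A)"
  proof (rule matrix_eqI)
    fix v
    have t: "transpose (A' - A) = transpose A' - transpose A" by (simp add: transpose_def vec_eq_iff)
    show "(Lam A' M - Lam A M) *v v = ((A' - A) ** ?N ** transpose A' + A ** ?N ** transpose (A' - A)) *v v"
      unfolding Lam_def t
      by (simp add: matrix_vector_mult_diff_rdistrib matrix_vector_mult_add_rdistrib matrix_vector_mult_diff_distrib flip: matrix_vector_mul_assoc)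
  qed
  then have "norm (Lam A' M - Lam A M) \<le> norm ((A' - A) ** ?N ** transpose A') + norm (A ** ?N ** transpose (A' - A))"
    by (metis norm_triangle_ineq)
  also have "\<dots> \<le> (\<epsilon> * norm M) * (norm A + 1) + (norm A * norm M) * \<epsilon>"
  proof (rule add_mono)
    have "norm ((A' - A) ** ?N ** transpose A') \<le> norm ((A' - A) ** ?N) * norm (transpose A')" by (rule norm_mult_le)
    also have "\<dots> \<le> (\<epsilon> * norm M) * (norm A + 1)"
    proof (rule mult_mono)
      show "norm ((A' - A) ** ?N) \<le> \<epsilon> * norm M"
        using norm_mult_le[of "A' - A" ?N] mult_mono[OF assms(1) norm_skew_le[of M] \<epsilon>] by simp
    qed (use A' \<epsilon> in \<open>auto simp: norm_transpose\<close>)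
    finally show "norm ((A' - A) ** ?N ** transpose A') \<le> (\<epsilon> * norm M) * (norm A + 1)" .
    have "norm (A ** ?N ** transpose (A' - A)) \<le> norm (A ** ?N) * norm (transpose (A' - A))" by (rule norm_mult_le)
    also have "\<dots> \<le> (norm A * norm M) * \<epsilon>"
    proof (rule mult_mono)
      show "norm (A ** ?N) \<le> norm A * norm M"
        using norm_mult_le[of A ?N] mult_left_mono[OF norm_skew_le[of M], of "norm A"] by simp
    qed (use assms in \<open>auto simp: norm_transpose\<close>)
    finally show "norm (A ** ?N ** transpose (A' - A)) \<le> (norm A * norm M) * \<epsilon>" .
  qed
  also have "\<dots> = (\<epsilon> * (2 * norm A + 1)) * norm M" by (simp add: algebra_simps)
  finally show ?thesis .
qed

section \<open>Limits in Grassmannians\<close>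

lemma tendsto_matrix_vector_mult:
  fixes A :: "'b \<Rightarrow> real^'n^'m"
  assumes "(A \<longlongrightarrow> A') F" "(v \<longlongrightarrow> v') F"
  shows "((\<lambda>x. A x *v v x) \<longlongrightarrow> A' *v v') F"
  using assms by (intro vec_tendstoI) (auto simp: matrix_vector_mult_def intro!: tendsto_intros)

text \<open>Convergence of the matrices \<open>Q n\<close>, projections onto \<open>L n\<close>, is
  matched with the quotient topology. For existence, \<open>Q n\<close> carries a frame of
  \<open>L'\<close> to frames of \<open>L n\<close> that converge to it. For uniqueness, a point of
  a limit \<open>X\<close> is approximated by points of \<open>L n\<close>, which \<open>Q n\<close>
  fixes, so it is fixed by \<open>Q'\<close>; dimensions then agree. Uniqueness is what the
  \<open>THE\<close> in \<open>boundary_map\<close> requires.\<close>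

lemma limitin_grassmannian:
  fixes L :: "nat \<Rightarrow> (real^'n) set" and Q :: "nat \<Rightarrow> real^'n^'n"
  assumes L: "\<And>n. subspace (L n)" "\<And>n. dim (L n) = k"
    and Q: "\<And>n v. Q n *v v \<in> L n" "\<And>n v. v \<in> L n \<Longrightarrow> Q n *v v = v"
    and lim: "Q \<longlonglongrightarrow> Q'" and L': "L' = {v. Q' *v v = v}" "dim L' = k"
  shows "limitin (grassmannian k) L X sequentially \<longleftrightarrow> X = L'"
proof -
  let ?q = "\<lambda>v :: nat \<Rightarrow> real^'n. span (v ` {1..k})"
  have subL': "subspace L'" unfolding L'(1) by (auto simp: subspace_def matrix_vector_right_distrib matrix_vector_mult_scaleR)
  have ft: "topspace (frame_topology k) = {v \<in> extensional {1..k}. inj_on v {1..k} \<and> independent (v ` {1..k} :: (real^'n) set)}"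
    by (auto simp: frame_topology_def PiE_def)
  have ex: "\<exists>v. v \<in> topspace (frame_topology k) \<and> ?q v = W" if W: "subspace W" "dim W = k" for W :: "(real^'n) set"
  proof -
    obtain b where b: "b \<subseteq> W" "independent b" "W \<subseteq> span b" "card b = k" using basis_exists[of W] W(2) by metis
    have "finite b" using b(2) independent_imp_finite by blast
    then obtain v where v: "bij_betw v {1..k} b" using b(4) by (metis ex_bij_betw_nat_finite_1)
    have "restrict v {1..k} ` {1..k} = b" using v by (auto simp: bij_betw_def)
    moreover have "inj_on (restrict v {1..k}) {1..k}" using bij_betw_imp_inj_on[OF v] by (simp add: inj_on_restrict_eq)
    moreover have "span b = W" by (rule subset_antisym[OF span_minimal[OF b(1) W(1)] b(3)])
    ultimately show ?thesis using b(2) by (intro exI[of _ "restrict v {1..k}"]) (simp add: ft)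
  qed
  have Gtop: "topspace (grassmannian k :: (real^'n) set topology) = ?q ` topspace (frame_topology k)"
    unfolding grassmannian_def by (rule topspace_quotient_topology)
  have memG: "W \<in> topspace (grassmannian k)" if "subspace W" "dim W = k" for W :: "(real^'n) set"
    unfolding Gtop using ex[OF that] by blast
  have Gdim: "subspace W" "dim W = k" if WG: "W \<in> topspace (grassmannian k)" for W :: "(real^'n) set"
  proof -
    obtain v where v: "v \<in> topspace (frame_topology k)" "W = ?q v" using WG unfolding Gtop by blast
    then show "subspace W" by simp
    show "dim W = k" using v unfolding ft by (simp add: dim_eq_card_independent card_image)
  qed
  have Qv: "(\<lambda>n. Q n *v v) \<longlonglongrightarrow> Q' *v v" for v
    by (rule tendsto_matrix_vector_mult[OF lim tendsto_const])
  show ?thesis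
  proof
    assume X: "limitin (grassmannian k) L X sequentially"
    then have XG: "X \<in> topspace (grassmannian k)" by (rule limitin_topspace)
    have "X \<subseteq> L'"
    proof
      fix w assume w: "w \<in> X"
      have "norm (Q' *v w - w) \<le> e" if e: "0 < e" for e
      proof -
        \<comment> \<open>The error below is at most \<open>d + ((norm Q' + 1) * d + d)\<close>,
          that is \<open>C * d\<close>.\<close>
        define C where "C = norm Q' + 3"
        have C: "0 < C" unfolding C_def by (simp add: add_nonneg_pos)
        define d where "d = e / C"
        have d: "0 < d" using e C by (simp add: d_def)
        \<comment> \<open>The subspaces that meet the ball around \<open>w\<close>. This set is
          open: for fixed coefficients the linear combination depends continuously on the frame, and
          one takes the union over all coefficients.\<close>
        define U where "U = {W \<in> topspace (grassmannian k). \<exists>x\<in>W. dist x w < d}"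
        have "openin (grassmannian k) U"
          unfolding grassmannian_def openin_quotient_topology
        proof
          show "U \<subseteq> ?q ` topspace (frame_topology k)" unfolding U_def Gtop by blast
          let ?P = "{v \<in> topspace (frame_topology k). ?q v \<in> U}"
          have eq: "?P = (\<Union>a\<in>(UNIV :: (nat \<Rightarrow> real) set). {v \<in> topspace (frame_topology k). (\<Sum>i\<in>{1..k}. a i *\<^sub>R v i) \<in> ball w d})"
          proof -
            have "?q v \<in> U \<longleftrightarrow> (\<exists>a. (\<Sum>i\<in>{1..k}. a i *\<^sub>R v i) \<in> ball w d)" if v: "v \<in> topspace (frame_topology k)" for v
            proof -
              have inj: "inj_on v {1..k}" using v by (simp add: ft)
              have sp: "?q v = range (\<lambda>u. \<Sum>x\<in>v ` {1..k}. u x *\<^sub>R x)" by (rule span_finite) simp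
              have m: "x \<in> ?q v \<longleftrightarrow> (\<exists>a. x = (\<Sum>i\<in>{1..k}. a i *\<^sub>R v i))" for x
              proof
                assume "x \<in> ?q v"
                then obtain u where "x = (\<Sum>x\<in>v ` {1..k}. u x *\<^sub>R x)" unfolding sp by blast
                then have "x = (\<Sum>i\<in>{1..k}. u (v i) *\<^sub>R v i)" unfolding sum.reindex[OF inj] o_def .
                then show "\<exists>a. x = (\<Sum>i\<in>{1..k}. a i *\<^sub>R v i)" by (intro exI[of _ "\<lambda>i. u (v i)"])
              next
                assume "\<exists>a. x = (\<Sum>i\<in>{1..k}. a i *\<^sub>R v i)"
                then obtain a where "x = (\<Sum>i\<in>{1..k}. a i *\<^sub>R v i)" by (elim exE)
                then show "x \<in> ?q v" by (simp only:) (intro span_sum span_mul span_base imageI)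
              qed
              have vG: "?q v \<in> topspace (grassmannian k)" unfolding Gtop using v by blast
              show ?thesis
              proof
                assume "?q v \<in> U"
                then obtain x where x: "x \<in> ?q v" "dist x w < d" unfolding U_def by blast
                obtain a where a: "x = (\<Sum>i\<in>{1..k}. a i *\<^sub>R v i)" using x(1) unfolding m by (elim exE)
                show "\<exists>a. (\<Sum>i\<in>{1..k}. a i *\<^sub>R v i) \<in> ball w d"
                  by (intro exI[of _ a]) (use x(2) in \<open>simp add: a dist_commute\<close>)
              next
                assume "\<exists>a. (\<Sum>i\<in>{1..k}. a i *\<^sub>R v i) \<in> ball w d"
                then obtain a where a: "(\<Sum>i\<in>{1..k}. a i *\<^sub>R v i) \<in> ball w d" by (elim exE)
                have "(\<Sum>i\<in>{1..k}. a i *\<^sub>R v i) \<in> ?q v" unfolding m by (rule exI[of _ a]) (rule refl)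
                moreover have "dist (\<Sum>i\<in>{1..k}. a i *\<^sub>R v i) w < d" using a by (simp add: dist_commute)
                ultimately show "?q v \<in> U" using vG unfolding U_def by blast
              qed
            qed
            then show ?thesis by blast
          qed
          show "openin (frame_topology k) ?P"
            unfolding eq
          proof (intro openin_Union ballI)
            fix T assume "T \<in> range (\<lambda>a. {v \<in> topspace (frame_topology k). (\<Sum>i\<in>{1..k}. a i *\<^sub>R v i) \<in> ball w d})"
            then obtain a where T: "T = {v \<in> topspace (frame_topology k). (\<Sum>i\<in>{1..k}. a i *\<^sub>R v i) \<in> ball w d}" by blast
            have "continuous_map (frame_topology k) euclidean (\<lambda>v. a i *\<^sub>R (v i :: real^'n))" if "i \<in> {1..k}" for i
            proof -
              have p: "continuous_map (frame_topology k) euclidean (\<lambda>v. v i :: real^'n)"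
                unfolding frame_topology_def by (intro continuous_map_from_subtopology continuous_map_product_projection that)
              have s: "continuous_map euclidean euclidean (\<lambda>x :: real^'n. a i *\<^sub>R x)" by (auto intro!: continuous_intros)
              show ?thesis using continuous_map_compose[OF p s] by (simp add: o_def)
            qed
            then have "continuous_map (frame_topology k) euclidean (\<lambda>v. \<Sum>i\<in>{1..k}. a i *\<^sub>R (v i :: real^'n))"
              by (intro continuous_map_sum) auto
            then show "openin (frame_topology k) T" unfolding T by (rule openin_continuous_map_preimage) simp
          qed
        qed
        moreover have "X \<in> U" using XG w d by (auto simp: U_def intro!: bexI[of _ w])
        ultimately have ev: "\<forall>\<^sub>F n in sequentially. L n \<in> U" using X by (auto simp: limitin_def)
        have "\<forall>\<^sub>F n in sequentially. dist (Q n) Q' < 1" using lim by (rule tendstoD) simp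
        moreover have "\<forall>\<^sub>F n in sequentially. dist (Q n *v w) (Q' *v w) < d" using Qv d by (rule tendstoD)
        ultimately have "\<forall>\<^sub>F n in sequentially. norm (Q' *v w - w) \<le> e" using ev
        proof eventually_elim
          case (elim n)
          obtain x where x: "x \<in> L n" "dist x w < d" using elim(3) by (auto simp: U_def)
          have nQ: "norm (Q n) \<le> norm Q' + 1" using elim(1) norm_triangle_ineq[of Q' "Q n - Q'"] by (simp add: dist_norm)
          have "Q' *v w - w = (Q' *v w - Q n *v w) + (Q n *v (w - x) + (x - w))"
            using Q(2)[OF x(1)] by (simp add: matrix_vector_mult_diff_distrib)
          then have "norm (Q' *v w - w) \<le> norm (Q' *v w - Q n *v w) + (norm (Q n *v (w - x)) + norm (x - w))"
            by (simp only:) (rule order_trans[OF norm_triangle_ineq add_left_mono[OF norm_triangle_ineq]])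
          also have "\<dots> \<le> d + ((norm Q' + 1) * d + d)"
          proof (intro add_mono)
            show "norm (Q' *v w - Q n *v w) \<le> d" using elim(2) by (simp add: dist_norm norm_minus_commute)
            have "norm (Q n *v (w - x)) \<le> norm (Q n) * norm (w - x)" by (rule norm_mult_vec_le)
            also have "\<dots> \<le> (norm Q' + 1) * d" using nQ x(2) by (intro mult_mono) (auto simp: dist_norm norm_minus_commute)
            finally show "norm (Q n *v (w - x)) \<le> (norm Q' + 1) * d" .
            show "norm (x - w) \<le> d" using x(2) by (simp add: dist_norm)
          qed
          also have "\<dots> = C * d" by (simp add: C_def algebra_simps)
          also have "\<dots> = e" using C by (simp add: d_def)
          finally show ?case .
        qed
        then show ?thesis by simp
      qed
      then have "norm (Q' *v w - w) \<le> 0" by (rule field_le_epsilon[of _ 0, simplified])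
      then show "w \<in> L'" by (simp add: L'(1))
    qed
    then show "X = L'" using subspace_dim_equal[OF Gdim(1)[OF XG] subL'] Gdim(2)[OF XG] L'(2) by simp
  next
    assume XL: "X = L'"
    obtain v where v: "v \<in> topspace (frame_topology k)" "?q v = L'" using ex[OF subL' L'(2)] by blast
    have vL: "v i \<in> L'" if "i \<in> {1..k}" for i unfolding v(2)[symmetric] using that by (intro span_base) auto
    have mem: "L n \<in> topspace (grassmannian k)" for n by (rule memG[OF L])
    show "limitin (grassmannian k) L X sequentially"
      unfolding limitin_def XL
    proof (intro conjI allI impI)
      show "L' \<in> topspace (grassmannian k)" by (rule memG[OF subL' L'(2)])
      fix U assume U: "openin (grassmannian k) U \<and> L' \<in> U"
      then have op: "openin (frame_topology k) {v \<in> topspace (frame_topology k). ?q v \<in> U}"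
        unfolding grassmannian_def openin_quotient_topology by blast
      then obtain T where T: "openin (product_topology (\<lambda>_. euclidean) {1..k}) T"
        "{v \<in> topspace (frame_topology k). ?q v \<in> U} = T \<inter> {v. inj_on v {1..k} \<and> independent (v ` {1..k} :: (real^'n) set)}"
        unfolding frame_topology_def openin_subtopology by blast
      have vT: "v \<in> T" using v U T(2) by blast
      define vn where "vn n = restrict (\<lambda>i. Q n *v v i) {1..k}" for n
      have "limitin (product_topology (\<lambda>_. euclidean) {1..k}) vn v sequentially"
        unfolding limitin_componentwise
      proof (intro conjI ballI)
        show "v \<in> extensional {1..k}" using v(1) by (simp add: ft)
        show "\<forall>\<^sub>F n in sequentially. vn n \<in> topspace (product_topology (\<lambda>_. euclidean) {1..k})" by (simp add: vn_def)
        fix i assume i: "i \<in> {1..k}"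
        have "(\<lambda>n. Q n *v v i) \<longlonglongrightarrow> v i" using Qv[of "v i"] vL[OF i] by (simp add: L'(1))
        then show "limitin euclidean (\<lambda>n. vn n i) (v i) sequentially" using i by (simp add: vn_def)
      qed
      then have ev: "\<forall>\<^sub>F n in sequentially. vn n \<in> T" using T(1) vT by (auto simp: limitin_def)
      \<comment> \<open>Once \<open>Q n\<close> is within 1/2 of \<open>Q'\<close>, it is injective
        on \<open>L'\<close>, because \<open>Q'\<close> is the identity there.\<close>
      have li: "\<forall>\<^sub>F n in sequentially. inj_on (vn n) {1..k} \<and> independent (vn n ` {1..k})"
      proof -
        have "\<forall>\<^sub>F n in sequentially. dist (Q n) Q' < 1/2" using lim by (rule tendstoD) simp
        then show ?thesis
        proof eventually_elim
          case (elim n)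
          have inj: "inj_on ((*v) (Q n)) (span (v ` {1..k}))"
          proof (rule inj_onI)
            fix x y assume xy: "x \<in> span (v ` {1..k})" "y \<in> span (v ` {1..k})" "Q n *v x = Q n *v y"
            let ?z = "x - y"
            have "?z \<in> L'" using xy v(2) by (metis span_diff)
            then have "?z = (Q' - Q n) *v ?z" using xy(3) by (simp add: L'(1) matrix_vector_mult_diff_rdistrib matrix_vector_mult_diff_distrib)
            then have "norm ?z \<le> norm (Q' - Q n) * norm ?z" by (metis norm_mult_vec_le)
            also have "\<dots> \<le> 1/2 * norm ?z" using elim by (intro mult_right_mono) (auto simp: dist_norm norm_minus_commute)
            finally show "x = y" by simp
          qed
          have ind: "independent (v ` {1..k})" "inj_on v {1..k}" using v(1) by (auto simp: ft)
          have im: "vn n ` {1..k} = (*v) (Q n) ` v ` {1..k}" by (auto simp: vn_def)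
          have "independent (vn n ` {1..k})"
            unfolding im by (rule linear_independent_injective_image[OF matrix_vector_mul_linear ind(1) inj])
          moreover have "inj_on (vn n) {1..k}"
            unfolding vn_def inj_on_restrict_eq
            using comp_inj_on[OF ind(2) inj_on_subset[OF inj span_superset]] unfolding o_def .
          ultimately show ?case by blast
        qed
      qed
      show "\<forall>\<^sub>F n in sequentially. L n \<in> U"
        using ev li
      proof eventually_elim
        case (elim n)
        then have vU: "vn n \<in> {v \<in> topspace (frame_topology k). ?q v \<in> U}" unfolding T(2) by blast
        have "?q (vn n) \<subseteq> L n" using Q(1) by (intro span_minimal L) (auto simp: vn_def)
        moreover have "dim (?q (vn n)) = k" using elim by (simp add: dim_eq_card_independent card_image)
        ultimately have "?q (vn n) = L n" using subspace_dim_equal[of "?q (vn n)" "L n"] L by simp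
        then show ?case using vU by simp
      qed
    qed
  qed
qed

section \<open>Anosov representations as limit line systems\<close>

text \<open>Convergence of lines becomes convergence of vectors after a correction of signs, to
  which an even function is blind.\<close>

lemma even_tendsto:
  fixes h :: "nat \<Rightarrow> 'a::real_normed_vector" and F :: "'a \<Rightarrow> 'b::topological_space"
  assumes l: "(\<lambda>n. ldist (h n) l) \<longlonglongrightarrow> 0" and ev: "\<And>x. F (- x) = F x" and F: "isCont F l"
  shows "(\<lambda>n. F (h n)) \<longlonglongrightarrow> F l"
proof -
  have "\<exists>s. (s = 1 \<or> s = -1) \<and> norm (h n - s *\<^sub>R l) = ldist (h n) l" for n
    using ldist_cases[of "h n" l] by metis
  then obtain s where s: "\<And>n. s n = 1 \<or> s n = -1" "\<And>n. norm (h n - s n *\<^sub>R l) = ldist (h n) l" by metis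
  have "norm (s n *\<^sub>R h n - l) = ldist (h n) l" for n
  proof -
    have "s n *\<^sub>R h n - l = s n *\<^sub>R (h n - s n *\<^sub>R l)" using s(1)[of n] by (auto simp: scaleR_diff_right)
    then show ?thesis using s(1)[of n] s(2)[of n] by auto
  qed
  then have "(\<lambda>n. s n *\<^sub>R h n - l) \<longlonglongrightarrow> 0" using l by (intro tendsto_norm_zero_cancel[of "\<lambda>n. s n *\<^sub>R h n - l"]) simp
  then have "(\<lambda>n. s n *\<^sub>R h n) \<longlonglongrightarrow> l" by (simp add: LIM_zero_iff)
  then have "(\<lambda>n. F (s n *\<^sub>R h n)) \<longlonglongrightarrow> F l" by (rule isCont_tendsto_compose[OF F])
  moreover have "F (s n *\<^sub>R h n) = F (h n)" for n using s(1)[of n] ev by auto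
  ultimately show ?thesis by simp
qed

text \<open>For a unit vector, the orthogonal projection onto its line: a continuous encoding of the
  line that forgets the sign.\<close>

definition outer :: "real^'n \<Rightarrow> real^'n^'n" where
  "outer h = (\<chi> i j. h $ i * h $ j)"

lemma outer_mult: "outer h *v v = (h \<bullet> v) *\<^sub>R h"
  by (simp add: outer_def matrix_vector_mult_def vec_eq_iff inner_vec_def sum_distrib_left mult.assoc mult.commute mult.left_commute)

lemma outer_minus: "outer (- h) = outer h" by (simp add: outer_def)

lemma isCont_outer: "isCont outer h"
  unfolding isCont_def outer_def by (intro vec_tendstoI) (auto intro!: tendsto_intros)

lemma tendsto_matrix_mult:
  fixes A :: "'b \<Rightarrow> real^'n^'m" and B :: "'b \<Rightarrow> real^'k^'n"
  assumes "(A \<longlongrightarrow> A') F" "(B \<longlongrightarrow> B') F"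
  shows "((\<lambda>x. A x ** B x) \<longlongrightarrow> A' ** B') F"
  using assms by (intro vec_tendstoI) (auto simp: matrix_matrix_mult_def intro!: tendsto_intros)

lemma tendsto_wedge:
  assumes "(u \<longlongrightarrow> u') F" "(v \<longlongrightarrow> v') F"
  shows "((\<lambda>x. wedge (u x) (v x)) \<longlongrightarrow> wedge u' v') F"
  using assms unfolding wedge_def by (intro vec_tendstoI) (auto intro!: tendsto_intros)

lemma wedge_scale: "wedge (a *\<^sub>R u) v = a *\<^sub>R wedge u v" "wedge u (a *\<^sub>R v) = a *\<^sub>R wedge u v"
  by (simp_all add: wedge_def vec_eq_iff algebra_simps)

definition unit_wedge :: "real^'n \<Rightarrow> real^'n \<Rightarrow> real^'n^'n" where
  "unit_wedge a b = (1 / sqrt 2) *\<^sub>R wedge a b"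

definition orthonormal_pair :: "real^'n \<Rightarrow> real^'n \<Rightarrow> bool" where
  "orthonormal_pair a b \<longleftrightarrow> a \<bullet> a = 1 \<and> b \<bullet> b = 1 \<and> a \<bullet> b = 0"

lemma unit_wedge_mult: "unit_wedge a b *v w = (1 / sqrt 2) *\<^sub>R ((b \<bullet> w) *\<^sub>R a - (a \<bullet> w) *\<^sub>R b)"
  by (simp add: unit_wedge_def wedge_mult flip: scaleR_matrix_vector_assoc)

lemma pair_comb_eq_0: "orthonormal_pair a b \<Longrightarrow> s *\<^sub>R a + t *\<^sub>R b = 0 \<longleftrightarrow> s = 0 \<and> t = 0"
proof
  assume o: "orthonormal_pair a b" and z: "s *\<^sub>R a + t *\<^sub>R b = 0"
  have "(s *\<^sub>R a + t *\<^sub>R b) \<bullet> a = 0" "(s *\<^sub>R a + t *\<^sub>R b) \<bullet> b = 0" unfolding z by simp_all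
  then show "s = 0 \<and> t = 0" using o by (simp add: orthonormal_pair_def inner_add_left inner_add_right inner_commute)
qed simp

lemma unit_wedge_ker:
  assumes "orthonormal_pair a b"
  shows "unit_wedge a b *v w = 0 \<longleftrightarrow> a \<bullet> w = 0 \<and> b \<bullet> w = 0"
proof -
  have "unit_wedge a b *v w = 0 \<longleftrightarrow> (b \<bullet> w) *\<^sub>R a + (- (a \<bullet> w)) *\<^sub>R b = 0"
    by (simp add: unit_wedge_mult)
  then show ?thesis unfolding pair_comb_eq_0[OF assms] by auto
qed

text \<open>On the plane of \<open>a\<close> and \<open>b\<close>, a unit wedge is a quarter turn
  scaled by 1 / sqrt 2, and it vanishes on the complement. Hence
  \<open>mat 1 + 2 *\<^sub>R (H ** H)\<close> is the projection onto its kernel, a formula that is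
  even and continuous in \<open>H\<close>.\<close>

lemma unit_wedge_square:
  assumes "orthonormal_pair a b"
  shows "2 *\<^sub>R (unit_wedge a b *v (unit_wedge a b *v w)) = - ((a \<bullet> w) *\<^sub>R a + (b \<bullet> w) *\<^sub>R b)"
proof -
  have 1: "a \<bullet> (unit_wedge a b *v w) = (1 / sqrt 2) * (b \<bullet> w)" "b \<bullet> (unit_wedge a b *v w) = - ((1 / sqrt 2) * (a \<bullet> w))"
    using assms by (simp_all add: unit_wedge_mult orthonormal_pair_def inner_diff_right inner_commute)
  have "unit_wedge a b *v (unit_wedge a b *v w) = (1 / sqrt 2) *\<^sub>R ((- ((1 / sqrt 2) * (a \<bullet> w))) *\<^sub>R a - ((1 / sqrt 2) * (b \<bullet> w)) *\<^sub>R b)"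
    by (subst unit_wedge_mult) (simp only: 1)
  also have "\<dots> = - (((1 / sqrt 2) * (1 / sqrt 2)) *\<^sub>R ((a \<bullet> w) *\<^sub>R a + (b \<bullet> w) *\<^sub>R b))"
    by (simp add: algebra_simps)
  also have "(1 / sqrt 2) * (1 / sqrt 2) = 1 / 2" by simp
  finally show ?thesis by simp
qed

lemma dim_ker_pair:
  fixes T T' :: "real^'n^'n"
  assumes T: "T ** T' = mat 1" "T' ** T = mat 1" and ab: "orthonormal_pair a b"
  shows "subspace {v. unit_wedge a b *v (T *v v) = 0}" "dim {v. unit_wedge a b *v (T *v v) = 0} = CARD('n) - 2"
proof -
  let ?W = "{w. unit_wedge a b *v w = 0}"
  have TT: "T' *v (T *v v) = v" "T *v (T' *v v) = v" for v by (simp_all add: matrix_vector_mul_assoc T)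
  show "subspace {v. unit_wedge a b *v (T *v v) = 0}"
    by (auto simp: subspace_def matrix_vector_right_distrib matrix_vector_mult_scaleR)
  have "a \<noteq> b" using ab by (auto simp: orthonormal_pair_def)
  have "independent {a, b}"
  proof (rule pairwise_orthogonal_independent)
    show "pairwise orthogonal {a, b}" using ab by (auto simp: pairwise_def orthogonal_def orthonormal_pair_def inner_commute)
    show "0 \<notin> {a, b}" using ab by (auto simp: orthonormal_pair_def)
  qed
  then have d2: "dim {a, b} = 2" using \<open>a \<noteq> b\<close> by (simp add: dim_eq_card_independent)
  have "(a \<bullet> y = 0 \<and> b \<bullet> y = 0) \<longleftrightarrow> (\<forall>x\<in>span {a, b}. orthogonal x y)" for y
  proof
    assume y: "a \<bullet> y = 0 \<and> b \<bullet> y = 0"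
    then have "orthogonal y x" if "x \<in> {a, b}" for x using that by (auto simp: orthogonal_def inner_commute)
    then show "\<forall>x\<in>span {a, b}. orthogonal x y" using orthogonal_to_span orthogonal_commute by blast
  next
    assume "\<forall>x\<in>span {a, b}. orthogonal x y"
    then show "a \<bullet> y = 0 \<and> b \<bullet> y = 0" by (simp add: orthogonal_def span_base)
  qed
  then have "?W = {y \<in> UNIV. \<forall>x\<in>span {a, b}. orthogonal x y}" unfolding unit_wedge_ker[OF ab] by blast
  moreover have "dim {y \<in> UNIV. \<forall>x\<in>span {a, b}. orthogonal x y} + dim (span {a, b}) = dim (UNIV :: (real^'n) set)"
    by (rule dim_subspace_orthogonal_to_vectors) auto
  ultimately have dW: "dim ?W = CARD('n) - 2" using d2 by (simp add: dim_UNIV dim_span)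
  have "{v. unit_wedge a b *v (T *v v) = 0} = (*v) T' ` ?W"
  proof (intro equalityI subsetI)
    fix v assume "v \<in> {v. unit_wedge a b *v (T *v v) = 0}"
    then show "v \<in> (*v) T' ` ?W" by (intro image_eqI[of _ _ "T *v v"]) (auto simp: TT)
  qed (auto simp: TT)
  moreover have "inj_on ((*v) T') (span ?W)" by (rule inj_on_subset[of _ UNIV]) (auto intro!: inj_on_inverseI[where g = "(*v) T"] simp: TT)
  ultimately show "dim {v. unit_wedge a b *v (T *v v) = 0} = CARD('n) - 2"
    using dim_image_eq[OF matrix_vector_mul_linear] dW by metis
qed

lemma singular_value_eq:
  fixes T T' A :: "real^'n^'n"
  assumes T: "T ** T' = mat 1" "T' ** T = mat 1" and B: "\<And>u v. B u v = (T *v u) \<bullet> (T *v v)"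
    and s: "std_svd (T ** A ** T') \<sigma> e f" and i: "i \<in> {1..CARD('n)}"
  shows "singular_value B i A = \<sigma> i"
  unfolding singular_value_def
proof (rule the_equality)
  have TT: "T *v (T' *v v) = v" for v by (simp add: matrix_vector_mul_assoc T)
  have "is_svd B A \<sigma> (\<lambda>i. T' *v e i) (\<lambda>i. T' *v f i)" unfolding is_svd_conjugate[OF T B] TT using s by simp
  then show "\<exists>\<sigma>' e f. is_svd B A \<sigma>' e f \<and> \<sigma> i = \<sigma>' i" by blast
  fix x assume "\<exists>\<sigma> e f. is_svd B A \<sigma> e f \<and> x = \<sigma> i"
  then show "x = \<sigma> i" using std_svd_unique[OF _ s i] unfolding is_svd_conjugate[OF T B] by metis
qed

section \<open>Matrices representing elements of the projective group\<close>

lemma carrier_PGL: "X \<in> carrier PGL \<longleftrightarrow> (\<exists>A. invertible A \<and> X = {c *\<^sub>R A | c. c \<noteq> 0})"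
proof -
  have "scalar_matrices #>\<^bsub>GL\<^esub> A = {c *\<^sub>R A | c. c \<noteq> 0}" for A :: "real^'n^'n"
    unfolding r_coset_def scalar_matrices_def GL_def by (auto simp flip: scalar_matrix_assoc)
  then show ?thesis by (auto simp: PGL_def FactGroup_def RCOSETS_def GL_def)
qed

lemma PGL_mult: "A \<in> X \<Longrightarrow> A' \<in> Y \<Longrightarrow> A ** A' \<in> X \<otimes>\<^bsub>PGL\<^esub> Y"
  by (auto simp: PGL_def FactGroup_def set_mult_def GL_def)

lemma PGL_elem:
  assumes "X \<in> carrier PGL" "A \<in> X"
  shows "invertible A" "X = {c *\<^sub>R A | c. c \<noteq> 0}"
proof -
  obtain A0 where A0: "invertible A0" "X = {c *\<^sub>R A0 | c. c \<noteq> 0}" using assms carrier_PGL by blast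
  then obtain c where c: "c \<noteq> 0" "A = c *\<^sub>R A0" using assms by blast
  show "invertible A" unfolding c(2) by (rule scalar_invertible[OF c(1) A0(1)])
  show "X = {c *\<^sub>R A | c. c \<noteq> 0}"
  proof (intro equalityI subsetI)
    fix Y assume "Y \<in> X"
    then obtain b where "b \<noteq> 0" "Y = b *\<^sub>R A0" using A0 by blast
    then show "Y \<in> {c *\<^sub>R A | c. c \<noteq> 0}" using c by (intro CollectI exI[of _ "b / c"]) simp
  next
    fix Y assume "Y \<in> {c *\<^sub>R A | c. c \<noteq> 0}"
    then obtain b where "b \<noteq> 0" "Y = b *\<^sub>R A" by blast
    then show "Y \<in> X" unfolding A0(2) using c by (intro CollectI exI[of _ "b * c"]) simp
  qed
qed

lemma PGL_one: "mat 1 \<in> \<one>\<^bsub>PGL\<^esub>"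
  by (auto simp: PGL_def FactGroup_def scalar_matrices_def intro: exI[of _ 1])

definition proj_matrix_rep :: "('g, 'm) monoid_scheme \<Rightarrow> ('g \<Rightarrow> real^'n^'n) \<Rightarrow> bool" where
  "proj_matrix_rep G E \<longleftrightarrow>
     (\<forall>g\<in>carrier G. invertible (E g)) \<and>
     (\<forall>g\<in>carrier G. \<forall>h\<in>carrier G. \<exists>t. t \<noteq> 0 \<and> E (g \<otimes>\<^bsub>G\<^esub> h) = t *\<^sub>R (E g ** E h)) \<and>
     (\<forall>g\<in>carrier G. \<exists>t. t \<noteq> 0 \<and> E g ** E (inv\<^bsub>G\<^esub> g) = t *\<^sub>R mat 1 \<and> E (inv\<^bsub>G\<^esub> g) ** E g = t *\<^sub>R mat 1)"

context marked_group begin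

lemma gap_system_mv:
  assumes E: "proj_matrix_rep G E" and cq: "0 < c" "0 < q" "q < 1"
    and top: "\<And>g. g \<in> carrier G \<Longrightarrow> \<exists>e h. top_gap ((*v) (E g)) e h (c * q ^ wl g)"
  shows "gap_system G S (\<lambda>g. (*v) (E g)) c q"
proof (rule gap_system.intro[OF marked_group_axioms], rule gap_system_axioms.intro)
  fix g assume g: "g \<in> carrier G"
  show "linear ((*v) (E g))" by simp
  show "\<exists>e h. top_gap ((*v) (E g)) e h (c * q ^ wl g)" by (rule top[OF g])
  obtain t where t: "t \<noteq> 0" "E g ** E (inv g) = t *\<^sub>R mat 1" "E (inv g) ** E g = t *\<^sub>R mat 1"
    using E g unfolding proj_matrix_rep_def by blast
  show "\<exists>t. t \<noteq> 0 \<and> (\<forall>h\<in>carrier G. \<forall>v. E h *v (E g *v (E (inv g) *v v)) = t *\<^sub>R (E h *v v) \<and>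
        E (inv g) *v (E g *v (E h *v v)) = t *\<^sub>R (E h *v v))"
  proof (intro exI[of _ t] conjI ballI allI t(1))
    fix h v
    have "E g *v (E (inv g) *v v) = t *\<^sub>R v" for v by (simp add: matrix_vector_mul_assoc t(2) flip: scaleR_matrix_vector_assoc)
    then show "E h *v (E g *v (E (inv g) *v v)) = t *\<^sub>R (E h *v v)" by (simp add: matrix_vector_mult_scaleR)
    show "E (inv g) *v (E g *v (E h *v v)) = t *\<^sub>R (E h *v v)"
      by (simp add: matrix_vector_mul_assoc[of "E (inv g)"] t(3) flip: scaleR_matrix_vector_assoc)
  qed
next
  fix g h assume gh: "g \<in> carrier G" "h \<in> carrier G"
  obtain t where t: "t \<noteq> 0" "E (g \<otimes> h) = t *\<^sub>R (E g ** E h)" using E gh unfolding proj_matrix_rep_def by blast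
  then show "\<exists>t. t \<noteq> 0 \<and> (\<forall>v. E (g \<otimes> h) *v v = t *\<^sub>R (E g *v (E h *v v)))"
    by (intro exI[of _ t]) (simp add: matrix_vector_mul_assoc flip: scaleR_matrix_vector_assoc)
qed (use cq in auto)

lemma gap_system_Lam:
  assumes E: "proj_matrix_rep G E" and cq: "0 < c" "0 < q" "q < 1"
    and top: "\<And>g. g \<in> carrier G \<Longrightarrow> \<exists>e h. top_gap (Lam (E g)) e h (c * q ^ wl g)"
  shows "gap_system G S (\<lambda>g. Lam (E g)) c q"
proof (rule gap_system.intro[OF marked_group_axioms], rule gap_system_axioms.intro)
  fix g assume g: "g \<in> carrier G"
  show "linear (Lam (E g))" by (rule linear_Lam)
  show "\<exists>e h. top_gap (Lam (E g)) e h (c * q ^ wl g)" by (rule top[OF g])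
  obtain t where t: "t \<noteq> 0" "E g ** E (inv g) = t *\<^sub>R mat 1" "E (inv g) ** E g = t *\<^sub>R mat 1"
    using E g unfolding proj_matrix_rep_def by blast
  show "\<exists>t. t \<noteq> 0 \<and> (\<forall>h\<in>carrier G. \<forall>v. Lam (E h) (Lam (E g) (Lam (E (inv g)) v)) = t *\<^sub>R Lam (E h) v \<and>
        Lam (E (inv g)) (Lam (E g) (Lam (E h) v)) = t *\<^sub>R Lam (E h) v)"
  proof (intro exI[of _ "t\<^sup>2"] conjI ballI allI)
    show "t\<^sup>2 \<noteq> 0" using t(1) by simp
    fix h v
    \<comment> \<open>The two operators do not cancel to a scalar but to a multiple of
      \<open>skew = Lam (mat 1)\<close>, which is then absorbed by \<open>Lam (E h)\<close>. The
      scalar is squared since \<open>Lam\<close> is quadratic in the matrix.\<close>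
    have 1: "Lam (E g) (Lam (E (inv g)) w) = t\<^sup>2 *\<^sub>R Lam (mat 1) w"
      "Lam (E (inv g)) (Lam (E g) w) = t\<^sup>2 *\<^sub>R Lam (mat 1) w" for w
      unfolding Lam_mult[symmetric] t(2,3) Lam_scale by simp_all
    show "Lam (E h) (Lam (E g) (Lam (E (inv g)) v)) = t\<^sup>2 *\<^sub>R Lam (E h) v"
    proof -
      have "Lam (E h) (Lam (E g) (Lam (E (inv g)) v)) = t\<^sup>2 *\<^sub>R Lam (E h) (Lam (mat 1) v)"
        by (simp only: 1 linear_scale[OF linear_Lam])
      also have "Lam (E h) (Lam (mat 1) v) = Lam (E h ** mat 1) v" by (rule Lam_mult[symmetric])
      finally show ?thesis by simp
    qed
    show "Lam (E (inv g)) (Lam (E g) (Lam (E h) v)) = t\<^sup>2 *\<^sub>R Lam (E h) v"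
    proof -
      have "Lam (E (inv g)) (Lam (E g) (Lam (E h) v)) = t\<^sup>2 *\<^sub>R Lam (mat 1) (Lam (E h) v)" by (simp only: 1)
      also have "Lam (mat 1) (Lam (E h) v) = Lam (mat 1 ** E h) v" by (rule Lam_mult[symmetric])
      finally show ?thesis by simp
    qed
  qed
next
  fix g h assume gh: "g \<in> carrier G" "h \<in> carrier G"
  obtain t where t: "t \<noteq> 0" "E (g \<otimes> h) = t *\<^sub>R (E g ** E h)" using E gh unfolding proj_matrix_rep_def by blast
  then show "\<exists>t. t \<noteq> 0 \<and> (\<forall>v. Lam (E (g \<otimes> h)) v = t *\<^sub>R Lam (E g) (Lam (E h) v))"
    by (intro exI[of _ "t\<^sup>2"]) (simp add: Lam_scale Lam_mult)
qed (use cq in auto)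

end

locale rep_setup = marked_group G S for G :: "'g monoid" (structure) and S +
  fixes B :: "real^'n \<Rightarrow> real^'n \<Rightarrow> real" and T T' :: "real^'n^'n"
  assumes card3: "3 \<le> CARD('n)" and TT: "T ** T' = mat 1" "T' ** T = mat 1"
    and B: "\<And>u v. B u v = (T *v u) \<bullet> (T *v v)"
begin

lemma T_inv: "T *v (T' *v v) = v" "T' *v (T *v v) = v"
  by (simp_all add: matrix_vector_mul_assoc TT)

text \<open>The matrix \<open>T\<close> carries \<open>B\<close> to the standard inner product, and \<open>m\<close> picks representing matrices.\<close>

definition selection :: "('g \<Rightarrow> (real^'n^'n) set) \<Rightarrow> ('g \<Rightarrow> real^'n^'n) \<Rightarrow> bool" where
  "selection \<rho> m \<longleftrightarrow> \<rho> \<in> representations G \<and> (\<forall>g\<in>carrier G. m g \<in> \<rho> g)"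

definition D :: "('g \<Rightarrow> real^'n^'n) \<Rightarrow> 'g \<Rightarrow> real^'n^'n" where
  "D m g = T ** m g ** T'"

text \<open>The contragredient of \<open>D\<close>, up to scalars. Its image directions are those
  which \<open>D m g\<close> stretches least, and its limit lines are the normals of the limit
  hyperplanes.\<close>

definition E :: "('g \<Rightarrow> real^'n^'n) \<Rightarrow> 'g \<Rightarrow> real^'n^'n" where
  "E m g = transpose (D m (inv g))"

lemma conj_mult: "(T ** X ** T') ** (T ** Y ** T') = T ** (X ** Y) ** T'"
proof -
  have "(T ** X ** T') ** (T ** Y ** T') = T ** X ** (T' ** T) ** Y ** T'" by (simp only: matrix_mul_assoc)
  then show ?thesis by (simp add: TT matrix_mul_assoc)
qed

lemma conj_scale: "T ** (c *\<^sub>R X) ** T' = c *\<^sub>R (T ** X ** T')"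
  by (simp add: matrix_scalar_ac flip: scalar_matrix_assoc)

lemma conj_invertible: "invertible X \<Longrightarrow> invertible (T ** X ** T')"
  using TT by (intro invertible_mult) (auto simp: invertible_def)

context
  fixes \<rho> m assumes sel: "selection \<rho> m"
begin

lemma rho: "g \<in> carrier G \<Longrightarrow> \<rho> g \<in> carrier PGL" "g \<in> carrier G \<Longrightarrow> h \<in> carrier G \<Longrightarrow> \<rho> (g \<otimes> h) = \<rho> g \<otimes>\<^bsub>PGL\<^esub> \<rho> h"
  "g \<in> carrier G \<Longrightarrow> m g \<in> \<rho> g"
  using sel by (auto simp: selection_def representations_def hom_def)

lemma rho_elem: "g \<in> carrier G \<Longrightarrow> A \<in> \<rho> g \<Longrightarrow> \<exists>t. t \<noteq> 0 \<and> m g = t *\<^sub>R A"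
proof -
  assume g: "g \<in> carrier G" "A \<in> \<rho> g"
  have "m g \<in> {c *\<^sub>R A | c. c \<noteq> 0}" using rho(3)[OF g(1)] unfolding PGL_elem(2)[OF rho(1)[OF g(1)] g(2)] .
  then show "\<exists>t. t \<noteq> 0 \<and> m g = t *\<^sub>R A" by blast
qed

lemma rho_inverse:
  assumes g: "g \<in> carrier G" and A: "A \<in> \<rho> g" "M \<in> \<rho> (inv g)"
  shows "\<exists>t. t \<noteq> 0 \<and> M ** A = t *\<^sub>R mat 1 \<and> A ** M = t *\<^sub>R mat 1"
proof -
  interpret P: group "PGL :: (real^'n^'n) set monoid" by (rule group_PGL)
  have h: "\<rho> \<in> hom G PGL" using sel by (simp add: selection_def representations_def)
  have "\<rho> \<one> = \<one>\<^bsub>PGL\<^esub>" using hom_one[OF h group_axioms group_PGL] .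
  then have "M ** A \<in> \<one>\<^bsub>PGL\<^esub>" using PGL_mult[OF A(2,1)] rho(2)[of "inv g" g] g by simp
  then obtain t where t: "t \<noteq> 0" "M ** A = t *\<^sub>R mat 1"
    using PGL_elem(2)[OF P.one_closed PGL_one] by blast
  then have "((1 / t) *\<^sub>R M) ** A = mat 1" by (simp flip: scalar_matrix_assoc)
  then have "A ** ((1 / t) *\<^sub>R M) = mat 1" using matrix_left_right_inverse by blast
  then have "(1 / t) *\<^sub>R (A ** M) = mat 1" by (simp add: matrix_scalar_ac flip: scalar_matrix_assoc)
  then have "A ** M = t *\<^sub>R mat 1" using t(1) by (metis divide_self_if scaleR_one scaleR_scaleR times_divide_eq_right mult.right_neutral)
  then show ?thesis using t by blast
qed

lemma D_rep: "proj_matrix_rep G (D m)"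
  unfolding proj_matrix_rep_def
proof (intro conjI ballI)
  fix g assume g: "g \<in> carrier G"
  show "invertible (D m g)" unfolding D_def by (rule conj_invertible[OF PGL_elem(1)[OF rho(1)[OF g] rho(3)[OF g]]])
  obtain t where t: "t \<noteq> 0" "m (inv g) ** m g = t *\<^sub>R mat 1" "m g ** m (inv g) = t *\<^sub>R mat 1"
    using rho_inverse[OF g rho(3)[OF g] rho(3)] g by blast
  have "T ** (t *\<^sub>R mat 1) ** T' = t *\<^sub>R mat 1" unfolding conj_scale by (simp add: TT)
  then show "\<exists>t. t \<noteq> 0 \<and> D m g ** D m (inv g) = t *\<^sub>R mat 1 \<and> D m (inv g) ** D m g = t *\<^sub>R mat 1"
    using t unfolding D_def conj_mult by metis
  fix h assume h: "h \<in> carrier G"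
  have "m g ** m h \<in> \<rho> (g \<otimes> h)" using PGL_mult rho g h by metis
  then obtain u where u: "u \<noteq> 0" "m (g \<otimes> h) = u *\<^sub>R (m g ** m h)" using rho_elem g h by blast
  then show "\<exists>t. t \<noteq> 0 \<and> D m (g \<otimes> h) = t *\<^sub>R (D m g ** D m h)"
    unfolding D_def conj_mult by (intro exI[of _ u]) (simp add: conj_scale)
qed

lemma E_rep: "proj_matrix_rep G (E m)"
  unfolding proj_matrix_rep_def
proof (intro conjI ballI)
  note R = D_rep[unfolded proj_matrix_rep_def]
  fix g assume g: "g \<in> carrier G"
  show "invertible (E m g)" unfolding E_def using R g by (intro transpose_invertible) auto
  obtain t where t: "t \<noteq> 0" "D m g ** D m (inv g) = t *\<^sub>R mat 1" "D m (inv g) ** D m g = t *\<^sub>R mat 1"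
    using R g by blast
  have tr: "transpose (t *\<^sub>R mat 1) = (t *\<^sub>R mat 1 :: real^'n^'n)" by (simp add: transpose_scalar transpose_mat)
  show "\<exists>t. t \<noteq> 0 \<and> E m g ** E m (inv g) = t *\<^sub>R mat 1 \<and> E m (inv g) ** E m g = t *\<^sub>R mat 1"
    using t g tr unfolding E_def matrix_transpose_mul[symmetric] by (intro exI[of _ t]) simp
  fix h assume h: "h \<in> carrier G"
  obtain u where "u \<noteq> 0" "D m (inv h \<otimes> inv g) = u *\<^sub>R (D m (inv h) ** D m (inv g))" using R g h by (meson inv_closed)
  then show "\<exists>t. t \<noteq> 0 \<and> E m (g \<otimes> h) = t *\<^sub>R (E m g ** E m h)"
    unfolding E_def matrix_transpose_mul[symmetric] using g h by (intro exI[of _ u]) (simp add: inv_mult_group transpose_scalar)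
qed

lemma anosov_gap:
  assumes an: "anosov G S B p \<rho>" and p: "1 \<le> p" "Suc p \<le> CARD('n)"
  obtains c q where "0 < c" "0 < q" "q < 1"
    "\<And>g A \<sigma> e f. g \<in> carrier G \<Longrightarrow> A \<in> \<rho> g \<Longrightarrow> std_svd (T ** A ** T') \<sigma> e f \<Longrightarrow> \<sigma> (Suc p) / \<sigma> p \<le> c * q ^ wl g"
proof -
  obtain c \<mu> where c: "0 < c" "0 < \<mu>"
    and a: "\<And>g A. g \<in> carrier G \<Longrightarrow> A \<in> \<rho> g \<Longrightarrow> singular_value B (p + 1) A / singular_value B p A \<le> c * exp (- \<mu> * real (wl g))"
    using an unfolding anosov_def by blast
  show ?thesis
  proof (rule that[of c "exp (- \<mu>)"])
    fix g A \<sigma> e f assume g: "g \<in> carrier G" "A \<in> \<rho> g" and s: "std_svd (T ** A ** T') \<sigma> e f"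
    have "exp (- \<mu> * real (wl g)) = exp (- \<mu>) ^ wl g" by (simp add: exp_of_nat_mult[symmetric] mult.commute)
    then show "\<sigma> (Suc p) / \<sigma> p \<le> c * exp (- \<mu>) ^ wl g"
      using a[OF g] singular_value_eq[OF TT B s] p by simp
  qed (use c in auto)
qed

end

text \<open>Witnesses of both Anosov inequalities, the primed ones for the second gap, with the
  exponential rate written as a base below 1. The inequalities concern all representing matrices and
  all decompositions, whichever are picked later.\<close>

definition good :: "('g \<Rightarrow> (real^'n^'n) set) \<Rightarrow> ('g \<Rightarrow> real^'n^'n) \<Rightarrow> real \<Rightarrow> real \<Rightarrow> real \<Rightarrow> real \<Rightarrow> bool" where
  "good \<rho> m c q c' q' \<longleftrightarrow> selection \<rho> m \<and> 0 < c \<and> 0 < q \<and> q < 1 \<and> 0 < c' \<and> 0 < q' \<and> q' < 1 \<and>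
     (\<forall>g\<in>carrier G. \<forall>A\<in>\<rho> g. \<forall>\<sigma> e f. std_svd (T ** A ** T') \<sigma> e f \<longrightarrow>
        \<sigma> 2 / \<sigma> 1 \<le> c * q ^ wl g \<and> \<sigma> 3 / \<sigma> 2 \<le> c' * q' ^ wl g)"

lemma ex_good:
  assumes "selection \<rho> m" "anosov G S B 1 \<rho>" "anosov G S B 2 \<rho>"
  shows "\<exists>c q c' q'. good \<rho> m c q c' q'"
proof (rule anosov_gap[OF assms(1,2)])
  fix c q assume 1: "0 < c" "0 < q" "q < 1"
    "\<And>g A \<sigma> e f. g \<in> carrier G \<Longrightarrow> A \<in> \<rho> g \<Longrightarrow> std_svd (T ** A ** T') \<sigma> e f \<Longrightarrow> \<sigma> (Suc 1) / \<sigma> 1 \<le> c * q ^ wl g"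
  show ?thesis
  proof (rule anosov_gap[OF assms(1,3)])
    fix c' q' assume 2: "0 < c'" "0 < q'" "q' < 1"
      "\<And>g A \<sigma> e f. g \<in> carrier G \<Longrightarrow> A \<in> \<rho> g \<Longrightarrow> std_svd (T ** A ** T') \<sigma> e f \<Longrightarrow> \<sigma> (Suc 2) / \<sigma> 2 \<le> c' * q' ^ wl g"
    have n: "Suc 1 = 2" "Suc 2 = 3" by simp_all
    have "good \<rho> m c q c' q'"
      unfolding good_def
    proof (intro conjI ballI allI impI)
      fix g A \<sigma> e f assume a: "g \<in> carrier G" "A \<in> \<rho> g" "std_svd (T ** A ** T') \<sigma> e f"
      show "\<sigma> 2 / \<sigma> 1 \<le> c * q ^ wl g" using 1(4)[OF a] unfolding n .
      show "\<sigma> 3 / \<sigma> 2 \<le> c' * q' ^ wl g" using 2(4)[OF a] unfolding n .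
    qed (use assms(1) 1(1-3) 2(1-3) in auto)
    then show ?thesis by blast
  qed (use card3 in auto)
qed (use card3 in auto)

end

section \<open>Boundary maps\<close>

lemma even_nbhd:
  fixes F :: "'a::real_normed_vector \<Rightarrow> 'b::metric_space"
  assumes ev: "\<And>x. F (- x) = F x" and F: "isCont F l" and e: "0 < e"
  obtains d where "0 < d" "\<And>x. ldist x l < d \<Longrightarrow> dist (F x) (F l) < e"
proof -
  obtain d where d: "0 < d" "\<And>x. dist x l < d \<Longrightarrow> dist (F x) (F l) < e"
    using F e unfolding continuous_at_eps_delta by blast
  have "dist (F x) (F l) < e" if x: "ldist x l < d" for x
  proof (cases "norm (x - l) \<le> norm (x + l)")
    case True
    then show ?thesis using d(2)[of x] x by (simp add: ldist_def dist_norm)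
  next
    case False
    have "norm (- x - l) = norm (x + l)" by (metis add_uminus_conv_diff minus_add_distrib norm_minus_cancel)
    then have "dist (F (- x)) (F l) < e" using d(2)[of "- x"] x False by (simp add: ldist_def dist_norm)
    then show ?thesis by (simp add: ev)
  qed
  then show ?thesis using that d(1) by blast
qed

abbreviation (in marked_group) "boundary \<equiv> gromov_boundary G S"

lemma (in marked_group) topspace_boundary: "topspace boundary = cls ` rays"
  unfolding gromov_boundary_def topspace_quotient_topology by (auto simp: geodesic_rays_def PiE_def Pi_def)

lemma (in marked_group) cls_mem:
  assumes "r \<in> rays" "s \<in> cls r"
  shows "s \<in> rays" "cls r = cls s"
proof -
  show s: "s \<in> rays" by (rule cls_rays[OF assms(2)])
  show "cls r = cls s" using assms(2) unfolding cls_eq_iff[OF assms(1) s] by (simp add: asymptotic_class_def)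
qed

lemma (in gap_system) even_lim_some:
  assumes ev: "\<And>x. F (- x) = F x" and r: "r \<in> rays"
  shows "F (lim (SOME r'. r' \<in> cls r)) = F (lim r)"
proof -
  let ?r = "SOME r'. r' \<in> cls r"
  have m: "?r \<in> cls r" using cls_self[OF r] by (rule someI[of "\<lambda>r'. r' \<in> cls r"])
  note rr = cls_mem(1)[OF r m]
  have "ldist (lim r) (lim ?r) = 0" by (rule lim_cls[OF r rr cls_mem(2)[OF r m]])
  then obtain t where "t = 1 \<or> t = -1" "lim r = t *\<^sub>R lim ?r" using ldist_unit_multiple[OF lim(1)[OF r] lim(1)[OF rr]] by blast
  then show ?thesis using ev by auto
qed

text \<open>The boundary is a quotient of the space of rays, so continuity may be tested there; rays
  that share their first \<open>n\<close> vertices with \<open>r\<close> form an open set, on which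
  \<open>lim_continuous\<close> applies. Evenness of \<open>F\<close> removes the dependence on the
  sign and on the chosen ray.\<close>

lemma (in gap_system) continuous_map_lim:
  fixes F :: "'a \<Rightarrow> 'b::metric_space"
  assumes ev: "\<And>x. F (- x) = F x" and F: "\<And>x. isCont F x"
  shows "continuous_map boundary euclidean (\<lambda>x. F (lim (SOME r. r \<in> x)))"
proof -
  let ?X = "subtopology (product_topology (\<lambda>_. discrete_topology (carrier G)) (UNIV :: nat set)) rays"
  have tX: "topspace ?X = rays" by (auto simp: geodesic_rays_def PiE_def Pi_def)
  have q: "quotient_map ?X boundary cls" unfolding gromov_boundary_def by (rule quotient_map_quotient_topology)
  note some = even_lim_some[of F, OF ev]
  have "continuous_map ?X euclidean (\<lambda>r. F (lim r))"
    unfolding continuous_map_def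
  proof (intro conjI allI impI)
    show "(\<lambda>r. F (lim r)) \<in> topspace ?X \<rightarrow> topspace euclidean" by simp
    fix U :: "'b set" assume U: "openin euclidean U"
    show "openin ?X {r \<in> topspace ?X. F (lim r) \<in> U}"
    proof (subst openin_subopen, intro ballI)
      fix r assume "r \<in> {r \<in> topspace ?X. F (lim r) \<in> U}"
      then have r: "r \<in> rays" "F (lim r) \<in> U" using tX by auto
      obtain e where e: "0 < e" "ball (F (lim r)) e \<subseteq> U" using U r(2) by (metis open_contains_ball open_openin)
      obtain d where d: "0 < d" "\<And>x. ldist x (lim r) < d \<Longrightarrow> dist (F x) (F (lim r)) < e"
        by (rule even_nbhd[of F, OF ev F e(1)]) (rule that)
      have "\<forall>\<^sub>F n in sequentially. 2 * cst r * q ^ n < d" by (rule order_tendstoD(2)[OF qpow_tendsto d(1)])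
      then obtain n where n: "2 * cst r * q ^ n < d" by (auto simp: eventually_sequentially)
      let ?V = "{r' \<in> rays. \<forall>k\<le>n. r' k = r k}"
      have "openin ?X ?V"
      proof -
        have "openin (product_topology (\<lambda>_. discrete_topology (carrier G)) (UNIV :: nat set)) (PiE UNIV (\<lambda>k. if k \<le> n then {r k} else carrier G))"
        proof (rule product_topology_basis)
          show "openin (discrete_topology (carrier G)) (if k \<le> n then {r k} else carrier G)" for k
            using raysD(1)[OF r(1)] by simp
          show "finite {k. (if k \<le> n then {r k} else carrier G) \<noteq> topspace (discrete_topology (carrier G))}"
            by (rule finite_subset[of _ "{..n}"]) (auto split: if_splits)
        qed
        moreover have "?V = PiE UNIV (\<lambda>k. if k \<le> n then {r k} else carrier G) \<inter> rays"
        proof -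
          have "r' \<in> PiE UNIV (\<lambda>k. if k \<le> n then {r k} else carrier G) \<longleftrightarrow> (\<forall>k\<le>n. r' k = r k)" if r': "r' \<in> rays" for r'
            unfolding PiE_iff using raysD(1)[OF r'] by simp
          then show ?thesis by blast
        qed
        ultimately show ?thesis unfolding openin_subtopology by blast
      qed
      moreover have "r \<in> ?V" using r by simp
      moreover have "?V \<subseteq> {r \<in> topspace ?X. F (lim r) \<in> U}"
      proof
        fix r' assume r': "r' \<in> ?V"
        then have "ldist (lim r') (lim r) < d" using lim_continuous[OF r(1), of r' n] n ldist_commute[of "lim r"] by auto
        then have "F (lim r') \<in> U" using d(2) e(2) by (auto simp: dist_commute)
        then show "r' \<in> {r \<in> topspace ?X. F (lim r) \<in> U}" using r' tX by simp
      qed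
      ultimately show "\<exists>V. openin ?X V \<and> r \<in> V \<and> V \<subseteq> {r \<in> topspace ?X. F (lim r) \<in> U}" by blast
    qed
  qed
  then have "continuous_map ?X euclidean ((\<lambda>x. F (lim (SOME r. r \<in> x))) \<circ> cls)"
    by (rule continuous_map_eq) (simp only: tX o_apply some)
  then show ?thesis using continuous_compose_quotient_map_eq[OF q] by blast
qed

section \<open>Boundary maps as fixed spaces of projections\<close>

context rep_setup begin

definition Q1 :: "real^'n \<Rightarrow> real^'n^'n" where "Q1 h = T' ** outer h ** T"
text \<open>For a unit wedge \<open>H\<close>, the projection onto the kernel of
  \<open>H ** T\<close>, by \<open>unit_wedge_square\<close>.\<close>

definition Q3 :: "real^'n^'n \<Rightarrow> real^'n^'n" where "Q3 H = T' ** (mat 1 + 2 *\<^sub>R (H ** H)) ** T"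

lemma Q1_mult: "Q1 h *v v = (h \<bullet> (T *v v)) *\<^sub>R (T' *v h)"
  by (simp add: Q1_def outer_mult matrix_vector_mult_scaleR flip: matrix_vector_mul_assoc)

lemma Q3_mult: "Q3 H *v v = v + T' *v (2 *\<^sub>R (H *v (H *v (T *v v))))"
  by (simp add: Q3_def matrix_vector_mult_add_rdistrib matrix_vector_right_distrib T_inv
      flip: matrix_vector_mul_assoc scaleR_matrix_vector_assoc)

lemma Q1_fix: "norm h = 1 \<Longrightarrow> {v. Q1 h *v v = v} = {v. \<exists>t. T *v v = t *\<^sub>R h}"
proof (intro equalityI subsetI)
  fix v assume "v \<in> {v. Q1 h *v v = v}"
  then have "T *v v = T *v ((h \<bullet> (T *v v)) *\<^sub>R (T' *v h))" by (simp add: Q1_mult)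
  then show "v \<in> {v. \<exists>t. T *v v = t *\<^sub>R h}" by (auto simp: matrix_vector_mult_scaleR T_inv)
next
  fix v assume h: "norm h = 1" and "v \<in> {v. \<exists>t. T *v v = t *\<^sub>R h}"
  then obtain t where t: "T *v v = t *\<^sub>R h" by blast
  have "T' *v (T *v v) = t *\<^sub>R (T' *v h)" by (simp add: t matrix_vector_mult_scaleR)
  then have v: "v = t *\<^sub>R (T' *v h)" by (simp add: T_inv)
  have "h \<bullet> h = 1" using h by (simp add: norm_eq_1)
  then have "h \<bullet> (T *v v) = t" unfolding t by simp
  then show "v \<in> {v. Q1 h *v v = v}" by (simp add: Q1_mult flip: v)
qed

lemma Q3_fix:
  assumes ab: "orthonormal_pair a b"
  shows "{v. Q3 (unit_wedge a b) *v v = v} = {v. unit_wedge a b *v (T *v v) = 0}"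
proof -
  have "Q3 (unit_wedge a b) *v v = v \<longleftrightarrow> unit_wedge a b *v (T *v v) = 0" for v
  proof -
    let ?w = "(a \<bullet> (T *v v)) *\<^sub>R a + (b \<bullet> (T *v v)) *\<^sub>R b"
    have "Q3 (unit_wedge a b) *v v = v \<longleftrightarrow> T' *v (- ?w) = 0"
      unfolding Q3_mult unit_wedge_square[OF ab] by simp
    also have "\<dots> \<longleftrightarrow> ?w = 0"
    proof
      assume "T' *v (- ?w) = 0"
      then have "T *v (T' *v (- ?w)) = 0" by simp
      then show "?w = 0" unfolding T_inv neg_equal_0_iff_equal .
    qed simp
    also have "\<dots> \<longleftrightarrow> unit_wedge a b *v (T *v v) = 0" unfolding pair_comb_eq_0[OF ab] unit_wedge_ker[OF ab] ..
    finally show ?thesis .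
  qed
  then show ?thesis by simp
qed

lemma Q1_props:
  assumes h: "norm h = 1"
  shows "subspace {v. Q1 h *v v = v}" "dim {v. Q1 h *v v = v} = 1" "Q1 h *v (Q1 h *v v) = Q1 h *v v"
proof -
  have hh: "h \<bullet> h = 1" using h by (simp add: norm_eq_1)
  show "subspace {v. Q1 h *v v = v}" by (auto simp: subspace_def matrix_vector_right_distrib matrix_vector_mult_scaleR)
  show "Q1 h *v (Q1 h *v v) = Q1 h *v v" by (simp add: Q1_mult matrix_vector_mult_scaleR T_inv hh)
  have "{v. Q1 h *v v = v} = span {T' *v h}"
  proof (intro equalityI subsetI)
    fix v assume "v \<in> {v. Q1 h *v v = v}"
    then have "v = (h \<bullet> (T *v v)) *\<^sub>R (T' *v h)" by (simp add: Q1_mult)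
    then show "v \<in> span {T' *v h}" by (metis span_base span_mul singletonI)
  next
    fix v assume "v \<in> span {T' *v h}"
    then obtain t where "v = t *\<^sub>R (T' *v h)" by (auto simp: span_singleton)
    then show "v \<in> {v. Q1 h *v v = v}" by (simp add: Q1_mult matrix_vector_mult_scaleR T_inv hh)
  qed
  moreover have "T' *v h \<noteq> 0"
  proof
    assume "T' *v h = 0"
    then have "T *v (T' *v h) = 0" by simp
    then show False using h unfolding T_inv by simp
  qed
  ultimately show "dim {v. Q1 h *v v = v} = 1" by (simp add: dim_span dim_eq_card_independent)
qed

lemma Q3_props:
  assumes ab: "orthonormal_pair a b"
  shows "subspace {v. Q3 (unit_wedge a b) *v v = v}" "dim {v. Q3 (unit_wedge a b) *v v = v} = CARD('n) - 2"
    "Q3 (unit_wedge a b) *v (Q3 (unit_wedge a b) *v v) = Q3 (unit_wedge a b) *v v"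
proof -
  show "subspace {v. Q3 (unit_wedge a b) *v v = v}" "dim {v. Q3 (unit_wedge a b) *v v = v} = CARD('n) - 2"
    unfolding Q3_fix[OF ab] by (rule dim_ker_pair[OF TT ab])+
  let ?v = "Q3 (unit_wedge a b) *v v"
  let ?s = "a \<bullet> (T *v v)" and ?t = "b \<bullet> (T *v v)"
  have "T *v ?v = T *v v - (?s *\<^sub>R a + ?t *\<^sub>R b)"
    unfolding Q3_mult unit_wedge_square[OF ab] by (simp add: matrix_vector_right_distrib T_inv matrix_vector_mult_diff_distrib)
  then have "a \<bullet> (T *v ?v) = 0 \<and> b \<bullet> (T *v ?v) = 0"
    using ab by (simp add: orthonormal_pair_def inner_diff_right inner_add_right inner_commute)
  then have "?v \<in> {v. Q3 (unit_wedge a b) *v v = v}" unfolding Q3_fix[OF ab] unit_wedge_ker[OF ab] by simp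
  then show "Q3 (unit_wedge a b) *v ?v = ?v" by simp
qed

lemma isCont_Q1: "isCont Q1 h"
  unfolding isCont_def Q1_def by (intro tendsto_matrix_mult tendsto_const isCont_outer[unfolded isCont_def])

lemma isCont_Q3: "isCont Q3 H"
  unfolding isCont_def Q3_def by (intro tendsto_intros tendsto_matrix_mult)

lemma Q1_minus: "Q1 (- h) = Q1 h" by (simp add: Q1_def outer_minus)

lemma Q3_minus: "Q3 (- H) = Q3 H"
proof -
  have "(- H) ** (- H) = H ** H" by (simp add: matrix_matrix_mult_def vec_eq_iff)
  then show ?thesis by (simp add: Q3_def)
qed

text \<open>\<open>Q\<close> turns a top direction of the system into a projection onto the space of
  longest axes, and \<open>ok\<close> singles out the directions for which it is one, of rank
  \<open>k\<close>. As \<open>axes\<close> covers whatever \<open>longest_axes_space\<close>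
  selects, the choices along a ray converge with the directions, and asymptotic rays give the same
  space.\<close>

lemma boundary_map_eq:
  fixes Q :: "'a::euclidean_space \<Rightarrow> real^'n^'n"
  assumes gs: "gap_system G S R c q" and Q: "\<And>h. isCont Q h" "\<And>h. Q (- h) = Q h"
    and axes: "\<And>g. g \<in> carrier G \<Longrightarrow> \<exists>h\<in>gap_system.tops G S R c q g. ok h \<and> longest_axes_space B k (\<rho> g) = {v. Q h *v v = v}"
    and ok: "\<And>h. ok h \<Longrightarrow> subspace {v. Q h *v v = v} \<and> dim {v. Q h *v v = v} = k \<and> (\<forall>v. Q h *v (Q h *v v) = Q h *v v)"
    and okl: "\<And>r. r \<in> rays \<Longrightarrow> ok (gap_system.lim G S R c q r)" and r: "r \<in> rays"
  shows "boundary_map G S B \<rho> k (cls r) = {v. Q (gap_system.lim G S R c q r) *v v = v}"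
proof -
  interpret gap_system G S R c q by (rule gs)
  let ?L = "\<lambda>s. {v. Q (lim s) *v v = v}"
  have *: "limitin (grassmannian k) (\<lambda>n. longest_axes_space B k (\<rho> (s n))) X sequentially \<longleftrightarrow> X = ?L s" if s: "s \<in> rays" for s X
  proof -
    have "\<forall>n. \<exists>h. h \<in> tops (s n) \<and> ok h \<and> longest_axes_space B k (\<rho> (s n)) = {v. Q h *v v = v}"
      using axes[OF raysD(1)[OF s]] by blast
    then obtain h where h: "\<And>n. h n \<in> tops (s n)" "\<And>n. ok (h n)" "\<And>n. longest_axes_space B k (\<rho> (s n)) = {v. Q (h n) *v v = v}" by metis
    have "(\<lambda>n. ldist (h n) (lim s)) \<longlonglongrightarrow> 0"
      by (rule tendsto_sandwich[OF always_eventually always_eventually tendsto_const qpow_tendsto[of "cst s"]])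
        (use lim_ray[OF s h(1)] ldist_nonneg in auto)
    then have "(\<lambda>n. Q (h n)) \<longlonglongrightarrow> Q (lim s)" by (rule even_tendsto[OF _ Q(2) Q(1)])
    then show ?thesis
      unfolding h(3) by (rule limitin_grassmannian[rotated 4]) (use ok[OF h(2)] ok[OF okl[OF s]] in auto)
  qed
  have eq: "?L s = ?L r" if s: "s \<in> cls r" for s
  proof -
    note sr = cls_mem(1)[OF r s]
    have "ldist (lim r) (lim s) = 0" by (rule lim_cls[OF r sr cls_mem(2)[OF r s]])
    then obtain t where "t = 1 \<or> t = -1" "lim r = t *\<^sub>R lim s" using ldist_unit_multiple[OF lim(1)[OF r] lim(1)[OF sr]] by blast
    then show ?thesis using Q(2) by auto
  qed
  show ?thesis
    unfolding boundary_map_def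
  proof (rule the_equality)
    show "\<forall>s\<in>cls r. limitin (grassmannian k) (\<lambda>n. longest_axes_space B k (\<rho> (s n))) (?L r) sequentially"
    proof
      fix s assume s: "s \<in> cls r"
      show "limitin (grassmannian k) (\<lambda>n. longest_axes_space B k (\<rho> (s n))) (?L r) sequentially"
        unfolding *[OF cls_rays[OF s]] eq[OF s] ..
    qed
    fix X assume "\<forall>s\<in>cls r. limitin (grassmannian k) (\<lambda>n. longest_axes_space B k (\<rho> (s n))) X sequentially"
    then show "X = ?L r" using cls_self[OF r] *[OF r] by blast
  qed
qed

text \<open>Up to \<open>T\<close>, the vector \<open>l1\<close> spans \<open>\<xi>\<^sup>1\<close>, the orthogonal complement of \<open>l2\<close> is \<open>\<xi>\<^sup>d\<^sup>-\<^sup>1\<close>, and the kernel of the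
  skew-symmetric matrix \<open>l3\<close> is \<open>\<xi>\<^sup>d\<^sup>-\<^sup>2\<close>.\<close>

definition l1 :: "('g \<Rightarrow> real^'n^'n) \<Rightarrow> real \<Rightarrow> real \<Rightarrow> (nat \<Rightarrow> 'g) \<Rightarrow> real^'n" where
  "l1 m c q = gap_system.lim G S (\<lambda>g. (*v) (D m g)) c q"
definition l2 :: "('g \<Rightarrow> real^'n^'n) \<Rightarrow> real \<Rightarrow> real \<Rightarrow> (nat \<Rightarrow> 'g) \<Rightarrow> real^'n" where
  "l2 m c q = gap_system.lim G S (\<lambda>g. (*v) (E m g)) c q"
definition l3 :: "('g \<Rightarrow> real^'n^'n) \<Rightarrow> real \<Rightarrow> real \<Rightarrow> (nat \<Rightarrow> 'g) \<Rightarrow> real^'n^'n" where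
  "l3 m c q = gap_system.lim G S (\<lambda>g. Lam (E m g)) c q"

context
  fixes \<rho> m c q c' q' assumes gd: "good \<rho> m c q c' q'"
begin

lemma sel: "selection \<rho> m" and cq: "0 < c" "0 < q" "q < 1" "0 < c'" "0 < q'" "q' < 1"
  using gd by (auto simp: good_def)

lemma gaps:
  assumes "g \<in> carrier G" "A \<in> \<rho> g" "std_svd (T ** A ** T') \<sigma> e f"
  shows "\<sigma> 2 / \<sigma> 1 \<le> c * q ^ wl g" "\<sigma> 3 / \<sigma> 2 \<le> c' * q' ^ wl g"
  using gd assms unfolding good_def by blast+

lemma D_inv: "g \<in> carrier G \<Longrightarrow> invertible (D m g)" "g \<in> carrier G \<Longrightarrow> invertible (E m g)"
  using D_rep[OF sel] E_rep[OF sel] by (auto simp: proj_matrix_rep_def)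

text \<open>One image frame \<open>f\<close> serves all three systems. \<open>E m g\<close> is the
  transposed inverse of \<open>D m g\<close> up to a scalar, so its frame is \<open>f\<close> in
  reverse order, and its gaps are the Anosov inequalities at \<open>inv g\<close>, which has the
  same length.\<close>

lemma svd_tops:
  assumes g: "g \<in> carrier G" and A: "A \<in> \<rho> g" and s: "std_svd (T ** A ** T') \<sigma> e f"
  shows "\<exists>t e'. (t = 1 \<or> t = -1) \<and> top_gap ((*v) (D m g)) e' (t *\<^sub>R f 1) (c * q ^ wl g)"
    and "\<exists>e'. top_gap ((*v) (E m g)) e' (f CARD('n)) (c * q ^ wl g)"
    and "\<exists>e'. top_gap (Lam (E m g)) e' (unit_wedge (f CARD('n)) (f (CARD('n) - 1))) (c' * q' ^ wl g)"
proof -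
  have d2: "2 \<le> CARD('n)" using card3 by simp
  have iA: "invertible (T ** A ** T')" using PGL_elem(1)[OF rho(1)[OF sel g] A] by (rule conj_invertible)
  obtain t where t: "t \<noteq> 0" "m g = t *\<^sub>R A" using rho_elem[OF sel g A] by blast
  have "(*v) (D m g) = (\<lambda>v. t *\<^sub>R ((T ** A ** T') *v v))"
    unfolding D_def t(2) conj_scale by (rule ext) (simp flip: scaleR_matrix_vector_assoc)
  then have "top_gap ((*v) (D m g)) (e 1) (sgn t *\<^sub>R f 1) (\<sigma> 2 / \<sigma> 1)"
    using top_gap_scale[OF matrix_vector_mul_linear std_svd_top_gap[OF s iA d2] t(1)] by simp
  from top_gap_mono[OF this gaps(1)[OF g A s]]
  show "\<exists>t e'. (t = 1 \<or> t = -1) \<and> top_gap ((*v) (D m g)) e' (t *\<^sub>R f 1) (c * q ^ wl g)"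
    using t(1) by (intro exI[of _ "sgn t"] exI[of _ "e 1"]) (auto simp: sgn_if)
  have ig: "inv g \<in> carrier G" using g by simp
  obtain u where u: "u \<noteq> 0" "m (inv g) ** A = u *\<^sub>R mat 1" using rho_inverse[OF sel g A rho(3)[OF sel ig]] by blast
  have "(T ** m (inv g) ** T') ** (T ** A ** T') = u *\<^sub>R mat 1"
    unfolding conj_mult u(2) conj_scale by (simp add: TT)
  note si = std_svd_inverse[OF s iA this u(1)]
  let ?r = "\<lambda>i. CARD('n) + 1 - i"
  note gi = gaps[OF ig rho(3)[OF sel ig] si, unfolded wl_inv[OF g]]
  have st: "std_svd (E m g) (\<lambda>i. \<bar>u\<bar> / \<sigma> (?r i)) (\<lambda>i. sgn u *\<^sub>R e (?r i)) (\<lambda>i. f (?r i))"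
    unfolding E_def D_def by (rule std_svd_transpose[OF si])
  have r12: "CARD('n) + 1 - 1 = CARD('n)" "CARD('n) + 1 - 2 = CARD('n) - 1" by simp_all
  show "\<exists>e'. top_gap ((*v) (E m g)) e' (f CARD('n)) (c * q ^ wl g)"
    using top_gap_mono[OF std_svd_top_gap[OF st D_inv(2)[OF g] d2] gi(1)] unfolding r12 by blast
  show "\<exists>e'. top_gap (Lam (E m g)) e' (unit_wedge (f CARD('n)) (f (CARD('n) - 1))) (c' * q' ^ wl g)"
    using top_gap_mono[OF Lam_top_gap[OF st D_inv(2)[OF g] card3] gi(2)] unfolding r12 unit_wedge_def by blast
qed

lemma ex_svd:
  assumes g: "g \<in> carrier G" and A: "A \<in> \<rho> g"
  obtains \<sigma> e f where "std_svd (T ** A ** T') \<sigma> e f"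
  using std_svd_exists[OF conj_invertible[OF PGL_elem(1)[OF rho(1)[OF sel g] A]]] that by blast

lemma gs1: "gap_system G S (\<lambda>g. (*v) (D m g)) c q"
proof (rule gap_system_mv[OF D_rep[OF sel] cq(1-3)])
  fix g assume g: "g \<in> carrier G"
  obtain \<sigma> e f where s: "std_svd (T ** m g ** T') \<sigma> e f" by (rule ex_svd[OF g rho(3)[OF sel g]])
  show "\<exists>e h. top_gap ((*v) (D m g)) e h (c * q ^ wl g)" using svd_tops(1)[OF g rho(3)[OF sel g] s] by blast
qed

lemma gs2: "gap_system G S (\<lambda>g. (*v) (E m g)) c q"
proof (rule gap_system_mv[OF E_rep[OF sel] cq(1-3)])
  fix g assume g: "g \<in> carrier G"
  obtain \<sigma> e f where s: "std_svd (T ** m g ** T') \<sigma> e f" by (rule ex_svd[OF g rho(3)[OF sel g]])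
  show "\<exists>e h. top_gap ((*v) (E m g)) e h (c * q ^ wl g)" using svd_tops(2)[OF g rho(3)[OF sel g] s] by blast
qed

lemma gs3: "gap_system G S (\<lambda>g. Lam (E m g)) c' q'"
proof (rule gap_system_Lam[OF E_rep[OF sel] cq(4-6)])
  fix g assume g: "g \<in> carrier G"
  obtain \<sigma> e f where s: "std_svd (T ** m g ** T') \<sigma> e f" by (rule ex_svd[OF g rho(3)[OF sel g]])
  show "\<exists>e h. top_gap (Lam (E m g)) e h (c' * q' ^ wl g)" using svd_tops(3)[OF g rho(3)[OF sel g] s] by blast
qed

lemma colim_l2: "gap_system.colim G S (\<lambda>g. (*v) (D m g)) c q = l2 m c q"
  unfolding gap_system.colim_def[OF gs1] l2_def E_def adjoint_matrix ..

text \<open>Whatever the choice operator returns stems from some decomposition of some representing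
  matrix, and nothing more is known about it when the singular values coincide.\<close>

lemma longest_axes:
  assumes g: "g \<in> carrier G"
  obtains A \<sigma> e f where "A \<in> \<rho> g" "std_svd (T ** A ** T') \<sigma> e (\<lambda>i. T *v f i)" "longest_axes_space B k (\<rho> g) = span (f ` {1..k})"
proof -
  obtain \<sigma> e f where s: "std_svd (T ** m g ** T') \<sigma> e f" by (rule ex_svd[OF g rho(3)[OF sel g]])
  have "is_svd B (m g) \<sigma> (\<lambda>i. T' *v e i) (\<lambda>i. T' *v f i)" unfolding is_svd_conjugate[OF TT B] T_inv using s by simp
  then have "\<exists>W. \<exists>A\<in>\<rho> g. \<exists>\<sigma> e f. is_svd B A \<sigma> e f \<and> W = span (f ` {1..k})" using rho(3)[OF sel g] by blast
  from someI_ex[OF this] obtain A \<sigma> e f where "A \<in> \<rho> g" "is_svd B A \<sigma> e f" "longest_axes_space B k (\<rho> g) = span (f ` {1..k})"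
    unfolding longest_axes_space_def by blast
  then show ?thesis using that unfolding is_svd_conjugate[OF TT B] by blast
qed

lemma axes1:
  assumes g: "g \<in> carrier G"
  shows "\<exists>h\<in>gap_system.tops G S (\<lambda>g. (*v) (D m g)) c q g. norm h = 1 \<and> longest_axes_space B 1 (\<rho> g) = {v. Q1 h *v v = v}"
proof (rule longest_axes[OF g, of 1])
  fix A \<sigma> e f assume A: "A \<in> \<rho> g" "std_svd (T ** A ** T') \<sigma> e (\<lambda>i. T *v f i)" "longest_axes_space B 1 (\<rho> g) = span (f ` {1..1})"
  obtain t e' where t: "t = 1 \<or> t = -1" "top_gap ((*v) (D m g)) e' (t *\<^sub>R (T *v f 1)) (c * q ^ wl g)"
    using svd_tops(1)[OF g A(1,2)] by blast
  let ?h = "t *\<^sub>R (T *v f 1)"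
  have n: "norm ?h = 1" using t(2) by (simp add: top_gap_def)
  have "span (f ` {1..1}) = {v. \<exists>u. T *v v = u *\<^sub>R ?h}"
  proof (intro equalityI subsetI)
    fix v assume "v \<in> span (f ` {1..1})"
    then obtain u where "v = u *\<^sub>R f 1" by (auto simp: span_singleton)
    then have "T *v v = (u * t) *\<^sub>R ?h" using t(1) by (auto simp: matrix_vector_mult_scaleR)
    then show "v \<in> {v. \<exists>u. T *v v = u *\<^sub>R ?h}" by blast
  next
    fix v assume "v \<in> {v. \<exists>u. T *v v = u *\<^sub>R ?h}"
    then obtain u where "T *v v = u *\<^sub>R ?h" by blast
    then have "T' *v (T *v v) = T' *v (T *v ((u * t) *\<^sub>R f 1))" by (simp add: matrix_vector_mult_scaleR)
    then have "v = (u * t) *\<^sub>R f 1" unfolding T_inv .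
    then show "v \<in> span (f ` {1..1})" by (auto intro: span_mul span_base)
  qed
  then have "longest_axes_space B 1 (\<rho> g) = {v. Q1 ?h *v v = v}" unfolding A(3) Q1_fix[OF n] .
  then show ?thesis using t(2) n unfolding gap_system.tops_def[OF gs1] by blast
qed

text \<open>In the coordinates given by \<open>T\<close>, the first d - 2 axes span the orthogonal
  complement of the last two vectors of the image frame, which is the kernel of the wedge of
  these.\<close>

lemma axes3:
  assumes g: "g \<in> carrier G"
  shows "\<exists>h\<in>gap_system.tops G S (\<lambda>g. Lam (E m g)) c' q' g. (\<exists>a b. orthonormal_pair a b \<and> h = unit_wedge a b) \<and>
     longest_axes_space B (CARD('n) - 2) (\<rho> g) = {v. Q3 h *v v = v}"
proof (rule longest_axes[OF g, of "CARD('n) - 2"])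
  let ?d = "CARD('n)"
  fix A \<sigma> e f assume A: "A \<in> \<rho> g" "std_svd (T ** A ** T') \<sigma> e (\<lambda>i. T *v f i)"
    "longest_axes_space B (?d - 2) (\<rho> g) = span (f ` {1..?d - 2})"
  let ?f = "\<lambda>i. T *v f i"
  note fr = std_frameD[OF std_svdD(2)[OF A(2)]]
  have I: "?d \<in> {1..?d}" "?d - 1 \<in> {1..?d}" "?d \<noteq> ?d - 1" using card3 by auto
  have o: "orthonormal_pair (?f ?d) (?f (?d - 1))" using fr[OF I(1,1)] fr[OF I(2,2)] fr[OF I(1,2)] I(3) by (simp add: orthonormal_pair_def)
  obtain e' where t: "top_gap (Lam (E m g)) e' (unit_wedge (?f ?d) (?f (?d - 1))) (c' * q' ^ wl g)"
    using svd_tops(3)[OF g A(1,2)] by blast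
  have "span (f ` {1..?d - 2}) = {v. Q3 (unit_wedge (?f ?d) (?f (?d - 1))) *v v = v}"
    unfolding Q3_fix[OF o]
  proof (intro equalityI)
    show "span (f ` {1..?d - 2}) \<subseteq> {v. unit_wedge (?f ?d) (?f (?d - 1)) *v (T *v v) = 0}"
    proof (rule span_minimal[OF _ dim_ker_pair(1)[OF TT o]], rule subsetI)
      fix v assume "v \<in> f ` {1..?d - 2}"
      then obtain j where j: "1 \<le> j" "j \<le> ?d - 2" "v = f j" by auto
      have "j \<le> ?d" "j \<noteq> ?d" "j \<noteq> ?d - 1" using j(1,2) card3 by linarith+
      then obtain i where i: "i \<in> {1..?d}" "i \<noteq> ?d" "i \<noteq> ?d - 1" "v = f i" using j(1,3) by force
      have "?f ?d \<bullet> ?f i = 0" "?f (?d - 1) \<bullet> ?f i = 0" using fr[OF I(1) i(1)] fr[OF I(2) i(1)] i(2,3) by auto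
      then show "v \<in> {v. unit_wedge (?f ?d) (?f (?d - 1)) *v (T *v v) = 0}" unfolding unit_wedge_ker[OF o] i(4) by simp
    qed
    show "{v. unit_wedge (?f ?d) (?f (?d - 1)) *v (T *v v) = 0} \<subseteq> span (f ` {1..?d - 2})"
    proof
      fix v assume "v \<in> {v. unit_wedge (?f ?d) (?f (?d - 1)) *v (T *v v) = 0}"
      then have z: "(T *v v) \<bullet> ?f ?d = 0" "(T *v v) \<bullet> ?f (?d - 1) = 0" unfolding unit_wedge_ker[OF o] by (auto simp: inner_commute)
      have "T' *v (T *v v) = T' *v (\<Sum>i\<in>{1..?d}. ((T *v v) \<bullet> ?f i) *\<^sub>R ?f i)"
        using std_frame_expand[OF std_svdD(2)[OF A(2)], of "T *v v"] by simp
      also have "\<dots> = (\<Sum>i\<in>{1..?d}. ((T *v v) \<bullet> ?f i) *\<^sub>R f i)"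
        unfolding linear_sum[OF matrix_vector_mul_linear] matrix_vector_mult_scaleR T_inv ..
      finally have v: "v = (\<Sum>i\<in>{1..?d}. ((T *v v) \<bullet> ?f i) *\<^sub>R f i)" unfolding T_inv .
      have "((T *v v) \<bullet> ?f i) *\<^sub>R f i \<in> span (f ` {1..?d - 2})" if i: "i \<in> {1..?d}" for i
      proof (cases "i = ?d \<or> i = ?d - 1")
        case True
        then show ?thesis using z by (auto simp: span_zero)
      next
        case False
        then have "i \<in> {1..?d - 2}" using i by auto
        then show ?thesis by (intro span_mul span_base imageI)
      qed
      then show "v \<in> span (f ` {1..?d - 2})" by (subst v) (rule span_sum)
    qed
  qed
  then show ?thesis using t o unfolding gap_system.tops_def[OF gs3] A(3) by blast
qed

text \<open>Incidence of the limit flag: the wedges at finite stages contain the top direction of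
  \<open>E\<close> as a factor, and orthogonality passes to the limit. Geometrically, the limit
  spaces of dimension d - 2 and 1 lie in the limit hyperplane.\<close>

lemma lim3_form:
  assumes r: "r \<in> rays"
  shows "\<exists>\<psi>. orthonormal_pair (l2 m c q r) \<psi> \<and> l3 m c' q' r = unit_wedge (l2 m c q r) \<psi>"
    and "l1 m c q r \<bullet> l2 m c q r = 0"
proof -
  interpret R1: gap_system G S "\<lambda>g. (*v) (D m g)" c q by (rule gs1)
  interpret R2: gap_system G S "\<lambda>g. (*v) (E m g)" c q by (rule gs2)
  interpret R3: gap_system G S "\<lambda>g. Lam (E m g)" c' q' by (rule gs3)
  let ?l2 = "l2 m c q r" and ?l3 = "l3 m c' q' r" and ?l1 = "l1 m c q r"
  note cr = raysD(1)[OF r]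
  have "\<exists>h \<phi> \<psi>. h \<in> R1.tops (r n) \<and> \<phi> \<in> R2.tops (r n) \<and> unit_wedge \<phi> \<psi> \<in> R3.tops (r n) \<and> orthonormal_pair \<phi> \<psi> \<and> h \<bullet> \<phi> = 0" for n
  proof -
    let ?d = "CARD('n)"
    obtain \<sigma> e f where s: "std_svd (T ** m (r n) ** T') \<sigma> e f" by (rule ex_svd[OF cr rho(3)[OF sel cr]])
    note fr = std_frameD[OF std_svdD(2)[OF s]]
    have I: "?d \<in> {1..?d}" "?d - 1 \<in> {1..?d}" "1 \<in> {1..?d}" "?d \<noteq> ?d - 1" "1 \<noteq> ?d" using card3 by auto
    have o: "orthonormal_pair (f ?d) (f (?d - 1))" using fr[OF I(1,1)] fr[OF I(2,2)] fr[OF I(1,2)] I(4) by (simp add: orthonormal_pair_def)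
    note st = svd_tops[OF cr rho(3)[OF sel cr] s]
    obtain t where t: "t *\<^sub>R f 1 \<in> R1.tops (r n)" using st(1) unfolding R1.tops_def by blast
    have "(t *\<^sub>R f 1) \<bullet> f ?d = 0" using fr[OF I(3,1)] I(5) by simp
    moreover have "f ?d \<in> R2.tops (r n)" using st(2) unfolding R2.tops_def by blast
    moreover have "unit_wedge (f ?d) (f (?d - 1)) \<in> R3.tops (r n)" using st(3) unfolding R3.tops_def by blast
    ultimately show ?thesis using t o by blast
  qed
  then obtain h \<phi> \<psi> where H: "\<And>n. h n \<in> R1.tops (r n)" "\<And>n. \<phi> n \<in> R2.tops (r n)" "\<And>n. unit_wedge (\<phi> n) (\<psi> n) \<in> R3.tops (r n)"
    "\<And>n. orthonormal_pair (\<phi> n) (\<psi> n)" "\<And>n. h n \<bullet> \<phi> n = 0" by metis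
  have n1: "norm ?l1 = 1" "norm ?l2 = 1" "norm ?l3 = 1"
    unfolding l1_def l2_def l3_def by (rule R1.lim(1)[OF r] R2.lim(1)[OF r] R3.lim(1)[OF r])+
  have L: "ldist (h n) ?l1 \<le> R1.cst r * q ^ n" "ldist (\<phi> n) ?l2 \<le> R2.cst r * q ^ n" "ldist (unit_wedge (\<phi> n) (\<psi> n)) ?l3 \<le> R3.cst r * q' ^ n" for n
    unfolding l1_def l2_def l3_def by (rule R1.lim_ray[OF r H(1)] R2.lim_ray[OF r H(2)] R3.lim_ray[OF r H(3)])+
  have z2: "(\<lambda>n. ldist (\<phi> n) ?l2) \<longlonglongrightarrow> 0"
    by (rule tendsto_sandwich[OF always_eventually always_eventually tendsto_const R2.qpow_tendsto[of "R2.cst r"]]) (use L(2) ldist_nonneg in auto)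
  have z3: "(\<lambda>n. ldist (unit_wedge (\<phi> n) (\<psi> n)) ?l3) \<longlonglongrightarrow> 0"
    by (rule tendsto_sandwich[OF always_eventually always_eventually tendsto_const R3.qpow_tendsto[of "R3.cst r"]]) (use L(3) ldist_nonneg in auto)
  have "\<bar>?l1 \<bullet> ?l2\<bar> \<le> 0"
  proof (rule R1.le_if_le_qpow)
    fix n :: nat assume "0 \<le> n"
    have "norm (h n) = 1" by (rule R1.tops_unit[OF H(1)])
    then show "\<bar>?l1 \<bullet> ?l2\<bar> \<le> 0 + (R1.cst r + R2.cst r) * q ^ n"
      using abs_inner_ldist[of "?l2" ?l1 "h n"] abs_inner_ldist[of "h n" ?l2 "\<phi> n"] H(5)[of n] L(1,2)[of n] n1
      by (simp add: inner_commute ldist_commute distrib_right)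
  qed
  then show "?l1 \<bullet> ?l2 = 0" by simp
  have "\<exists>s. (s = 1 \<or> s = -1) \<and> norm (\<phi> n - s *\<^sub>R ?l2) = ldist (\<phi> n) ?l2" for n
    using ldist_cases[of "\<phi> n" ?l2] by metis
  then obtain s where s: "\<And>n. s n = 1 \<or> s n = -1" "\<And>n. norm (\<phi> n - s n *\<^sub>R ?l2) = ldist (\<phi> n) ?l2" by metis
  have "norm (s n *\<^sub>R \<phi> n - ?l2) = ldist (\<phi> n) ?l2" for n
  proof -
    have "s n *\<^sub>R \<phi> n - ?l2 = s n *\<^sub>R (\<phi> n - s n *\<^sub>R ?l2)" using s(1)[of n] by (auto simp: scaleR_diff_right)
    then show ?thesis using s(1)[of n] s(2)[of n] by auto
  qed
  then have "(\<lambda>n. s n *\<^sub>R \<phi> n - ?l2) \<longlonglongrightarrow> 0" using z2 by (intro tendsto_norm_zero_cancel[of "\<lambda>n. s n *\<^sub>R \<phi> n - ?l2"]) simp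
  then have sl: "(\<lambda>n. s n *\<^sub>R \<phi> n) \<longlonglongrightarrow> ?l2" by (simp add: LIM_zero_iff)
  have "\<forall>n. \<psi> n \<in> sphere 0 1" using H(4) by (simp add: orthonormal_pair_def norm_eq_1)
  \<comment> \<open>The first factor converges after sign correction; for the second one no
    convergence is known, and a subsequence is enough since the wedge itself converges up to
    sign.\<close>
  then obtain \<psi>' \<kappa> where k: "\<psi>' \<in> sphere 0 1" "strict_mono (\<kappa> :: nat \<Rightarrow> nat)" "(\<psi> \<circ> \<kappa>) \<longlonglongrightarrow> \<psi>'"
    using compact_sphere[of "0 :: real^'n" 1] unfolding compact_def by metis
  have sk: "(\<lambda>n. s (\<kappa> n) *\<^sub>R \<phi> (\<kappa> n)) \<longlonglongrightarrow> ?l2" using LIMSEQ_subseq_LIMSEQ[OF sl k(2)] by (simp add: o_def)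
  have pk: "(\<lambda>n. \<psi> (\<kappa> n)) \<longlonglongrightarrow> \<psi>'" using k(3) by (simp add: o_def)
  have "(\<lambda>n. (s (\<kappa> n) *\<^sub>R \<phi> (\<kappa> n)) \<bullet> \<psi> (\<kappa> n)) \<longlonglongrightarrow> ?l2 \<bullet> \<psi>'" by (rule tendsto_inner[OF sk pk])
  moreover have "(s (\<kappa> n) *\<^sub>R \<phi> (\<kappa> n)) \<bullet> \<psi> (\<kappa> n) = 0" for n using H(4) by (simp add: orthonormal_pair_def)
  ultimately have "(\<lambda>n::nat. 0::real) \<longlonglongrightarrow> ?l2 \<bullet> \<psi>'" by (simp only:)
  then have "?l2 \<bullet> \<psi>' = 0" by (rule LIMSEQ_unique[OF _ tendsto_const])
  then have o: "orthonormal_pair ?l2 \<psi>'" using n1(2) k(1) by (simp add: orthonormal_pair_def norm_eq_1)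
  have "(\<lambda>n. ldist (unit_wedge (s (\<kappa> n) *\<^sub>R \<phi> (\<kappa> n)) (\<psi> (\<kappa> n))) ?l3) \<longlonglongrightarrow> ldist (unit_wedge ?l2 \<psi>') ?l3"
    unfolding unit_wedge_def by (intro tendsto_ldist tendsto_scaleR tendsto_const tendsto_wedge sk pk)
  moreover have "ldist (unit_wedge (s (\<kappa> n) *\<^sub>R \<phi> (\<kappa> n)) (\<psi> (\<kappa> n))) ?l3 = ldist (unit_wedge (\<phi> (\<kappa> n)) (\<psi> (\<kappa> n))) ?l3" for n
  proof -
    have "unit_wedge (s (\<kappa> n) *\<^sub>R \<phi> (\<kappa> n)) (\<psi> (\<kappa> n)) = s (\<kappa> n) *\<^sub>R unit_wedge (\<phi> (\<kappa> n)) (\<psi> (\<kappa> n))" by (simp add: unit_wedge_def wedge_scale)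
    then show ?thesis using s(1)[of "\<kappa> n"] by auto
  qed
  ultimately have "(\<lambda>n. ldist (unit_wedge (\<phi> (\<kappa> n)) (\<psi> (\<kappa> n))) ?l3) \<longlonglongrightarrow> ldist (unit_wedge ?l2 \<psi>') ?l3" by simp
  moreover have "(\<lambda>n. ldist (unit_wedge (\<phi> (\<kappa> n)) (\<psi> (\<kappa> n))) ?l3) \<longlonglongrightarrow> 0" using LIMSEQ_subseq_LIMSEQ[OF z3 k(2)] by (simp add: o_def)
  ultimately have "ldist (unit_wedge ?l2 \<psi>') ?l3 = 0" by (rule LIMSEQ_unique)
  moreover have "norm (unit_wedge ?l2 \<psi>') = 1" unfolding unit_wedge_def using o by (intro norm_wedge) (auto simp: orthonormal_pair_def)
  ultimately obtain t where t: "t = 1 \<or> t = -1" "?l3 = t *\<^sub>R unit_wedge ?l2 \<psi>'" using ldist_unit_multiple[of ?l3 "unit_wedge ?l2 \<psi>'"] n1(3) by (metis ldist_commute)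
  have "?l3 = unit_wedge ?l2 (t *\<^sub>R \<psi>')" unfolding t(2) by (simp add: unit_wedge_def wedge_scale)
  moreover have "orthonormal_pair ?l2 (t *\<^sub>R \<psi>')" using o t(1) by (auto simp: orthonormal_pair_def)
  ultimately show "\<exists>\<psi>. orthonormal_pair ?l2 \<psi> \<and> ?l3 = unit_wedge ?l2 \<psi>" by blast
qed

lemma unit1: "r \<in> rays \<Longrightarrow> norm (l1 m c q r) = 1"
  unfolding l1_def by (rule gap_system.lim(1)[OF gs1])

lemma bm1:
  assumes r: "r \<in> rays"
  shows "boundary_map G S B \<rho> 1 (cls r) = {v. \<exists>t. T *v v = t *\<^sub>R l1 m c q r}"
proof -
  have "boundary_map G S B \<rho> 1 (cls r) = {v. Q1 (l1 m c q r) *v v = v}"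
    unfolding l1_def
    by (rule boundary_map_eq[where ok = "\<lambda>h. norm h = 1" and Q = Q1 and R = "\<lambda>g. (*v) (D m g)", OF gs1 isCont_Q1 Q1_minus axes1 _ _ r])
      (use Q1_props gap_system.lim(1)[OF gs1] in auto)
  then show ?thesis unfolding Q1_fix[OF unit1[OF r]] .
qed

lemma bm3:
  assumes r: "r \<in> rays"
  shows "boundary_map G S B \<rho> (CARD('n) - 2) (cls r) = {v. l3 m c' q' r *v (T *v v) = 0}"
proof -
  obtain \<psi> where o: "orthonormal_pair (l2 m c q r) \<psi>" "l3 m c' q' r = unit_wedge (l2 m c q r) \<psi>" using lim3_form(1)[OF r] by blast
  have "boundary_map G S B \<rho> (CARD('n) - 2) (cls r) = {v. Q3 (l3 m c' q' r) *v v = v}"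
    unfolding l3_def
  proof (rule boundary_map_eq[where ok = "\<lambda>h. \<exists>a b. orthonormal_pair a b \<and> h = unit_wedge a b" and Q = Q3 and R = "\<lambda>g. Lam (E m g)", OF gs3 isCont_Q3 Q3_minus axes3 _ _ r])
    fix h :: "real^'n^'n" assume "\<exists>a b. orthonormal_pair a b \<and> h = unit_wedge a b"
    then obtain a b where ab: "orthonormal_pair a b" "h = unit_wedge a b" by blast
    show "subspace {v. Q3 h *v v = v} \<and> dim {v. Q3 h *v v = v} = CARD('n) - 2 \<and> (\<forall>v. Q3 h *v (Q3 h *v v) = Q3 h *v v)"
      unfolding ab(2) using Q3_props[OF ab(1)] by blast
  next
    fix r' assume "r' \<in> rays"
    then show "\<exists>a b. orthonormal_pair a b \<and> gap_system.lim G S (\<lambda>g. Lam (E m g)) c' q' r' = unit_wedge a b"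
      using lim3_form(1)[of r'] unfolding l3_def by blast
  qed
  then show ?thesis unfolding o(2) Q3_fix[OF o(1)] .
qed

lemma transverse:
  assumes "word_hyperbolic G S" "r \<in> rays" "r' \<in> rays" "cls r \<noteq> cls r'"
  shows "l1 m c q r \<bullet> l2 m c q r' \<noteq> 0"
  using gap_system.lim_transverse[OF gs1 assms] unfolding colim_l2 l1_def .

lemma form_value:
  assumes "l3 m c' q' r = unit_wedge \<phi> \<psi>"
  shows "u \<bullet> (l3 m c' q' r *v v) = (1 / sqrt 2) * ((\<psi> \<bullet> v) * (\<phi> \<bullet> u) - (\<phi> \<bullet> v) * (\<psi> \<bullet> u))"
  unfolding assms unit_wedge_mult by (simp add: inner_diff_right inner_commute)

text \<open>The form \<open>l3\<close> of \<open>z\<close> has kernel \<open>\<xi>\<^sup>d\<^sup>-\<^sup>2(z)\<close>, so the sum is direct with it if and only if the form does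
  not vanish on the two lines.\<close>

lemma hyperconvex_criterion:
  assumes hyp: "word_hyperbolic G S" and r: "x \<in> rays" "y \<in> rays" "z \<in> rays"
    and ne: "cls x \<noteq> cls y" "cls y \<noteq> cls z" "cls x \<noteq> cls z"
  shows "{u + v | u v. u \<in> boundary_map G S B \<rho> 1 (cls x) \<and> v \<in> boundary_map G S B \<rho> 1 (cls y)}
          \<inter> boundary_map G S B \<rho> (CARD('n) - 2) (cls z) = {0} \<longleftrightarrow>
     l1 m c q x \<bullet> (l3 m c' q' z *v l1 m c q y) \<noteq> 0"
proof -
  let ?u = "l1 m c q x" and ?v = "l1 m c q y" and ?\<phi> = "l2 m c q z"
  obtain \<psi> where o: "orthonormal_pair ?\<phi> \<psi>" "l3 m c' q' z = unit_wedge ?\<phi> \<psi>" using lim3_form(1)[OF r(3)] by blast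
  let ?X = "{u + v | u v. u \<in> {w. \<exists>t. T *v w = t *\<^sub>R ?u} \<and> v \<in> {w. \<exists>t. T *v w = t *\<^sub>R ?v}} \<inter> {w. ?\<phi> \<bullet> (T *v w) = 0 \<and> \<psi> \<bullet> (T *v w) = 0}"
  have tr: "?u \<bullet> ?\<phi> \<noteq> 0" "?v \<bullet> ?\<phi> \<noteq> 0" using transverse[OF hyp] r ne by blast+
  let ?det = "(\<psi> \<bullet> ?v) * (?\<phi> \<bullet> ?u) - (?\<phi> \<bullet> ?v) * (\<psi> \<bullet> ?u)"
  have mem: "w \<in> ?X \<longleftrightarrow> (\<exists>s t. T *v w = s *\<^sub>R ?u + t *\<^sub>R ?v \<and> s * (?\<phi> \<bullet> ?u) + t * (?\<phi> \<bullet> ?v) = 0 \<and> s * (\<psi> \<bullet> ?u) + t * (\<psi> \<bullet> ?v) = 0)" for w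
  proof
    assume "w \<in> ?X"
    then obtain a b s t where w: "w = a + b" "T *v a = s *\<^sub>R ?u" "T *v b = t *\<^sub>R ?v" "?\<phi> \<bullet> (T *v w) = 0" "\<psi> \<bullet> (T *v w) = 0" by blast
    have "T *v w = s *\<^sub>R ?u + t *\<^sub>R ?v" unfolding w(1) by (simp add: matrix_vector_right_distrib w(2,3))
    then show "\<exists>s t. T *v w = s *\<^sub>R ?u + t *\<^sub>R ?v \<and> s * (?\<phi> \<bullet> ?u) + t * (?\<phi> \<bullet> ?v) = 0 \<and> s * (\<psi> \<bullet> ?u) + t * (\<psi> \<bullet> ?v) = 0"
      using w(4,5) by (intro exI[of _ s] exI[of _ t]) (simp add: inner_add_right)
  next
    assume "\<exists>s t. T *v w = s *\<^sub>R ?u + t *\<^sub>R ?v \<and> s * (?\<phi> \<bullet> ?u) + t * (?\<phi> \<bullet> ?v) = 0 \<and> s * (\<psi> \<bullet> ?u) + t * (\<psi> \<bullet> ?v) = 0"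
    then obtain s t where w: "T *v w = s *\<^sub>R ?u + t *\<^sub>R ?v" "s * (?\<phi> \<bullet> ?u) + t * (?\<phi> \<bullet> ?v) = 0" "s * (\<psi> \<bullet> ?u) + t * (\<psi> \<bullet> ?v) = 0" by blast
    have "T' *v (T *v w) = T' *v (s *\<^sub>R ?u) + T' *v (t *\<^sub>R ?v)" unfolding w(1) by (simp add: matrix_vector_right_distrib)
    then have "w = T' *v (s *\<^sub>R ?u) + T' *v (t *\<^sub>R ?v)" unfolding T_inv .
    moreover have "?\<phi> \<bullet> (T *v w) = 0" "\<psi> \<bullet> (T *v w) = 0" unfolding w(1) using w(2,3) by (simp_all add: inner_add_right)
    moreover have "T' *v (s *\<^sub>R ?u) \<in> {w. \<exists>t. T *v w = t *\<^sub>R ?u}" "T' *v (t *\<^sub>R ?v) \<in> {w. \<exists>t. T *v w = t *\<^sub>R ?v}"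
      by (auto simp: T_inv)
    ultimately show "w \<in> ?X" by blast
  qed
  have "?X = {0} \<longleftrightarrow> ?det \<noteq> 0"
  proof
    assume X: "?X = {0}"
    show "?det \<noteq> 0"
    proof
      assume d: "?det = 0"
      \<comment> \<open>The solution of the degenerate linear system. It is not zero: otherwise the
        two lines would coincide, but \<open>l2\<close> at \<open>x\<close> annihilates the first
        and not the second.\<close>
      let ?w = "T' *v ((?\<phi> \<bullet> ?v) *\<^sub>R ?u + (- (?\<phi> \<bullet> ?u)) *\<^sub>R ?v)"
      have "?w \<in> ?X"
        unfolding mem T_inv by (intro exI[of _ "?\<phi> \<bullet> ?v"] exI[of _ "- (?\<phi> \<bullet> ?u)"]) (use d in \<open>simp add: mult.commute\<close>)
      then have "?w = 0" unfolding X by (rule singletonD)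
      then have "T *v ?w = 0" by simp
      then have "(?\<phi> \<bullet> ?v) *\<^sub>R ?u = (?\<phi> \<bullet> ?u) *\<^sub>R ?v" unfolding T_inv by simp
      then have "((?\<phi> \<bullet> ?v) *\<^sub>R ?u) \<bullet> l2 m c q x = ((?\<phi> \<bullet> ?u) *\<^sub>R ?v) \<bullet> l2 m c q x" by simp
      then have "(?\<phi> \<bullet> ?u) * (?v \<bullet> l2 m c q x) = 0" using lim3_form(2)[OF r(1)] by simp
      then show False using tr(1) transverse[OF hyp r(2,1)] ne(1) by (auto simp: inner_commute)
    qed
  next
    assume d: "?det \<noteq> 0"
    show "?X = {0}"
    proof (intro equalityI subsetI)
      fix w assume "w \<in> ?X"
      then obtain s t where w: "T *v w = s *\<^sub>R ?u + t *\<^sub>R ?v" "s * (?\<phi> \<bullet> ?u) + t * (?\<phi> \<bullet> ?v) = 0" "s * (\<psi> \<bullet> ?u) + t * (\<psi> \<bullet> ?v) = 0"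
        unfolding mem by blast
      have "s * ?det = (\<psi> \<bullet> ?v) * (s * (?\<phi> \<bullet> ?u) + t * (?\<phi> \<bullet> ?v)) - (?\<phi> \<bullet> ?v) * (s * (\<psi> \<bullet> ?u) + t * (\<psi> \<bullet> ?v))" by (simp add: algebra_simps)
      then have s: "s = 0" using w(2,3) d by simp
      have "t * ?det = (?\<phi> \<bullet> ?u) * (s * (\<psi> \<bullet> ?u) + t * (\<psi> \<bullet> ?v)) - (\<psi> \<bullet> ?u) * (s * (?\<phi> \<bullet> ?u) + t * (?\<phi> \<bullet> ?v))" by (simp add: algebra_simps)
      then have "t = 0" using w(2,3) d by simp
      then have "T' *v (T *v w) = 0" using s w(1) by simp
      then show "w \<in> {0}" unfolding T_inv by simp
    next
      fix w :: "real^'n" assume "w \<in> {0}"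
      then show "w \<in> ?X" unfolding mem by (intro exI[of _ 0]) simp
    qed
  qed
  then show ?thesis unfolding bm1[OF r(1)] bm1[OF r(2)] bm3[OF r(3)] form_value[OF o(2)]
    unfolding o(2) unit_wedge_ker[OF o(1)] by simp
qed

end

end

section \<open>Continuity in the representation, and non-degeneracy of the limit curve\<close>

context rep_setup begin

lemma conj_close: "norm (D m' g - D m g) \<le> norm T * norm T' * norm (m' g - m g)"
proof -
  have "D m' g - D m g = T ** (m' g - m g) ** T'"
  proof (rule matrix_eqI)
    fix v show "(D m' g - D m g) *v v = T ** (m' g - m g) ** T' *v v"
      unfolding D_def by (simp add: matrix_vector_mult_diff_rdistrib matrix_vector_mult_diff_distrib flip: matrix_vector_mul_assoc)
  qed
  also have "norm \<dots> \<le> norm (T ** (m' g - m g)) * norm T'" by (rule norm_mult_le)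
  also have "\<dots> \<le> norm T * norm (m' g - m g) * norm T'" by (intro mult_right_mono norm_mult_le) simp
  finally show ?thesis by (simp add: mult_ac)
qed

text \<open>Closeness of the representing matrices on \<open>S\<close> is inherited by all three
  systems; for the contragredient this uses that \<open>S\<close> contains the inverses of its
  elements. The constants of the second representation are quantified inside, after
  \<open>\<epsilon>\<close>.\<close>

lemma stable:
  assumes gd: "good \<rho> m c q c' q'" and r: "r \<in> rays" and \<eta>: "0 < \<eta>"
  shows "\<exists>\<epsilon>>0. \<forall>\<rho>' m' a b a' b'. good \<rho>' m' a b a' b' \<longrightarrow> (\<forall>s\<in>S. norm (m' s - m s) \<le> \<epsilon>) \<longrightarrow>
    ldist (l1 m c q r) (l1 m' a b r) \<le> \<eta> \<and> ldist (l2 m c q r) (l2 m' a b r) \<le> \<eta> \<and> ldist (l3 m c' q' r) (l3 m' a' b' r) \<le> \<eta>"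
proof (rule gap_system.lim_stable[OF gs1[OF gd] r \<eta>], rule gap_system.lim_stable[OF gs2[OF gd] r \<eta>], rule gap_system.lim_stable[OF gs3[OF gd] r \<eta>])
  fix e1 e2 e3 :: real
  assume e: "0 < e1" "0 < e2" "0 < e3"
    and s1: "\<And>R' c' q'. gap_system G S R' c' q' \<Longrightarrow> (\<And>s. s \<in> S \<Longrightarrow> \<exists>t. t \<noteq> 0 \<and> (\<forall>v. norm (t *\<^sub>R R' s v - D m s *v v) \<le> e1 * norm v)) \<Longrightarrow>
       ldist (gap_system.lim G S (\<lambda>g. (*v) (D m g)) c q r) (gap_system.lim G S R' c' q' r) \<le> \<eta>"
    and s2: "\<And>R' c' q'. gap_system G S R' c' q' \<Longrightarrow> (\<And>s. s \<in> S \<Longrightarrow> \<exists>t. t \<noteq> 0 \<and> (\<forall>v. norm (t *\<^sub>R R' s v - E m s *v v) \<le> e2 * norm v)) \<Longrightarrow>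
       ldist (gap_system.lim G S (\<lambda>g. (*v) (E m g)) c q r) (gap_system.lim G S R' c' q' r) \<le> \<eta>"
    and s3: "\<And>R' c'' q''. gap_system G S R' c'' q'' \<Longrightarrow> (\<And>s. s \<in> S \<Longrightarrow> \<exists>t. t \<noteq> 0 \<and> (\<forall>v. norm (t *\<^sub>R R' s v - Lam (E m s) v) \<le> e3 * norm v)) \<Longrightarrow>
       ldist (gap_system.lim G S (\<lambda>g. Lam (E m g)) c' q' r) (gap_system.lim G S R' c'' q'' r) \<le> \<eta>"
  define K where "K = norm T * norm T' + 1"
  \<comment> \<open>Bounds the factor \<open>2 * norm (E m s) + 1\<close> of
    \<open>Lam_close\<close> for all generators at once.\<close>
  define N where "N = 2 * (\<Sum>s\<in>S. norm (E m s)) + 1"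
  define \<delta> where "\<delta> = min (min e1 e2) (min 1 (e3 / N))"
  have K: "0 < K" "norm T * norm T' \<le> K" by (simp_all add: K_def add_nonneg_pos)
  have sE: "norm (E m s) \<le> (\<Sum>s\<in>S. norm (E m s))" if "s \<in> S" for s by (rule member_le_sum[OF that _ S_fin]) simp
  have N: "0 < N" by (simp add: N_def add_nonneg_pos sum_nonneg)
  have \<delta>: "0 < \<delta>" "\<delta> \<le> e1" "\<delta> \<le> e2" "\<delta> \<le> 1" "\<delta> \<le> e3 / N" using e N by (auto simp: \<delta>_def)
  show ?thesis
  proof (intro exI[of _ "\<delta> / K"] conjI allI impI)
    show "0 < \<delta> / K" using \<delta> K by simp
    fix \<rho>' m' a b a' b' assume gd': "good \<rho>' m' a b a' b'" and cl: "\<forall>s\<in>S. norm (m' s - m s) \<le> \<delta> / K"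
    have Dc: "norm (D m' s - D m s) \<le> \<delta>" if s: "s \<in> S" for s
    proof -
      have "norm (D m' s - D m s) \<le> norm T * norm T' * norm (m' s - m s)" by (rule conj_close)
      also have "\<dots> \<le> K * (\<delta> / K)" using cl s K by (intro mult_mono) auto
      finally show ?thesis using K by simp
    qed
    have Ec: "norm (E m' s - E m s) \<le> \<delta>" if s: "s \<in> S" for s
    proof -
      have "E m' s - E m s = transpose (D m' (inv s) - D m (inv s))" by (simp add: E_def transpose_def vec_eq_iff)
      then show ?thesis using Dc[OF S_inv[OF s]] by (simp add: norm_transpose)
    qed
    have *: "norm (1 *\<^sub>R (X' *v v) - X *v v) \<le> e * norm v" if x: "norm (X' - X) \<le> \<delta>" "\<delta> \<le> e" for X X' :: "real^'n^'n" and e v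
    proof -
      have "norm (X' *v v - X *v v) \<le> norm (X' - X) * norm v" using norm_mult_vec_le[of "X' - X" v] by (simp add: matrix_vector_mult_diff_rdistrib)
      also have "\<dots> \<le> e * norm v" using x by (intro mult_right_mono) auto
      finally show ?thesis by simp
    qed
    show "ldist (l1 m c q r) (l1 m' a b r) \<le> \<eta>"
      unfolding l1_def
    proof (rule s1[OF gs1[OF gd']])
      fix s assume s: "s \<in> S"
      show "\<exists>t. t \<noteq> 0 \<and> (\<forall>v. norm (t *\<^sub>R (D m' s *v v) - D m s *v v) \<le> e1 * norm v)"
        by (intro exI[of _ 1] conjI allI *[OF Dc[OF s] \<delta>(2)]) simp
    qed
    show "ldist (l2 m c q r) (l2 m' a b r) \<le> \<eta>"
      unfolding l2_def
    proof (rule s2[OF gs2[OF gd']])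
      fix s assume s: "s \<in> S"
      show "\<exists>t. t \<noteq> 0 \<and> (\<forall>v. norm (t *\<^sub>R (E m' s *v v) - E m s *v v) \<le> e2 * norm v)"
        by (intro exI[of _ 1] conjI allI *[OF Ec[OF s] \<delta>(3)]) simp
    qed
    show "ldist (l3 m c' q' r) (l3 m' a' b' r) \<le> \<eta>"
      unfolding l3_def
    proof (rule s3[OF gs3[OF gd']])
      fix s assume s: "s \<in> S"
      have "norm (Lam (E m' s) M - Lam (E m s) M) \<le> e3 * norm M" for M
      proof -
        have "norm (Lam (E m' s) M - Lam (E m s) M) \<le> (\<delta> * (2 * norm (E m s) + 1)) * norm M" by (rule Lam_close[OF Ec[OF s] \<delta>(4)])
        also have "\<dots> \<le> ((e3 / N) * N) * norm M" using \<delta>(1,5) sE[OF s] e(3) N by (intro mult_right_mono mult_mono) (auto simp: N_def)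
        finally show ?thesis using N by simp
      qed
      then show "\<exists>t. t \<noteq> 0 \<and> (\<forall>v. norm (t *\<^sub>R Lam (E m' s) v - Lam (E m s) v) \<le> e3 * norm v)"
        by (intro exI[of _ 1]) simp
    qed
  qed
qed

text \<open>A minimality argument: were the limit curve over \<open>I\<close> contained in a hyperplane, then pulling that hyperplane
  back by group elements contracting the boundary into \<open>I\<close> would produce, in the limit, a hyperplane
  containing the whole limit curve.\<close>

lemma limit_curve_leaves_hyperplane:
  assumes gd: "good \<rho> m c q c' q'" and hyp: "word_hyperbolic G S" and wi: "weakly_irreducible G S B \<rho>"
    and comp: "compact_space boundary" and nosing: "\<And>x. \<not> openin boundary {x}"
    and I: "openin boundary I" "x0 \<in> I" and w: "w \<noteq> 0"
  shows "\<exists>y\<in>rays. cls y \<in> I \<and> l1 m c q y \<bullet> w \<noteq> 0"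
proof (rule ccontr)
  assume neg0: "\<not> ?thesis"
  have neg: "l1 m c q y \<bullet> w = 0" if "y \<in> rays" "cls y \<in> I" for y using neg0 that by blast
  interpret R: gap_system G S "\<lambda>g. (*v) (D m g)" c q by (rule gs1[OF gd])
  have l1: "l1 m c q = R.lim" by (rule ext) (simp add: l1_def)
  have "x0 \<in> cls ` rays" using openin_subset[OF I(1)] I(2) topspace_boundary by blast
  then obtain r where r: "r \<in> rays" "cls r = x0" by blast
  define P where "P x = outer (R.lim (SOME r. r \<in> x))" for x
  have cP: "continuous_map boundary euclidean P" unfolding P_def by (rule R.continuous_map_lim[of outer, OF outer_minus isCont_outer])
  have P: "P (cls s) = outer (R.lim s)" if "s \<in> rays" for s unfolding P_def by (rule R.even_lim_some[of outer, OF outer_minus that])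
  \<comment> \<open>The projections onto the lines outside \<open>I\<close> form a compact set; off
    this closed set, being near a line over \<open>I\<close> implies being over
    \<open>I\<close>.\<close>
  define C where "C = P ` (topspace boundary - I)"
  have "compactin boundary (topspace boundary - I)" by (rule closedin_compact_space[OF comp]) (rule openin_closedin_eq[THEN iffD1, OF I(1), THEN conjunct2])
  then have "compactin euclidean C" unfolding C_def by (rule image_compactin[OF _ cP])
  then have oC: "open (- C)" by (simp add: compact_imp_closed open_Compl)
  have inI: "cls s \<in> I" if s: "s \<in> rays" "outer (R.lim s) \<in> - C" for s
  proof (rule ccontr)
    assume "cls s \<notin> I"
    then have "cls s \<in> topspace boundary - I" using s(1) topspace_boundary by blast
    then have "P (cls s) \<in> C" unfolding C_def by (rule imageI)
    then show False using s(2) P[OF s(1)] by simp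
  qed
  \<comment> \<open>Transversality makes the limit curve injective: a point with the same line as
    \<open>r\<close> would be orthogonal to \<open>l2\<close> at \<open>r\<close>.\<close>
  have rC: "outer (R.lim r) \<in> - C"
  proof
    assume "outer (R.lim r) \<in> C"
    then obtain s where s: "s \<in> rays" "cls s \<notin> I" "outer (R.lim r) = outer (R.lim s)" unfolding C_def using topspace_boundary P by auto
    have ne: "cls s \<noteq> cls r" using s(2) r(2) I(2) by auto
    have "outer (R.lim s) *v l2 m c q r = 0" unfolding s(3)[symmetric] outer_mult using lim3_form(2)[OF gd r(1)] unfolding l1 by simp
    then have "R.lim s \<bullet> l2 m c q r = 0 \<or> R.lim s = 0" unfolding outer_mult by simp
    moreover have "R.lim s \<noteq> 0" using R.lim(1)[OF s(1)] by auto
    ultimately show False using transverse[OF gd hyp s(1) r(1) ne] unfolding l1 by simp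
  qed
  show False
  proof (rule R.contraction[OF hyp r(1)])
    fix t and g :: "nat \<Rightarrow> 'g"
    assume t: "t \<in> rays" and g: "\<And>j. g j \<in> carrier G"
      and ct: "\<And>y. y \<in> rays \<Longrightarrow> cls y \<noteq> cls t \<Longrightarrow> (\<lambda>j. ldist (R.lim (\<lambda>n. g j \<otimes> y n)) (R.lim r)) \<longlonglongrightarrow> 0"
    \<comment> \<open>The normal of the hyperplane pulled back by \<open>g j\<close>. After
      normalisation, a subsequence converges to the normal of the limit hyperplane.\<close>
    define W where "W j = transpose (D m (g j)) *v w" for j
    have W0: "W j \<noteq> 0" for j
    proof
      assume W0: "W j = 0"
      have "invertible (transpose (D m (g j)))" using D_inv(1)[OF gd g] by (rule transpose_invertible)
      then obtain X where "X ** transpose (D m (g j)) = mat 1" unfolding invertible_def by blast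
      moreover have "X *v W j = (X ** transpose (D m (g j))) *v w" by (simp only: W_def matrix_vector_mul_assoc)
      ultimately have "w = X *v W j" by (simp only: matrix_vector_mul_lid)
      then show False using w W0 by simp
    qed
    define n where "n j = (1 / norm (W j)) *\<^sub>R W j" for j
    have "\<forall>j. n j \<in> sphere 0 1" using W0 by (simp add: n_def)
    then obtain n' \<kappa> where k: "n' \<in> sphere 0 1" "strict_mono (\<kappa> :: nat \<Rightarrow> nat)" "(n \<circ> \<kappa>) \<longlonglongrightarrow> n'"
      using compact_sphere[of "0 :: real^'n" 1] unfolding compact_def by metis
    have n0: "n' \<noteq> 0" using k(1) by auto
    have perp: "R.lim y \<bullet> n' = 0" if y: "y \<in> rays" "cls y \<noteq> cls t" for y
    proof -
      have "(\<lambda>j. outer (R.lim (\<lambda>n. g j \<otimes> y n))) \<longlonglongrightarrow> outer (R.lim r)"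
        by (rule even_tendsto[of _ _ outer, OF ct[OF y] outer_minus isCont_outer])
      then have "\<forall>\<^sub>F j in sequentially. outer (R.lim (\<lambda>n. g j \<otimes> y n)) \<in> - C" by (rule topological_tendstoD[OF _ oC rC])
      then have "\<forall>\<^sub>F j in sequentially. R.lim y \<bullet> n j = 0"
      proof eventually_elim
        case (elim j)
        note yr = translate_ray[OF g y(1)]
        obtain a where a: "a \<noteq> 0" "R.lim (\<lambda>n. g j \<otimes> y n) = a *\<^sub>R (D m (g j) *v R.lim y)" using R.lim_translate[OF g y(1)] by blast
        have "(a *\<^sub>R (D m (g j) *v R.lim y)) \<bullet> w = 0" using neg[OF yr inI[OF yr elim]] unfolding l1 a(2) .
        then have "(D m (g j) *v R.lim y) \<bullet> w = 0" using a(1) by simp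
        then have "R.lim y \<bullet> W j = 0" unfolding W_def by (metis inner_commute inner_transpose_move)
        then show "R.lim y \<bullet> n j = 0" unfolding n_def by simp
      qed
      then have "(\<lambda>j. R.lim y \<bullet> n j) \<longlonglongrightarrow> 0" by (rule tendsto_eventually)
      then have "(\<lambda>j. R.lim y \<bullet> n (\<kappa> j)) \<longlonglongrightarrow> 0" using LIMSEQ_subseq_LIMSEQ[OF _ k(2)] by (force simp: o_def)
      moreover have "(\<lambda>j. R.lim y \<bullet> n (\<kappa> j)) \<longlonglongrightarrow> R.lim y \<bullet> n'" using k(3) unfolding o_def by (intro tendsto_inner tendsto_const)
      ultimately show ?thesis by (rule LIMSEQ_unique[symmetric])
    qed
    have Pn: "P (cls y) *v n' = (R.lim y \<bullet> n') *\<^sub>R R.lim y" if "y \<in> rays" for y unfolding P[OF that] outer_mult ..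
    \<comment> \<open>The boundary points whose line leaves the limit hyperplane. This set is open
      and contains at most \<open>cls t\<close>, so it is empty as there are no isolated
      points.\<close>
    define Z where "Z = {x \<in> topspace boundary. P x \<in> {A. A *v n' \<noteq> 0}}"
    have "open {A :: real^'n^'n. A *v n' \<noteq> 0}"
    proof -
      have "continuous_on UNIV (\<lambda>A :: real^'n^'n. A *v n')"
        unfolding continuous_on_def by (intro ballI tendsto_matrix_vector_mult tendsto_intros)
      then show ?thesis by (intro open_Collect_neq continuous_on_const)
    qed
    then have oZ: "openin boundary Z" unfolding Z_def by (intro openin_continuous_map_preimage[OF cP]) simp
    have "Z \<subseteq> {cls t}"
    proof
      fix x assume x: "x \<in> Z"
      then obtain y where y: "y \<in> rays" "x = cls y" using topspace_boundary unfolding Z_def by blast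
      have "(R.lim y \<bullet> n') *\<^sub>R R.lim y \<noteq> 0" using x unfolding Z_def y(2) Pn[OF y(1), symmetric] by simp
      then have "cls y = cls t" using perp[OF y(1)] by force
      then show "x \<in> {cls t}" using y(2) by simp
    qed
    then have "Z = {}" using oZ nosing by (metis subset_singletonD)
    then have all: "R.lim y \<bullet> n' = 0" if y: "y \<in> rays" for y
    proof -
      have "P (cls y) *v n' = 0" using \<open>Z = {}\<close> y topspace_boundary unfolding Z_def by blast
      then have "R.lim y \<bullet> n' = 0 \<or> R.lim y = 0" unfolding Pn[OF y] by simp
      moreover have "R.lim y \<noteq> 0" using R.lim(1)[OF y] by auto
      ultimately show ?thesis by blast
    qed
    let ?W = "{v. (T *v v) \<bullet> n' = 0}"
    have "subspace ?W" by (auto simp: subspace_def matrix_vector_right_distrib matrix_vector_mult_scaleR inner_add_left)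
    moreover have "T' *v n' \<notin> ?W" using n0 by (simp add: T_inv)
    then have "?W \<noteq> UNIV" by blast
    moreover have "boundary_map G S B \<rho> 1 x \<subseteq> ?W" if "x \<in> topspace boundary" for x
    proof -
      obtain y where y: "y \<in> rays" "x = cls y" using \<open>x \<in> topspace boundary\<close> topspace_boundary by blast
      show ?thesis unfolding y(2) bm1[OF gd y(1)] l1 using all[OF y(1)] by auto
    qed
    ultimately show False using wi unfolding weakly_irreducible_def by blast
  qed
qed

end

section \<open>Arcs in the boundary circle\<close>

lemma cis_2pi_eq:
  assumes "cis (2 * pi * s) = cis (2 * pi * t)" "\<bar>s - t\<bar> < 1"
  shows "s = t"
proof -
  have "sin (2 * pi * s) = sin (2 * pi * t) \<and> cos (2 * pi * s) = cos (2 * pi * t)" using assms(1) by (auto simp: complex_eq_iff)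
  then obtain n :: int where "2 * pi * s = 2 * pi * t + 2 * pi * n" unfolding sin_cos_eq_iff by (auto simp: mult_ac)
  then have "2 * pi * s = 2 * pi * (t + n)" by (simp add: distrib_left)
  then have n: "s = t + n" by simp
  then have "\<bar>real_of_int n\<bar> < 1" using assms(2) by simp
  then have "n = 0" by linarith
  then show ?thesis using n by simp
qed

lemma ex_cis_2pi:
  assumes u: "norm u = 1" "norm w = 1"
  shows "\<exists>t. a < t \<and> t \<le> a + 1 \<and> u = w * cis (2 * pi * t)"
proof -
  have w: "w \<noteq> 0" using u by auto
  have "norm (u / w) = 1" using u by (simp add: norm_divide)
  then obtain x where x: "u / w = cis x" by (metis complex_norm_eq_1_exp cis_conv_exp)
  define k where "k = \<lfloor>a + 1 - x / (2 * pi)\<rfloor>"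
  have "a < x / (2 * pi) + k \<and> x / (2 * pi) + k \<le> a + 1" unfolding k_def using floor_correct[of "a + 1 - x / (2 * pi)"] by (simp only: of_int_add of_int_1) linarith
  moreover have "cis (2 * pi * (x / (2 * pi) + k)) = cis x" 
  proof -
    have "2 * pi * (x / (2 * pi) + k) = x + 2 * pi * k" by (simp add: distrib_left)
    then show ?thesis by (simp add: cis_mult[symmetric])
  qed
  ultimately show ?thesis using x w by (intro exI[of _ "x / (2 * pi) + k"]) (simp add: field_simps)
qed

text \<open>The circle is traversed once, starting at \<open>z\<close>, by a map
  \<open>\<gamma>\<close> of period 1 on the whole line. Arcs are open because their complements are
  again images of compact intervals.\<close>

lemma punctured_circle_param:
  assumes hom: "X homeomorphic_space top_of_set (sphere (0::complex) 1)" and z: "z \<in> topspace X"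
  obtains \<gamma> :: "real \<Rightarrow> 'a" where "continuous_map (top_of_set {0<..<1}) X \<gamma>" "bij_betw \<gamma> {0<..<1} (topspace X - {z})"
    "\<And>a b. 0 < a \<Longrightarrow> a < b \<Longrightarrow> b < 1 \<Longrightarrow> openin X (\<gamma> ` {a<..<b})"
proof -
  let ?C = "sphere (0::complex) 1"
  obtain h k where h: "continuous_map X (top_of_set ?C) h" "continuous_map (top_of_set ?C) X k"
    "\<And>x. x \<in> topspace X \<Longrightarrow> k (h x) = x" "\<And>u. u \<in> ?C \<Longrightarrow> h (k u) = u"
    using hom unfolding homeomorphic_space_def homeomorphic_maps_def by auto
  have hC: "h x \<in> ?C" if "x \<in> topspace X" for x using h(1) that by (auto simp: continuous_map_def)
  have kX: "k u \<in> topspace X" if "u \<in> ?C" for u using h(2) that by (auto simp: continuous_map_def)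
  define e where "e t = h z * cis (2 * pi * t)" for t
  have nz: "norm (h z) = 1" using hC[OF z] by simp
  have eC: "e t \<in> ?C" for t using nz by (simp add: e_def norm_mult)
  have e_inj: "s = t" if "e s = e t" "\<bar>s - t\<bar> < 1" for s t using that nz by (intro cis_2pi_eq) (auto simp: e_def)
  have e_surj: "\<exists>t. a < t \<and> t \<le> a + 1 \<and> u = e t" if "u \<in> ?C" for a u using ex_cis_2pi[of u "h z" a] that nz by (simp add: e_def)
  have e01: "e 0 = h z" "e 1 = h z" by (simp_all add: e_def)
  have e_per: "e (t + 1) = e t" for t unfolding e_def by (simp add: distrib_left cis_mult[symmetric])
  have ce: "continuous_on A e" for A unfolding e_def by (intro continuous_intros)
  define \<gamma> where "\<gamma> = k \<circ> e"
  have c: "continuous_map (top_of_set A) X \<gamma>" for A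
    unfolding \<gamma>_def using ce eC by (intro continuous_map_compose[OF _ h(2)]) (auto simp: continuous_map_in_subtopology)
  have hg: "h (\<gamma> t) = e t" for t unfolding \<gamma>_def using h(4)[OF eC] by simp
  have g_inj: "s = t" if "\<gamma> s = \<gamma> t" "\<bar>s - t\<bar> < 1" for s t using that hg e_inj by metis
  have g_surj: "\<exists>t. a < t \<and> t \<le> a + 1 \<and> x = \<gamma> t" if "x \<in> topspace X" for x a
    using e_surj[OF hC[OF that], of a] h(3)[OF that] by (auto simp: \<gamma>_def)
  have gX: "\<gamma> t \<in> topspace X" for t unfolding \<gamma>_def using kX[OF eC] by simp
  have gz: "\<gamma> 0 = z" "\<gamma> 1 = z" using h(3)[OF z] by (simp_all add: \<gamma>_def e01)
  have g_per: "\<gamma> (t + 1) = \<gamma> t" for t by (simp add: \<gamma>_def e_per)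
  have "bij_betw \<gamma> {0<..<1} (topspace X - {z})"
    unfolding bij_betw_def
  proof (intro conjI equalityI subsetI)
    show "inj_on \<gamma> {0<..<1}" by (intro inj_onI g_inj) auto
    fix x assume "x \<in> \<gamma> ` {0<..<1}"
    then obtain t where t: "0 < t" "t < 1" "x = \<gamma> t" by auto
    have "x \<noteq> z"
    proof
      assume "x = z"
      then have "\<gamma> t = \<gamma> 0" using t(3) gz by simp
      then have "t = 0" using t(1,2) by (intro g_inj) auto
      then show False using t(1) by simp
    qed
    then show "x \<in> topspace X - {z}" using gX t(3) by simp
  next
    fix x assume x: "x \<in> topspace X - {z}"
    obtain t where t: "0 < t" "t \<le> 0 + 1" "x = \<gamma> t" using g_surj[of x 0] x by auto
    then have "t \<noteq> 1" using x gz by auto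
    then show "x \<in> \<gamma> ` {0<..<1}" using t by auto
  qed
  moreover have "openin X (\<gamma> ` {a<..<b})" if ab: "0 < a" "a < b" "b < 1" for a b
  proof -
    have "compactin (top_of_set {b..a + 1}) {b..a + 1}" by (simp add: compactin_subtopology)
    then have "compactin X (\<gamma> ` {b..a + 1})" by (rule image_compactin[OF _ c])
    moreover have "Hausdorff_space X" using homeomorphic_Hausdorff_space[OF hom] by (simp add: Hausdorff_space_subtopology)
    ultimately have cl: "closedin X (\<gamma> ` {b..a + 1})" by (rule compactin_imp_closedin[rotated])
    \<comment> \<open>The complementary interval runs from \<open>b\<close> through 1, that is
      through \<open>z\<close>, up to \<open>a + 1\<close>; periodicity makes this possible.\<close>
    have "\<gamma> ` {a<..<b} = topspace X - \<gamma> ` {b..a + 1}"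
    proof (intro equalityI subsetI)
      fix x assume "x \<in> \<gamma> ` {a<..<b}"
      then obtain t where t: "a < t" "t < b" "x = \<gamma> t" by auto
      have "\<gamma> s \<noteq> \<gamma> t" if s: "b \<le> s" "s \<le> a + 1" for s
      proof
        assume "\<gamma> s = \<gamma> t"
        then have "s = t" using s t ab by (intro g_inj) auto
        then show False using s t by simp
      qed
      then show "x \<in> topspace X - \<gamma> ` {b..a + 1}" using gX t(3) by force
    next
      fix x assume x: "x \<in> topspace X - \<gamma> ` {b..a + 1}"
      obtain t where t: "a < t" "t \<le> a + 1" "x = \<gamma> t" using g_surj[of x a] x by auto
      then have "t < b" using x by force
      then show "x \<in> \<gamma> ` {a<..<b}" using t by auto
    qed
    then show ?thesis using cl by (simp add: openin_diff)
  qed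
  ultimately show ?thesis using that c by blast
qed

text \<open>An open point would be clopen in the connected circle, which has at least the two points
  1 and -1.\<close>

lemma circle_no_open_singleton:
  assumes hom: "X homeomorphic_space top_of_set (sphere (0::complex) 1)"
  shows "\<not> openin X {x}"
proof
  assume o: "openin X {x}"
  let ?C = "sphere (0::complex) 1"
  obtain h where h: "homeomorphic_map X (top_of_set ?C) h" using hom homeomorphic_space by blast
  have x: "x \<in> topspace X" using openin_subset[OF o] by simp
  have "openin (top_of_set ?C) (h ` {x})" using homeomorphic_map_openness[OF h, of "{x}"] x o by simp
  moreover have "closedin (top_of_set ?C) {h x}" 
    using homeomorphic_imp_surjective_map[OF h] x by (intro closed_subset) auto
  moreover have "connected ?C" by (rule connected_sphere) simp
  ultimately have "{h x} = {} \<or> {h x} = ?C" by (auto simp: connected_clopen)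
  then have "1 = h x" "-1 = h x" by (auto simp: set_eq_iff)
  then show False by (metis one_neq_neg_one)
qed

lemma circle_compact:
  assumes "X homeomorphic_space top_of_set (sphere (0::complex) 1)"
  shows "compact_space X"
  using homeomorphic_compact_space[OF assms] by (simp add: compact_space_subtopology)

section \<open>Folds of the projected limit curve\<close>

lemma ivt_extremum:
  fixes g :: "real \<Rightarrow> real"
  assumes c: "continuous_on {a..b} g" and o: "a < s" "s < b" and e: "0 < (g s - g a) * (g s - g b)"
  shows "\<exists>t u. a \<le> t \<and> t < u \<and> u \<le> b \<and> g t = g u"
proof -
  have main: "\<exists>t u. a \<le> t \<and> t < u \<and> u \<le> b \<and> h t = h u"
    if h: "continuous_on {a..b} h" "h a < h s" "h b < h s" for h :: "real \<Rightarrow> real"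
  proof -
    \<comment> \<open>The larger of the end values is attained on either side of \<open>s\<close>,
      and not at \<open>s\<close>, where \<open>h\<close> is larger.\<close>
    let ?y = "max (h a) (h b)"
    have "continuous_on {a..s} h" "continuous_on {s..b} h" using h(1) o by (auto elim: continuous_on_subset)
    then obtain t u where "a \<le> t" "t \<le> s" "h t = ?y" "s \<le> u" "u \<le> b" "h u = ?y"
      using IVT'[of h a ?y s] IVT2'[of h b ?y s] h(2,3) o by auto
    moreover have "t \<noteq> s" using calculation h(2,3) by auto
    ultimately show ?thesis by (intro exI[of _ t] exI[of _ u]) auto
  qed
  consider "g a < g s" "g b < g s" | "g s < g a" "g s < g b" using e by (auto simp: zero_less_mult_iff)
  then show ?thesis
  proof cases
    case 1
    then show ?thesis by (rule main[OF c])
  next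
    case 2
    then show ?thesis using main[of "\<lambda>t. - g t"] continuous_on_minus[OF c] by auto
  qed
qed

text \<open>Even in each argument, so that its sign depends only on the lines spanned by the vectors.\<close>

definition fold_form :: "real^'n \<Rightarrow> real^'n \<Rightarrow> real^'n \<Rightarrow> real^'n \<Rightarrow> real^'n^'n \<Rightarrow> real" where
  "fold_form x y w \<phi> M = (x \<bullet> (M *v w)) * (y \<bullet> (M *v w)) * ((\<phi> \<bullet> x) * (\<phi> \<bullet> y))"

lemma ldist_sign: "ldist u u' \<le> d \<Longrightarrow> \<exists>t. t * t = 1 \<and> norm (u - t *\<^sub>R u') \<le> d"
  by (rule ldist_cases[of u u']) (metis mult_1 mult_minus_left minus_minus)

lemma fold_form_robust:
  fixes x y w \<phi> :: "real^'n"
  assumes "0 < fold_form x y w \<phi> M"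
  shows "\<exists>\<eta>>0. \<forall>x' y' w' \<phi>' M'. ldist x x' \<le> \<eta> \<longrightarrow> ldist y y' \<le> \<eta> \<longrightarrow> ldist w w' \<le> \<eta> \<longrightarrow> ldist \<phi> \<phi>' \<le> \<eta> \<longrightarrow> ldist M M' \<le> \<eta> \<longrightarrow>
    0 < fold_form x' y' w' \<phi>' M'"
proof -
  define F where "F p = fold_form (fst p) (fst (snd p)) (fst (snd (snd p))) (fst (snd (snd (snd p)))) (snd (snd (snd (snd p))))"
    for p :: "(real^'n) \<times> (real^'n) \<times> (real^'n) \<times> (real^'n) \<times> (real^'n^'n)"
  let ?p = "(x, y, w, \<phi>, M)"
  have "isCont F ?p"
    unfolding isCont_def F_def fold_form_def by (intro tendsto_intros tendsto_matrix_vector_mult)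
  moreover have p0: "0 < F ?p" using assms by (simp add: F_def)
  ultimately obtain d where d: "0 < d" "\<And>p. dist p ?p < d \<Longrightarrow> dist (F p) (F ?p) < F ?p"
    unfolding continuous_at_eps_delta by blast
  show ?thesis
  \<comment> \<open>Five sign-corrected differences of size at most d / 6 add up to less than
    d.\<close>
  proof (intro exI[of _ "d / 6"] conjI allI impI)
    show "0 < d / 6" using d by simp
    fix x' y' w' \<phi>' M'
    assume l: "ldist x x' \<le> d / 6" "ldist y y' \<le> d / 6" "ldist w w' \<le> d / 6" "ldist \<phi> \<phi>' \<le> d / 6" "ldist M M' \<le> d / 6"
    obtain a where a: "a * a = 1" "norm (x - a *\<^sub>R x') \<le> d / 6" using ldist_sign[OF l(1)] by blast
    obtain b where b: "b * b = 1" "norm (y - b *\<^sub>R y') \<le> d / 6" using ldist_sign[OF l(2)] by blast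
    obtain c where c: "c * c = 1" "norm (w - c *\<^sub>R w') \<le> d / 6" using ldist_sign[OF l(3)] by blast
    obtain e where e: "e * e = 1" "norm (\<phi> - e *\<^sub>R \<phi>') \<le> d / 6" using ldist_sign[OF l(4)] by blast
    obtain k where k: "k * k = 1" "norm (M - k *\<^sub>R M') \<le> d / 6" using ldist_sign[OF l(5)] by blast
    let ?q = "(a *\<^sub>R x', b *\<^sub>R y', c *\<^sub>R w', e *\<^sub>R \<phi>', k *\<^sub>R M')"
    have "norm (?p - ?q) \<le> norm (x - a *\<^sub>R x') + (norm (y - b *\<^sub>R y') + (norm (w - c *\<^sub>R w') + (norm (\<phi> - e *\<^sub>R \<phi>') + norm (M - k *\<^sub>R M'))))"
      unfolding diff_Pair by (intro order_trans[OF norm_Pair_le] add_left_mono order_refl)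
    also have "\<dots> < d" using a(2) b(2) c(2) e(2) k(2) d(1) by linarith
    finally have "dist ?q ?p < d" by (simp only: dist_norm norm_minus_commute[of ?q])
    from d(2)[OF this] have "0 < F ?q" by (simp add: dist_real_def)
    moreover have "F ?q = (a * a) * (b * b) * (c * c) * (e * e) * (k * k) * fold_form x' y' w' \<phi>' M'"
      unfolding F_def fold_form_def by (simp add: matrix_vector_mult_scaleR mult_ac flip: scaleR_matrix_vector_assoc)
    ultimately show "0 < fold_form x' y' w' \<phi>' M'" unfolding a(1) b(1) c(1) e(1) k(1) by simp
  qed
qed

text \<open>An arc avoiding \<open>z\<close>, lifted to rays. The lift is arbitrary, only the
  classes vary continuously; it is recorded so that the same rays can be used for every
  representation.\<close>

definition (in marked_group) ray_arc :: "(nat \<Rightarrow> 'g) \<Rightarrow> (real \<Rightarrow> nat \<Rightarrow> 'g) \<Rightarrow> bool" where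
  "ray_arc z \<sigma> \<longleftrightarrow> z \<in> rays \<and> continuous_map (top_of_set {0<..<1}) boundary (\<lambda>t. cls (\<sigma> t)) \<and>
     (\<forall>t\<in>{0<..<1}. \<sigma> t \<in> rays \<and> cls (\<sigma> t) \<noteq> cls z) \<and> inj_on (\<lambda>t. cls (\<sigma> t)) {0<..<1}"

context rep_setup begin

definition fold_at where
  "fold_at m c q c' q' z x w y = fold_form (l1 m c q x) (l1 m c q y) (l1 m c q w) (l2 m c q z) (l3 m c' q' z)"

lemma robust_fold:
  assumes gd: "good \<rho> m c q c' q'" and r: "z \<in> rays" "x \<in> rays" "w \<in> rays" "y \<in> rays"
    and pos: "0 < fold_at m c q c' q' z x w y"
  shows "\<exists>\<epsilon>>0. \<forall>\<rho>' m' a b a' b'. good \<rho>' m' a b a' b' \<longrightarrow> (\<forall>s\<in>S. norm (m' s - m s) \<le> \<epsilon>) \<longrightarrow> 0 < fold_at m' a b a' b' z x w y"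
proof -
  obtain \<eta> where \<eta>: "0 < \<eta>" and F: "\<forall>x' y' w' \<phi>' M'. ldist (l1 m c q x) x' \<le> \<eta> \<longrightarrow> ldist (l1 m c q y) y' \<le> \<eta> \<longrightarrow> ldist (l1 m c q w) w' \<le> \<eta> \<longrightarrow>
      ldist (l2 m c q z) \<phi>' \<le> \<eta> \<longrightarrow> ldist (l3 m c' q' z) M' \<le> \<eta> \<longrightarrow> 0 < fold_form x' y' w' \<phi>' M'"
    using fold_form_robust[OF pos[unfolded fold_at_def]] by blast
  note st = stable[OF gd _ \<eta>]
  obtain ex where ex: "0 < ex" "\<forall>\<rho>' m' a b a' b'. good \<rho>' m' a b a' b' \<longrightarrow> (\<forall>s\<in>S. norm (m' s - m s) \<le> ex) \<longrightarrow>
    ldist (l1 m c q x) (l1 m' a b x) \<le> \<eta> \<and> ldist (l2 m c q x) (l2 m' a b x) \<le> \<eta> \<and> ldist (l3 m c' q' x) (l3 m' a' b' x) \<le> \<eta>"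
    using st[OF r(2)] by blast
  obtain ey where ey: "0 < ey" "\<forall>\<rho>' m' a b a' b'. good \<rho>' m' a b a' b' \<longrightarrow> (\<forall>s\<in>S. norm (m' s - m s) \<le> ey) \<longrightarrow>
    ldist (l1 m c q y) (l1 m' a b y) \<le> \<eta> \<and> ldist (l2 m c q y) (l2 m' a b y) \<le> \<eta> \<and> ldist (l3 m c' q' y) (l3 m' a' b' y) \<le> \<eta>"
    using st[OF r(4)] by blast
  obtain ew where ew: "0 < ew" "\<forall>\<rho>' m' a b a' b'. good \<rho>' m' a b a' b' \<longrightarrow> (\<forall>s\<in>S. norm (m' s - m s) \<le> ew) \<longrightarrow>
    ldist (l1 m c q w) (l1 m' a b w) \<le> \<eta> \<and> ldist (l2 m c q w) (l2 m' a b w) \<le> \<eta> \<and> ldist (l3 m c' q' w) (l3 m' a' b' w) \<le> \<eta>"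
    using st[OF r(3)] by blast
  obtain ez where ez: "0 < ez" "\<forall>\<rho>' m' a b a' b'. good \<rho>' m' a b a' b' \<longrightarrow> (\<forall>s\<in>S. norm (m' s - m s) \<le> ez) \<longrightarrow>
    ldist (l1 m c q z) (l1 m' a b z) \<le> \<eta> \<and> ldist (l2 m c q z) (l2 m' a b z) \<le> \<eta> \<and> ldist (l3 m c' q' z) (l3 m' a' b' z) \<le> \<eta>"
    using st[OF r(1)] by blast
  let ?e = "min (min ex ey) (min ew ez)"
  show ?thesis
  proof (intro exI[of _ ?e] conjI allI impI)
    show "0 < ?e" using ex(1) ey(1) ew(1) ez(1) by simp
    fix \<rho>' m' a b a' b' assume g: "good \<rho>' m' a b a' b'" and cl: "\<forall>s\<in>S. norm (m' s - m s) \<le> ?e"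
    have c: "\<forall>s\<in>S. norm (m' s - m s) \<le> ex" "\<forall>s\<in>S. norm (m' s - m s) \<le> ey" "\<forall>s\<in>S. norm (m' s - m s) \<le> ew" "\<forall>s\<in>S. norm (m' s - m s) \<le> ez"
      using cl by auto
    have "ldist (l1 m c q x) (l1 m' a b x) \<le> \<eta>" using ex(2) g c(1) by blast
    moreover have "ldist (l1 m c q y) (l1 m' a b y) \<le> \<eta>" using ey(2) g c(2) by blast
    moreover have "ldist (l1 m c q w) (l1 m' a b w) \<le> \<eta>" using ew(2) g c(3) by blast
    moreover have "ldist (l2 m c q z) (l2 m' a b z) \<le> \<eta>" "ldist (l3 m c' q' z) (l3 m' a' b' z) \<le> \<eta>" using ez(2) g c(4) by blast+
    ultimately show "0 < fold_at m' a b a' b' z x w y" unfolding fold_at_def using F by blast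
  qed
qed

text \<open>With \<open>l3 z = unit_wedge \<phi> \<psi>\<close>, the quotient below is the projection of the limit curve from \<open>\<xi>\<^sup>d\<^sup>-\<^sup>2(z)\<close>,
  read in the affine chart that sends \<open>\<xi>\<^sup>d\<^sup>-\<^sup>1(z)\<close> to infinity.\<close>

definition chart where "chart m c q \<phi> \<psi> r = (\<psi> \<bullet> l1 m c q r) / (\<phi> \<bullet> l1 m c q r)"

context
  fixes \<rho> m c q c' q' z \<sigma> \<psi>
  assumes gd: "good \<rho> m c q c' q'" and hyp: "word_hyperbolic G S" and arc: "ray_arc z \<sigma>"
    and psi: "orthonormal_pair (l2 m c q z) \<psi>" "l3 m c' q' z = unit_wedge (l2 m c q z) \<psi>"
begin

abbreviation "coord r \<equiv> chart m c q (l2 m c q z) \<psi> r"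

lemma arcD:
  "z \<in> rays" "0 < t \<Longrightarrow> t < 1 \<Longrightarrow> \<sigma> t \<in> rays" "0 < t \<Longrightarrow> t < 1 \<Longrightarrow> cls (\<sigma> t) \<noteq> cls z"
  "0 < t \<Longrightarrow> t < 1 \<Longrightarrow> 0 < u \<Longrightarrow> u < 1 \<Longrightarrow> t \<noteq> u \<Longrightarrow> cls (\<sigma> t) \<noteq> cls (\<sigma> u)"
  using arc by (auto simp: ray_arc_def inj_on_def)

lemma chart_denom: "0 < t \<Longrightarrow> t < 1 \<Longrightarrow> l2 m c q z \<bullet> l1 m c q (\<sigma> t) \<noteq> 0"
  using transverse[OF gd hyp arcD(2) arcD(1) arcD(3)] by (simp add: inner_commute)

lemma form_chart:
  assumes "0 < t" "t < 1" "0 < u" "u < 1"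
  shows "l1 m c q (\<sigma> t) \<bullet> (l3 m c' q' z *v l1 m c q (\<sigma> u)) =
    (1 / sqrt 2) * ((l2 m c q z \<bullet> l1 m c q (\<sigma> t)) * (l2 m c q z \<bullet> l1 m c q (\<sigma> u)) * (coord (\<sigma> u) - coord (\<sigma> t)))"
  unfolding form_value[OF gd psi(2)] chart_def using chart_denom[OF assms(1,2)] chart_denom[OF assms(3,4)]
  by (simp add: field_simps)

text \<open>By \<open>form_chart\<close> each value of the form is a difference of coordinates times
  two denominators. The last factor of \<open>fold_form\<close> completes all denominators to
  squares, so the sign of the product of differences remains.\<close>

lemma fold_at_pos_iff:
  assumes "0 < a" "a < 1" "0 < s" "s < 1" "0 < b" "b < 1"
  shows "0 < fold_at m c q c' q' z (\<sigma> a) (\<sigma> s) (\<sigma> b) \<longleftrightarrow> 0 < (coord (\<sigma> s) - coord (\<sigma> a)) * (coord (\<sigma> s) - coord (\<sigma> b))"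
proof -
  let ?d = "\<lambda>t. l2 m c q z \<bullet> l1 m c q (\<sigma> t)"
  let ?k = "1 / sqrt 2 * ?d a * ?d b * ?d s"
  have "fold_at m c q c' q' z (\<sigma> a) (\<sigma> s) (\<sigma> b) = (?k * ?k) * ((coord (\<sigma> s) - coord (\<sigma> a)) * (coord (\<sigma> s) - coord (\<sigma> b)))"
    unfolding fold_at_def fold_form_def form_chart[OF assms(1-4)] form_chart[OF assms(5,6,3,4)] by (simp only: mult_ac)
  moreover have "?k \<noteq> 0" using chart_denom assms by simp
  then have "0 < ?k * ?k" by (metis not_real_square_gt_zero)
  ultimately show ?thesis by (simp only: zero_less_mult_iff) auto
qed

lemma criterion_arc:
  assumes "0 < t" "t < 1" "0 < u" "u < 1" "t \<noteq> u"
  shows "{v + w | v w. v \<in> boundary_map G S B \<rho> 1 (cls (\<sigma> t)) \<and> w \<in> boundary_map G S B \<rho> 1 (cls (\<sigma> u))}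
          \<inter> boundary_map G S B \<rho> (CARD('n) - 2) (cls z) = {0} \<longleftrightarrow> coord (\<sigma> t) \<noteq> coord (\<sigma> u)"
proof -
  have "l1 m c q (\<sigma> t) \<bullet> (l3 m c' q' z *v l1 m c q (\<sigma> u)) \<noteq> 0 \<longleftrightarrow> coord (\<sigma> t) \<noteq> coord (\<sigma> u)"
    unfolding form_chart[OF assms(1-4)] using chart_denom assms by auto
  then show ?thesis
    using hyperconvex_criterion[OF gd hyp arcD(2)[OF assms(1,2)] arcD(2)[OF assms(3,4)] arcD(1) arcD(4)[OF assms] arcD(3)[OF assms(3,4)] arcD(3)[OF assms(1,2)]]
    by simp
qed

text \<open>The vectors \<open>l1\<close> are not continuous because of their signs. The coordinate
  is rewritten in terms of the projections \<open>outer\<close>, which are, by expanding the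
  quotient with its denominator.\<close>

lemma continuous_chart: "continuous_on {0<..<1} (\<lambda>t. coord (\<sigma> t))"
proof -
  interpret R: gap_system G S "\<lambda>g. (*v) (D m g)" c q by (rule gs1[OF gd])
  define P where "P x = outer (R.lim (SOME r. r \<in> x))" for x
  have cP: "continuous_map boundary euclidean P" unfolding P_def by (rule R.continuous_map_lim[of outer, OF outer_minus isCont_outer])
  have "continuous_map (top_of_set {0<..<1}) euclidean (P \<circ> (\<lambda>t. cls (\<sigma> t)))"
    by (rule continuous_map_compose[OF _ cP]) (use arc in \<open>simp add: ray_arc_def\<close>)
  then have cont: "continuous_on {0<..<1} (\<lambda>t. P (cls (\<sigma> t)))" by (simp add: o_def)
  have P: "P (cls (\<sigma> t)) *v v = (l1 m c q (\<sigma> t) \<bullet> v) *\<^sub>R l1 m c q (\<sigma> t)" if "0 < t" "t < 1" for t v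
    unfolding P_def R.even_lim_some[of outer, OF outer_minus arcD(2)[OF that]] outer_mult l1_def ..
  let ?\<phi> = "l2 m c q z"
  have cv: "continuous_on {0<..<1} (\<lambda>t. ?\<phi> \<bullet> (P (cls (\<sigma> t)) *v v))" for v
    using cont unfolding continuous_on_def by (intro ballI tendsto_inner tendsto_const tendsto_matrix_vector_mult) auto
  have "continuous_on {0<..<1} (\<lambda>t. (?\<phi> \<bullet> (P (cls (\<sigma> t)) *v \<psi>)) / (?\<phi> \<bullet> (P (cls (\<sigma> t)) *v ?\<phi>)))"
    by (intro continuous_on_divide cv) (use chart_denom in \<open>auto simp: P inner_commute\<close>)
  then show ?thesis
    by (rule continuous_on_eq) (use chart_denom in \<open>auto simp: P chart_def inner_commute\<close>)
qed

text \<open>The strict fold makes the coordinate take some value at two parameters in [a, b]; these,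
  not \<open>a\<close> and \<open>b\<close> themselves, violate hyperconvexity together with
  \<open>z\<close>.\<close>

lemma not_hyperconvex_if_fold:
  assumes o: "0 < a" "a < s" "s < b" "b < 1" and pos: "0 < fold_at m c q c' q' z (\<sigma> a) (\<sigma> s) (\<sigma> b)"
  shows "\<not> hyperconvex_112 G S B \<rho>"
proof -
  have "0 < (coord (\<sigma> s) - coord (\<sigma> a)) * (coord (\<sigma> s) - coord (\<sigma> b))" using pos fold_at_pos_iff[of a s b] o by simp
  moreover have "continuous_on {a..b} (\<lambda>t. coord (\<sigma> t))" by (rule continuous_on_subset[OF continuous_chart]) (use o in auto)
  ultimately obtain t u where tu: "a \<le> t" "t < u" "u \<le> b" "coord (\<sigma> t) = coord (\<sigma> u)" using ivt_extremum[of a b "\<lambda>t. coord (\<sigma> t)" s] o by blast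
  have I: "0 < t" "t < 1" "0 < u" "u < 1" "t \<noteq> u" using tu o by auto
  have "cls (\<sigma> t) \<in> topspace boundary" "cls (\<sigma> u) \<in> topspace boundary" "cls z \<in> topspace boundary"
    using arcD I topspace_boundary by auto
  moreover have "cls (\<sigma> t) \<noteq> cls (\<sigma> u) \<and> cls (\<sigma> u) \<noteq> cls z \<and> cls (\<sigma> t) \<noteq> cls z" using arcD I by blast
  ultimately show ?thesis using criterion_arc[OF I] tu(4) unfolding hyperconvex_112_def by blast
qed

lemma fold_between:
  assumes wi: "weakly_irreducible G S B \<rho>" and comp: "compact_space boundary" and nosing: "\<And>x. \<not> openin boundary {x}"
    and op: "openin boundary ((\<lambda>t. cls (\<sigma> t)) ` {a<..<b})" and o: "0 < a" "a < b" "b < 1" and eq: "coord (\<sigma> a) = coord (\<sigma> b)"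
  shows "\<exists>s. a < s \<and> s < b \<and> 0 < fold_at m c q c' q' z (\<sigma> a) (\<sigma> s) (\<sigma> b)"
proof -
  \<comment> \<open>The normal of the hyperplane of coordinate value
    \<open>coord (\<sigma> a)\<close>. A point of the limit curve off this hyperplane has another
    coordinate, and then both differences of the fold are equal and non-zero.\<close>
  define w where "w = \<psi> - coord (\<sigma> a) *\<^sub>R l2 m c q z"
  have "w \<bullet> \<psi> = 1" using psi(1) by (simp add: w_def inner_diff_left orthonormal_pair_def)
  then have w0: "w \<noteq> 0" by auto
  have ne: "cls (\<sigma> ((a + b) / 2)) \<in> (\<lambda>t. cls (\<sigma> t)) ` {a<..<b}" using o by (intro imageI) simp
  obtain y where y: "y \<in> rays" "cls y \<in> (\<lambda>t. cls (\<sigma> t)) ` {a<..<b}" "l1 m c q y \<bullet> w \<noteq> 0"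
    using limit_curve_leaves_hyperplane[OF gd hyp wi comp nosing op ne w0] by blast
  then obtain s where s: "a < s" "s < b" "cls y = cls (\<sigma> s)" by auto
  have I: "0 < s" "s < 1" "0 < a" "a < 1" "0 < b" "b < 1" using s o by auto
  have "ldist (l1 m c q y) (l1 m c q (\<sigma> s)) = 0"
    unfolding l1_def by (rule gap_system.lim_cls[OF gs1[OF gd] y(1) arcD(2)[OF I(1,2)] s(3)])
  then have "w \<bullet> l1 m c q (\<sigma> s) \<noteq> 0" using y(3) abs_inner_ldist[of w "l1 m c q y" "l1 m c q (\<sigma> s)"] by (auto simp: inner_commute)
  then have "coord (\<sigma> s) \<noteq> coord (\<sigma> a)" unfolding w_def chart_def[of _ _ _ _ _ "\<sigma> s"] using chart_denom[OF I(1,2)]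
    by (auto simp: inner_diff_left field_simps)
  then have "0 < (coord (\<sigma> s) - coord (\<sigma> a)) * (coord (\<sigma> s) - coord (\<sigma> b))" unfolding eq[symmetric] using not_real_square_gt_zero[of "coord (\<sigma> s) - coord (\<sigma> a)"] by (simp only: right_minus_eq) blast
  then show ?thesis using s fold_at_pos_iff[OF I(3,4,1,2,5,6)] by blast
qed

end

end

section \<open>Neighbourhoods of a representation\<close>

lemma openin_PGL_near: "openin PGL_topology {X \<in> carrier PGL. \<exists>A\<in>X. norm (A - M) < \<epsilon>}"
proof -
  let ?U = "{X \<in> carrier PGL. \<exists>A\<in>X. norm (A - M) < \<epsilon>}"
  let ?f = "\<lambda>A :: real^'n^'n. scalar_matrices #>\<^bsub>GL\<^esub> A"
  have f: "?f A \<in> carrier PGL \<and> ?f A = {c *\<^sub>R A | c. c \<noteq> 0}" if A: "A \<in> carrier GL" for A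
  proof -
    have c: "?f A \<in> carrier PGL"
      unfolding topspace_PGL_topology[symmetric] PGL_topology_def topspace_quotient_topology using A by simp
    have "A \<in> ?f A" using A by (auto simp: r_coset_def scalar_matrices_def GL_def intro!: exI[of _ 1] exI[of _ "mat 1"])
    then show ?thesis using c PGL_elem(2)[OF c] by blast
  qed
  \<comment> \<open>A class contains a matrix near \<open>M\<close> if some multiple of
    \<open>A\<close> is near \<open>M\<close>; this is open in \<open>A\<close> for each scalar, and
    unions of open sets are open.\<close>
  have "{A \<in> topspace (top_of_set (carrier GL)). ?f A \<in> ?U} = carrier GL \<inter> (\<Union>c\<in>-{0}. {A. norm (c *\<^sub>R A - M) < \<epsilon>})"
  proof (intro equalityI subsetI)
    fix A assume "A \<in> {A \<in> topspace (top_of_set (carrier GL)). ?f A \<in> ?U}"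
    then have A: "A \<in> carrier GL" "\<exists>X\<in>?f A. norm (X - M) < \<epsilon>" by simp_all
    then obtain c where "c \<noteq> 0" "norm (c *\<^sub>R A - M) < \<epsilon>" using f[OF A(1)] by auto
    then show "A \<in> carrier GL \<inter> (\<Union>c\<in>-{0}. {A. norm (c *\<^sub>R A - M) < \<epsilon>})" using A(1) by blast
  next
    fix A assume "A \<in> carrier GL \<inter> (\<Union>c\<in>-{0}. {A. norm (c *\<^sub>R A - M) < \<epsilon>})"
    then obtain c where A: "A \<in> carrier GL" "c \<noteq> 0" "norm (c *\<^sub>R A - M) < \<epsilon>" by blast
    then have "c *\<^sub>R A \<in> ?f A" using f[OF A(1)] by auto
    then show "A \<in> {A \<in> topspace (top_of_set (carrier GL)). ?f A \<in> ?U}" using A f[OF A(1)] by auto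
  qed
  moreover have "open (\<Union>c\<in>-{0}. {A. norm (c *\<^sub>R A - M) < \<epsilon>})"
    by (intro open_UN ballI open_Collect_less continuous_intros)
  ultimately have "openin (top_of_set (carrier GL)) {A \<in> topspace (top_of_set (carrier GL)). ?f A \<in> ?U}"
    by (simp only: openin_open_Int)
  moreover have "?U \<subseteq> ?f ` topspace (top_of_set (carrier GL))"
    unfolding topspace_quotient_topology[symmetric] PGL_topology_def[symmetric] topspace_PGL_topology by blast
  ultimately show ?thesis unfolding PGL_topology_def openin_quotient_topology by blast
qed

lemma openin_representations_near:
  fixes m :: "'g \<Rightarrow> real^'n^'n"
  assumes S: "finite S" "S \<subseteq> carrier G"
  shows "openin (representation_topology G) {\<rho> \<in> representations G. \<forall>s\<in>S. \<exists>A\<in>\<rho> s. norm (A - m s) < \<epsilon>}"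
proof -
  let ?P = "product_topology (\<lambda>_. PGL_topology :: (real^'n^'n) set topology) (carrier G)"
  let ?V = "\<lambda>s. {X \<in> carrier PGL. \<exists>A\<in>X. norm (A - m s) < \<epsilon>}"
  let ?T = "(\<Inter>s\<in>S. {\<rho> \<in> topspace ?P. \<rho> s \<in> ?V s}) \<inter> topspace ?P"
  have "openin ?P ?T"
    using S by (intro openin_INT openin_continuous_map_preimage[OF continuous_map_product_projection] openin_PGL_near) auto
  moreover have "{\<rho> \<in> representations G. \<forall>s\<in>S. \<exists>A\<in>\<rho> s. norm (A - m s) < \<epsilon>} = ?T \<inter> representations G"
  proof -
    have "\<rho> \<in> topspace ?P" if "\<rho> \<in> representations G" for \<rho>
      using that topspace_representation_topology[of G] unfolding representation_topology_def topspace_subtopology by blast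
    moreover have "\<rho> s \<in> carrier PGL" if "\<rho> \<in> representations G" "s \<in> S" for \<rho> :: "'g \<Rightarrow> (real^'n^'n) set" and s
      using that S unfolding representations_def hom_def by auto
    ultimately show ?thesis by auto
  qed
  ultimately show ?thesis unfolding representation_topology_def openin_subtopology by blast
qed

context rep_setup begin

text \<open>Representing matrices are arbitrary away from the generators. For a nearby
  representation, those at the generators can be taken close to the given ones.\<close>

lemma ex_selection:
  assumes \<rho>: "\<rho> \<in> representations G" and s: "\<And>s. s \<in> S \<Longrightarrow> \<exists>A\<in>\<rho> s. Q s A"
  shows "\<exists>m. selection \<rho> m \<and> (\<forall>s\<in>S. Q s (m s))"
proof -
  have "\<exists>A. A \<in> \<rho> g \<and> (g \<in> S \<longrightarrow> Q g A)" if g: "g \<in> carrier G" for g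
  proof (cases "g \<in> S")
    case False
    have "\<rho> g \<in> carrier PGL" using \<rho> g by (auto simp: representations_def hom_def)
    then obtain A where "\<rho> g = {c *\<^sub>R A | c. c \<noteq> 0}" using carrier_PGL by blast
    then have "1 *\<^sub>R A \<in> \<rho> g" by (metis (mono_tags, lifting) mem_Collect_eq zero_neq_one)
    then show ?thesis using False by blast
  qed (use s in blast)
  then have "\<exists>m. \<forall>g\<in>carrier G. m g \<in> \<rho> g \<and> (g \<in> S \<longrightarrow> Q g (m g))" by (intro bchoice) blast
  then show ?thesis using \<rho> S_carrier unfolding selection_def by blast
qed

text \<open>The third point of a triple violating hyperconvexity is removed from the circle. The
  other two then lie on one arc and have the same coordinate, up to interchanging them to have
  \<open>a < b\<close>.\<close>

lemma fold_exists:
  assumes gd: "good \<rho> m c q c' q'" and hyp: "word_hyperbolic G S" and wi: "weakly_irreducible G S B \<rho>"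
    and hom: "boundary homeomorphic_space top_of_set (sphere (0::complex) 1)" and nh: "\<not> hyperconvex_112 G S B \<rho>"
  shows "\<exists>z \<sigma> a s b. ray_arc z \<sigma> \<and> 0 < a \<and> a < s \<and> s < b \<and> b < 1 \<and> 0 < fold_at m c q c' q' z (\<sigma> a) (\<sigma> s) (\<sigma> b)"
proof -
  let ?bm = "boundary_map G S B \<rho>"
  obtain X Y Z where xyz: "X \<in> topspace boundary" "Y \<in> topspace boundary" "Z \<in> topspace boundary" "X \<noteq> Y" "Y \<noteq> Z" "X \<noteq> Z"
    and ni: "{u + v | u v. u \<in> ?bm 1 X \<and> v \<in> ?bm 1 Y} \<inter> ?bm (CARD('n) - 2) Z \<noteq> {0}"
    using nh unfolding hyperconvex_112_def by blast
  obtain z where z: "z \<in> rays" "Z = cls z" using xyz(3) topspace_boundary by blast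
  obtain \<psi> where psi: "orthonormal_pair (l2 m c q z) \<psi>" "l3 m c' q' z = unit_wedge (l2 m c q z) \<psi>" using lim3_form(1)[OF gd z(1)] by blast
  show ?thesis
  proof (rule punctured_circle_param[OF hom xyz(3)])
    fix \<gamma> :: "real \<Rightarrow> (nat \<Rightarrow> 'g) set"
    assume g: "continuous_map (top_of_set {0<..<1}) boundary \<gamma>" "bij_betw \<gamma> {0<..<1} (topspace boundary - {Z})"
      and go: "\<And>a b. 0 < a \<Longrightarrow> a < b \<Longrightarrow> b < 1 \<Longrightarrow> openin boundary (\<gamma> ` {a<..<b})"
    have gi: "\<gamma> ` {0<..<1} = topspace boundary - {Z}" "inj_on \<gamma> {0<..<1}" using g(2) by (auto simp: bij_betw_def)
    have "\<forall>t\<in>{0<..<1}. \<exists>r. r \<in> rays \<and> cls r = \<gamma> t"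
    proof
      fix t :: real assume "t \<in> {0<..<1}"
      then have "\<gamma> t \<in> \<gamma> ` {0<..<1}" by (rule imageI)
      then have "\<gamma> t \<in> cls ` rays" unfolding gi(1) topspace_boundary by (rule DiffD1)
      then show "\<exists>r. r \<in> rays \<and> cls r = \<gamma> t" by (auto simp only: image_iff)
    qed
    then have "\<exists>\<sigma>. \<forall>t\<in>{0<..<1}. \<sigma> t \<in> rays \<and> cls (\<sigma> t) = \<gamma> t" by (rule bchoice)
    then obtain \<sigma> where s: "\<forall>t\<in>{0<..<1}. \<sigma> t \<in> rays \<and> cls (\<sigma> t) = \<gamma> t" by (elim exE) (rule that)
    have arc: "ray_arc z \<sigma>"
      unfolding ray_arc_def
    proof (intro conjI ballI z(1))
      show "continuous_map (top_of_set {0<..<1}) boundary (\<lambda>t. cls (\<sigma> t))"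
        by (rule continuous_map_eq[OF g(1)]) (use s in auto)
      show "inj_on (\<lambda>t. cls (\<sigma> t)) {0<..<1}" using gi(2) s by (auto simp: inj_on_def)
      fix t :: real assume t: "t \<in> {0<..<1}"
      then show "\<sigma> t \<in> rays" using s by blast
      have "\<gamma> t \<in> \<gamma> ` {0<..<1}" using t by (rule imageI)
      then have "\<gamma> t \<noteq> Z" unfolding gi(1) by simp
      then show "cls (\<sigma> t) \<noteq> cls z" using s t z(2) by simp
    qed
    let ?f = "chart m c q (l2 m c q z) \<psi>"
    have main: "\<exists>s. a < s \<and> s < b \<and> 0 < fold_at m c q c' q' z (\<sigma> a) (\<sigma> s) (\<sigma> b)"
      if o: "0 < a" "a < b" "b < 1" "?f (\<sigma> a) = ?f (\<sigma> b)" for a b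
    proof (rule fold_between[OF gd hyp arc psi wi circle_compact[OF hom] circle_no_open_singleton[OF hom] _ o])
      have "(\<lambda>t. cls (\<sigma> t)) ` {a<..<b} = \<gamma> ` {a<..<b}" using s o by (intro image_cong) auto
      then show "openin boundary ((\<lambda>t. cls (\<sigma> t)) ` {a<..<b})" using go[OF o(1-3)] by simp
    qed
    have "X \<in> \<gamma> ` {0<..<1}" "Y \<in> \<gamma> ` {0<..<1}" unfolding gi(1) using xyz by auto
    then obtain a b where ab: "0 < a" "a < 1" "X = cls (\<sigma> a)" "0 < b" "b < 1" "Y = cls (\<sigma> b)" using s by auto
    then have ne: "a \<noteq> b" using xyz(4) by auto
    have eq: "?f (\<sigma> a) = ?f (\<sigma> b)"
      using criterion_arc[OF gd hyp arc psi ab(1,2,4,5) ne] ni unfolding ab(3,6) z(2) by blast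
    show ?thesis
    proof (cases "a < b")
      case True
      then show ?thesis using main[OF ab(1) True ab(5) eq] arc ab by blast
    next
      case False
      then have "b < a" using ne by simp
      then show ?thesis using main[OF ab(4) _ ab(2) eq[symmetric]] arc ab by blast
    qed
  qed
qed

text \<open>The rays of the fold and the arc belong to the group, not to \<open>\<rho>\<close>, so
  they can be kept for \<open>\<rho>'\<close>. The latter brings its own selection and its own
  Anosov constants, which \<open>robust_fold\<close> permits.\<close>

lemma not_hyperconvex_nbhd:
  assumes hyp: "word_hyperbolic G S" and hom: "boundary homeomorphic_space top_of_set (sphere (0::complex) 1)"
    and \<rho>: "\<rho> \<in> weakly_irreducible_anosov_12 G S B" "\<not> hyperconvex_112 G S B \<rho>"
  shows "\<exists>N. openin (representation_topology G) N \<and> \<rho> \<in> N \<and>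
    (\<forall>\<rho>'\<in>N \<inter> weakly_irreducible_anosov_12 G S B. \<not> hyperconvex_112 G S B \<rho>')"
proof -
  have R: "\<rho> \<in> representations G" "anosov G S B 1 \<rho>" "anosov G S B 2 \<rho>" "weakly_irreducible G S B \<rho>"
    using \<rho>(1) by (auto simp: weakly_irreducible_anosov_12_def)
  have "\<exists>A\<in>\<rho> s. True" if "s \<in> S" for s
  proof -
    have "\<rho> s \<in> carrier PGL" using R(1) that S_carrier by (auto simp: representations_def hom_def)
    then obtain A where "\<rho> s = {c *\<^sub>R A | c. c \<noteq> 0}" using carrier_PGL by blast
    then have "1 *\<^sub>R A \<in> \<rho> s" by (metis (mono_tags, lifting) mem_Collect_eq zero_neq_one)
    then show ?thesis by blast
  qed
  then obtain m where m: "selection \<rho> m" using ex_selection[OF R(1), of "\<lambda>_ _. True"] by blast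
  obtain c q c' q' where gd: "good \<rho> m c q c' q'" using ex_good[OF m R(2,3)] by blast
  obtain z \<sigma> a s b where arc: "ray_arc z \<sigma>" and o: "0 < a" "a < s" "s < b" "b < 1"
    and pos: "0 < fold_at m c q c' q' z (\<sigma> a) (\<sigma> s) (\<sigma> b)"
    using fold_exists[OF gd hyp R(4) hom \<rho>(2)] by blast
  have rr: "z \<in> rays" "\<sigma> a \<in> rays" "\<sigma> s \<in> rays" "\<sigma> b \<in> rays" using arc o by (auto simp: ray_arc_def)
  obtain \<epsilon> where e: "0 < \<epsilon>" and st: "\<forall>\<rho>' m' a1 b1 a2 b2. good \<rho>' m' a1 b1 a2 b2 \<longrightarrow> (\<forall>s\<in>S. norm (m' s - m s) \<le> \<epsilon>) \<longrightarrow>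
      0 < fold_at m' a1 b1 a2 b2 z (\<sigma> a) (\<sigma> s) (\<sigma> b)"
    using robust_fold[OF gd rr pos] by blast
  let ?N = "{\<rho> \<in> representations G. \<forall>s\<in>S. \<exists>A\<in>\<rho> s. norm (A - m s) < \<epsilon>}"
  have "openin (representation_topology G) ?N" by (rule openin_representations_near[OF S_fin S_sub])
  moreover have "\<rho> \<in> ?N"
  proof (intro CollectI conjI ballI R(1))
    fix s assume "s \<in> S"
    then have "m s \<in> \<rho> s" using m S_carrier by (auto simp: selection_def)
    then show "\<exists>A\<in>\<rho> s. norm (A - m s) < \<epsilon>" using e by (intro bexI[of _ "m s"]) simp_all
  qed
  moreover have "\<not> hyperconvex_112 G S B \<rho>'" if N: "\<rho>' \<in> ?N" and W: "\<rho>' \<in> weakly_irreducible_anosov_12 G S B" for \<rho>'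
  proof -
    have an: "\<rho>' \<in> representations G" "anosov G S B 1 \<rho>'" "anosov G S B 2 \<rho>'"
      using W by (auto simp: weakly_irreducible_anosov_12_def)
    obtain m' where m': "selection \<rho>' m'" "\<forall>s\<in>S. norm (m' s - m s) < \<epsilon>"
      using ex_selection[OF an(1), of "\<lambda>s A. norm (A - m s) < \<epsilon>"] N by blast
    obtain a1 b1 a2 b2 where gd': "good \<rho>' m' a1 b1 a2 b2" using ex_good[OF m'(1) an(2,3)] by blast
    have pos': "0 < fold_at m' a1 b1 a2 b2 z (\<sigma> a) (\<sigma> s) (\<sigma> b)" using st gd' m'(2) by (meson less_imp_le)
    obtain \<psi> where psi: "orthonormal_pair (l2 m' a1 b1 z) \<psi>" "l3 m' a2 b2 z = unit_wedge (l2 m' a1 b1 z) \<psi>"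
      using lim3_form(1)[OF gd' rr(1)] by blast
    show ?thesis by (rule not_hyperconvex_if_fold[OF gd' hyp arc psi o pos'])
  qed
  ultimately show ?thesis by blast
qed

end

theorem proposition9p3:
  fixes G :: "'g monoid" and S :: "'g set"
    and B :: "real^'n \<Rightarrow> real^'n \<Rightarrow> real"
  assumes "group G"
    and "finite_symmetric_generating_set G S"
    and "word_hyperbolic G S"
    and "gromov_boundary G S homeomorphic_space top_of_set (sphere (0::complex) 1)"
    and "CARD('n) \<ge> 3"
    and "inner_product B"
  shows "openin (subtopology (representation_topology G) (weakly_irreducible_anosov_12 G S B))
             {\<rho> \<in> weakly_irreducible_anosov_12 G S B. \<not> hyperconvex_112 G S B \<rho>} \<and>
         closedin (subtopology (representation_topology G) (weakly_irreducible_anosov_12 G S B))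
             {\<rho> \<in> weakly_irreducible_anosov_12 G S B. hyperconvex_112 G S B \<rho>}"
proof (rule inner_product_matrix[OF assms(6)])
  fix T T' :: "real^'n^'n"
  assume T: "T ** T' = mat 1" "T' ** T = mat 1" "\<And>u v. B u v = (T *v u) \<bullet> (T *v v)"
  let ?W = "weakly_irreducible_anosov_12 G S B"
  let ?X = "subtopology (representation_topology G) ?W"
  let ?O = "{\<rho> \<in> ?W. \<not> hyperconvex_112 G S B \<rho>}"
  interpret rep_setup G S B T T'
  proof (rule rep_setup.intro)
    show "marked_group G S" by (rule marked_group.intro[OF assms(1)]) (rule marked_group_axioms.intro[OF assms(2)])
    show "rep_setup_axioms B T T'" by (rule rep_setup_axioms.intro[OF assms(5) T])
  qed
  have o: "openin ?X ?O"
  proof (subst openin_subopen, intro ballI)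
    fix \<rho> assume \<rho>: "\<rho> \<in> ?O"
    obtain N where N: "openin (representation_topology G) N" "\<rho> \<in> N" "\<forall>\<rho>'\<in>N \<inter> ?W. \<not> hyperconvex_112 G S B \<rho>'"
      using not_hyperconvex_nbhd[OF assms(3,4), of \<rho>] \<rho> by blast
    have "openin ?X (N \<inter> ?W)" using N(1) unfolding openin_subtopology by blast
    moreover have "\<rho> \<in> N \<inter> ?W" "N \<inter> ?W \<subseteq> ?O" using N(2,3) \<rho> by auto
    ultimately show "\<exists>U. openin ?X U \<and> \<rho> \<in> U \<and> U \<subseteq> ?O" by blast
  qed
  have t: "topspace ?X = ?W"
    unfolding topspace_subtopology topspace_representation_topology by (auto simp: weakly_irreducible_anosov_12_def)
  have "topspace ?X - {\<rho> \<in> ?W. hyperconvex_112 G S B \<rho>} = ?O" unfolding t by blast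
  then show ?thesis using o t by (auto simp: closedin_def)
qed

end
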